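(* Suppose $v\in S_n$ is such that $X_v$ is defined by inclusions. Then $$\mathcal{K}(S/I_v)=\mathfrak{G}_{w_0v}(t_1,\ldots,t_n;t_n,\ldots,t_1)=\prod_{(x,y)\in D(v)}\left(1-\frac{t_{y-r_v(x,y)}}{t_{x+r_v(x,y)}}\right),$$ and $$\mathcal{C}(S/I_v)=\mathfrak{S}_{w_0v}(t_1,\ldots,t_n;t_n,\ldots,t_1)=\prod_{(x,y)\in D(v)}\left(t_{y-r_v(x,y)}-t_{x+r_v(x,y)}\right).$$
   Context: Write $[a,b]=\{x\in\mathbb{Z}: a\le x\le b\}$. For $v\in S_n$ set $r_v(p,q)=\#\{k\le q : v(k)\ge p\}$, $D(v)=\{(p,q)\in[1,n]^2 : v(q)<p,\ v^{-1}(p)>q\}$, $E(v)=\{(p,q)\in D(v): (p,q+1)\notin D(v),\ (p-1,q)\notin D(v)\}$. $X_v$ (or $v$) is defined by inclusions if $q-r_v(p,q)=\min\{p-1,q\}$ for every $(p,q)\in E(v)$. $w_0\in S_n$ is $w_0(i)=n+1-i$, and $(w_0v)(i)=w_0(v(i))$. $S=\mathbb{C}[z_{p,q}]_{1\le q<p\le n}$; $M$ is the $n\times n$ matrix with entry $z_{p,q}$ at row $p$, column $q$ for $p>q$, $1$'s on the diagonal, $0$'s above. For $A,B\subseteq[1,n]$ with $\#A=\#B$, $d_{A,B}$ is the minor with rows $A$ and columns $B$; $I_{(p,q,r)}$ is generated by all $d_{A,B}$ with $A\subseteq[p,n]$, $B\subseteq[1,q]$, $\#A=\#B=r+1$; and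 $I_v=\sum_{(p,q)\in E(v)}I_{(p,q,r_v(p,q))}$. $S$ is $\mathbb{Z}^n$-graded by $\deg z_{i,j}=\mathbf{a}_j-\mathbf{a}_i$, where $\mathbf{a}_1,\dots,\mathbf{a}_n$ is the standard basis of $\mathbb{Z}^n$; $I_v$ is homogeneous. For $\lambda=\sum_j\lambda_j\mathbf{a}_j$ write $\mathbf{t}^\lambda=\prod_j t_j^{\lambda_j}$. For a finitely generated graded $S$-module $N$, the Hilbert series is $\mathcal{H}(N)=\sum_\lambda \dim(N_\lambda)\mathbf{t}^\lambda$, the $K$-polynomial is $\mathcal{K}(N)=\mathcal{H}(N)\prod_{1\le j<i\le n}(1-\mathbf{t}^{\deg z_{i,j}})$ (a Laurent polynomial in $t_1,\dots,t_n$), and the multidegree $\mathcal{C}(N)$ is the sum of the lowest degree terms of the result of substituting $1-t_i$ for $t_i$ in $\mathcal{K}(N)$ for every $i$ (expanded as a power series). $\mathfrak{S}_u(x;y)$ and $\mathfrak{G}_u(x;y)$ are the double Schubert and double Grothendieck polynomials, determined by $\mathfrak{S}_{w_0}=\prod_{i+j\le n}(x_i-y_j)$, $\mathfrak{G}_{w_0}=\prod_{i+j\le n}(1-x_i/y_j)$ and, whenever $u(i)>u(i+1)$, with $s_i$ the adjacent transposition of $i$ and $i+1$ (and also its action swapping $x_i,x_{i+1}$), $\mathfrak{S}_{us_i}=\dfrac{\mathfrak{S}_u-s_i\mathfrak{S}_u}{x_i-x_{i+1}}$ and $\mathfrak{G}_{us_i}=\dfrac{x_{i+1}\mathfrak{G}_u-x_i\,s_i\mathfrak{G}_u}{x_{i+1}-x_i}$.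 The notation $(t_1,\dots,t_n;t_n,\dots,t_1)$ means $x_i=t_i$, $y_j=t_{n+1-j}$. *)

theory Defs
  imports
    "HOL-Library.Poly_Mapping"
    "HOL-Computational_Algebra.Formal_Power_Series"
    "HOL-Combinatorics.Permutations"
    "HOL-Algebra.QuotRing"
    "HOL-Algebra.Embedded_Algebras"
    "Jordan_Normal_Form.Determinant"
    "Jordan_Normal_Form.DL_Submatrix"
begin

section \<open>Permutations, diagrams and essential sets\<close>

text \<open>An element of \<open>S\<^sub>n\<close> is a function \<open>v :: nat \<Rightarrow> nat\<close> with \<open>v permutes {1..n}\<close>; it is the
  identity outside \<open>{1..n}\<close>.\<close>

definition rk :: "(nat \<Rightarrow> nat) \<Rightarrow> nat \<Rightarrow> nat \<Rightarrow> nat" where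
  "rk v p q = card {k. 1 \<le> k \<and> k \<le> q \<and> p \<le> v k}"

definition diagram :: "nat \<Rightarrow> (nat \<Rightarrow> nat) \<Rightarrow> (nat \<times> nat) set" where
  "diagram n v = {(p, q). p \<in> {1..n} \<and> q \<in> {1..n} \<and> v q < p \<and> q < inv_into UNIV v p}"

definition essential_set :: "nat \<Rightarrow> (nat \<Rightarrow> nat) \<Rightarrow> (nat \<times> nat) set" where
  "essential_set n v =
     {(p, q). (p, q) \<in> diagram n v \<and> (p, q + 1) \<notin> diagram n v \<and> (p - 1, q) \<notin> diagram n v}"

definition defined_by_inclusions :: "nat \<Rightarrow> (nat \<Rightarrow> nat) \<Rightarrow> bool" where
  "defined_by_inclusions n v \<longleftrightarrow>
     (\<forall>(p, q) \<in> essential_set n v. int q - int (rk v p q) = min (int p - 1) (int q))"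

definition w0 :: "nat \<Rightarrow> nat \<Rightarrow> nat" where
  "w0 n i = (if i \<in> {1..n} then n + 1 - i else i)"


section \<open>The polynomial ring and the ideal of a permutation\<close>

text \<open>A polynomial over \<open>\<complex>\<close> in variables \<open>z\<^sub>p\<^sub>q\<close> maps exponent vectors to coefficients, and the
  product of \<^typ>\<open>'a \<Rightarrow>\<^sub>0 'b\<close> is convolution. The ring \<open>S\<close> is the subring of those polynomials
  in which only the variables with \<open>1 \<le> q < p \<le> n\<close> occur.\<close>

type_synonym zexp = "(nat \<times> nat) \<Rightarrow>\<^sub>0 nat"
type_synonym zpoly = "zexp \<Rightarrow>\<^sub>0 complex"

definition zvars :: "nat \<Rightarrow> (nat \<times> nat) set" where
  "zvars n = {(p, q). 1 \<le> q \<and> q < p \<and> p \<le> n}"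

definition zring :: "nat \<Rightarrow> zpoly ring" where
  "zring n =
     \<lparr>carrier = {f. \<forall>m \<in> Poly_Mapping.keys f. Poly_Mapping.keys m \<subseteq> zvars n},
      mult = (*), one = 1, zero = 0, add = (+)\<rparr>"

definition zvar :: "nat \<Rightarrow> nat \<Rightarrow> zpoly" where
  "zvar p q = Poly_Mapping.single (Poly_Mapping.single (p, q) 1) 1"

text \<open>Matrix indices of \<^typ>\<open>'a mat\<close> start at 0, so row \<open>p\<close> and column \<open>q\<close> of \<open>M\<close> are stored
  at position \<open>(p - 1, q - 1)\<close>; \<open>minor n A B\<close> takes the 1-based index sets.\<close>

definition zmat :: "nat \<Rightarrow> zpoly mat" where
  "zmat n = mat n n (\<lambda>(i, j). if j < i then zvar (i + 1) (j + 1) else if i = j then 1 else 0)"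

definition minor :: "nat \<Rightarrow> nat set \<Rightarrow> nat set \<Rightarrow> zpoly" where
  "minor n A B = det (submatrix (zmat n) ((\<lambda>a. a - 1) ` A) ((\<lambda>b. b - 1) ` B))"

definition rank_ideal :: "nat \<Rightarrow> nat \<Rightarrow> nat \<Rightarrow> nat \<Rightarrow> zpoly set" where
  "rank_ideal n p q r =
     Idl\<^bsub>zring n\<^esub> {minor n A B | A B.
       A \<subseteq> {p..n} \<and> B \<subseteq> {1..q} \<and> card A = r + 1 \<and> card B = r + 1}"

definition perm_ideal :: "nat \<Rightarrow> (nat \<Rightarrow> nat) \<Rightarrow> zpoly set" where
  "perm_ideal n v =
     {\<Sum>e \<in> essential_set n v. f e | f.
       \<forall>(p, q) \<in> essential_set n v. f (p, q) \<in> rank_ideal n p q (rk v p q)}"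


section \<open>Laurent polynomials with integer coefficients\<close>

type_synonym 'v laurent = "('v \<Rightarrow>\<^sub>0 int) \<Rightarrow>\<^sub>0 int"

definition lvar :: "'v \<Rightarrow> 'v laurent" where
  "lvar x = Poly_Mapping.single (Poly_Mapping.single x 1) 1"

definition lvar_inv :: "'v \<Rightarrow> 'v laurent" where
  "lvar_inv x = Poly_Mapping.single (Poly_Mapping.single x (-1)) 1"

text \<open>The ring homomorphism sending each variable \<open>x\<close> to the variable \<open>\<sigma> x\<close> (\<open>\<sigma>\<close> need not be
  injective).\<close>

definition lrename :: "('v \<Rightarrow> 'w) \<Rightarrow> 'v laurent \<Rightarrow> 'w laurent" where
  "lrename \<sigma> f = (\<Sum>m \<in> Poly_Mapping.keys f.
     Poly_Mapping.single
       (\<Sum>x \<in> Poly_Mapping.keys m. Poly_Mapping.single (\<sigma> x) (Poly_Mapping.lookup m x))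
       (Poly_Mapping.lookup f m))"


section \<open>Hilbert series, K-polynomial and multidegree\<close>

definition zdeg :: "zexp \<Rightarrow> (nat \<Rightarrow>\<^sub>0 int)" where
  "zdeg m = (\<Sum>(i, j) \<in> Poly_Mapping.keys m.
     Poly_Mapping.single j (int (Poly_Mapping.lookup m (i, j)))
     - Poly_Mapping.single i (int (Poly_Mapping.lookup m (i, j))))"

text \<open>The graded piece \<open>(S/I)\<^sub>\<mu>\<close> is the image of \<open>S\<^sub>\<mu>\<close> in the quotient ring, whose scalars are the
  classes of the constant polynomials. The function \<open>hilbert n I\<close> is the coefficient function of the
  Hilbert series \<open>\<H>(S/I)\<close>.\<close>

definition graded_piece :: "nat \<Rightarrow> zpoly set \<Rightarrow> (nat \<Rightarrow>\<^sub>0 int) \<Rightarrow> zpoly set set" where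
  "graded_piece n I \<mu> =
     {I +>\<^bsub>zring n\<^esub> f | f. f \<in> carrier (zring n) \<and> (\<forall>m \<in> Poly_Mapping.keys f. zdeg m = \<mu>)}"

definition scalars :: "nat \<Rightarrow> zpoly set \<Rightarrow> zpoly set set" where
  "scalars n I = {I +>\<^bsub>zring n\<^esub> (Poly_Mapping.single 0 c) | c. True}"

definition hilbert :: "nat \<Rightarrow> zpoly set \<Rightarrow> (nat \<Rightarrow>\<^sub>0 int) \<Rightarrow> int" where
  "hilbert n I \<mu> = int ((ring.dim (zring n Quot I) over scalars n I) (graded_piece n I \<mu>))"

definition hilbert_denom :: "nat \<Rightarrow> nat laurent" where
  "hilbert_denom n = (\<Prod>(i, j) \<in> zvars n.
     1 - Poly_Mapping.single (zdeg (Poly_Mapping.single (i, j) 1)) 1)"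

text \<open>The coefficients of the product of a Laurent polynomial with a formal series.\<close>

definition laurent_times_series ::
    "nat laurent \<Rightarrow> ((nat \<Rightarrow>\<^sub>0 int) \<Rightarrow> int) \<Rightarrow> ((nat \<Rightarrow>\<^sub>0 int) \<Rightarrow> int)" where
  "laurent_times_series P h \<mu> =
     (\<Sum>\<nu> \<in> Poly_Mapping.keys P. Poly_Mapping.lookup P \<nu> * h (\<mu> - \<nu>))"

text \<open>The K-polynomial of \<open>S/I\<close>. The abstraction function is meaningful because the product has
  only finitely many nonzero coefficients when \<open>I\<close> is homogeneous.\<close>

definition K_polynomial :: "nat \<Rightarrow> zpoly set \<Rightarrow> nat laurent" where
  "K_polynomial n I = Abs_poly_mapping (laurent_times_series (hilbert_denom n) (hilbert n I))"

text \<open>To expand the substitution \<open>t\<^sub>i \<mapsto> 1 - t\<^sub>i\<close> as a power series and read off its homogeneous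
  components, an auxiliary variable \<open>s\<close> records the total degree: \<open>t\<^sub>i\<close> is replaced by
  \<open>1 - s t\<^sub>i\<close>, in formal power series in \<open>s\<close>, so that the coefficient of \<open>s\<^sup>d\<close> is the degree \<open>d\<close>
  part in the \<open>t\<^sub>i\<close>. The inverse of \<open>1 - s t\<^sub>i\<close> is the geometric series.\<close>

definition one_minus_power :: "nat \<Rightarrow> int \<Rightarrow> nat laurent fps" where
  "one_minus_power i a =
     (if 0 \<le> a then (1 - fps_X * fps_const (lvar i)) ^ nat a
      else (Abs_fps (\<lambda>k. lvar i ^ k)) ^ nat (- a))"

definition subst_one_minus :: "nat laurent \<Rightarrow> nat laurent fps" where
  "subst_one_minus f = (\<Sum>m \<in> Poly_Mapping.keys f.
     of_int (Poly_Mapping.lookup f m)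
     * (\<Prod>i \<in> Poly_Mapping.keys m. one_minus_power i (Poly_Mapping.lookup m i)))"

definition lowest_degree_part :: "nat laurent fps \<Rightarrow> nat laurent" where
  "lowest_degree_part F = fps_nth F (subdegree F)"

definition multidegree :: "nat \<Rightarrow> zpoly set \<Rightarrow> nat laurent" where
  "multidegree n I = lowest_degree_part (subst_one_minus (K_polynomial n I))"


section \<open>Double Schubert and double Grothendieck polynomials\<close>

datatype xyvar = X nat | Y nat

definition swap_x :: "nat \<Rightarrow> xyvar laurent \<Rightarrow> xyvar laurent" where
  "swap_x i = lrename (transpose (X i) (X (i + 1)))"

text \<open>The recursions are stated with the denominators cleared; this determines the quotient because
  the ring of Laurent polynomials over \<open>\<int>\<close> is a domain.\<close>

definition double_schubert_family :: "nat \<Rightarrow> ((nat \<Rightarrow> nat) \<Rightarrow> xyvar laurent) \<Rightarrow> bool" where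
  "double_schubert_family n F \<longleftrightarrow>
     F (w0 n) = (\<Prod>(i, j) \<in> {(i, j). 1 \<le> i \<and> 1 \<le> j \<and> i + j \<le> n}. lvar (X i) - lvar (Y j)) \<and>
     (\<forall>u i. u permutes {1..n} \<and> 1 \<le> i \<and> i < n \<and> u (i + 1) < u i \<longrightarrow>
        (lvar (X i) - lvar (X (i + 1))) * F (u \<circ> transpose i (i + 1)) = F u - swap_x i (F u))"

definition double_grothendieck_family :: "nat \<Rightarrow> ((nat \<Rightarrow> nat) \<Rightarrow> xyvar laurent) \<Rightarrow> bool" where
  "double_grothendieck_family n F \<longleftrightarrow>
     F (w0 n) =
       (\<Prod>(i, j) \<in> {(i, j). 1 \<le> i \<and> 1 \<le> j \<and> i + j \<le> n}. 1 - lvar (X i) * lvar_inv (Y j)) \<and>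
     (\<forall>u i. u permutes {1..n} \<and> 1 \<le> i \<and> i < n \<and> u (i + 1) < u i \<longrightarrow>
        (lvar (X (i + 1)) - lvar (X i)) * F (u \<circ> transpose i (i + 1))
          = lvar (X (i + 1)) * F u - lvar (X i) * swap_x i (F u))"

text \<open>On \<open>S\<^sub>n\<close> there is exactly one such family; its values elsewhere are arbitrary, hence
  the unique choice is made for each \<open>u\<close> separately.\<close>

definition double_schubert :: "nat \<Rightarrow> (nat \<Rightarrow> nat) \<Rightarrow> xyvar laurent" where
  "double_schubert n u = (THE f. \<exists>F. double_schubert_family n F \<and> F u = f)"

definition double_grothendieck :: "nat \<Rightarrow> (nat \<Rightarrow> nat) \<Rightarrow> xyvar laurent" where
  "double_grothendieck n u = (THE f. \<exists>F. double_grothendieck_family n F \<and> F u = f)"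

text \<open>The specialization \<open>(t\<^sub>1, \<dots>, t\<^sub>n; t\<^sub>n, \<dots>, t\<^sub>1)\<close>.\<close>

definition specialize_t :: "nat \<Rightarrow> xyvar laurent \<Rightarrow> nat laurent" where
  "specialize_t n = lrename (\<lambda>z. case z of X i \<Rightarrow> i | Y j \<Rightarrow> n + 1 - j)"

end

theory Submission imports Defs begin

text \<open>Write \<open>loc k n v w\<close> for \<open>\<GG>\<^bsub>w\<^sub>0v\<^esub>\<close> (if \<open>k\<close>) or \<open>\<SS>\<^bsub>w\<^sub>0v\<^esub>\<close> (otherwise) at
  \<open>x\<^sub>i = t\<^bsub>w(i)\<^esub>\<close>, \<open>y\<^sub>j = t\<^bsub>n+1-j\<^esub>\<close>, the restriction of a Schubert class to the torus fixed point
  \<open>w\<close>. These restrictions vanish unless \<open>w \<le> v\<close> in Bruhat order, are known at \<open>w = v\<close>, and satisfy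
  the congruences that identifying \<open>t\<^sub>x\<close> and \<open>t\<^sub>y\<close> identifies the values at \<open>w\<close> and \<open>(x y) w\<close>. If
  \<open>v\<close> is defined by inclusions, a product of weights indexed by the inclusions between coordinate
  and standard flags has the same properties. In cohomology the difference of the two vanishes for
  reasons of degree. In K-theory the total degree is replaced by the degrees in
  \<open>t\<^sub>1, \<dots>, t\<^sub>c\<close> for each \<open>c\<close>; the bounds needed follow from the result in cohomology. At \<open>w = id\<close>
  the product is the one over the diagram.

  For the Hilbert series, descend from \<open>w\<^sub>0\<close> to \<open>id\<close> through affine slices at the points \<open>w\<close>: passing
  from \<open>ws\<^sub>i\<close> to \<open>w\<close> adds one variable, and spanning sets modulo the minors are built by the divided
  difference recursion of \<open>loc\<close>. At \<open>id\<close> this bounds \<open>\<H>(S/I\<^sub>v)\<close> above by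
  \<open>loc True n v id\<close> divided by the weights of all variables. On the other hand, \<open>I\<^sub>v\<close> is contained in
  the ideal of the inclusions, which is generated by entries of the matrix and of its inverse; these
  are as many as the boxes of the diagram and have the degrees occurring in the product. So products
  of spanning elements with powers of the generators span \<open>S\<close>, their number in each degree is the
  dimension of \<open>S\<close>, hence they are linearly independent and the bound is attained.\<close>

text \<open>Why fixed points suffice: if the two families agree at the points above
  \<open>u\<close>, their difference at \<open>u\<close> is divisible by one weight for each
  noninversion of \<open>u\<close>. These weights are pairwise coprime, and in cohomology they are
  more than the degree of either family, because \<open>v\<close> has fewer noninversions than any
  \<open>u\<close> below it. In K-theory a weight 1 - t_a/t_b has total degree 0 and this count says
  nothing; its degree in t_1, ..., t_c records whether a \<le> c < b, and a \<open>c\<close> that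
  tells \<open>u\<close> from \<open>v\<close> leaves one degree missing. The product has one weight
  for each equation of an inclusion, except that equations which overlap in a chain of inclusions
  count once. That this correction is compatible with transpositions is the combinatorial core. It
  rests on \<open>forbidden_configuration\<close>; every use of the hypothesis on \<open>v\<close>
  passes through \<open>essential_positive_rank\<close>. The slices yield spanning sets only.
  Independence usually comes from a Groebner basis or from Cohen-Macaulayness; here the comparison
  with the ideal of the inclusions replaces both.\<close>

abbreviation "keys \<equiv> Poly_Mapping.keys"
abbreviation "lookup \<equiv> Poly_Mapping.lookup"
abbreviation "single \<equiv> Poly_Mapping.single"

section \<open>Laurent polynomials\<close>

definition restrict_keys :: "('m \<Rightarrow> bool) \<Rightarrow> ('m \<Rightarrow>\<^sub>0 'b::comm_monoid_add) \<Rightarrow> ('m \<Rightarrow>\<^sub>0 'b)" where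
  "restrict_keys P f = (\<Sum>m | m \<in> keys f \<and> P m. single m (lookup f m))"

lemma lookup_restrict_keys:
  "lookup (restrict_keys P f) m = (if P m then lookup f m else 0)"
proof -
  have "lookup (restrict_keys P f) m
      = (\<Sum>k | k \<in> keys f \<and> P k. if k = m then lookup f m else 0)"
    unfolding restrict_keys_def lookup_sum lookup_single when_def
    by (intro sum.cong) auto
  also have "\<dots> = (if P m then lookup f m else 0)"
    by (subst sum.delta) (auto simp: in_keys_iff)
  finally show ?thesis .
qed

lemma keys_restrict_keys: "keys (restrict_keys P f) = {m \<in> keys f. P m}"
  by (auto simp: in_keys_iff lookup_restrict_keys split: if_splits)

lemma restrict_keys_True: "restrict_keys (\<lambda>_. True) f = f"
  by (rule poly_mapping_eqI) (simp add: lookup_restrict_keys)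

lemma restrict_keys_add: "restrict_keys P (f + g) = restrict_keys P f + restrict_keys P g"
  by (rule poly_mapping_eqI) (simp add: lookup_restrict_keys lookup_add)

lemma restrict_keys_zero [simp]: "restrict_keys P 0 = 0"
  by (rule poly_mapping_eqI) (simp add: lookup_restrict_keys)

lemma restrict_keys_split: "f = restrict_keys P f + restrict_keys (\<lambda>m. \<not> P m) f"
  by (rule poly_mapping_eqI) (simp add: lookup_restrict_keys lookup_add)

lemma restrict_keys_id: "(\<And>m. m \<in> keys f \<Longrightarrow> P m) \<Longrightarrow> restrict_keys P f = f"
  by (rule poly_mapping_eqI) (auto simp: lookup_restrict_keys in_keys_iff)

lemma restrict_keys_none: "(\<And>m. m \<in> keys f \<Longrightarrow> \<not> P m) \<Longrightarrow> restrict_keys P f = 0"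
  by (rule poly_mapping_eqI) (auto simp: lookup_restrict_keys in_keys_iff)

lemma poly_mapping_expand:
  "f = (\<Sum>m \<in> keys f. single m (lookup f m))"
  using restrict_keys_True[of f] unfolding restrict_keys_def by simp

lemma keys_mult_ex:
  assumes "k \<in> keys (f * g)"
  obtains a b where "a \<in> keys f" "b \<in> keys g" "k = a + b"
  using keys_mult[of f g] assms by blast

text \<open>The parts of top weight of \<open>f\<close> and \<open>g\<close> have a nonzero product,
  since the ring is a domain, and no other product of parts reaches that weight, so nothing cancels
  it.\<close>

lemma max_weight_mult:
  fixes f g :: "('m::{ordered_cancel_comm_monoid_add, linorder}) \<Rightarrow>\<^sub>0 ('b::idom)" and \<delta> :: "'m \<Rightarrow> int"
  assumes add: "\<And>a b. \<delta> (a + b) = \<delta> a + \<delta> b"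
    and le: "\<And>m. m \<in> keys (f * g) \<Longrightarrow> \<delta> m \<le> h"
    and f: "\<And>m. m \<in> keys f \<Longrightarrow> \<delta> m \<le> a" "m0 \<in> keys f" "\<delta> m0 = a"
    and m: "m \<in> keys g"
  shows "\<delta> m \<le> h - a"
proof -
  define b where "b = Max (\<delta> ` keys g)"
  have b: "\<delta> k \<le> b" if "k \<in> keys g" for k
    using that unfolding b_def by auto
  have "b \<in> \<delta> ` keys g"
    unfolding b_def by (rule Max_in) (use m in auto)
  then obtain m1 where m1: "m1 \<in> keys g" "\<delta> m1 = b" by auto
  let ?f0 = "restrict_keys (\<lambda>m. \<delta> m = a) f" and ?f1 = "restrict_keys (\<lambda>m. \<delta> m \<noteq> a) f"
  let ?g0 = "restrict_keys (\<lambda>m. \<delta> m = b) g" and ?g1 = "restrict_keys (\<lambda>m. \<delta> m \<noteq> b) g"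
  have "m0 \<in> keys ?f0" "m1 \<in> keys ?g0"
    using f m1 by (auto simp: keys_restrict_keys)
  then have "?f0 \<noteq> 0" "?g0 \<noteq> 0" by auto
  then have "?f0 * ?g0 \<noteq> 0" by simp
  then obtain k where k: "k \<in> keys (?f0 * ?g0)"
    by (metis in_keys_iff lookup_zero poly_mapping_eqI)
  then have dk: "\<delta> k = a + b"
    by (elim keys_mult_ex) (auto simp: keys_restrict_keys add)
  have "f * g = (?f0 + ?f1) * (?g0 + ?g1)"
    using restrict_keys_split[of f "\<lambda>m. \<delta> m = a"] restrict_keys_split[of g "\<lambda>m. \<delta> m = b"] by simp
  then have fg: "f * g = ?f0 * ?g0 + (?f0 * ?g1 + ?f1 * (?g0 + ?g1))"
    by (simp add: algebra_simps)
  have 1: "k \<notin> keys (?f0 * ?g1)"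
  proof
    assume "k \<in> keys (?f0 * ?g1)"
    then obtain x y where "x \<in> keys ?f0" "y \<in> keys ?g1" "k = x + y"
      by (elim keys_mult_ex)
    then show False using b[of y] dk by (auto simp: keys_restrict_keys add)
  qed
  have 2: "k \<notin> keys (?f1 * g)"
  proof
    assume "k \<in> keys (?f1 * g)"
    then obtain x y where "x \<in> keys ?f1" "y \<in> keys g" "k = x + y"
      by (elim keys_mult_ex)
    then show False using b[of y] f(1)[of x] dk by (auto simp: keys_restrict_keys add)
  qed
  have "?g0 + ?g1 = g" using restrict_keys_split[of g "\<lambda>m. \<delta> m = b"] by simp
  then have "lookup (f * g) k = lookup (?f0 * ?g0) k"
    using 1 2 unfolding fg lookup_add by (simp add: in_keys_iff)
  then have "k \<in> keys (f * g)" using k by (simp add: in_keys_iff)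
  then have "a + b \<le> h" using le dk by force
  then show ?thesis using b[OF m] by linarith
qed

text \<open>\<open>T'\<close> lists the inverses of the values \<open>T\<close>, because the target
  is a mere commutative ring. Targets used later are Laurent polynomials, the reals and formal power
  series.\<close>

definition mono_eval :: "('v \<Rightarrow> 'a::comm_ring_1) \<Rightarrow> ('v \<Rightarrow> 'a) \<Rightarrow> ('v \<Rightarrow>\<^sub>0 int) \<Rightarrow> 'a" where
  "mono_eval T T' m = (\<Prod>x \<in> keys m.
     if 0 \<le> lookup m x then T x ^ nat (lookup m x)
     else T' x ^ nat (- lookup m x))"

definition laurent_eval :: "('v \<Rightarrow> 'a::comm_ring_1) \<Rightarrow> ('v \<Rightarrow> 'a) \<Rightarrow> 'v laurent \<Rightarrow> 'a" where
  "laurent_eval T T' f = (\<Sum>m \<in> keys f. of_int (lookup f m) * mono_eval T T' m)"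

lemma int_power_add:
  fixes t t' :: "'a::comm_ring_1"
  assumes "t * t' = 1"
  shows "(if 0 \<le> a + b then t ^ nat (a + b) else t' ^ nat (- (a + b))) =
    (if 0 \<le> a then t ^ nat a else t' ^ nat (- a)) * (if 0 \<le> b then t ^ nat b else t' ^ nat (- b))"
proof -
  have key: "t ^ p * t' ^ q = (if q \<le> p then t ^ (p - q) else t' ^ (q - p))" for p q
  proof (cases "q \<le> p")
    case True
    then obtain d where "p = d + q" by (metis le_add_diff_inverse2)
    moreover have "t ^ (d + q) * t' ^ q = t ^ d * (t * t') ^ q"
      by (simp only: power_add power_mult_distrib mult_ac)
    ultimately show ?thesis using assms by simp
  next
    case False
    then obtain d where "q = d + p" by (metis le_add_diff_inverse2 nat_le_linear)
    moreover have "t ^ p * t' ^ (d + p) = t' ^ d * (t * t') ^ p"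
      by (simp only: power_add power_mult_distrib mult_ac)
    ultimately show ?thesis using assms False by simp
  qed
  consider "0 \<le> a" "0 \<le> b" | "a < 0" "b < 0" | "0 \<le> a" "b < 0" | "a < 0" "0 \<le> b" by linarith
  then show ?thesis
  proof cases
    case 1 then show ?thesis by (simp add: nat_add_distrib power_add)
  next
    case 2
    then have "nat (- (a + b)) = nat (- a) + nat (- b)" by simp
    then show ?thesis using 2 by (simp add: power_add)
  next
    case 3
    have "nat (a + b) = nat a - nat (- b)" "nat (- (a + b)) = nat (- b) - nat a" "(nat (- b) \<le> nat a) = (0 \<le> a + b)"
      using 3 by auto
    then show ?thesis using 3 key[of "nat a" "nat (- b)"] by simp
  next
    case 4
    have "nat (a + b) = nat b - nat (- a)" "nat (- (a + b)) = nat (- a) - nat b" "(nat (- a) \<le> nat b) = (0 \<le> a + b)"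
      using 4 by auto
    then show ?thesis using 4 key[of "nat b" "nat (- a)"] by (simp add: mult.commute)
  qed
qed

lemma mono_eval_superset:
  assumes "finite A" "keys m \<subseteq> A"
  shows "mono_eval T T' m = (\<Prod>x \<in> A.
     if 0 \<le> lookup m x then T x ^ nat (lookup m x)
     else T' x ^ nat (- lookup m x))"
  unfolding mono_eval_def
  by (rule prod.mono_neutral_left) (use assms in \<open>auto simp: in_keys_iff\<close>)

locale laurent_hom =
  fixes T T' :: "'v \<Rightarrow> 'a::comm_ring_1"
  assumes unit: "T x * T' x = 1"
begin

lemma mono_eval_add: "mono_eval T T' (a + b) = mono_eval T T' a * mono_eval T T' b"
proof -
  let ?A = "keys a \<union> keys b"
  have "mono_eval T T' (a + b) = (\<Prod>x \<in> ?A.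
     if 0 \<le> lookup (a + b) x then T x ^ nat (lookup (a + b) x)
     else T' x ^ nat (- lookup (a + b) x))"
    by (rule mono_eval_superset) (simp_all add: Poly_Mapping.keys_add)
  also have "\<dots> = (\<Prod>x \<in> ?A. (if 0 \<le> lookup a x then T x ^ nat (lookup a x)
     else T' x ^ nat (- lookup a x)) * (if 0 \<le> lookup b x then T x ^ nat (lookup b x)
     else T' x ^ nat (- lookup b x)))"
    unfolding lookup_add by (intro prod.cong refl int_power_add unit)
  also have "\<dots> = mono_eval T T' a * mono_eval T T' b"
    unfolding prod.distrib by (subst (1 2) mono_eval_superset[of ?A]) auto
  finally show ?thesis .
qed

lemma mono_eval_zero [simp]: "mono_eval T T' 0 = 1"
  by (simp add: mono_eval_def)

lemma superset: "finite A \<Longrightarrow> keys f \<subseteq> A \<Longrightarrow>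
  laurent_eval T T' f = (\<Sum>m \<in> A. of_int (lookup f m) * mono_eval T T' m)"
  unfolding laurent_eval_def by (rule sum.mono_neutral_left) (auto simp: in_keys_iff)

lemma add: "laurent_eval T T' (f + g) = laurent_eval T T' f + laurent_eval T T' g"
proof -
  let ?A = "keys f \<union> keys g"
  have "laurent_eval T T' (f + g) = (\<Sum>m \<in> ?A. of_int (lookup (f + g) m) * mono_eval T T' m)"
    by (rule superset) (simp_all add: Poly_Mapping.keys_add)
  also have "\<dots> = laurent_eval T T' f + laurent_eval T T' g"
    by (subst (1 2) superset[of ?A]) (auto simp: lookup_add sum.distrib algebra_simps)
  finally show ?thesis .
qed

lemma zero [simp]: "laurent_eval T T' 0 = 0"
  by (simp add: laurent_eval_def)

lemma diff: "laurent_eval T T' (f - g) = laurent_eval T T' f - laurent_eval T T' g"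
  using add[of "f - g" g] by simp

lemma sum: "laurent_eval T T' (sum f A) = (\<Sum>a\<in>A. laurent_eval T T' (f a))"
  by (induction A rule: infinite_finite_induct) (simp_all add: add)

lemma single: "laurent_eval T T' (single m c) = of_int c * mono_eval T T' m"
  by (cases "c = 0") (simp_all add: laurent_eval_def)

lemma one [simp]: "laurent_eval T T' 1 = 1"
  using single[of 0 1] by simp

lemma mult: "laurent_eval T T' (f * g) = laurent_eval T T' f * laurent_eval T T' g"
proof -
  have "f * g = (\<Sum>a\<in>keys f. \<Sum>b\<in>keys g.
      single (a + b) (lookup f a * lookup g b))"
    by (subst poly_mapping_expand[of f], subst poly_mapping_expand[of g])
      (simp add: sum_product mult_single)
  then have "laurent_eval T T' (f * g) = (\<Sum>a\<in>keys f. \<Sum>b\<in>keys g.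
      of_int (lookup f a) * mono_eval T T' a * (of_int (lookup g b) * mono_eval T T' b))"
    by (simp add: sum single mono_eval_add mult_ac)
  then show ?thesis by (simp add: laurent_eval_def sum_product)
qed

lemma prod: "laurent_eval T T' (prod f A) = (\<Prod>a\<in>A. laurent_eval T T' (f a))"
  by (induction A rule: infinite_finite_induct) (simp_all add: mult)

lemma power: "laurent_eval T T' (f ^ k) = laurent_eval T T' f ^ k"
  by (induction k) (simp_all add: mult)

lemma lvar [simp]: "laurent_eval T T' (lvar x) = T x"
  unfolding lvar_def single by (simp add: mono_eval_def)

lemma lvar_inv [simp]: "laurent_eval T T' (lvar_inv x) = T' x"
  unfolding lvar_inv_def single by (simp add: mono_eval_def)

end

lemma lvar_lvar_inv [simp]: "lvar x * lvar_inv x = 1" "lvar_inv x * lvar x = 1"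
  by (simp_all add: lvar_def lvar_inv_def mult_single flip: single_add)

lemma lvar_power: "lvar x ^ k = single (single x (int k)) 1"
proof (induction k)
  case (Suc k)
  then show ?case by (simp add: lvar_def mult_single flip: single_add)
qed simp

lemma lvar_inv_power: "lvar_inv x ^ k = single (single x (- int k)) 1"
proof (induction k)
  case (Suc k)
  then show ?case by (simp add: lvar_inv_def mult_single algebra_simps flip: single_add)
qed simp

lemma prod_single_one:
  "(\<Prod>x\<in>A. single (g x) (1::'b::comm_semiring_1)) = single (\<Sum>x\<in>A. g x) 1"
  by (induction A rule: infinite_finite_induct) (simp_all add: mult_single)

text \<open>Through this identity renaming inherits the homomorphism properties of
  evaluations.\<close>

lemma lrename_eq_eval: "lrename \<sigma> = laurent_eval (\<lambda>x. lvar (\<sigma> x)) (\<lambda>x. lvar_inv (\<sigma> x))"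
proof
  fix f :: "'a laurent"
  have *: "of_int c * mono_eval (\<lambda>x. lvar (\<sigma> x)) (\<lambda>x. lvar_inv (\<sigma> x)) m
      = single (\<Sum>x \<in> keys m. single (\<sigma> x) (lookup m x)) c" for m c
  proof -
    have "mono_eval (\<lambda>x. lvar (\<sigma> x)) (\<lambda>x. lvar_inv (\<sigma> x)) m
        = (\<Prod>x \<in> keys m. single (single (\<sigma> x) (lookup m x)) 1)"
      unfolding mono_eval_def by (intro prod.cong refl) (simp add: lvar_power lvar_inv_power)
    then show ?thesis
      by (simp add: prod_single_one mult_single flip: single_of_int)
  qed
  show "lrename \<sigma> f = laurent_eval (\<lambda>x. lvar (\<sigma> x)) (\<lambda>x. lvar_inv (\<sigma> x)) f"
    unfolding lrename_def laurent_eval_def * ..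
qed

lemma lrename_hom: "laurent_hom (\<lambda>x. lvar (\<sigma> x)) (\<lambda>x. lvar_inv (\<sigma> x))"
  by unfold_locales simp

lemma lrename_diff: "lrename \<sigma> (f - g) = lrename \<sigma> f - lrename \<sigma> g"
  and lrename_mult: "lrename \<sigma> (f * g) = lrename \<sigma> f * lrename \<sigma> g"
  and lrename_prod: "lrename \<sigma> (prod h A) = (\<Prod>a\<in>A. lrename \<sigma> (h a))"
  and lrename_power: "lrename \<sigma> (f ^ k) = lrename \<sigma> f ^ k"
  and lrename_zero [simp]: "lrename \<sigma> 0 = 0"
  and lrename_one [simp]: "lrename \<sigma> 1 = 1"
  and lrename_lvar [simp]: "lrename \<sigma> (lvar x) = lvar (\<sigma> x)"
  and lrename_lvar_inv [simp]: "lrename \<sigma> (lvar_inv x) = lvar_inv (\<sigma> x)"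
  unfolding lrename_eq_eval
  by (simp_all add: laurent_hom.diff[OF lrename_hom]
      laurent_hom.mult[OF lrename_hom] laurent_hom.prod[OF lrename_hom]
      laurent_hom.power[OF lrename_hom] laurent_hom.zero[OF lrename_hom] laurent_hom.one[OF lrename_hom]
      laurent_hom.lvar[OF lrename_hom] laurent_hom.lvar_inv[OF lrename_hom])

context laurent_hom begin

lemma eval_lrename:
  fixes \<sigma> :: "'w \<Rightarrow> 'v"
  shows "laurent_eval T T' (lrename \<sigma> f) = laurent_eval (\<lambda>x. T (\<sigma> x)) (\<lambda>x. T' (\<sigma> x)) f"
proof -
  have "mono_eval T T' (\<Sum>x \<in> keys m. single (\<sigma> x) (lookup m x))
      = mono_eval (\<lambda>x. T (\<sigma> x)) (\<lambda>x. T' (\<sigma> x)) m" for m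
  proof -
    have s: "mono_eval T T' (sum g A) = (\<Prod>a\<in>A. mono_eval T T' (g a))" for g :: "'w \<Rightarrow> _" and A
      by (induction A rule: infinite_finite_induct) (simp_all add: mono_eval_add)
    show ?thesis unfolding s
      by (simp add: mono_eval_def) (intro prod.cong refl, auto simp: in_keys_iff)
  qed
  then show ?thesis unfolding lrename_def sum single
    by (simp add: laurent_eval_def)
qed

end

lemma lrename_lrename: "lrename \<tau> (lrename \<sigma> f) = lrename (\<lambda>x. \<tau> (\<sigma> x)) f"
  unfolding lrename_eq_eval[of \<tau>] lrename_eq_eval[of "\<lambda>x. \<tau> (\<sigma> x)"]
  by (rule laurent_hom.eval_lrename) (unfold_locales, simp)

lemma lrename_id: "lrename (\<lambda>x. x) f = f"
  unfolding lrename_def poly_mapping_expand[symmetric] ..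

text \<open>Both recursions become \<open>wt a b * F (u s\<^sub>i) = F u - cf a b * s\<^sub>i (F u)\<close>; the flag selects
  K-theory.\<close>

definition wt :: "bool \<Rightarrow> 'v \<Rightarrow> 'v \<Rightarrow> 'v laurent" where
  "wt k a b = (if k then 1 - lvar a * lvar_inv b else lvar a - lvar b)"

definition cf :: "bool \<Rightarrow> 'v \<Rightarrow> 'v \<Rightarrow> 'v laurent" where
  "cf k a b = (if k then lvar a * lvar_inv b else 1)"

lemma wt_same [simp]: "wt k a a = 0"
  by (simp add: wt_def)

lemma cf_same [simp]: "cf k a a = 1"
  by (simp add: cf_def)

lemma cf_cf: "cf k a b * cf k b c = cf k a c"
proof -
  have "lvar a * lvar_inv b * (lvar b * lvar_inv c) = lvar a * (lvar_inv b * lvar b) * lvar_inv c"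
    by (simp only: mult_ac)
  then show ?thesis by (simp add: cf_def)
qed

text \<open>Cocycle rule: \<open>cf\<close> measures how far the K-theoretic weight is from being
  additive along \<open>a\<close>, \<open>b\<close>, \<open>c\<close>; in cohomology it is
  1.\<close>

lemma wt_add: "wt k a c = wt k a b + cf k a b * wt k b c"
proof -
  have "lvar a * lvar_inv b * (lvar b * lvar_inv c) = lvar a * (lvar_inv b * lvar b) * lvar_inv c"
    by (simp only: mult_ac)
  then show ?thesis by (simp add: wt_def cf_def algebra_simps)
qed

lemma wt_swap: "wt k a b = - cf k a b * wt k b a"
  using wt_add[of k a a b] by (simp add: algebra_simps eq_neg_iff_add_eq_0)

lemma lrename_wt [simp]: "lrename \<sigma> (wt k a b) = wt k (\<sigma> a) (\<sigma> b)"
  by (simp add: wt_def lrename_diff lrename_mult)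

lemma lrename_cf [simp]: "lrename \<sigma> (cf k a b) = cf k (\<sigma> a) (\<sigma> b)"
  by (simp add: cf_def lrename_mult)

lemma lvar_times_lvar_inv:
  "lvar a * lvar_inv b = single (single a 1 - single b 1) 1"
  by (simp add: lvar_def lvar_inv_def mult_single single_uminus)

lemma wt_nonzero [simp]: "wt k a b = 0 \<longleftrightarrow> a = b"
proof
  assume *: "wt k a b = 0"
  show "a = b"
  proof (rule ccontr)
    assume ab: "a \<noteq> b"
    show False
    proof (cases k)
      case True
      have "lookup (wt k a b) 0 = 1"
      proof -
        have "lookup (single a (1::int) - single b 1) a = 1"
          using ab by (simp add: lookup_minus lookup_single)
        then have "single a (1::int) - single b 1 \<noteq> 0" by force
        then show ?thesis using True
          by (simp add: wt_def lvar_times_lvar_inv lookup_minus lookup_single lookup_one when_def)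
      qed
      then show False using * by simp
    next
      case False
      then have "lookup (lvar a) (single a 1) = lookup (lvar b) (single a 1)"
        using * by (simp add: wt_def)
      then have "single b (1::int) = single a 1"
        by (simp add: lvar_def lookup_single when_def split: if_splits)
      then have "lookup (single b (1::int)) a = 1" by simp
      then show False using ab by (simp add: lookup_single)
    qed
  qed
qed simp

text \<open>Congruence modulo \<open>d\<close> is preserved by sums and products, and by inverses
  because 1/a - 1/b = -(a - b)/(ab).\<close>

lemma laurent_eval_diff_dvd:
  assumes "laurent_hom T T'" "laurent_hom U U'"
    and d: "\<And>z. d dvd T z - U z"
  shows "d dvd laurent_eval T T' f - laurent_eval U U' f"
proof -
  interpret t: laurent_hom T T' by fact
  interpret u: laurent_hom U U' by fact
  have mult: "d dvd a * b - a' * b'" if "d dvd a - a'" "d dvd b - b'" for a b a' b'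
  proof -
    have "a * b - a' * b' = (a - a') * b + a' * (b - b')" by (simp add: algebra_simps)
    then show ?thesis using that by simp
  qed
  have power: "d dvd a ^ k - a' ^ k" if "d dvd a - a'" for a a' and k :: nat
    by (induction k) (simp_all add: mult that)
  have prod: "d dvd prod g A - prod g' A" if "\<And>x. d dvd g x - g' x" for g g' and A :: "'a set"
    by (induction A rule: infinite_finite_induct) (simp_all add: mult that)
  have inv: "d dvd T' z - U' z" for z
  proof -
    have "- (T z - U z) * (T' z * U' z) = (U z * U' z) * T' z - (T z * T' z) * U' z"
      by (simp add: algebra_simps)
    also have "\<dots> = T' z - U' z" using t.unit u.unit by simp
    finally show ?thesis using d[of z] by (metis dvd_minus_iff dvd_mult2)
  qed
  have mono: "d dvd mono_eval T T' m - mono_eval U U' m" for m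
    unfolding mono_eval_def by (rule prod) (auto intro: power d inv)
  have "laurent_eval T T' f - laurent_eval U U' f = (\<Sum>m\<in>keys f.
      of_int (lookup f m) * (mono_eval T T' m - mono_eval U U' m))"
    unfolding laurent_eval_def by (simp add: sum_subtractf algebra_simps)
  then show ?thesis by (simp add: dvd_sum mono)
qed

lemma lrename_diff_dvd:
  assumes "\<And>z. \<sigma> z = \<tau> z \<or> {\<sigma> z, \<tau> z} = {a, b}"
  shows "wt False a b dvd lrename \<sigma> f - lrename \<tau> f"
proof -
  have "wt False a b dvd lvar (\<sigma> z) - lvar (\<tau> z)" for z
    using assms[of z] dvd_minus_iff[of "lvar a - lvar b" "lvar a - lvar b"]
    by (auto simp: doubleton_eq_iff wt_def)
  then show ?thesis
    unfolding lrename_eq_eval by (intro laurent_eval_diff_dvd lrename_hom)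
qed

text \<open>The weights of the two theories differ by the unit \<open>- lvar_inv b\<close>, so
  divisibility can always be tested on the linear form.\<close>

lemma wt_dvd_iff: "wt k a b dvd f \<longleftrightarrow> wt False a b dvd f"
proof (cases k)
  case True
  have 1: "wt True a b = - lvar_inv b * wt False a b"
    by (simp add: wt_def algebra_simps)
  have "lvar b * wt True a b = lvar b - (lvar b * lvar_inv b) * lvar a"
    by (simp add: wt_def algebra_simps del: lvar_lvar_inv)
  then have 2: "wt False a b = - lvar b * wt True a b"
    by (simp add: wt_def)
  have "wt False a b dvd wt True a b" unfolding 1 by (rule dvd_triv_right)
  moreover have "wt True a b dvd wt False a b" by (subst 2) (rule dvd_triv_right)
  ultimately show ?thesis using True by (auto intro: dvd_trans)
qed simp

text \<open>Factor theorem: modulo the weight, \<open>f\<close> is congruent to its image under the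
  identification.\<close>

lemma wt_dvd_of_identify:
  assumes "lrename (id(b := a)) f = 0"
  shows "wt k a b dvd f"
proof -
  have "wt False a b dvd lrename (\<lambda>z. z) f - lrename (id(b := a)) f"
    by (rule lrename_diff_dvd) auto
  then show ?thesis using assms by (simp add: lrename_id wt_dvd_iff[of k])
qed

subsection \<open>Divided differences\<close>

text \<open>Swapping the variables changes \<open>f\<close> by a multiple of the weight, and in
  K-theory 1 - \<open>cf\<close> is the weight itself.\<close>

lemma divided_difference_dvd: "wt k a b dvd f - cf k a b * lrename (transpose a b) f"
proof -
  have "wt k a b dvd lrename (\<lambda>z. z) f - lrename (transpose a b) f"
    unfolding wt_dvd_iff[of k] by (rule lrename_diff_dvd) (auto simp: transpose_def)
  then have 1: "wt k a b dvd f - lrename (transpose a b) f"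
    by (simp add: lrename_id)
  have 2: "f - cf k a b * lrename (transpose a b) f
      = (f - lrename (transpose a b) f) + (1 - cf k a b) * lrename (transpose a b) f"
    by (simp add: algebra_simps)
  have 3: "1 - cf k a b = (if k then wt k a b else 0)"
    by (simp add: wt_def cf_def)
  show ?thesis unfolding 2 3 using 1 by (intro dvd_add) auto
qed

text \<open>\<open>SOME\<close> stands for a division: the quotient exists by
  \<open>divided_difference_dvd\<close> and is unique for distinct \<open>a\<close> and
  \<open>b\<close>, the ring being a domain.\<close>

definition ddiff :: "bool \<Rightarrow> 'v \<Rightarrow> 'v \<Rightarrow> 'v laurent \<Rightarrow> 'v laurent" where
  "ddiff k a b f = (SOME g. wt k a b * g = f - cf k a b * lrename (transpose a b) f)"

lemma ddiff: "wt k a b * ddiff k a b f = f - cf k a b * lrename (transpose a b) f"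
proof -
  obtain g where "f - cf k a b * lrename (transpose a b) f = wt k a b * g"
    by (rule dvdE[OF divided_difference_dvd])
  then have "\<exists>g. wt k a b * g = f - cf k a b * lrename (transpose a b) f"
    by (intro exI[of _ g]) simp
  then show ?thesis unfolding ddiff_def by (rule someI_ex)
qed

lemma lrename_ddiff:
  "wt k (\<sigma> a) (\<sigma> b) * lrename \<sigma> (ddiff k a b f)
    = lrename \<sigma> f - cf k (\<sigma> a) (\<sigma> b) * lrename (\<lambda>z. \<sigma> (transpose a b z)) f"
proof -
  have "lrename \<sigma> (wt k a b * ddiff k a b f) = lrename \<sigma> (f - cf k a b * lrename (transpose a b) f)"
    by (simp only: ddiff)
  then show ?thesis by (simp add: lrename_mult lrename_diff lrename_lrename)
qed

lemma commuting_identity: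
  fixes e :: "'a::comm_ring_1"
  assumes "e * x = f - c * t" "e * y = s - c * u"
  shows "e * (x - d * y) = f - c * t - d * s + d * c * u"
proof -
  have "e * (x - d * y) = e * x - d * (e * y)" by (simp add: algebra_simps)
  then show ?thesis unfolding assms by (simp add: algebra_simps)
qed

text \<open>Multiplied by both weights, the two sides expand to the same combination of the four
  images of \<open>f\<close> under the group generated by the two swaps.\<close>

lemma ddiff_commute:
  fixes f :: "'v::linorder laurent"
  assumes "a \<noteq> b" "c \<noteq> d" "{a, b} \<inter> {c, d} = {}"
  shows "ddiff k a b (ddiff k c d f) = ddiff k c d (ddiff k a b f)"
proof -
  let ?s = "transpose a b" and ?t = "transpose c d"
  have st: "(\<lambda>z. ?s (?t z)) = (\<lambda>z. ?t (?s z))"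
    using assms by (auto simp: transpose_def fun_eq_iff)
  have fixd: "?s c = c" "?s d = d" "?t a = a" "?t b = b"
    using assms by (auto simp: transpose_def)
  have 1: "wt k c d * (wt k a b * ddiff k a b (ddiff k c d f))
      = f - cf k c d * lrename ?t f - cf k a b * lrename ?s f
        + cf k a b * cf k c d * lrename (\<lambda>z. ?s (?t z)) f"
    unfolding ddiff[of k a b]
    by (rule commuting_identity) (use lrename_ddiff[of k ?s c d f] in \<open>simp_all add: ddiff fixd\<close>)
  have 2: "wt k a b * (wt k c d * ddiff k c d (ddiff k a b f))
      = f - cf k a b * lrename ?s f - cf k c d * lrename ?t f
        + cf k c d * cf k a b * lrename (\<lambda>z. ?t (?s z)) f"
    unfolding ddiff[of k c d]
    by (rule commuting_identity) (use lrename_ddiff[of k ?t a b f] in \<open>simp_all add: ddiff fixd\<close>)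
  have "wt k c d * (wt k a b * ddiff k a b (ddiff k c d f))
      = wt k a b * (wt k c d * ddiff k c d (ddiff k a b f))"
    unfolding 1 2 st by (simp add: algebra_simps)
  then have "wt k c d * wt k a b * ddiff k a b (ddiff k c d f)
      = wt k c d * wt k a b * ddiff k c d (ddiff k a b f)"
    by (simp add: mult_ac)
  then show ?thesis using assms by simp
qed

lemma wt_add': "wt k a c = wt k b c + cf k b c * wt k a b"
proof -
  have "lvar b * lvar_inv c * (lvar a * lvar_inv b) = lvar a * (lvar b * lvar_inv b) * lvar_inv c"
    by (simp only: mult_ac)
  then show ?thesis by (simp add: wt_def cf_def algebra_simps)
qed

text \<open>Numerator and denominator of the divided difference change by the same unit when the two
  variables are swapped.\<close>

lemma lrename_transpose_ddiff:
  fixes f :: "'v::linorder laurent"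
  assumes "a \<noteq> b"
  shows "lrename (transpose a b) (ddiff k a b f) = ddiff k a b f"
proof -
  have "wt k b a * lrename (transpose a b) (ddiff k a b f)
      = lrename (transpose a b) f - cf k b a * f"
    using lrename_ddiff[of k "transpose a b" a b f] by (simp add: lrename_id)
  note 1 = this
  have "wt k a b * lrename (transpose a b) (ddiff k a b f)
      = - cf k a b * (wt k b a * lrename (transpose a b) (ddiff k a b f))"
    by (subst wt_swap) (simp add: mult.assoc)
  also have "\<dots> = (cf k a b * cf k b a) * f - cf k a b * lrename (transpose a b) f"
    unfolding 1 by (simp only: algebra_simps) simp
  finally have "wt k a b * lrename (transpose a b) (ddiff k a b f)
      = f - cf k a b * lrename (transpose a b) f"
    unfolding cf_cf by simp
  then have "wt k a b * lrename (transpose a b) (ddiff k a b f) = wt k a b * ddiff k a b f"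
    by (simp only: ddiff)
  then show ?thesis using assms by simp
qed

text \<open>Multiplied by the three weights, each side becomes the same combination of the six
  images of \<open>f\<close> under permutations of the three variables. The expansion uses that a
  divided difference is invariant under its own swap.\<close>

lemma ddiff_braid:
  fixes f :: "'v::linorder laurent"
  assumes "a \<noteq> b" "b \<noteq> c" "a \<noteq> c"
  shows "ddiff k a b (ddiff k b c (ddiff k a b f)) = ddiff k b c (ddiff k a b (ddiff k b c f))"
proof -
  let ?s = "transpose a b" and ?t = "transpose b c"
  let ?E = "wt k a b" and ?F = "wt k b c" and ?G = "wt k a c"
  let ?p = "cf k a b" and ?q = "cf k b c" and ?r = "cf k a c"
  have fixd: "?s a = b" "?s b = a" "?s c = c" "?t a = a" "?t b = c" "?t c = b"
    using assms by (auto simp: transpose_def)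
  have braid: "(\<lambda>z. ?s (?t (?s z))) = (\<lambda>z. ?t (?s (?t z)))"
    using assms by (auto simp: transpose_def fun_eq_iff)
  define g1 where "g1 = ddiff k a b f"
  define g2 where "g2 = ddiff k b c g1"
  define h1 where "h1 = ddiff k b c f"
  define h2 where "h2 = ddiff k a b h1"
  define fs where "fs = lrename ?s f"
  define ft where "ft = lrename ?t f"
  define fst where "fst = lrename (\<lambda>z. ?s (?t z)) f"
  define fts where "fts = lrename (\<lambda>z. ?t (?s z)) f"
  define fsts where "fsts = lrename (\<lambda>z. ?s (?t (?s z))) f"
  have a1: "?E * g1 = f - ?p * fs" unfolding g1_def fs_def by (rule ddiff)
  have a2: "?G * lrename ?t g1 = ft - ?r * fts"
    using lrename_ddiff[of k ?t a b f] by (simp add: fixd g1_def ft_def fts_def)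
  have a3: "?F * g2 = g1 - ?q * lrename ?t g1" unfolding g2_def by (rule ddiff)
  have a4: "?F * lrename (\<lambda>z. ?s (?t z)) g1 = fst - ?q * fsts"
    using lrename_ddiff[of k "\<lambda>z. ?s (?t z)" a b f] by (simp add: fixd g1_def fst_def fsts_def)
  have a5: "?G * lrename ?s g2 = g1 - ?r * lrename (\<lambda>z. ?s (?t z)) g1"
    using lrename_ddiff[of k ?s b c g1] assms
    by (simp add: fixd g2_def g1_def lrename_transpose_ddiff)
  have a6: "?E * ddiff k a b g2 = g2 - ?p * lrename ?s g2" by (rule ddiff)
  \<comment> \<open>By the cocycle rule, \<open>?G * g1 - ?p * ?F * g1\<close> collapses to
    \<open>?E * g1\<close>, which is known from \<open>a1\<close>.\<close>
  have G: "?G = ?E + ?p * ?F" by (rule wt_add)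
  have "?E * ?F * ?G * ddiff k a b g2 = ?G * (?F * g2) - ?p * ?F * (?G * lrename ?s g2)"
    using arg_cong[OF a6, of "\<lambda>z. ?F * ?G * z"] by (simp add: algebra_simps)
  also have "\<dots> = ?G * g1 - ?q * (?G * lrename ?t g1) - ?p * ?F * g1
      + ?p * ?r * (?F * lrename (\<lambda>z. ?s (?t z)) g1)"
    unfolding a3 a5 by (simp add: algebra_simps)
  also have "\<dots> = ?E * g1 - ?q * (ft - ?r * fts) + ?p * ?r * (fst - ?q * fsts)"
    unfolding a2 a4 unfolding G by (simp add: algebra_simps)
  also have "\<dots> = f - ?p * fs - ?q * ft + ?q * ?r * fts + ?p * ?r * fst - ?p * ?q * ?r * fsts"
    unfolding a1 by (simp add: algebra_simps)
  finally have 1: "?E * ?F * ?G * ddiff k a b g2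
      = f - ?p * fs - ?q * ft + ?q * ?r * fts + ?p * ?r * fst - ?p * ?q * ?r * fsts" .
  have b1: "?F * h1 = f - ?q * ft" unfolding h1_def ft_def by (rule ddiff)
  have b2: "?G * lrename ?s h1 = fs - ?r * fst"
    using lrename_ddiff[of k ?s b c f] by (simp add: fixd h1_def fs_def fst_def)
  have b3: "?E * h2 = h1 - ?p * lrename ?s h1" unfolding h2_def by (rule ddiff)
  have b4: "?E * lrename (\<lambda>z. ?t (?s z)) h1 = fts - ?p * fsts"
    using lrename_ddiff[of k "\<lambda>z. ?t (?s z)" b c f] by (simp add: fixd h1_def fts_def fsts_def braid)
  have b5: "?G * lrename ?t h2 = h1 - ?r * lrename (\<lambda>z. ?t (?s z)) h1"
    using lrename_ddiff[of k ?t a b h1] assms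
    by (simp add: fixd h2_def h1_def lrename_transpose_ddiff)
  have b6: "?F * ddiff k b c h2 = h2 - ?q * lrename ?t h2" by (rule ddiff)
  have G': "?G = ?F + ?q * ?E" by (rule wt_add')
  have "?E * ?F * ?G * ddiff k b c h2 = ?G * (?E * h2) - ?q * ?E * (?G * lrename ?t h2)"
    using arg_cong[OF b6, of "\<lambda>z. ?E * ?G * z"] by (simp add: algebra_simps)
  also have "\<dots> = ?G * h1 - ?p * (?G * lrename ?s h1) - ?q * ?E * h1
      + ?q * ?r * (?E * lrename (\<lambda>z. ?t (?s z)) h1)"
    unfolding b3 b5 by (simp add: algebra_simps)
  also have "\<dots> = ?F * h1 - ?p * (fs - ?r * fst) + ?q * ?r * (fts - ?p * fsts)"
    unfolding b2 b4 unfolding G' by (simp add: algebra_simps)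
  also have "\<dots> = f - ?p * fs - ?q * ft + ?q * ?r * fts + ?p * ?r * fst - ?p * ?q * ?r * fsts"
    unfolding b1 by (simp add: algebra_simps)
  finally have "?E * ?F * ?G * ddiff k a b g2 = ?E * ?F * ?G * ddiff k b c h2" using 1 by simp
  then show ?thesis using assms by (simp add: g1_def g2_def h1_def h2_def)
qed

subsection \<open>Existence and uniqueness of the Schubert and Grothendieck families\<close>

fun xyvar_code :: "xyvar \<Rightarrow> nat \<times> bool" where
  "xyvar_code (X i) = (i, False)"
| "xyvar_code (Y i) = (i, True)"

text \<open>An arbitrary linear order: it orders the exponents, and with ordered exponents the
  Laurent polynomials form a domain, in which weights can be cancelled.\<close>

instantiation xyvar :: linorder begin
definition less_eq_xyvar :: "xyvar \<Rightarrow> xyvar \<Rightarrow> bool" where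
  "less_eq_xyvar a b \<longleftrightarrow> fst (xyvar_code a) < fst (xyvar_code b)
     \<or> fst (xyvar_code a) = fst (xyvar_code b) \<and> snd (xyvar_code a) \<le> snd (xyvar_code b)"
definition less_xyvar :: "xyvar \<Rightarrow> xyvar \<Rightarrow> bool" where
  "less_xyvar a b \<longleftrightarrow> a \<le> b \<and> a \<noteq> b"
instance
proof
  fix a b c :: xyvar
  show "(a < b) = (a \<le> b \<and> \<not> b \<le> a)"
    by (cases a; cases b) (auto simp: less_eq_xyvar_def less_xyvar_def)
  show "a \<le> a" by (simp add: less_eq_xyvar_def)
  show "a \<le> b \<Longrightarrow> b \<le> c \<Longrightarrow> a \<le> c"
    by (auto simp: less_eq_xyvar_def)
  show "a \<le> b \<Longrightarrow> b \<le> a \<Longrightarrow> a = b"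
    by (cases a; cases b) (auto simp: less_eq_xyvar_def)
  show "a \<le> b \<or> b \<le> a"
    by (cases a; cases b) (auto simp: less_eq_xyvar_def)
qed
end

definition longest_class :: "bool \<Rightarrow> nat \<Rightarrow> xyvar laurent" where
  "longest_class k n = (\<Prod>(i, j) \<in> {(i, j). 1 \<le> i \<and> 1 \<le> j \<and> i + j \<le> n}. wt k (X i) (Y j))"

definition schubert_family :: "bool \<Rightarrow> nat \<Rightarrow> ((nat \<Rightarrow> nat) \<Rightarrow> xyvar laurent) \<Rightarrow> bool" where
  "schubert_family k n F \<longleftrightarrow> F (w0 n) = longest_class k n \<and>
     (\<forall>u i. u permutes {1..n} \<and> 1 \<le> i \<and> i < n \<and> u (i + 1) < u i \<longrightarrow>
        wt k (X i) (X (i + 1)) * F (u \<circ> transpose i (i + 1))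
          = F u - cf k (X i) (X (i + 1)) * swap_x i (F u))"

lemma double_schubert_family_eq: "double_schubert_family n F = schubert_family False n F"
  by (simp add: double_schubert_family_def schubert_family_def longest_class_def wt_def cf_def)

text \<open>Multiplying the recursion by the inverse of the second variable brings it into the
  common form.\<close>

lemma double_grothendieck_family_eq: "double_grothendieck_family n F = schubert_family True n F"
proof -
  have "((lvar (X (i + 1)) - lvar (X i)) * A = lvar (X (i + 1)) * B - lvar (X i) * C) =
      (wt True (X i) (X (i + 1)) * A = B - cf True (X i) (X (i + 1)) * C)" (is "?l = ?rhs")
    for i and A B C :: "xyvar laurent"
  proof -
    let ?p = "lvar (X (i + 1))" and ?q = "lvar (X i)" and ?r = "lvar_inv (X (i + 1))"
    have 1: "?r * ((?p - ?q) * A) = (?p * ?r) * A - ?q * ?r * A" "?r * (?p * B - ?q * C) = (?p * ?r) * B - ?q * ?r * C"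
      by (simp_all add: algebra_simps del: lvar_lvar_inv)
    have "?l = (?r * ((?p - ?q) * A) = ?r * (?p * B - ?q * C))"
    proof
      assume "?r * ((?p - ?q) * A) = ?r * (?p * B - ?q * C)"
      then have "?p * ?r * ((?p - ?q) * A) = ?p * ?r * (?p * B - ?q * C)" by (simp only: mult.assoc)
      then show ?l by simp
    qed simp
    also have "\<dots> = ?rhs"
      unfolding 1 by (simp add: wt_def cf_def left_diff_distrib)
    finally show ?thesis .
  qed
  then show ?thesis
    by (simp add: double_grothendieck_family_def schubert_family_def longest_class_def wt_def)
qed

definition ascent :: "nat \<Rightarrow> (nat \<Rightarrow> nat) \<Rightarrow> nat \<Rightarrow> bool" where
  "ascent n u i \<longleftrightarrow> 1 \<le> i \<and> i < n \<and> u i < u (i + 1)"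

text \<open>The measure for inductions towards \<open>w0\<close>: by the rearrangement inequality it
  drops whenever an ascending pair, adjacent or not, is exchanged.\<close>

definition pos_sum :: "nat \<Rightarrow> (nat \<Rightarrow> nat) \<Rightarrow> nat" where
  "pos_sum n u = (\<Sum>i\<in>{1..n}. i * u i)"

lemma pos_sum_swap:
  assumes "i \<in> {1..n}" "j \<in> {1..n}" "i < j" "u i < u j"
  shows "pos_sum n (u \<circ> transpose i j) < pos_sum n u"
proof -
  have split: "pos_sum n w = i * w i + j * w j + (\<Sum>k\<in>{1..n} - {i, j}. k * w k)" for w
  proof -
    have "pos_sum n w = (\<Sum>k\<in>{i, j}. k * w k) + (\<Sum>k\<in>{1..n} - {i, j}. k * w k)"
      unfolding pos_sum_def using assms by (subst sum.subset_diff[of "{i, j}"]) (auto simp: add.commute)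
    then show ?thesis using assms by simp
  qed
  have "(\<Sum>k\<in>{1..n} - {i, j}. k * (u \<circ> transpose i j) k) = (\<Sum>k\<in>{1..n} - {i, j}. k * u k)"
    by (rule sum.cong) (auto simp: transpose_def)
  moreover have "i * u j + j * u i < i * u i + j * u j"
  proof -
    obtain d e where "j = i + d" "u j = u i + e" "d > 0" "e > 0"
      using assms by (metis less_imp_add_positive)
    then show ?thesis by (simp add: algebra_simps)
  qed
  ultimately show ?thesis unfolding split by simp
qed

text \<open>Each permutation is connected to \<open>w0\<close> through its least ascents, which
  fixes one reduced word; independence of this choice is \<open>family_fun_ascent\<close>.\<close>

function family_fun :: "bool \<Rightarrow> nat \<Rightarrow> (nat \<Rightarrow> nat) \<Rightarrow> xyvar laurent" where
  "family_fun k n u = (if \<exists>i. ascent n u i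
     then let i = (LEAST i. ascent n u i) in
       ddiff k (X i) (X (i + 1)) (family_fun k n (u \<circ> transpose i (i + 1)))
     else longest_class k n)"
  by auto
termination
proof (relation "measure (\<lambda>(k, n, u). pos_sum n u)")
  fix k :: bool and n u i
  assume *: "\<exists>i. ascent n u i" "i = (LEAST i. ascent n u i)"
  then have "ascent n u i" by (metis LeastI)
  then have "pos_sum n (u \<circ> transpose i (i + 1)) < pos_sum n u"
    by (intro pos_sum_swap) (auto simp: ascent_def)
  then show "((k, n, u \<circ> transpose i (i + 1)), k, n, u) \<in> measure (\<lambda>(k, n, u). pos_sum n u)"
    by simp
qed simp

declare family_fun.simps [simp del]

text \<open>Confluence: distant ascents commute, adjacent ones are joined by the braid relation, and
  the induction hypothesis covers the smaller permutations on the way.\<close>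

lemma family_fun_ascent:
  assumes "ascent n u j"
  shows "family_fun k n u = ddiff k (X j) (X (j + 1)) (family_fun k n (u \<circ> transpose j (j + 1)))"
  using assms
proof (induction "pos_sum n u" arbitrary: u j rule: less_induct)
  case less
  have smaller: "pos_sum n (u \<circ> transpose p (p + 1)) < pos_sum n u" if "ascent n u p" for u p
    using that by (intro pos_sum_swap) (auto simp: ascent_def)
  let ?D = "\<lambda>i. ddiff k (X i) (X (i + 1))" and ?s = "\<lambda>i. transpose i (i + 1)" and ?F = "family_fun k n"
  have IH: "?F u' = ?D p (?F (u' \<circ> ?s p))" if "pos_sum n u' < pos_sum n u" "ascent n u' p" for u' p
    using less.hyps[OF that] .
  \<comment> \<open>Both chains of three exchanges reverse the values at \<open>p\<close>,
    \<open>p + 1\<close> and \<open>p + 2\<close>, so they end in the same permutation.\<close>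
  have adj: "?D p (?F (u \<circ> ?s p)) = ?D (p + 1) (?F (u \<circ> ?s (p + 1)))"
    if "ascent n u p" "ascent n u (p + 1)" for p
  proof -
    note lt = smaller[OF that(1)] smaller[OF that(2)]
    have a1: "ascent n (u \<circ> ?s p) (p + 1)" "ascent n (u \<circ> ?s p \<circ> ?s (p + 1)) p"
      using that by (auto simp: ascent_def transpose_def)
    have a2: "ascent n (u \<circ> ?s (p + 1)) p" "ascent n (u \<circ> ?s (p + 1) \<circ> ?s p) (p + 1)"
      using that by (auto simp: ascent_def transpose_def)
    have "?F (u \<circ> ?s p) = ?D (p + 1) (?F (u \<circ> ?s p \<circ> ?s (p + 1)))"
      by (rule IH[OF lt(1) a1(1)])
    also have "?F (u \<circ> ?s p \<circ> ?s (p + 1)) = ?D p (?F (u \<circ> ?s p \<circ> ?s (p + 1) \<circ> ?s p))"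
      by (rule IH[OF _ a1(2)]) (use lt(1) smaller[OF a1(1)] in linarith)
    finally have 1: "?D p (?F (u \<circ> ?s p)) = ?D p (?D (p + 1) (?D p (?F (u \<circ> ?s p \<circ> ?s (p + 1) \<circ> ?s p))))"
      by (rule arg_cong)
    have "?F (u \<circ> ?s (p + 1)) = ?D p (?F (u \<circ> ?s (p + 1) \<circ> ?s p))"
      by (rule IH[OF lt(2) a2(1)])
    also have "?F (u \<circ> ?s (p + 1) \<circ> ?s p) = ?D (p + 1) (?F (u \<circ> ?s (p + 1) \<circ> ?s p \<circ> ?s (p + 1)))"
      by (rule IH[OF _ a2(2)]) (use lt(2) smaller[OF a2(1)] in linarith)
    finally have 2: "?D (p + 1) (?F (u \<circ> ?s (p + 1)))
        = ?D (p + 1) (?D p (?D (p + 1) (?F (u \<circ> ?s (p + 1) \<circ> ?s p \<circ> ?s (p + 1)))))"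
      by (rule arg_cong)
    have "u \<circ> ?s p \<circ> ?s (p + 1) \<circ> ?s p = u \<circ> ?s (p + 1) \<circ> ?s p \<circ> ?s (p + 1)"
      by (auto simp: fun_eq_iff transpose_def)
    then show ?thesis unfolding 1 2 by (subst ddiff_braid) auto
  qed
  define i where "i = (LEAST i. ascent n u i)"
  have i: "ascent n u i" unfolding i_def using less.prems by (rule LeastI)
  have Fi: "?F u = ?D i (?F (u \<circ> ?s i))"
    using less.prems by (subst family_fun.simps) (auto simp: i_def Let_def)
  consider "i = j" | "j = i + 1" | "i = j + 1" | "i \<noteq> j" "j \<noteq> i + 1" "i \<noteq> j + 1" by blast
  then show ?case
  proof cases
    case 1 then show ?thesis using Fi by simp
  next
    case 2 then show ?thesis using Fi adj[of i] i less.prems by simp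
  next
    case 3 then show ?thesis using Fi adj[of j] i less.prems by simp
  next
    case 4
    have a: "ascent n (u \<circ> ?s i) j" "ascent n (u \<circ> ?s j) i"
      using i less.prems 4 by (auto simp: ascent_def transpose_def)
    have "?F (u \<circ> ?s i) = ?D j (?F (u \<circ> ?s i \<circ> ?s j))"
      by (rule IH[OF smaller[OF i] a(1)])
    moreover have "?F (u \<circ> ?s j) = ?D i (?F (u \<circ> ?s j \<circ> ?s i))"
      by (rule IH[OF smaller[OF less.prems] a(2)])
    moreover have "u \<circ> ?s i \<circ> ?s j = u \<circ> ?s j \<circ> ?s i"
      using 4 by (auto simp: fun_eq_iff transpose_def)
    ultimately show ?thesis unfolding Fi using 4 by (simp add: ddiff_commute)
  qed
qed

lemma schubert_family_exists: "schubert_family k n (family_fun k n)"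
  unfolding schubert_family_def
proof (intro conjI allI impI)
  have "\<nexists>i. ascent n (w0 n) i"
    by (auto simp: ascent_def w0_def)
  then show "family_fun k n (w0 n) = longest_class k n"
    by (subst family_fun.simps, intro if_not_P)
next
  fix u i assume *: "u permutes {1..n} \<and> 1 \<le> i \<and> i < n \<and> u (i + 1) < u i"
  let ?v = "u \<circ> transpose i (i + 1)"
  have "ascent n ?v i" using * by (auto simp: ascent_def)
  moreover have "?v \<circ> transpose i (i + 1) = u" by (auto simp: fun_eq_iff)
  ultimately have "family_fun k n ?v = ddiff k (X i) (X (i + 1)) (family_fun k n u)"
    using family_fun_ascent[of n ?v i k] by simp
  then show "wt k (X i) (X (i + 1)) * family_fun k n ?v
      = family_fun k n u - cf k (X i) (X (i + 1)) * swap_x i (family_fun k n u)"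
    by (simp add: ddiff swap_x_def)
qed

text \<open>A strictly decreasing sequence of n values between 1 and n is squeezed from both
  ends.\<close>

lemma permutes_no_ascent:
  assumes u: "u permutes {1..n}" and na: "\<And>i. \<not> ascent n u i"
  shows "u = w0 n"
proof
  have dec: "u (i + 1) < u i" if "1 \<le> i" "i < n" for i
  proof -
    have "u (i + 1) \<noteq> u i" using permutes_inj[OF u] by (metis injD add_eq_self_zero one_neq_zero)
    then show ?thesis using na[of i] that by (auto simp: ascent_def)
  qed
  have upper: "u (Suc i) + i \<le> n" if "i < n" for i
    using that
  proof (induction i)
    case 0
    have "u 1 \<in> {1..n}" using 0 u permutes_in_image[OF u, of 1] by auto
    then show ?case by simp
  next
    case (Suc i)
    then show ?case using dec[of "Suc i"] by simp
  qed
  have lower: "i < u (n - i)" if "i < n" for i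
    using that
  proof (induction i)
    case 0
    have "u n \<in> {1..n}" using 0 u permutes_in_image[OF u, of n] by auto
    then show ?case by simp
  next
    case (Suc i)
    then have "n - Suc i + 1 = n - i" "1 \<le> n - Suc i" "n - Suc i < n" by auto
    then show ?case using Suc dec[of "n - Suc i"] by simp
  qed
  fix i
  show "u i = w0 n i"
  proof (cases "i \<in> {1..n}")
    case True
    then have "i - 1 < n" "n - i < n" "Suc (i - 1) = i" "n - (n - i) = i" by auto
    then show ?thesis using True upper[of "i - 1"] lower[of "n - i"] by (auto simp: w0_def)
  next
    case False
    then show ?thesis using u by (auto simp: w0_def permutes_not_in)
  qed
qed

lemma schubert_family_step:
  assumes "schubert_family k n F" "u permutes {1..n}" "1 \<le> i" "i < n" "u (i + 1) < u i"
  shows "wt k (X i) (X (i + 1)) * F (u \<circ> transpose i (i + 1)) = F u - cf k (X i) (X (i + 1)) * swap_x i (F u)"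
proof -
  have "\<forall>u i. u permutes {1..n} \<and> 1 \<le> i \<and> i < n \<and> u (i + 1) < u i \<longrightarrow>
        wt k (X i) (X (i + 1)) * F (u \<circ> transpose i (i + 1))
          = F u - cf k (X i) (X (i + 1)) * swap_x i (F u)"
    using assms(1) unfolding schubert_family_def by (rule conjunct2)
  from mp[OF this[THEN spec[of _ u], THEN spec[of _ i]]] show ?thesis
    using assms(2-) by (simp only: simp_thms)
qed

lemma schubert_family_unique:
  assumes F: "schubert_family k n F" and G: "schubert_family k n G" and u: "u permutes {1..n}"
  shows "F u = G u"
  using u
proof (induction "pos_sum n u" arbitrary: u rule: less_induct)
  case less
  show ?case
  proof (cases "\<exists>i. ascent n u i")
    case False
    then have "u = w0 n" using permutes_no_ascent less.prems by blast
    then show ?thesis using F G by (simp add: schubert_family_def)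
  next
    case True
    then obtain i where i: "ascent n u i" by blast
    let ?v = "u \<circ> transpose i (i + 1)"
    have v: "?v permutes {1..n}"
      using i by (intro permutes_compose permutes_swap_id less.prems) (auto simp: ascent_def)
    have "pos_sum n ?v < pos_sum n u"
      using i by (intro pos_sum_swap) (auto simp: ascent_def)
    then have eq: "F ?v = G ?v" using less.hyps v by blast
    have u: "?v \<circ> transpose i (i + 1) = u" by (auto simp: fun_eq_iff)
    have "?v (i + 1) < ?v i" "1 \<le> i" "i < n" using i by (auto simp: ascent_def)
    note eqs = schubert_family_step[OF F v this(2,3,1)] schubert_family_step[OF G v this(2,3,1)]
    have "wt k (X i) (X (i + 1)) * F u = wt k (X i) (X (i + 1)) * G u"
      unfolding eqs(1)[unfolded u] eqs(2)[unfolded u] eq ..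
    then show ?thesis by simp
  qed
qed

lemma double_schubert_eq:
  assumes "u permutes {1..n}"
  shows "double_schubert n u = family_fun False n u"
  unfolding double_schubert_def double_schubert_family_eq
proof (rule the_equality)
  show "\<exists>F. schubert_family False n F \<and> F u = family_fun False n u"
    using schubert_family_exists[of False n] by (intro exI[of _ "family_fun False n"]) simp
qed (elim exE conjE, simp add: schubert_family_unique[OF _ schubert_family_exists assms])

lemma double_grothendieck_eq:
  assumes "u permutes {1..n}"
  shows "double_grothendieck n u = family_fun True n u"
  unfolding double_grothendieck_def double_grothendieck_family_eq
proof (rule the_equality)
  show "\<exists>F. schubert_family True n F \<and> F u = family_fun True n u"
    using schubert_family_exists[of True n] by (intro exI[of _ "family_fun True n"]) simp
qed (elim exE conjE, simp add: schubert_family_unique[OF _ schubert_family_exists assms])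

section \<open>Localizations at the fixed points\<close>

lemma perm_range:
  assumes "v permutes {1..n}"
  shows "v i \<in> {1..n} \<longleftrightarrow> i \<in> {1..n}" "i \<notin> {1..n} \<Longrightarrow> v i = i" "v i = v j \<longleftrightarrow> i = j"
  using permutes_in_image[OF assms] permutes_not_in[OF assms] permutes_inj[OF assms]
  by (auto simp: inj_eq)

lemma perm_bounds:
  assumes "v permutes {1..n}"
  shows "1 \<le> i \<Longrightarrow> 1 \<le> v i" "1 \<le> i \<Longrightarrow> i \<le> n \<Longrightarrow> v i \<le> n"
  using perm_range(1)[OF assms, of i] perm_range(2)[OF assms, of i] by (cases "i \<le> n"; auto)+

lemma w0_permutes: "w0 n permutes {1..n}"
proof (rule bij_imp_permutes)
  have "w0 n (w0 n i) = i" for i by (auto simp: w0_def)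
  then show "bij_betw (w0 n) {1..n} {1..n}"
    by (intro bij_betwI[of _ _ _ "w0 n"]) (auto simp: w0_def)
qed (auto simp: w0_def)

lemma ascent_bounds: "ascent n v i \<Longrightarrow> i \<in> {1..n} \<and> i + 1 \<in> {1..n}"
  by (auto simp: ascent_def)

lemma permutes_comp_swap:
  "v permutes {1..n} \<Longrightarrow> i \<in> {1..n} \<Longrightarrow> j \<in> {1..n} \<Longrightarrow> v \<circ> transpose i j permutes {1..n}"
  by (intro permutes_compose permutes_swap_id)

text \<open>Induction upwards from the identity. The measure is taken at
  \<open>w0 n \<circ> v\<close>, whose ascents are the descents of \<open>v\<close>.\<close>

lemma permutes_ascent_induct [consumes 1, case_names id step]:
  assumes "v permutes {1..n}" and "P id"
    and step: "\<And>v i. v permutes {1..n} \<Longrightarrow> ascent n v i \<Longrightarrow> P v \<Longrightarrow> P (v \<circ> transpose i (i + 1))"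
  shows "P v"
  using assms(1)
proof (induction "pos_sum n (w0 n \<circ> v)" arbitrary: v rule: less_induct)
  case less
  note v = less.prems
  have inv: "w0 n (w0 n i) = i" for i by (auto simp: w0_def)
  show ?case
  proof (cases "\<exists>i. ascent n (w0 n \<circ> v) i")
    case False
    then have "w0 n \<circ> v = w0 n"
      using permutes_no_ascent[OF permutes_compose[OF v w0_permutes]] by blast
    then have "w0 n (v i) = w0 n i" for i by (simp add: fun_eq_iff)
    then have "v i = i" for i using inv[of "v i"] inv[of i] by simp
    then have "v = id" by (simp add: fun_eq_iff)
    then show ?thesis using assms(2) by simp
  next
    case True
    then obtain i where i: "ascent n (w0 n \<circ> v) i" by blast
    let ?v = "v \<circ> transpose i (i + 1)"
    have b: "i \<in> {1..n}" "i + 1 \<in> {1..n}" using ascent_bounds[OF i] by auto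
    have "pos_sum n (w0 n \<circ> ?v) < pos_sum n (w0 n \<circ> v)"
      using pos_sum_swap[of i n "i + 1" "w0 n \<circ> v"] i b by (auto simp: ascent_def comp_assoc)
    then have "P ?v" using less.hyps permutes_comp_swap[OF v b] by blast
    moreover have "v (i + 1) < v i"
      using i perm_range[OF v, of i] perm_range[OF v, of "i + 1"] b by (auto simp: ascent_def w0_def)
    then have "ascent n ?v i" using b by (auto simp: ascent_def)
    ultimately have "P (?v \<circ> transpose i (i + 1))"
      using step permutes_comp_swap[OF v b] by blast
    moreover have "?v \<circ> transpose i (i + 1) = v" by (auto simp: fun_eq_iff)
    ultimately show ?thesis by simp
  qed
qed

definition point_subst :: "nat \<Rightarrow> (nat \<Rightarrow> nat) \<Rightarrow> xyvar \<Rightarrow> nat" where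
  "point_subst n w z = (case z of X i \<Rightarrow> w i | Y j \<Rightarrow> n + 1 - j)"

definition loc :: "bool \<Rightarrow> nat \<Rightarrow> (nat \<Rightarrow> nat) \<Rightarrow> (nat \<Rightarrow> nat) \<Rightarrow> nat laurent" where
  "loc k n v w = lrename (point_subst n w) (family_fun k n (w0 n \<circ> v))"

lemma specialize_t_eq_loc: "specialize_t n (family_fun k n (w0 n \<circ> v)) = loc k n v id"
proof -
  have "(\<lambda>z. case z of X i \<Rightarrow> i | Y j \<Rightarrow> n + 1 - j) = point_subst n id"
    by (auto simp: fun_eq_iff point_subst_def split: xyvar.split)
  then show ?thesis unfolding specialize_t_def loc_def by (rule arg_cong)
qed

text \<open>Composition with \<open>w0\<close> reverses order: an ascent of \<open>v\<close> is a
  descent of \<open>w0 n \<circ> v\<close>, so the recursion of the families raises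
  \<open>v\<close>.\<close>

lemma loc_step:
  assumes v: "v permutes {1..n}" and i: "ascent n v i"
  shows "wt k (w i) (w (i + 1)) * loc k n (v \<circ> transpose i (i + 1)) w
    = loc k n v w - cf k (w i) (w (i + 1)) * loc k n v (w \<circ> transpose i (i + 1))"
proof -
  let ?u = "w0 n \<circ> v"
  have u: "?u permutes {1..n}" by (rule permutes_compose[OF v w0_permutes])
  have b: "i \<in> {1..n}" "i + 1 \<in> {1..n}" using ascent_bounds[OF i] by auto
  have desc: "?u (i + 1) < ?u i"
    using i perm_range[OF v, of i] perm_range[OF v, of "i + 1"] b by (auto simp: ascent_def w0_def)
  have "wt k (X i) (X (i + 1)) * family_fun k n (?u \<circ> transpose i (i + 1))
      = family_fun k n ?u - cf k (X i) (X (i + 1)) * swap_x i (family_fun k n ?u)"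
    by (rule schubert_family_step[OF schubert_family_exists u]) (use b desc in auto)
  then have "lrename (point_subst n w) (wt k (X i) (X (i + 1)) * family_fun k n (?u \<circ> transpose i (i + 1)))
      = lrename (point_subst n w) (family_fun k n ?u - cf k (X i) (X (i + 1)) * swap_x i (family_fun k n ?u))"
    by (rule arg_cong)
  moreover have "(\<lambda>z. point_subst n w (transpose (X i) (X (i + 1)) z)) = point_subst n (w \<circ> transpose i (i + 1))"
  proof
    fix z show "point_subst n w (transpose (X i) (X (i + 1)) z) = point_subst n (w \<circ> transpose i (i + 1)) z"
      by (cases z) (auto simp: point_subst_def transpose_def)
  qed
  ultimately show ?thesis
    by (simp add: loc_def lrename_mult lrename_diff swap_x_def lrename_lrename comp_assoc)
      (simp add: point_subst_def)
qed

lemma loc_id: "loc k n id w = (\<Prod>(i, j) \<in> {(i, j). 1 \<le> i \<and> i < j \<and> j \<le> n}. wt k (w i) j)"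
proof -
  have "family_fun k n (w0 n) = longest_class k n"
    using schubert_family_exists[of k n] by (simp add: schubert_family_def)
  then have "loc k n id w = (\<Prod>(i, j) \<in> {(i, j). 1 \<le> i \<and> 1 \<le> j \<and> i + j \<le> n}. wt k (w i) (n + 1 - j))"
    by (simp add: loc_def longest_class_def lrename_prod case_prod_unfold point_subst_def)
  also have "\<dots> = (\<Prod>(i, j) \<in> {(i, j). 1 \<le> i \<and> i < j \<and> j \<le> n}. wt k (w i) j)"
    by (rule prod.reindex_bij_witness[of _ "\<lambda>(i, j). (i, n + 1 - j)" "\<lambda>(i, j). (i, n + 1 - j)"]) auto
  finally show ?thesis .
qed

text \<open>What a divided difference at \<open>i\<close> produces is symmetric in the variables
  number \<open>i\<close> and \<open>i + 1\<close>, so it cannot tell the two points apart.\<close>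

lemma loc_swap:
  assumes v: "v permutes {1..n}" and i: "ascent n v i" and w: "w permutes {1..n}"
  shows "loc k n (v \<circ> transpose i (i + 1)) (w \<circ> transpose i (i + 1)) = loc k n (v \<circ> transpose i (i + 1)) w"
proof -
  let ?s = "transpose i (i + 1)" and ?a = "w i" and ?b = "w (i + 1)"
  have "?a \<noteq> ?b" using perm_range(3)[OF w] by simp
  have "wt k ?b ?a * loc k n (v \<circ> ?s) (w \<circ> ?s) = loc k n v (w \<circ> ?s) - cf k ?b ?a * loc k n v (w \<circ> ?s \<circ> ?s)"
    using loc_step[OF v i, of k "w \<circ> ?s"] by simp
  moreover have "w \<circ> ?s \<circ> ?s = w" by (auto simp: fun_eq_iff)
  ultimately have 1: "wt k ?b ?a * loc k n (v \<circ> ?s) (w \<circ> ?s) = loc k n v (w \<circ> ?s) - cf k ?b ?a * loc k n v w"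
    by simp
  have "wt k ?a ?b * loc k n (v \<circ> ?s) (w \<circ> ?s)
      = - cf k ?a ?b * (wt k ?b ?a * loc k n (v \<circ> ?s) (w \<circ> ?s))"
    by (subst wt_swap) (simp add: mult.assoc)
  also have "\<dots> = (cf k ?a ?b * cf k ?b ?a) * loc k n v w - cf k ?a ?b * loc k n v (w \<circ> ?s)"
    unfolding 1 by (simp only: algebra_simps) simp
  also have "\<dots> = wt k ?a ?b * loc k n (v \<circ> ?s) w"
    unfolding cf_cf loc_step[OF v i] by simp
  finally show ?thesis using \<open>?a \<noteq> ?b\<close> by simp
qed

lemma loc_identify:
  "lrename (id(y := x)) (loc k n v (transpose x y \<circ> w)) = lrename (id(y := x)) (loc k n v w)"
proof -
  have "(\<lambda>z. (id(y := x)) (point_subst n (transpose x y \<circ> w) z)) = (\<lambda>z. (id(y := x)) (point_subst n w z))"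
  proof
    fix z show "(id(y := x)) (point_subst n (transpose x y \<circ> w) z) = (id(y := x)) (point_subst n w z)"
      by (cases z) (auto simp: point_subst_def transpose_def)
  qed
  then show ?thesis unfolding loc_def lrename_lrename by simp
qed

subsection \<open>Bruhat order\<close>

text \<open>The rank criterion for Bruhat order, taken as its definition.\<close>

definition bruhat_le :: "(nat \<Rightarrow> nat) \<Rightarrow> (nat \<Rightarrow> nat) \<Rightarrow> bool" where
  "bruhat_le u v \<longleftrightarrow> (\<forall>p q. rk u p q \<le> rk v p q)"

lemma rk_0 [simp]: "rk v p 0 = 0"
  by (simp add: rk_def)

lemma finite_rk_set [simp]: "finite {k. Suc 0 \<le> k \<and> k \<le> q \<and> P k}" for P :: "nat \<Rightarrow> bool"
  by (rule finite_subset[of _ "{..q}"]) auto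

lemma rk_Suc: "rk v p (Suc q) = rk v p q + (if p \<le> v (Suc q) then 1 else 0)"
proof -
  have "{k. Suc 0 \<le> k \<and> k \<le> Suc q \<and> p \<le> v k}
      = (if p \<le> v (Suc q) then insert (Suc q) {k. Suc 0 \<le> k \<and> k \<le> q \<and> p \<le> v k}
         else {k. Suc 0 \<le> k \<and> k \<le> q \<and> p \<le> v k})"
    by (auto simp: le_Suc_eq)
  then show ?thesis by (simp add: rk_def)
qed

lemma rk_cong: "(\<And>k. 1 \<le> k \<Longrightarrow> k \<le> q \<Longrightarrow> p \<le> u k \<longleftrightarrow> p \<le> v k) \<Longrightarrow> rk u p q = rk v p q"
  unfolding rk_def by (rule arg_cong[of _ _ card]) auto

lemma rk_eq_0: "(\<And>k. 1 \<le> k \<Longrightarrow> k \<le> q \<Longrightarrow> u k < p) \<Longrightarrow> rk u p q = 0"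
  unfolding rk_def by (subst card_eq_0_iff) (auto simp: not_le[symmetric])

lemma rk_swap_other':
  assumes "1 \<le> i" "q \<noteq> i" and u: "u i = v (i + 1)" "u (i + 1) = v i" "\<And>k. k \<noteq> i \<Longrightarrow> k \<noteq> i + 1 \<Longrightarrow> u k = v k"
  shows "rk u p q = rk v p q"
proof (cases "q < i")
  case True
  then show ?thesis by (intro rk_cong) (simp add: u)
next
  case False
  then have "i + 1 \<le> q" using assms by simp
  then show ?thesis
  proof (induction q rule: dec_induct)
    case base
    obtain j where j: "i = Suc j" using assms by (cases i) auto
    have "rk u p j = rk v p j"
      by (rule rk_cong) (simp add: j u(3))
    then show ?case using u by (simp add: rk_Suc j)
  next
    case (step q)
    then show ?case by (simp add: rk_Suc u(3))
  qed
qed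

lemma rk_swap_other:
  assumes "1 \<le> i" "q \<noteq> i"
  shows "rk (v \<circ> transpose i (i + 1)) p q = rk v p q"
  by (rule rk_swap_other'[OF assms]) (auto simp: transpose_def)

lemma rk_swap_ascent':
  assumes i: "1 \<le> i" "v i < v (i + 1)" and u: "u i = v (i + 1)" "u (i + 1) = v i" "\<And>k. k \<noteq> i \<Longrightarrow> k \<noteq> i + 1 \<Longrightarrow> u k = v k"
  shows "rk u p i = (if p \<le> v (i + 1) then rk v p (i - 1) + 1 else rk v p (i + 1))"
proof -
  obtain j where j: "i = Suc j" using assms by (cases i) auto
  have "rk u p j = rk v p j"
    by (rule rk_cong) (simp add: j u(3))
  then show ?thesis using i u by (simp add: rk_Suc j)
qed

lemma rk_swap_ascent:
  assumes i: "1 \<le> i" "v i < v (i + 1)"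
  shows "rk (v \<circ> transpose i (i + 1)) p i = (if p \<le> v (i + 1) then rk v p (i - 1) + 1 else rk v p (i + 1))"
  by (rule rk_swap_ascent'[of i v, OF i]) (auto simp: transpose_def)

text \<open>Lifting property. Only ranks in column \<open>i\<close> change, and after the exchange
  they are the largest that the columns \<open>i - 1\<close> and \<open>i + 1\<close> allow.\<close>

lemma bruhat_le_swap:
  assumes i: "1 \<le> i" "v i < v (i + 1)"
    and le: "bruhat_le w v \<or> bruhat_le (w \<circ> transpose i (i + 1)) v"
  shows "bruhat_le w (v \<circ> transpose i (i + 1))"
  unfolding bruhat_le_def
proof (intro allI)
  fix p q
  have other: "rk w p q' \<le> rk v p q'" if "q' \<noteq> i" for q'
    using le that rk_swap_other[OF i(1) that, of w p] unfolding bruhat_le_def by metis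
  show "rk w p q \<le> rk (v \<circ> transpose i (i + 1)) p q"
  proof (cases "q = i")
    case False
    then show ?thesis using other[of q] rk_swap_other[OF i(1), of q v p] by simp
  next
    case True
    have "rk w p i \<le> rk w p (i - 1) + 1" "rk w p i \<le> rk w p (i + 1)"
      using i(1) rk_Suc[of w p "i - 1"] rk_Suc[of w p i] by auto
    moreover have "i - 1 \<noteq> i" using i(1) by simp
    ultimately show ?thesis using rk_swap_ascent[of i v p] i other[of "i - 1"] other[of "i + 1"] True
      by (auto split: if_splits)
  qed
qed

text \<open>For v = id the product contains a zero weight unless w(i) \<le> i for all i. Going up,
  \<open>loc_step\<close> involves two values that vanish by the lifting property.\<close>

lemma loc_support:
  assumes "v permutes {1..n}" "w permutes {1..n}" "\<not> bruhat_le w v"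
  shows "loc k n v w = 0"
  using assms
proof (induction v arbitrary: w rule: permutes_ascent_induct)
  case id
  show ?case
  proof (rule ccontr)
    assume nz: "loc k n id w \<noteq> 0"
    have le: "w i \<le> i" if "i \<in> {1..n}" for i
    proof (rule ccontr)
      assume "\<not> w i \<le> i"
      then have "(i, w i) \<in> {(i, j). 1 \<le> i \<and> i < j \<and> j \<le> n}"
        using that perm_range(1)[OF id.prems(1), of i] by auto
      moreover have "finite {(i, j). 1 \<le> i \<and> i < j \<and> j \<le> n}"
        by (rule finite_subset[of _ "{1..n} \<times> {1..n}"]) auto
      moreover have "(\<lambda>(i, j). wt k (w i) j) (i, w i) = 0" by simp
      ultimately have "loc k n id w = 0" unfolding loc_id by (intro prod_zero) blast+
      then show False using nz by simp
    qed
    have "rk w p q \<le> rk id p q" for p q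
      unfolding rk_def
    proof (rule card_mono)
      show "{k. 1 \<le> k \<and> k \<le> q \<and> p \<le> w k} \<subseteq> {k. 1 \<le> k \<and> k \<le> q \<and> p \<le> id k}"
        using le perm_range(2)[OF id.prems(1)] by auto (metis atLeastAtMost_iff le_trans order_refl)
    qed simp
    then show False using id.prems(2) unfolding bruhat_le_def by blast
  qed
next
  case (step v i)
  have b: "i \<in> {1..n}" "i + 1 \<in> {1..n}" "1 \<le> i" "v i < v (i + 1)"
    using ascent_bounds[OF step.hyps(2)] step.hyps(2) by (auto simp: ascent_def)
  have nle: "\<not> bruhat_le w v" "\<not> bruhat_le (w \<circ> transpose i (i + 1)) v"
    using bruhat_le_swap[OF b(3,4)] step.prems(2) by blast+
  have "loc k n v w = 0" "loc k n v (w \<circ> transpose i (i + 1)) = 0"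
    by (rule step.IH[OF step.prems(1) nle(1)])
      (rule step.IH[OF permutes_comp_swap[OF step.prems(1) b(1,2)] nle(2)])
  then have "wt k (w i) (w (i + 1)) * loc k n (v \<circ> transpose i (i + 1)) w = 0"
    using loc_step[OF step.hyps(1,2), of k w] by simp
  moreover have "wt k (w i) (w (i + 1)) \<noteq> 0" using perm_range(3)[OF step.prems(1)] by simp
  ultimately show ?case by (simp only: mult_eq_0_iff simp_thms)
qed

text \<open>The number of noninversions is the codimension of X_v, and their weights are the normal
  weights of X_v at its point \<open>v\<close>.\<close>

definition noninv :: "nat \<Rightarrow> (nat \<Rightarrow> nat) \<Rightarrow> (nat \<times> nat) set" where
  "noninv n v = {(i, j). 1 \<le> i \<and> i < j \<and> j \<le> n \<and> v i < v j}"

lemma finite_noninv [simp]: "finite (noninv n v)"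
  by (rule finite_subset[of _ "{1..n} \<times> {1..n}"]) (auto simp: noninv_def)

lemma transpose_adjacent_less:
  "a < b \<Longrightarrow> (a, b) \<noteq> (i, i + 1) \<Longrightarrow> transpose i (i + 1) a < transpose i (i + 1) (b::nat)"
  by (auto simp: transpose_def)

lemma noninv_swap:
  assumes i: "ascent n v i"
  shows "bij_betw (map_prod (transpose i (i + 1)) (transpose i (i + 1)))
    (noninv n (v \<circ> transpose i (i + 1))) (noninv n v - {(i, i + 1)})"
proof -
  let ?s = "transpose i (i + 1)"
  have b: "1 \<le> i" "i < n" "v i < v (i + 1)" using i by (auto simp: ascent_def)
  have s: "1 \<le> ?s a \<longleftrightarrow> 1 \<le> a" "?s a \<le> n \<longleftrightarrow> a \<le> n" for a
    using b by (auto simp: transpose_def)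
  show ?thesis
  proof (rule bij_betwI[of _ _ _ "map_prod ?s ?s"])
    show "map_prod ?s ?s \<in> noninv n (v \<circ> ?s) \<rightarrow> noninv n v - {(i, i + 1)}"
    proof (clarify, intro DiffI)
      fix x y assume xy: "(x, y) \<in> noninv n (v \<circ> ?s)"
      then have "(x, y) \<noteq> (i, i + 1)" using b by (auto simp: noninv_def)
      then have "?s x < ?s y" using xy transpose_adjacent_less by (auto simp: noninv_def)
      then show "map_prod ?s ?s (x, y) \<in> noninv n v" using xy s by (auto simp: noninv_def)
      have "map_prod ?s ?s (x, y) = (i, i + 1) \<Longrightarrow> x = i + 1 \<and> y = i"
        by (metis map_prod_simp prod.inject transpose_apply_first transpose_apply_second transpose_involutory)
      then show "map_prod ?s ?s (x, y) \<notin> {(i, i + 1)}" using xy by (auto simp: noninv_def)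
    qed
    show "map_prod ?s ?s \<in> noninv n v - {(i, i + 1)} \<rightarrow> noninv n (v \<circ> ?s)"
    proof (rule funcsetI)
      fix p assume p: "p \<in> noninv n v - {(i, i + 1)}"
      obtain x y where [simp]: "p = (x, y)" by (cases p)
      have xy: "(x, y) \<in> noninv n v" "(x, y) \<notin> {(i, i + 1)}" using p by auto
      then have "?s x < ?s y" using transpose_adjacent_less by (auto simp: noninv_def)
      then show "map_prod ?s ?s p \<in> noninv n (v \<circ> ?s)" using xy s by (auto simp: noninv_def)
    qed
  qed auto
qed

lemma prod_noninv_swap:
  assumes i: "ascent n v i"
  shows "(\<Prod>(a, b) \<in> noninv n v. g (v a) (v b))
    = g (v i) (v (i + 1)) * (\<Prod>(a, b) \<in> noninv n (v \<circ> transpose i (i + 1)).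
        g ((v \<circ> transpose i (i + 1)) a) ((v \<circ> transpose i (i + 1)) b))"
proof -
  have "(i, i + 1) \<in> noninv n v" using i by (auto simp: noninv_def ascent_def)
  then have "(\<Prod>(a, b) \<in> noninv n v. g (v a) (v b))
      = g (v i) (v (i + 1)) * (\<Prod>(a, b) \<in> noninv n v - {(i, i + 1)}. g (v a) (v b))"
    by (subst prod.remove[of _ "(i, i + 1)"]) auto
  also have "(\<Prod>(a, b) \<in> noninv n v - {(i, i + 1)}. g (v a) (v b))
     = (\<Prod>(a, b) \<in> noninv n (v \<circ> transpose i (i + 1)).
        g ((v \<circ> transpose i (i + 1)) a) ((v \<circ> transpose i (i + 1)) b))"
    by (subst prod.reindex_bij_betw[OF noninv_swap[OF i], symmetric]) (auto intro!: prod.cong)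
  finally show ?thesis .
qed

text \<open>When \<open>v\<close> is raised, one of the two terms of \<open>loc_step\<close>
  vanishes by \<open>loc_support\<close>; the weight that cancels belongs to the noninversion (i, i
  + 1).\<close>

lemma loc_diag:
  assumes "v permutes {1..n}"
  shows "loc k n v v = (\<Prod>(i, j) \<in> noninv n v. wt k (v i) (v j))"
  using assms
proof (induction v rule: permutes_ascent_induct)
  case id
  show ?case unfolding loc_id by (auto intro!: prod.cong simp: noninv_def)
next
  case (step v i)
  let ?s = "transpose i (i + 1)"
  have b: "i \<in> {1..n}" "i + 1 \<in> {1..n}" "1 \<le> i" "v i < v (i + 1)"
    using ascent_bounds[OF step.hyps(2)] step.hyps(2) by (auto simp: ascent_def)
  have v': "v \<circ> ?s permutes {1..n}" by (rule permutes_comp_swap[OF step.hyps(1) b(1,2)])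
  have "rk (v \<circ> ?s) (v (i + 1)) i > rk v (v (i + 1)) i"
    using b rk_swap_ascent[OF b(3,4), of "v (i + 1)"] rk_Suc[of v "v (i + 1)" "i - 1"] by simp
  then have "\<not> bruhat_le (v \<circ> ?s) v" by (auto simp: bruhat_le_def not_le)
  then have "loc k n v (v \<circ> ?s) = 0" by (rule loc_support[OF step.hyps(1) v'])
  then have "wt k (v i) (v (i + 1)) * loc k n (v \<circ> ?s) v = loc k n v v"
    using loc_step[OF step.hyps(1,2), of k v] by simp
  also have "loc k n v v = wt k (v i) (v (i + 1)) * (\<Prod>(a, b) \<in> noninv n (v \<circ> ?s). wt k ((v \<circ> ?s) a) ((v \<circ> ?s) b))"
    unfolding step.IH by (rule prod_noninv_swap[OF step.hyps(2)])
  finally have "loc k n (v \<circ> ?s) v = (\<Prod>(a, b) \<in> noninv n (v \<circ> ?s). wt k ((v \<circ> ?s) a) ((v \<circ> ?s) b))"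
    using perm_range(3)[OF step.hyps(1)] by simp
  then show ?case unfolding loc_swap[OF step.hyps(1,2) step.hyps(1)] .
qed

section \<open>Permutations defined by inclusions\<close>

lemma rk_split: "card {k. 1 \<le> k \<and> k \<le> q \<and> v k < p} + rk v p q = q"
proof -
  have "card {k. 1 \<le> k \<and> k \<le> q \<and> v k < p} + rk v p q
      = card ({k. 1 \<le> k \<and> k \<le> q \<and> v k < p} \<union> {k. 1 \<le> k \<and> k \<le> q \<and> p \<le> v k})"
    unfolding rk_def by (subst card_Un_disjoint) auto
  also have "{k. 1 \<le> k \<and> k \<le> q \<and> v k < p} \<union> {k. 1 \<le> k \<and> k \<le> q \<and> p \<le> v k} = {1..q}"
    by auto
  finally show ?thesis by simp
qed

locale inclusion_perm =
  fixes n :: nat and v :: "nat \<Rightarrow> nat"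
  assumes perm: "v permutes {1..n}" and incl: "defined_by_inclusions n v"
begin

abbreviation "vi \<equiv> inv_into UNIV v"

lemma vi_v [simp]: "vi (v i) = i"
  using permutes_inj[OF perm] by simp

lemma v_vi [simp]: "v (vi i) = i"
  using permutes_surj[OF perm] by (simp add: surj_f_inv_f)

lemma v_range [simp]: "v i \<in> {1..n} \<longleftrightarrow> i \<in> {1..n}"
  by (rule perm_range(1)[OF perm])

lemma v_eq [simp]: "v i = v j \<longleftrightarrow> i = j"
  by (rule perm_range(3)[OF perm])

lemma vi_range: "vi i \<in> {1..n} \<longleftrightarrow> i \<in> {1..n}"
  using v_range[of "vi i"] by simp

lemma v_ge_1: "1 \<le> i \<Longrightarrow> 1 \<le> v i" and v_le_n: "1 \<le> i \<Longrightarrow> i \<le> n \<Longrightarrow> v i \<le> n"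
  using v_range[of i] perm_range(2)[OF perm, of i] by (cases "i \<le> n"; auto)+

lemma diagramI: "x \<le> n \<Longrightarrow> 1 \<le> y \<Longrightarrow> v y < x \<Longrightarrow> y < vi x \<Longrightarrow> (x, y) \<in> diagram n v"
  using vi_range[of x] by (auto simp: diagram_def)

lemma diagramD:
  assumes "(x, y) \<in> diagram n v"
  shows "1 \<le> x" "x \<le> n" "1 \<le> y" "y \<le> n" "v y < x" "y < vi x" "vi x \<le> n"
  using assms vi_range[of x] by (auto simp: diagram_def)

lemma rk_complement: "card {k. 1 \<le> k \<and> k \<le> q \<and> v k < p} + rk v p q = q"
  by (rule rk_split)

lemma rk_complement': "card {k. 1 \<le> k \<and> k \<le> q \<and> v k < p} = q - rk v p q"
  using rk_complement[of q p] by simp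

text \<open>Moving right in row \<open>x\<close> as long as possible and then up in the column reached ends in an
  essential box, and the rank is constant along the way.\<close>

lemma essential_box:
  assumes xy: "(x, y) \<in> diagram n v"
  obtains p q where "(p, q) \<in> essential_set n v" "p \<le> x" "y \<le> q" "rk v p q = rk v x y"
    "\<forall>z. y < z \<and> z \<le> q \<longrightarrow> v z < x" "\<forall>z. 1 \<le> z \<and> z \<le> q \<and> v z < x \<longrightarrow> v z < p"
proof -
  note D = diagramD[OF xy]
  define z0 where "z0 = (LEAST z. y < z \<and> x \<le> v z)"
  have "y < vi x \<and> x \<le> v (vi x)" using D by simp
  then have z0: "y < z0" "x \<le> v z0" "z0 \<le> vi x"
    unfolding z0_def by (metis (mono_tags, lifting) LeastI, metis (mono_tags, lifting) LeastI, metis (mono_tags, lifting) Least_le)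
  have before: "v z < x" if "y < z" "z < z0" for z
    using not_less_Least[of z "\<lambda>z. y < z \<and> x \<le> v z"] that by (auto simp: z0_def not_le)
  define q where "q = z0 - 1"
  have q: "y \<le> q" "q < z0" "Suc q = z0" "1 \<le> q" using z0 D by (auto simp: q_def)
  have row: "v z < x" if "y < z" "z \<le> q" for z using before that q by auto
  have vq: "v q < x" using row[of q] D q by (cases "q = y") auto
  define S where "S = {w. w < x \<and> vi w \<le> q \<and> 1 \<le> vi w}"
  have fS: "finite S" by (rule finite_subset[of _ "{..x}"]) (auto simp: S_def)
  have vqS: "v q \<in> S" using vq q by (simp add: S_def)
  define p where "p = Suc (Max S)"
  have "Max S \<in> S" by (rule Max_in[OF fS]) (use vqS in blast)
  then have p: "p \<le> x" "vi (p - 1) \<le> q" by (auto simp: S_def p_def)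
  have col: "v z < p" if "1 \<le> z" "z \<le> q" "v z < x" for z
  proof -
    have "v z \<in> S" using that by (simp add: S_def)
    then show ?thesis using Max_ge[OF fS] by (simp add: p_def less_Suc_eq_le)
  qed
  have vip: "q < vi p"
  proof (rule ccontr)
    assume "\<not> q < vi p"
    then have *: "vi p \<le> q" by simp
    have "p \<noteq> x" using * z0 q by auto
    then have "p < x" using p by simp
    moreover have "1 \<le> vi p" using vi_range[of p] \<open>p < x\<close> D by (simp add: p_def)
    ultimately have "v (vi p) < p" using col[of "vi p"] * by simp
    then show False by simp
  qed
  have pq: "(p, q) \<in> diagram n v"
    using p D q vip col[OF q(4) _ vq] by (intro diagramI) auto
  moreover have "(p, q + 1) \<notin> diagram n v"
    using z0 q p by (auto simp: diagram_def)
  moreover have "(p - 1, q) \<notin> diagram n v"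
    using p by (auto simp: diagram_def)
  ultimately have ess: "(p, q) \<in> essential_set n v" by (simp add: essential_set_def)
  have "{k. 1 \<le> k \<and> k \<le> q \<and> p \<le> v k} = {k. 1 \<le> k \<and> k \<le> y \<and> x \<le> v k}"
  proof (rule equalityI; rule subsetI)
    fix k assume "k \<in> {k. 1 \<le> k \<and> k \<le> q \<and> p \<le> v k}"
    then have k: "1 \<le> k" "k \<le> q" "\<not> v k < p" by auto
    then have "\<not> v k < x" using col by blast
    moreover have "k \<le> y" using calculation row[of k] k by (meson not_le)
    ultimately show "k \<in> {k. 1 \<le> k \<and> k \<le> y \<and> x \<le> v k}" using k by auto
  qed (use p q in auto)
  then have "rk v p q = rk v x y" by (simp add: rk_def)
  then show thesis by (rule that[OF ess p(1) q(1)]) (use row col in blast)+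
qed

text \<open>A positive rank r makes q - r smaller than q, so the minimum in the hypothesis is p - 1:
  all values below \<open>p\<close> occur in the first \<open>q\<close> positions. This is the
  inclusion of E_{p-1} in F_q.\<close>

lemma essential_positive_rank:
  assumes ess: "(p, q) \<in> essential_set n v" and r: "rk v p q > 0"
  shows "q - rk v p q = p - 1" "\<And>z. 1 \<le> z \<Longrightarrow> v z < p \<Longrightarrow> z \<le> q"
proof -
  have pq: "(p, q) \<in> diagram n v" using ess by (simp add: essential_set_def)
  note D = diagramD[OF pq]
  have "int q - int (rk v p q) = min (int p - 1) (int q)"
    using incl ess by (auto simp: defined_by_inclusions_def)
  then have *: "q = p - 1 + rk v p q" using r D rk_complement[of q p] by (auto simp: min_def split: if_splits)
  then show "q - rk v p q = p - 1" by simp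
  let ?A = "{k. 1 \<le> k \<and> k \<le> q \<and> v k < p}"
  have "card (v ` ?A) = p - 1"
    using rk_complement[of q p] * by (subst card_image) (auto simp: inj_on_def)
  moreover have "v ` ?A \<subseteq> {1..p - 1}"
  proof (rule image_subsetI)
    fix k assume "k \<in> ?A"
    then show "v k \<in> {1..p - 1}" using v_ge_1[of k] by auto
  qed
  ultimately have im: "v ` ?A = {1..p - 1}" by (intro card_subset_eq) auto
  fix z assume z: "1 \<le> z" "v z < p"
  then have "v z \<in> {1..p - 1}" using v_ge_1[of z] by auto
  then show "z \<le> q" unfolding im[symmetric] by auto
qed

text \<open>Together with the box, such indices contain one of the patterns 4231, 35142, 42513,
  351624. Because of \<open>l\<close> the essential box of (x, y) has positive rank, so the small
  value at \<open>m\<close> would have to occur before \<open>d\<close>.\<close>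

lemma forbidden_configuration:
  assumes xy: "(x, y) \<in> diagram n v"
    and l: "1 \<le> l" "l \<le> y" "x \<le> v l" and i: "1 \<le> i" "i \<le> y" "v i < x"
    and d: "y < d" "x \<le> v d" and m: "d < m" "v m < v i"
  shows False
proof -
  obtain p q where pq: "(p, q) \<in> essential_set n v" "p \<le> x" "y \<le> q" "rk v p q = rk v x y"
    "\<forall>z. y < z \<and> z \<le> q \<longrightarrow> v z < x" "\<forall>z. 1 \<le> z \<and> z \<le> q \<and> v z < x \<longrightarrow> v z < p"
    using essential_box[OF xy] by blast
  have "l \<in> {k. 1 \<le> k \<and> k \<le> y \<and> x \<le> v k}" using l by simp
  then have "rk v x y > 0" unfolding rk_def by (subst card_gt_0_iff) auto
  then have r: "rk v p q > 0" using pq by simp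
  have "q < d" using pq(5) d by (meson not_le)
  moreover have "v i < p" using pq(6) i pq(3) by (meson le_trans)
  ultimately have "m \<le> q" using essential_positive_rank(2)[OF pq(1) r, of m] m d by simp
  then show False using \<open>q < d\<close> m by simp
qed

text \<open>\<open>P a b\<close> says that \<open>v\<close> satisfies \<open>F\<^sub>b \<subseteq> E\<^sub>a\<^sub>-\<^sub>1\<close>, and \<open>Q a b\<close> that it satisfies
  \<open>E\<^sub>b \<subseteq> F\<^sub>a\<^sub>-\<^sub>1\<close>. \<open>R1\<close> and \<open>R2\<close> record the chains \<open>E\<^sub>b \<subseteq> F\<^sub>q \<subseteq> E\<^sub>a\<^sub>-\<^sub>1\<close> and
  \<open>F\<^sub>b \<subseteq> E\<^sub>p \<subseteq> F\<^sub>a\<^sub>-\<^sub>1\<close>, for which the equations of \<open>P\<close> and \<open>Q\<close> overlap.\<close>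

definition P :: "nat \<Rightarrow> nat \<Rightarrow> bool" where
  "P a b \<longleftrightarrow> 1 \<le> b \<and> a \<le> n \<and> (\<forall>l\<ge>1. l \<le> b \<longrightarrow> v l < a)"

definition Q :: "nat \<Rightarrow> nat \<Rightarrow> bool" where
  "Q a b \<longleftrightarrow> 1 \<le> b \<and> a \<le> n \<and> (\<forall>l\<ge>1. v l \<le> b \<longrightarrow> l < a)"

definition R1 :: "nat \<Rightarrow> nat \<Rightarrow> bool" where
  "R1 a b \<longleftrightarrow> 1 \<le> b \<and> a \<le> n \<and> (\<exists>q. (\<forall>l\<ge>1. v l \<le> b \<longrightarrow> l \<le> q) \<and> (\<forall>l\<ge>1. l \<le> q \<longrightarrow> v l < a))"

definition R2 :: "nat \<Rightarrow> nat \<Rightarrow> bool" where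
  "R2 a b \<longleftrightarrow> 1 \<le> b \<and> a \<le> n \<and> (\<exists>p. (\<forall>l\<ge>1. l \<le> b \<longrightarrow> v l \<le> p) \<and> (\<forall>l\<ge>1. v l \<le> p \<longrightarrow> l < a))"

lemma P_mono: "P a b \<Longrightarrow> a \<le> a' \<Longrightarrow> a' \<le> n \<Longrightarrow> 1 \<le> b' \<Longrightarrow> b' \<le> b \<Longrightarrow> P a' b'"
  by (force simp: P_def)

lemma Q_mono: "Q a b \<Longrightarrow> a \<le> a' \<Longrightarrow> a' \<le> n \<Longrightarrow> 1 \<le> b' \<Longrightarrow> b' \<le> b \<Longrightarrow> Q a' b'"
  by (force simp: Q_def)

lemma R1_mono: "R1 a b \<Longrightarrow> a \<le> a' \<Longrightarrow> a' \<le> n \<Longrightarrow> 1 \<le> b' \<Longrightarrow> b' \<le> b \<Longrightarrow> R1 a' b'"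
  unfolding R1_def by (meson le_trans less_le_trans)

lemma R2_mono: "R2 a b \<Longrightarrow> a \<le> a' \<Longrightarrow> a' \<le> n \<Longrightarrow> 1 \<le> b' \<Longrightarrow> b' \<le> b \<Longrightarrow> R2 a' b'"
  unfolding R2_def by (meson le_trans less_le_trans)

lemma prefix_less:
  assumes "\<And>l. 1 \<le> l \<Longrightarrow> l \<le> b \<Longrightarrow> v l < a"
  shows "b = 0 \<or> b < a"
proof (cases "b = 0")
  case False
  have "v ` {1..b} \<subseteq> {1..a - 1}" using assms v_ge_1 by fastforce
  then have "card (v ` {1..b}) \<le> card {1..a - 1}" by (intro card_mono) auto
  moreover have "card (v ` {1..b}) = b" by (subst card_image) (auto simp: inj_on_def)
  ultimately show ?thesis using assms[of 1] False by auto
qed simp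

lemma values_less:
  assumes "\<And>l. 1 \<le> l \<Longrightarrow> v l \<le> b \<Longrightarrow> l < a"
  shows "b = 0 \<or> b < a"
proof (cases "b = 0")
  case False
  have vi1: "1 \<le> vi l" if "1 \<le> l" for l
    using vi_range[of l] that perm_range(2)[OF perm, of "vi l"] by (cases "l \<le> n") auto
  have "vi ` {1..b} \<subseteq> {1..a - 1}" using assms vi1 by fastforce
  then have "card (vi ` {1..b}) \<le> card {1..a - 1}" by (intro card_mono) auto
  moreover have "card (vi ` {1..b}) = b"
    by (subst card_image) (auto intro!: inj_on_inverseI[of _ v])
  ultimately show ?thesis using assms[of "vi 1"] vi1[of 1] False by auto
qed simp

lemma P_less: "P a b \<Longrightarrow> b < a"
  using prefix_less[of b a] by (auto simp: P_def)

lemma Q_less: "Q a b \<Longrightarrow> b < a"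
  using values_less[of b a] by (auto simp: Q_def)

lemma R1_imp: assumes "R1 a b" shows "P a b \<and> Q a b"
proof -
  obtain q where q: "1 \<le> b" "a \<le> n" "\<And>l. 1 \<le> l \<Longrightarrow> v l \<le> b \<Longrightarrow> l \<le> q" "\<And>l. 1 \<le> l \<Longrightarrow> l \<le> q \<Longrightarrow> v l < a"
    using assms unfolding R1_def by blast
  have "b < Suc q" using values_less[of b "Suc q"] q(1,3) by force
  moreover have "q < a" using prefix_less[of q a] q(4) \<open>b < Suc q\<close> q(1) by auto
  ultimately show ?thesis using q by (force simp: P_def Q_def)
qed

lemma R2_imp: assumes "R2 a b" shows "P a b \<and> Q a b"
proof -
  obtain p where p: "1 \<le> b" "a \<le> n" "\<And>l. 1 \<le> l \<Longrightarrow> l \<le> b \<Longrightarrow> v l \<le> p" "\<And>l. 1 \<le> l \<Longrightarrow> v l \<le> p \<Longrightarrow> l < a"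
    using assms unfolding R2_def by blast
  have "b < Suc p" using prefix_less[of b "Suc p"] p(1,3) by force
  moreover have "p < a" using values_less[of p a] p(4) \<open>b < Suc p\<close> p(1) by auto
  ultimately show ?thesis using p by (force simp: P_def Q_def)
qed

section \<open>Permutations satisfying the inclusions of v\<close>

definition sat :: "(nat \<Rightarrow> nat) \<Rightarrow> bool" where
  "sat u \<longleftrightarrow> (\<forall>a b. (P a b \<longrightarrow> u b < a) \<and> (Q a b \<longrightarrow> b < u a))"

lemma satD: "sat u \<Longrightarrow> P a b \<Longrightarrow> u b < a" "sat u \<Longrightarrow> Q a b \<Longrightarrow> b < u a"
  by (auto simp: sat_def)

lemma sat_v: "sat v"
  unfolding sat_def
proof (intro allI conjI impI)
  fix a b
  show "v b < a" if "P a b" using that by (simp add: P_def)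
  show "b < v a" if "Q a b"
  proof (rule ccontr)
    assume "\<not> b < v a"
    moreover have "1 \<le> a" using Q_less[OF that] by simp
    ultimately have "a < a" using that unfolding Q_def by (meson not_less)
    then show False by simp
  qed
qed

lemma sat_id: "sat id"
  using P_less Q_less by (auto simp: sat_def)

text \<open>\<open>P\<close> takes a value and a position. Read as value u(j) and position i it
  singles out the pair (i, j), and this pair is a noninversion of \<open>u\<close>.\<close>

lemma sat_P_label:
  assumes "sat u" "P (u j) i" "1 \<le> j"
  shows "i < j" "u i < u j"
proof -
  show "u i < u j" using satD(1)[OF assms(1,2)] .
  show "i < j"
  proof (rule ccontr)
    assume "\<not> i < j"
    then have "P (u j) j" using assms(2,3) by (force simp: P_def)
    then show False using satD(1)[OF assms(1)] by blast
  qed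
qed

lemma sat_Q_label:
  assumes "sat u" "Q j (u i)" "i \<le> n"
  shows "i < j" "u i < u j"
proof -
  show "u i < u j" using satD(2)[OF assms(1,2)] .
  show "i < j"
  proof (rule ccontr)
    assume "\<not> i < j"
    then have "Q i (u i)" using assms(2,3) by (force simp: Q_def)
    then show False using satD(2)[OF assms(1)] by blast
  qed
qed

text \<open>The middle step \<open>q\<close> of the chain lies between the positions, i \<le> q < j,
  since otherwise \<open>u\<close> would violate an inclusion; each half of the chain then gives one
  conclusion.\<close>

lemma sat_R1_label:
  assumes "sat u" "R1 (u j) (u i)" "1 \<le> i" "i \<le> n" "1 \<le> j" "j \<le> n"
  shows "P (u j) i" "Q j (u i)"
proof -
  obtain q where q: "1 \<le> u i" "u j \<le> n" "\<And>l. 1 \<le> l \<Longrightarrow> v l \<le> u i \<Longrightarrow> l \<le> q" "\<And>l. 1 \<le> l \<Longrightarrow> l \<le> q \<Longrightarrow> v l < u j"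
    using assms(2) unfolding R1_def by blast
  have "i \<le> q"
  proof (rule ccontr)
    assume "\<not> i \<le> q"
    then have "Q i (u i)" using q assms by (force simp: Q_def)
    then show False using satD(2)[OF assms(1)] by blast
  qed
  moreover have "q < j"
  proof (rule ccontr)
    assume "\<not> q < j"
    then have "P (u j) j" using q assms by (force simp: P_def)
    then show False using satD(1)[OF assms(1)] by blast
  qed
  ultimately show "P (u j) i" "Q j (u i)" using q assms by (force simp: P_def Q_def)+
qed

text \<open>Here the middle step \<open>p\<close> of the chain lies between the values, u(i) \<le> p
  < u(j).\<close>

lemma sat_R2_label:
  assumes "sat u" "R2 j i" "1 \<le> u i" "u i \<le> n" "1 \<le> u j" "u j \<le> n"
  shows "P (u j) i" "Q j (u i)"
proof -
  obtain p where p: "1 \<le> i" "j \<le> n" "\<And>l. 1 \<le> l \<Longrightarrow> l \<le> i \<Longrightarrow> v l \<le> p" "\<And>l. 1 \<le> l \<Longrightarrow> v l \<le> p \<Longrightarrow> l < j"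
    using assms(2) unfolding R2_def by blast
  have "u i \<le> p"
  proof (rule ccontr)
    assume "\<not> u i \<le> p"
    then have "P (u i) i" using p assms by (force simp: P_def)
    then show False using satD(1)[OF assms(1)] by blast
  qed
  moreover have "p < u j"
  proof (rule ccontr)
    assume "\<not> p < u j"
    then have "Q j (u j)" using p assms by (force simp: Q_def)
    then show False using satD(2)[OF assms(1)] by blast
  qed
  ultimately show "P (u j) i" "Q j (u i)" using p assms by (force simp: P_def Q_def)+
qed

text \<open>The multiplicity of the weight of positions \<open>i\<close>, \<open>j\<close> in the localization at \<open>u\<close>; it is
  \<open>[P] + [Q] - [R]\<close>, because \<open>R\<close> implies \<open>P\<close> and \<open>Q\<close>.\<close>

definition mu :: "(nat \<Rightarrow> nat) \<Rightarrow> nat \<Rightarrow> nat \<Rightarrow> nat" where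
  "mu u i j = (if R1 (u j) (u i) \<or> R2 j i then 1 else of_bool (P (u j) i) + of_bool (Q j (u i)))"

lemma mu_pos:
  assumes "sat u" "u permutes {1..n}" "1 \<le> i" "i \<le> n" "1 \<le> j" "j \<le> n"
  shows "mu u i j > 0 \<longleftrightarrow> P (u j) i \<or> Q j (u i)"
proof -
  have "1 \<le> u i" "u i \<le> n" "1 \<le> u j" "u j \<le> n"
    using perm_range(1)[OF assms(2), of i] perm_range(1)[OF assms(2), of j] assms by auto
  then show ?thesis using sat_R1_label[OF assms(1) _ assms(3-6)] sat_R2_label[OF assms(1)]
    by (auto simp: mu_def)
qed

lemma mu_posD:
  assumes "sat u" "u permutes {1..n}" "1 \<le> i" "i \<le> n" "1 \<le> j" "j \<le> n" "mu u i j > 0"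
  shows "i < j" "u i < u j"
  using assms(7) sat_P_label[OF assms(1) _ assms(5)] sat_Q_label[OF assms(1) _ assms(4)]
  unfolding mu_pos[OF assms(1-6)] by blast+

text \<open>A noninversion that no inclusion covers, and one covered by two inclusions that come
  from no chain, both lead to a forbidden configuration.\<close>

lemma mu_v:
  assumes "1 \<le> i" "i \<le> n" "1 \<le> j" "j \<le> n"
  shows "mu v i j = (if i < j \<and> v i < v j then 1 else 0)"
proof (cases "i < j \<and> v i < v j")
  case False
  then have "\<not> mu v i j > 0" using mu_posD[OF sat_v perm assms] by blast
  then have "mu v i j = 0" by simp
  then show ?thesis using False by (simp only: if_False)
next
  case True
  have D: "(v j, i) \<in> diagram n v" using True assms v_le_n by (intro diagramI) auto
  have 1: "P (v j) i \<or> Q j (v i)"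
  proof (rule ccontr)
    assume "\<not> (P (v j) i \<or> Q j (v i))"
    then obtain l m where lm: "1 \<le> l" "l \<le> i" "v j \<le> v l" "1 \<le> m" "v m \<le> v i" "j \<le> m"
      using assms v_le_n[of j] v_ge_1[of i] by (auto simp: P_def Q_def not_less)
    then have "m \<noteq> i" "m \<noteq> j" using True by auto
    then have "v m < v i" "j < m" using lm by (auto simp: order.order_iff_strict)
    then show False
      using True assms by (intro forbidden_configuration[OF D lm(1-3), of i j m]) simp_all
  qed
  have 2: "R1 (v j) (v i) \<or> R2 j i" if PQ: "P (v j) i" "Q j (v i)"
  proof (rule ccontr)
    assume not: "\<not> (R1 (v j) (v i) \<or> R2 j i)"
    \<comment> \<open>The least middle step possible for \<open>R1\<close>: all values up to v(i)
      have occurred. Below, \<open>p\<close> is the least one possible for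
      \<open>R2\<close>.\<close>
    define q where "q = Max {l. 1 \<le> l \<and> v l \<le> v i}"
    have "{l. 1 \<le> l \<and> v l \<le> v i} \<subseteq> {..<j}"
      using PQ(2) unfolding Q_def by blast
    then have fin: "finite {l. 1 \<le> l \<and> v l \<le> v i}" by (rule finite_subset) simp
    have "i \<in> {l. 1 \<le> l \<and> v l \<le> v i}" using assms(1) by simp
    then have "q \<in> {l. 1 \<le> l \<and> v l \<le> v i}" unfolding q_def by (intro Max_in[OF fin]) blast
    then have q: "1 \<le> q" "v q \<le> v i" by simp_all
    have qm: "l \<le> q" if "1 \<le> l" "v l \<le> v i" for l
      unfolding q_def by (rule Max_ge[OF fin]) (use that in simp)
    have "\<not> (\<forall>l\<ge>1. l \<le> q \<longrightarrow> v l < v j)"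
      using not qm v_ge_1[OF assms(1)] v_le_n[OF assms(3,4)] unfolding R1_def by blast
    then obtain l1 where l1: "1 \<le> l1" "l1 \<le> q" "v j \<le> v l1"
      by (auto simp: not_less)
    define p where "p = Max (v ` {1..i})"
    have "p \<in> v ` {1..i}" unfolding p_def by (rule Max_in) (use assms in auto)
    then obtain l3 where l3: "1 \<le> l3" "l3 \<le> i" "p = v l3" by auto
    have pm: "\<And>l. 1 \<le> l \<Longrightarrow> l \<le> i \<Longrightarrow> v l \<le> p" by (auto simp: p_def)
    have "\<not> (\<forall>l\<ge>1. v l \<le> p \<longrightarrow> l < j)"
      using not pm assms unfolding R2_def by blast
    then obtain l4 where l4: "1 \<le> l4" "v l4 \<le> p" "j \<le> l4"
      by (auto simp: not_less)
    have "q < j" using PQ(2) q by (auto simp: Q_def)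
    then have "l1 \<noteq> j" using l1 by simp
    then have l1': "v j < v l1" using l1 by (simp add: order.order_iff_strict)
    have "i < l1" using PQ(1) l1 by (auto simp: P_def not_less[symmetric])
    then have "q \<noteq> i" using l1 by simp
    then have vq: "v q < v i" using q by (simp add: order.order_iff_strict)
    have "l3 < j" "v l3 < v j" using l3 True PQ(1) by (auto simp: P_def)
    then have "l4 \<noteq> j" "l4 \<noteq> l3" using l4 l3 by auto
    then have l4': "j < l4" "v l4 < v l3" using l4 l3 by (auto simp: order.order_iff_strict)
    then have D': "(v j, q) \<in> diagram n v"
      using vq True q assms v_le_n \<open>q < j\<close> by (intro diagramI) auto
    show False
      using l3 l4' \<open>v l3 < v j\<close> \<open>i < l1\<close> l1 \<open>q < j\<close>
      by (intro forbidden_configuration[OF D' l1(1-3), of l3 j l4]) simp_all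
  qed
  show ?thesis using True 1 2 by (auto simp: mu_def)
qed

end

text \<open>If \<open>f\<close> does not distinguish \<open>i\<close> from \<open>j\<close>,
  exponents may be moved between the rows \<open>i\<close> and \<open>j\<close> and between the
  columns \<open>i\<close> and \<open>j\<close>.\<close>

lemma prod_exponent_swap:
  fixes f :: "nat \<Rightarrow> nat \<Rightarrow> 'a::comm_monoid_mult"
  assumes I: "finite I" "i \<in> I" "j \<in> I" "i \<noteq> j"
    and f: "\<And>a. f a i = f a j" "\<And>b. f i b = f j b"
    and off: "\<And>a b. a \<in> I - {i, j} \<Longrightarrow> b \<in> I - {i, j} \<Longrightarrow> e a b = e' a b"
    and col: "\<And>a. a \<in> I - {i, j} \<Longrightarrow> e a i + e a j = e' a i + e' a j"
    and row: "\<And>b. b \<in> I - {i, j} \<Longrightarrow> e i b + e j b = e' i b + e' j b"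
    and zero: "\<And>a b. a \<in> {i, j} \<Longrightarrow> b \<in> {i, j} \<Longrightarrow> e a b = 0 \<and> e' a b = (0::nat)"
  shows "(\<Prod>a\<in>I. \<Prod>b\<in>I. f a b ^ e a b) = (\<Prod>a\<in>I. \<Prod>b\<in>I. f a b ^ e' a b)"
proof -
  have split: "prod g I = g i * g j * prod g (I - {i, j})" for g :: "nat \<Rightarrow> 'a"
  proof -
    have "prod g I = prod g {i, j} * prod g (I - {i, j})"
      using I by (subst prod.subset_diff[of "{i, j}"]) (auto simp: mult.commute)
    then show ?thesis using I by simp
  qed
  have 1: "(\<Prod>b\<in>I. f a b ^ e a b) = (\<Prod>b\<in>I. f a b ^ e' a b)" if "a \<in> I - {i, j}" for a
  proof -
    have "f a i ^ e a i * f a j ^ e a j = f a i ^ e' a i * f a j ^ e' a j"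
      using col[OF that] by (simp add: f flip: power_add)
    moreover have "(\<Prod>b\<in>I - {i, j}. f a b ^ e a b) = (\<Prod>b\<in>I - {i, j}. f a b ^ e' a b)"
      by (rule prod.cong) (simp_all add: off[OF that])
    ultimately show ?thesis unfolding split by simp
  qed
  have 2: "(\<Prod>b\<in>I. f i b ^ e i b) * (\<Prod>b\<in>I. f j b ^ e j b) = (\<Prod>b\<in>I. f i b ^ e' i b) * (\<Prod>b\<in>I. f j b ^ e' j b)"
  proof -
    have "(\<Prod>b\<in>I. f i b ^ e i b * f j b ^ e j b) = (\<Prod>b\<in>I. f i b ^ e' i b * f j b ^ e' j b)"
    proof (rule prod.cong)
      fix b assume b: "b \<in> I"
      show "f i b ^ e i b * f j b ^ e j b = f i b ^ e' i b * f j b ^ e' j b"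
      proof (cases "b \<in> {i, j}")
        case True
        then show ?thesis using zero[of i b] zero[of j b] by simp
      next
        case False
        then show ?thesis using row[of b] b by (simp add: f flip: power_add)
      qed
    qed simp
    then show ?thesis by (simp add: prod.distrib)
  qed
  show ?thesis
    unfolding split[of "\<lambda>a. \<Prod>b\<in>I. f a b ^ e a b"] split[of "\<lambda>a. \<Prod>b\<in>I. f a b ^ e' a b"] 2
    by (simp add: 1)
qed

section \<open>Chains in Bruhat order and their relation to the inclusions\<close>

lemma rk_beyond:
  assumes "u permutes {1..n}" "n \<le> q"
  shows "rk u p q = card {m. 1 \<le> m \<and> m \<le> q \<and> p \<le> m}"
proof -
  have "{1..n} \<subseteq> {1..q}" using assms by auto
  then have u: "u permutes {1..q}" by (rule permutes_subset[OF assms(1)])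
  have "u ` {k. 1 \<le> k \<and> k \<le> q \<and> p \<le> u k} = {m. 1 \<le> m \<and> m \<le> q \<and> p \<le> m}"
  proof (rule equalityI; rule subsetI)
    fix m assume "m \<in> u ` {k. 1 \<le> k \<and> k \<le> q \<and> p \<le> u k}"
    then show "m \<in> {m. 1 \<le> m \<and> m \<le> q \<and> p \<le> m}" using permutes_in_image[OF u] by auto
  next
    fix m assume m: "m \<in> {m. 1 \<le> m \<and> m \<le> q \<and> p \<le> m}"
    then have "m \<in> u ` {1..q}" using permutes_image[OF u] by auto
    then show "m \<in> u ` {k. 1 \<le> k \<and> k \<le> q \<and> p \<le> u k}" using m by auto
  qed
  then have "card {m. 1 \<le> m \<and> m \<le> q \<and> p \<le> m} = card (u ` {k. 1 \<le> k \<and> k \<le> q \<and> p \<le> u k})"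
    by (rule arg_cong[OF sym])
  also have "\<dots> = rk u p q" unfolding rk_def by (rule card_image[OF permutes_inj_on[OF u]])
  finally show ?thesis by (rule sym)
qed

lemma card_small_values:
  assumes u: "u permutes {1..n}" and "p \<le> n + 1"
  shows "card {k. 1 \<le> k \<and> k \<le> q \<and> u k < p} \<le> p - 1"
proof -
  have "u ` {k. 1 \<le> k \<and> k \<le> q \<and> u k < p} \<subseteq> {1..p - 1}"
  proof (rule image_subsetI)
    fix k assume k: "k \<in> {k. 1 \<le> k \<and> k \<le> q \<and> u k < p}"
    have "1 \<le> u k" using perm_range(1)[OF u, of k] perm_range(2)[OF u, of k] k by (cases "k \<le> n") auto
    moreover have "u k < p" using k by simp
    ultimately show "u k \<in> {1..p - 1}" by auto
  qed
  then have "card (u ` {k. 1 \<le> k \<and> k \<le> q \<and> u k < p}) \<le> card {1..p - 1}" by (intro card_mono) auto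
  moreover have "card (u ` {k. 1 \<le> k \<and> k \<le> q \<and> u k < p}) = card {k. 1 \<le> k \<and> k \<le> q \<and> u k < p}"
    by (rule card_image[OF permutes_inj_on[OF u]])
  ultimately show ?thesis by simp
qed

text \<open>At the first position \<open>i\<close> where the two differ, u(i) < v(i). The partner is
  the next position whose value lies above u(i) and not above v(i).\<close>

lemma bruhat_le_swap_up:
  assumes u: "u permutes {1..n}" and v: "v permutes {1..n}" and le: "bruhat_le u v" and ne: "u \<noteq> v"
  obtains i j where "1 \<le> i" "i < j" "j \<le> n" "u i < u j" "bruhat_le (u \<circ> transpose i j) v"
proof -
  define i where "i = (LEAST i. u i \<noteq> v i)"
  have "\<exists>i. u i \<noteq> v i" using ne by auto
  then have i: "u i \<noteq> v i" unfolding i_def by (rule LeastI_ex)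
  have before: "u l = v l" if "l < i" for l using not_less_Least[of l "\<lambda>i. u i \<noteq> v i"] that by (auto simp: i_def)
  have ir: "i \<in> {1..n}"
  proof (rule ccontr)
    assume "i \<notin> {1..n}"
    then show False using i perm_range(2)[OF u] perm_range(2)[OF v] by simp
  qed
  then obtain i' where i': "i = Suc i'" by (cases i) auto
  have "u i < v i"
  proof (rule ccontr)
    assume "\<not> u i < v i"
    then have "v i < u i" using i by simp
    then have "rk u (u i) i > rk v (u i) i"
      using rk_cong[of i' "u i" u v] before i' by (simp add: rk_Suc)
    then show False using le by (auto simp: bruhat_le_def not_le[symmetric])
  qed
  define j where "j = (LEAST j. i < j \<and> u i < u j \<and> u j \<le> v i)"
  obtain j0 where j0: "v i = u j0" using surjD[OF permutes_surj[OF u], of "v i"] by blast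
  have "\<not> j0 < i" using before[of j0] j0 perm_range(3)[OF v] by force
  moreover have "j0 \<noteq> i" using i j0 by auto
  ultimately have "i < j0 \<and> u i < u j0 \<and> u j0 \<le> v i" using j0 \<open>u i < v i\<close> by auto
  then have "i < j \<and> u i < u j \<and> u j \<le> v i" unfolding j_def by (rule LeastI)
  then have j: "i < j" "u i < u j" "u j \<le> v i" by simp_all
  have gap: "\<not> (u i < u l \<and> u l \<le> v i)" if "i < l" "l < j" for l
    using not_less_Least[of l "\<lambda>j. i < j \<and> u i < u j \<and> u j \<le> v i"] that by (auto simp: j_def)
  have jr: "j \<le> n"
  proof (rule ccontr)
    assume "\<not> j \<le> n"
    then have "u j = j" using perm_range(2)[OF u, of j] by auto
    then show False using j ir perm_range(1)[OF v, of i] \<open>\<not> j \<le> n\<close> by auto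
  qed
  have "rk (u \<circ> transpose i j) p q \<le> rk v p q" for p q
  proof (cases "i \<le> q \<and> q < j \<and> u i < p \<and> p \<le> u j")
    case True
    \<comment> \<open>Here the exchange raises the rank of \<open>u\<close> by one. The bound comes
      from the threshold v(i) + 1: \<open>?B\<close> is compared by hypothesis, \<open>?A\<close> is
      the same for both, and position \<open>i\<close> counts on both sides.\<close>
    let ?A = "{k. 1 \<le> k \<and> k < i \<and> p \<le> v k \<and> v k \<le> v i}"
    let ?B = "\<lambda>u. {k. 1 \<le> k \<and> k \<le> q \<and> v i + 1 \<le> u k}"
    have fin: "finite ?A" "finite (?B u)" "finite (?B v)"
      by (rule finite_subset[of _ "{..i}"]; auto) (rule finite_subset[of _ "{..q}"]; auto)+
    have "{k. 1 \<le> k \<and> k \<le> q \<and> p \<le> (u \<circ> transpose i j) k} \<subseteq> insert i (?A \<union> ?B u)"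
    proof
      fix k assume k: "k \<in> {k. 1 \<le> k \<and> k \<le> q \<and> p \<le> (u \<circ> transpose i j) k}"
      show "k \<in> insert i (?A \<union> ?B u)"
      proof (cases "k = i")
        case False
        then have kk: "1 \<le> k" "k \<le> q" "p \<le> u k" using k True by (auto simp: transpose_def)
        show ?thesis
        proof (cases "k < i")
          case True
          then show ?thesis using kk before[OF True] by auto
        next
          case False
          then have "\<not> (u i < u k \<and> u k \<le> v i)" using gap[of k] kk True \<open>k \<noteq> i\<close> by auto
          then show ?thesis using kk True by auto
        qed
      qed simp
    qed
    then have "rk (u \<circ> transpose i j) p q \<le> card (insert i (?A \<union> ?B u))"
      unfolding rk_def by (intro card_mono) (use fin in auto)
    also have "\<dots> \<le> 1 + (card ?A + card (?B u))"
      using card_insert_le_m1[of "1 + (card ?A + card (?B u))" "?A \<union> ?B u" i] card_Un_le[of ?A "?B u"] by simp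
    also have "card (?B u) \<le> card (?B v)"
      using le unfolding bruhat_le_def rk_def by (rule allE[of _ "v i + 1"]) (erule allE[of _ q])
    also have "1 + (card ?A + card (?B v)) = card (insert i (?A \<union> ?B v))"
    proof -
      have "?A \<inter> ?B v = {}" by auto
      then have "card (?A \<union> ?B v) = card ?A + card (?B v)" using fin by (intro card_Un_disjoint) auto
      then show ?thesis using fin by (subst card_insert_disjoint) auto
    qed
    also have "\<dots> \<le> rk v p q"
      unfolding rk_def using True j ir by (intro card_mono) auto
    finally show ?thesis by simp
  next
    case False
    have "rk (u \<circ> transpose i j) p q \<le> rk u p q"
    proof (cases "q < j")
      case True
      have "{k. 1 \<le> k \<and> k \<le> q \<and> p \<le> (u \<circ> transpose i j) k} \<subseteq> {k. 1 \<le> k \<and> k \<le> q \<and> p \<le> u k}"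
        using False True j by (auto simp: transpose_def split: if_splits)
      then show ?thesis unfolding rk_def by (intro card_mono) auto
    next
      case False
      have "transpose i j ` {k. 1 \<le> k \<and> k \<le> q \<and> p \<le> (u \<circ> transpose i j) k} \<subseteq> {k. 1 \<le> k \<and> k \<le> q \<and> p \<le> u k}"
        using False j ir by (auto simp: transpose_def)
      then have "card (transpose i j ` {k. 1 \<le> k \<and> k \<le> q \<and> p \<le> (u \<circ> transpose i j) k}) \<le> rk u p q"
        unfolding rk_def by (intro card_mono) auto
      then show ?thesis unfolding rk_def by (simp add: card_image)
    qed
    also have "\<dots> \<le> rk v p q" using le by (simp add: bruhat_le_def)
    finally show ?thesis .
  qed
  then have "bruhat_le (u \<circ> transpose i j) v" by (simp add: bruhat_le_def)
  then show thesis using that[of i j] ir j jr by auto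
qed

context inclusion_perm begin

text \<open>Outside the diagram the rank conditions reduce to the left or to the lower neighbour,
  inside the diagram to an essential box of equal rank. It is used for permutations and again for
  ideals of minors.\<close>

lemma essential_induct:
  assumes ess: "\<And>p q. (p, q) \<in> essential_set n v \<Longrightarrow> Z p q"
    and q0: "\<And>p. Z p 0" and pn: "\<And>q. Z (n + 1) q"
    and left: "\<And>p q. 1 \<le> p \<Longrightarrow> p \<le> n \<Longrightarrow> 1 \<le> q \<Longrightarrow> q \<le> n \<Longrightarrow> p \<le> v q \<Longrightarrow> Z p (q - 1) \<Longrightarrow> Z p q"
    and down: "\<And>p q. 1 \<le> p \<Longrightarrow> p \<le> n \<Longrightarrow> 1 \<le> q \<Longrightarrow> q \<le> n \<Longrightarrow> vi p \<le> q \<Longrightarrow> Z (p + 1) q \<Longrightarrow> Z p q"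
    and right: "\<And>p q. (p, q) \<in> diagram n v \<Longrightarrow> (p, q + 1) \<in> diagram n v \<Longrightarrow> Z p (q + 1) \<Longrightarrow> Z p q"
    and up: "\<And>p q. (p, q) \<in> diagram n v \<Longrightarrow> (p - 1, q) \<in> diagram n v \<Longrightarrow> Z (p - 1) q \<Longrightarrow> Z p q"
    and range: "1 \<le> p" "p \<le> n + 1" "q \<le> n"
  shows "Z p q"
proof -
  have diag: "Z p q" if "(p, q) \<in> diagram n v" for p q
    using that
  proof (induction "p + (n - q)" arbitrary: p q rule: less_induct)
    case less
    note D = diagramD[OF less.prems]
    consider "(p, q) \<in> essential_set n v" | "(p, q + 1) \<in> diagram n v" | "(p - 1, q) \<in> diagram n v"
      using less.prems by (auto simp: essential_set_def)
    then show ?case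
    proof cases
      case 2
      then have "p + (n - (q + 1)) < p + (n - q)" using diagramD(4)[OF 2] by simp
      then show ?thesis using right[OF less.prems 2] less.hyps 2 by blast
    next
      case 3
      then have "p - 1 + (n - q) < p + (n - q)" using D by simp
      then show ?thesis using up[OF less.prems 3] less.hyps 3 by blast
    qed (rule ess)
  qed
  show ?thesis using range
  proof (induction "q + (n + 1 - p)" arbitrary: p q rule: less_induct)
    case less
    show ?case
    proof (cases "q = 0 \<or> p = n + 1 \<or> (p, q) \<in> diagram n v")
      case True
      then show ?thesis using q0 pn diag by auto
    next
      case False
      then have r: "1 \<le> q" "p \<le> n" using less.prems by auto
      have "\<not> (v q < p \<and> q < vi p)" using False r less.prems diagramI by blast
      then consider "p \<le> v q" | "vi p \<le> q" by (meson not_le)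
      then show ?thesis
      proof cases
        case 1
        have "Z p (q - 1)" using r less.prems by (intro less.hyps) auto
        then show ?thesis using left 1 r less.prems by blast
      next
        case 2
        have "Z (p + 1) q" using r less.prems by (intro less.hyps) auto
        then show ?thesis using down 2 r less.prems by blast
      qed
    qed
  qed
qed

lemma rk_v_left: "1 \<le> q \<Longrightarrow> p \<le> v q \<Longrightarrow> rk v p q = rk v p (q - 1) + 1"
  using rk_Suc[of v p "q - 1"] by simp

lemma rk_v_right: "v (q + 1) < p \<Longrightarrow> rk v p (q + 1) = rk v p q"
  using rk_Suc[of v p q] by simp

lemma rk_v_row: "1 \<le> p \<Longrightarrow> p \<le> n \<Longrightarrow> rk v p q = rk v (p + 1) q + (if vi p \<le> q then 1 else 0)"
proof -
  assume p: "1 \<le> p" "p \<le> n"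
  have "{k. 1 \<le> k \<and> k \<le> q \<and> p \<le> v k}
      = {k. 1 \<le> k \<and> k \<le> q \<and> p + 1 \<le> v k} \<union> {k. 1 \<le> k \<and> k \<le> q \<and> k = vi p}"
    by (auto simp: Suc_le_eq order.order_iff_strict)
  moreover have "{k. 1 \<le> k \<and> k \<le> q \<and> k = vi p} = (if vi p \<le> q then {vi p} else {})"
    using vi_range[of p] p by auto
  ultimately show ?thesis unfolding rk_def by (simp add: card_insert_if)
qed

text \<open>An essential condition of rank 0 is some \<open>P p q\<close>. One of positive rank is
  \<open>Q (q + 1) (p - 1)\<close>, which puts all values below \<open>p\<close> into the first
  \<open>q\<close> positions of \<open>u\<close>.\<close>

lemma sat_imp_bruhat_le:
  assumes u: "u permutes {1..n}" and sat: "sat u"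
  shows "bruhat_le u v"
  unfolding bruhat_le_def
proof (intro allI)
  fix p q
  have main: "rk u p q \<le> rk v p q" if "1 \<le> p" "p \<le> n + 1" "q \<le> n" for p q
  proof (rule essential_induct[where Z = "\<lambda>p q. rk u p q \<le> rk v p q", OF _ _ _ _ _ _ _ that])
    fix p q assume e: "(p, q) \<in> essential_set n v"
    then have pq: "(p, q) \<in> diagram n v" by (simp add: essential_set_def)
    note D = diagramD[OF pq]
    show "rk u p q \<le> rk v p q"
    proof (cases "rk v p q = 0")
      case True
      then have "{k. 1 \<le> k \<and> k \<le> q \<and> p \<le> v k} = {}" by (simp add: rk_def)
      then have "P p q" using D by (auto simp: P_def not_le[symmetric])
      then have "u k < p" if "1 \<le> k" "k \<le> q" for k
        using P_mono[of p q p k] satD(1)[OF sat] D that by auto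
      then show ?thesis by (subst rk_eq_0) auto
    next
      case False
      then have r: "q - rk v p q = p - 1" "\<And>z. 1 \<le> z \<Longrightarrow> v z < p \<Longrightarrow> z \<le> q"
        using essential_positive_rank[OF e] by auto
      have "1 \<le> v q" using v_ge_1 D by simp
      have "Q (q + 1) (p - 1)" unfolding Q_def
        using r(2) D \<open>1 \<le> v q\<close> by (auto simp: less_Suc_eq_le)
      then have later: "p - 1 < u a" if "q < a" "a \<le> n" for a
        using Q_mono[of "q + 1" "p - 1" a "p - 1"] satD(2)[OF sat] that D \<open>1 \<le> v q\<close> by auto
      have "{1..p - 1} \<subseteq> u ` {k. 1 \<le> k \<and> k \<le> q \<and> u k < p}"
      proof
        fix m assume m: "m \<in> {1..p - 1}"
        then have "m \<in> u ` {1..n}" using permutes_image[OF u] D by auto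
        then obtain k where k: "k \<in> {1..n}" "m = u k" by auto
        moreover have "u k < p" using m k by auto
        moreover have "k \<le> q"
        proof (rule ccontr)
          assume "\<not> k \<le> q"
          then show False using later[of k] k \<open>u k < p\<close> by simp
        qed
        ultimately show "m \<in> u ` {k. 1 \<le> k \<and> k \<le> q \<and> u k < p}" by auto
      qed
      then have "card {1..p - 1} \<le> card (u ` {k. 1 \<le> k \<and> k \<le> q \<and> u k < p})" by (intro card_mono) auto
      also have "\<dots> \<le> card {k. 1 \<le> k \<and> k \<le> q \<and> u k < p}" by (rule card_image_le) simp
      finally have "p - 1 \<le> card {k. 1 \<le> k \<and> k \<le> q \<and> u k < p}" by simp
      then show ?thesis using rk_split[of q u p] r(1) False by linarith
    qed
  next
    fix q show "rk u (n + 1) q \<le> rk v (n + 1) q"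
    proof (cases "q \<le> n")
      case True
      have "rk u (n + 1) q = 0"
        using perm_bounds(2)[OF u] True by (intro rk_eq_0) fastforce
      then show ?thesis by simp
    next
      case False
      then show ?thesis using rk_beyond[OF u] rk_beyond[OF perm] by simp
    qed
  next
    fix p q assume "1 \<le> p" "p \<le> n" "1 \<le> q" "q \<le> n" "p \<le> v q" "rk u p (q - 1) \<le> rk v p (q - 1)"
    then show "rk u p q \<le> rk v p q"
      using rk_v_left[of q p] rk_Suc[of u p "q - 1"] by (auto split: if_splits)
  next
    fix p q assume a: "1 \<le> p" "p \<le> n" "1 \<le> q" "q \<le> n" "vi p \<le> q" "rk u (p + 1) q \<le> rk v (p + 1) q"
    obtain k0 where k0: "p = u k0" using surjD[OF permutes_surj[OF u], of p] by blast
    have "{k. 1 \<le> k \<and> k \<le> q \<and> p \<le> u k} \<subseteq> insert k0 {k. 1 \<le> k \<and> k \<le> q \<and> p + 1 \<le> u k}"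
    proof
      fix k assume k: "k \<in> {k. 1 \<le> k \<and> k \<le> q \<and> p \<le> u k}"
      show "k \<in> insert k0 {k. 1 \<le> k \<and> k \<le> q \<and> p + 1 \<le> u k}"
      proof (cases "k = k0")
        case False
        then have "u k \<noteq> p" unfolding k0 perm_range(3)[OF u, of k k0] .
        then show ?thesis using k by auto
      qed simp
    qed
    then have "rk u p q \<le> card (insert k0 {k. 1 \<le> k \<and> k \<le> q \<and> p + 1 \<le> u k})"
      unfolding rk_def by (intro card_mono) auto
    also have "\<dots> \<le> rk u (p + 1) q + 1" unfolding rk_def by (simp add: card_insert_if)
    finally show "rk u p q \<le> rk v p q" using a rk_v_row[of p q] by simp
  next
    fix p q assume a: "(p, q) \<in> diagram n v" "(p, q + 1) \<in> diagram n v" "rk u p (q + 1) \<le> rk v p (q + 1)"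
    then show "rk u p q \<le> rk v p q"
      using rk_v_right[of q p] rk_Suc[of u p q] diagramD(5)[OF a(2)] by (auto split: if_splits)
  next
    fix p q assume a: "(p, q) \<in> diagram n v" "(p - 1, q) \<in> diagram n v" "rk u (p - 1) q \<le> rk v (p - 1) q"
    have "rk u p q \<le> rk u (p - 1) q" unfolding rk_def by (intro card_mono) auto
    moreover have "rk v (p - 1) q = rk v p q"
      using rk_v_row[of "p - 1" q] diagramD[OF a(2)] diagramD[OF a(1)] by auto
    ultimately show "rk u p q \<le> rk v p q" using a by simp
  qed simp
  show "rk u p q \<le> rk v p q"
  proof (cases "n < q")
    case True
    then show ?thesis using rk_beyond[OF u, of q p] rk_beyond[OF perm, of q p] by simp
  next
    case False
    have ge1: "1 \<le> u k" if "1 \<le> k" for k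
      using perm_range(1)[OF u, of k] perm_range(2)[OF u, of k] that by (cases "k \<le> n") auto
    consider "p = 0" | "1 \<le> p" "p \<le> n + 1" | "n + 1 < p" by linarith
    then show ?thesis
    proof cases
      case 1 then show ?thesis by (simp add: rk_def)
    next
      case 2 then show ?thesis using main False by simp
    next
      case 3
      have "rk u p q = 0"
        using perm_bounds(2)[OF u] False 3 by (intro rk_eq_0) fastforce
      then show ?thesis by simp
    qed
  qed
qed

text \<open>\<open>P a b\<close> is a condition of rank 0, and \<open>Q a b\<close> is the bound a -
  1 - b for the rank in the box (b + 1, a - 1).\<close>

lemma bruhat_le_imp_sat:
  assumes u: "u permutes {1..n}" and le: "bruhat_le u v"
  shows "sat u"
  unfolding sat_def
proof (intro allI conjI impI)
  fix a b
  show "u b < a" if p: "P a b"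
  proof (rule ccontr)
    assume "\<not> u b < a"
    then have "b \<in> {k. 1 \<le> k \<and> k \<le> b \<and> a \<le> u k}" using p by (auto simp: P_def)
    then have "rk u a b > 0" unfolding rk_def by (subst card_gt_0_iff) auto
    moreover have "{k. 1 \<le> k \<and> k \<le> b \<and> a \<le> v k} = {}" using p by (auto simp: P_def not_le[symmetric])
    then have "rk v a b = 0" by (simp add: rk_def)
    moreover have "rk u a b \<le> rk v a b" using le unfolding bruhat_le_def by blast
    ultimately show False by simp
  qed
  show "b < u a" if q: "Q a b"
  proof (rule ccontr)
    assume nb: "\<not> b < u a"
    have ab: "1 \<le> b" "b < a" "a \<le> n" using Q_less[OF q] q by (auto simp: Q_def)
    have "vi ` {1..b} \<subseteq> {k. 1 \<le> k \<and> k \<le> a - 1 \<and> v k < b + 1}"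
    proof (rule image_subsetI)
      fix l assume l: "l \<in> {1..b}"
      have "1 \<le> vi l" using vi_range[of l] l ab by auto
      then show "vi l \<in> {k. 1 \<le> k \<and> k \<le> a - 1 \<and> v k < b + 1}" using q l by (auto simp: Q_def)
    qed
    then have "card (vi ` {1..b}) \<le> card {k. 1 \<le> k \<and> k \<le> a - 1 \<and> v k < b + 1}" by (intro card_mono) auto
    moreover have "card (vi ` {1..b}) = b"
      by (subst card_image) (auto intro!: inj_on_inverseI[of _ v])
    ultimately have "b \<le> card {k. 1 \<le> k \<and> k \<le> a - 1 \<and> v k < b + 1}" by simp
    then have "rk v (b + 1) (a - 1) \<le> a - 1 - b" using rk_split[of "a - 1" v "b + 1"] by linarith
    moreover have "rk u (b + 1) (a - 1) \<le> rk v (b + 1) (a - 1)" using le unfolding bruhat_le_def by blast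
    ultimately have "rk u (b + 1) (a - 1) \<le> a - 1 - b" by simp
    then have 1: "b \<le> card {k. 1 \<le> k \<and> k \<le> a - 1 \<and> u k < b + 1}"
      using rk_split[of "a - 1" u "b + 1"] ab by linarith
    have "insert a {k. 1 \<le> k \<and> k \<le> a - 1 \<and> u k < b + 1} \<subseteq> {k. 1 \<le> k \<and> k \<le> a \<and> u k < b + 1}"
      using nb ab by auto
    then have "card (insert a {k. 1 \<le> k \<and> k \<le> a - 1 \<and> u k < b + 1}) \<le> card {k. 1 \<le> k \<and> k \<le> a \<and> u k < b + 1}"
      by (intro card_mono) auto
    also have "\<dots> \<le> b" using card_small_values[OF u, of "b + 1" a] ab by simp
    finally show False using 1 ab by (simp add: card_insert_if split: if_splits)
  qed
qed

lemma sat_iff_bruhat_le: "u permutes {1..n} \<Longrightarrow> sat u \<longleftrightarrow> bruhat_le u v"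
  using sat_imp_bruhat_le bruhat_le_imp_sat by blast

end

section \<open>Multiplicities under transpositions\<close>

lemma swap_fun_eq:
  fixes u :: "nat \<Rightarrow> nat"
  assumes "u permutes {1..n}"
  shows "u \<circ> transpose i j = transpose (u i) (u j) \<circ> u"
  using perm_range(3)[OF assms] by (auto simp: fun_eq_iff transpose_def)

context inclusion_perm begin

text \<open>Excludes the one case in which an exchange of two positions would change the sum of the
  multiplicities, see \<open>mu_swap_aux\<close>. Extremal choices of the two chains would form a
  forbidden configuration.\<close>

lemma R_swap_compatible:
  assumes sat: "sat u'" and u': "u' i = y" "u' j = x"
    and ij: "1 \<le> i" "i < j" "j \<le> n" and xy: "1 \<le> x" "x < y" "y \<le> n"
  shows "\<not> (R1 y z \<and> \<not> R1 x z \<and> R2 j k \<and> \<not> R2 i k)"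
proof
  assume *: "R1 y z \<and> \<not> R1 x z \<and> R2 j k \<and> \<not> R2 i k"
  obtain q where q: "1 \<le> z" "\<And>l. 1 \<le> l \<Longrightarrow> v l \<le> z \<Longrightarrow> l \<le> q" "\<And>l. 1 \<le> l \<Longrightarrow> l \<le> q \<Longrightarrow> v l < y"
    using * unfolding R1_def by blast
  obtain p where p: "1 \<le> k" "\<And>l. 1 \<le> l \<Longrightarrow> l \<le> k \<Longrightarrow> v l \<le> p" "\<And>l. 1 \<le> l \<Longrightarrow> v l \<le> p \<Longrightarrow> l < j"
    using * unfolding R2_def by blast
  have "z \<le> n" using R1_imp[of y z] P_less[of y z] * xy by auto
  have "k \<le> n" using R2_imp[of j k] P_less[of j k] * ij by auto
  \<comment> \<open>The least middle step possible for \<open>R1\<close> with lower end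
    \<open>z\<close>.\<close>
  define q1 where "q1 = Max (vi ` {1..z})"
  have "q1 \<in> vi ` {1..z}" unfolding q1_def using q(1) by (intro Max_in) auto
  then obtain s where s: "s \<in> {1..z}" "q1 = vi s" by blast
  have q1: "1 \<le> q1" "v q1 \<le> z" "q1 \<le> n" using vi_range[of s] s \<open>z \<le> n\<close> by auto
  have q1m: "l \<le> q1" if "1 \<le> l" "v l \<le> z" for l
  proof -
    have "v l \<in> {1..z}" using that v_ge_1[of l] by auto
    then have "vi (v l) \<le> q1" unfolding q1_def by (intro Max_ge) blast+
    then show ?thesis by simp
  qed
  have "q1 \<le> q" using q(2) q1 by blast
  have iq: "q1 < i"
  proof (rule ccontr)
    assume "\<not> q1 < i"
    then have "\<forall>l\<ge>1. l \<le> i \<longrightarrow> v l < y" using q(3) \<open>q1 \<le> q\<close> by auto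
    then have "P y i" using ij xy unfolding P_def by blast
    then show False using satD(1)[OF sat, of y i] u' by simp
  qed
  have "\<not> (\<forall>l\<ge>1. l \<le> q1 \<longrightarrow> v l < x)"
    using * q1m q(1) xy unfolding R1_def by (meson less_imp_le_nat le_trans)
  then obtain l where l: "1 \<le> l" "l \<le> q1" "x \<le> v l" by (meson not_less)
  \<comment> \<open>The least middle step possible for \<open>R2\<close> with lower end
    \<open>k\<close>.\<close>
  define M where "M = Max (v ` {1..k})"
  have "M \<in> v ` {1..k}" unfolding M_def using p(1) by (intro Max_in) auto
  then obtain k1 where k1: "k1 \<in> {1..k}" "M = v k1" by blast
  have Mm: "v l \<le> M" if "1 \<le> l" "l \<le> k" for l
    unfolding M_def using that by (intro Max_ge) auto
  have "M \<le> p" using p(2) k1 by auto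
  have Mx: "M < x"
  proof (rule ccontr)
    assume "\<not> M < x"
    then have "\<forall>l\<ge>1. v l \<le> x \<longrightarrow> l < j" using p(3) \<open>M \<le> p\<close> by auto
    then have "Q j x" using ij xy unfolding Q_def by blast
    then show False using satD(2)[OF sat, of j x] u' by simp
  qed
  have "\<not> (\<forall>l\<ge>1. v l \<le> M \<longrightarrow> l < i)"
    using * Mm p(1) ij unfolding R2_def by (meson less_imp_le_nat le_trans)
  then obtain m2 where m2: "1 \<le> m2" "v m2 \<le> M" "i \<le> m2" by (meson not_less)
  have lk: "k < l" using Mm[of l] l Mx by (meson le_less_trans not_less)
  have "m2 \<noteq> k1" using m2 k1 lk l iq by auto
  then have vm2: "v m2 < M" using m2 k1 by (simp add: order.order_iff_strict)
  have "\<not> P y i" using satD(1)[OF sat, of y i] u' by auto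
  then obtain m4 where m4: "1 \<le> m4" "m4 \<le> i" "y \<le> v m4"
    using ij xy unfolding P_def by (meson not_less)
  have "q1 < m4"
  proof (rule ccontr)
    assume "\<not> q1 < m4"
    then show False using q(3)[of m4] m4 \<open>q1 \<le> q\<close> by simp
  qed
  have "\<not> Q j x" using satD(2)[OF sat, of j x] u' by auto
  then obtain m3 where m3: "1 \<le> m3" "v m3 \<le> x" "j \<le> m3"
    using ij xy unfolding Q_def by (meson not_less)
  have "M < v m3"
  proof (rule ccontr)
    assume "\<not> M < v m3"
    then show False using p(3)[of m3] m3 \<open>M \<le> p\<close> by simp
  qed
  have vq1: "v q1 < M"
  proof -
    have "m2 \<noteq> q1" using m2 iq by simp
    moreover have "\<not> v m2 \<le> z" using q1m[of m2] m2 iq by auto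
    ultimately show ?thesis using q1 vm2 by simp
  qed
  have m3n: "m3 \<le> n"
  proof (rule ccontr)
    assume "\<not> m3 \<le> n"
    then have "v m3 = m3" using perm_range(2)[OF perm, of m3] by auto
    then show False using m3 xy \<open>\<not> m3 \<le> n\<close> by simp
  qed
  have m42: "m4 < m2"
  proof -
    have "m4 \<noteq> m2" using m4 m2 vm2 Mx xy by auto
    then show ?thesis using m4 m2 by simp
  qed
  have D: "(v m3, q1) \<in> diagram n v"
    using q1 vq1 \<open>M < v m3\<close> m3 iq ij v_le_n[OF m3(1) m3n] by (intro diagramI) auto
  show False
    by (rule forbidden_configuration[OF D l(1,2), of k1 m4 m2])
      (use l m3 k1 lk \<open>M < v m3\<close> \<open>q1 < m4\<close> m4 m42 vm2 xy in auto)
qed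

text \<open>The mirror image of \<open>R_swap_compatible\<close> under conjugation by \<open>w0\<close>.\<close>

lemma R_swap_compatible':
  assumes sat: "sat u'" and u': "u' i = y" "u' j = x"
    and ij: "1 \<le> i" "i < j" "j \<le> n" and xy: "1 \<le> x" "x < y" "y \<le> n"
  shows "\<not> (R1 z x \<and> \<not> R1 z y \<and> R2 k i \<and> \<not> R2 k j)"
proof
  assume *: "R1 z x \<and> \<not> R1 z y \<and> R2 k i \<and> \<not> R2 k j"
  have zn: "z \<le> n" "k \<le> n" using * by (auto simp: R1_def R2_def)
  obtain q where q: "\<And>l. 1 \<le> l \<Longrightarrow> v l \<le> x \<Longrightarrow> l \<le> q" "\<And>l. 1 \<le> l \<Longrightarrow> l \<le> q \<Longrightarrow> v l < z"
    using * unfolding R1_def by blast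
  obtain p where p: "\<And>l. 1 \<le> l \<Longrightarrow> l \<le> i \<Longrightarrow> v l \<le> p" "\<And>l. 1 \<le> l \<Longrightarrow> v l \<le> p \<Longrightarrow> l < k"
    using * unfolding R2_def by blast
  have "z \<ge> 1" "k \<ge> 1" using R1_imp[of z x] P_less[of z x] R2_imp[of k i] P_less[of k i] * by auto
  \<comment> \<open>In the mirror image the extremal middle steps are the largest ones,
    \<open>f - 1\<close> for \<open>R1\<close> and \<open>g - 1\<close> for
    \<open>R2\<close>.\<close>
  define f where "f = (LEAST l. 1 \<le> l \<and> z \<le> v l)"
  have "1 \<le> vi z \<and> z \<le> v (vi z)" using vi_range[of z] \<open>z \<ge> 1\<close> zn by auto
  then have "1 \<le> f \<and> z \<le> v f" unfolding f_def by (rule LeastI)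
  then have f: "1 \<le> f" "z \<le> v f" by auto
  have fm: "v l < z" if "1 \<le> l" "l < f" for l
    using not_less_Least[of l "\<lambda>l. 1 \<le> l \<and> z \<le> v l"] that by (auto simp: f_def)
  have "q < f" using q(2)[of f] f by (meson not_less)
  have "\<not> (\<forall>l\<ge>1. v l \<le> y \<longrightarrow> l \<le> f - 1)"
  proof
    assume a: "\<forall>l\<ge>1. v l \<le> y \<longrightarrow> l \<le> f - 1"
    have "\<forall>l\<ge>1. l \<le> f - 1 \<longrightarrow> v l < z" using fm f by auto
    then have "R1 z y" using a zn xy unfolding R1_def by (intro conjI exI[of _ "f - 1"]) auto
    then show False using * by blast
  qed
  then obtain m where m: "1 \<le> m" "v m \<le> y" "f \<le> m" using f by fastforce
  have "x < v m"
  proof (rule ccontr)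
    assume "\<not> x < v m"
    then show False using q(1)[of m] m \<open>q < f\<close> by simp
  qed
  have jf: "j < f"
  proof (rule ccontr)
    assume "\<not> j < f"
    then have "\<forall>l\<ge>1. v l \<le> x \<longrightarrow> l < j" using q(1) \<open>q < f\<close> by fastforce
    then have "Q j x" using ij xy unfolding Q_def by auto
    then show False using satD(2)[OF sat, of j x] u' by simp
  qed
  define g where "g = (LEAST c. 1 \<le> c \<and> k \<le> vi c)"
  have "1 \<le> v k \<and> k \<le> vi (v k)" using v_ge_1[of k] \<open>k \<ge> 1\<close> by simp
  then have "1 \<le> g \<and> k \<le> vi g" unfolding g_def by (rule LeastI)
  then have g: "1 \<le> g" "k \<le> vi g" by auto
  have gm: "vi c < k" if "1 \<le> c" "c < g" for c
    using not_less_Least[of c "\<lambda>c. 1 \<le> c \<and> k \<le> vi c"] that by (auto simp: g_def)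
  have gv: "g \<le> v l" if "1 \<le> l" "k \<le> l" for l
  proof (rule ccontr)
    assume "\<not> g \<le> v l"
    then show False using gm[of "v l"] v_ge_1[of l] that by simp
  qed
  have "p < g" using p(2)[of "vi g"] g \<open>k \<ge> 1\<close> by (metis le_trans not_less v_vi)
  have yg: "y < g"
  proof (rule ccontr)
    assume "\<not> y < g"
    then have "\<forall>l\<ge>1. l \<le> i \<longrightarrow> v l < y" using p(1) \<open>p < g\<close> by fastforce
    then have "P y i" using ij xy unfolding P_def by auto
    then show False using satD(1)[OF sat, of y i] u' by simp
  qed
  have "\<not> (\<forall>l\<ge>1. l \<le> j \<longrightarrow> v l \<le> g - 1)"
  proof
    assume a: "\<forall>l\<ge>1. l \<le> j \<longrightarrow> v l \<le> g - 1"
    have "\<forall>l\<ge>1. v l \<le> g - 1 \<longrightarrow> l < k" using gv g by fastforce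
    then have "R2 k j" using a zn ij unfolding R2_def by (intro conjI exI[of _ "g - 1"]) auto
    then show False using * by blast
  qed
  then obtain l where l: "1 \<le> l" "l \<le> j" "g \<le> v l" using g by fastforce
  have il: "i < l"
  proof (rule ccontr)
    assume "\<not> i < l"
    then show False using p(1)[of l] l \<open>p < g\<close> by simp
  qed
  have "\<not> P y i" using satD(1)[OF sat, of y i] u' by auto
  then obtain l' where l': "1 \<le> l'" "l' \<le> i" "y \<le> v l'"
    using ij xy unfolding P_def by (meson not_less)
  have "v l' < g"
  proof (rule ccontr)
    assume "\<not> v l' < g"
    then show False using p(1)[of l'] l' \<open>p < g\<close> by simp
  qed
  have "\<not> Q j x" using satD(2)[OF sat, of j x] u' by auto
  then obtain m' where m': "1 \<le> m'" "v m' \<le> x" "j \<le> m'"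
    using ij xy unfolding Q_def by (meson not_less)
  have "m' < f" using q(1)[of m'] m' \<open>q < f\<close> by simp
  have "v l < z" using fm[of l] l jf by simp
  then have gf: "g \<le> v f" "f \<noteq> m" using l f m xy yg by auto
  then have fm': "f < m" using m by simp
  have "m < k"
  proof (rule ccontr)
    assume "\<not> m < k"
    then show False using gv[of m] m yg by simp
  qed
  have "v m \<noteq> v l'" using l' il l jf fm' by auto
  moreover have "v m \<le> v l'" using m l' by simp
  ultimately have "v m < v l'" by (rule le_neq_trans[rotated])
  have "g \<le> n"
  proof (rule ccontr)
    assume "\<not> g \<le> n"
    then have "v l = l \<and> n < l" using l ij perm_bounds(2)[OF perm, of l] by auto
    then show False using l ij by simp
  qed
  have D: "(g, m') \<in> diagram n v"
    using \<open>g \<le> n\<close> m' xy yg g \<open>m' < f\<close> fm' \<open>m < k\<close> by (intro diagramI) auto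
  show False
    by (rule forbidden_configuration[OF D l(1), of l' f m])
      (use l l' m' il ij \<open>v l' < g\<close> \<open>m' < f\<close> gf fm' \<open>v m < v l'\<close> in auto)
qed

text \<open>Taken over both positions, the terms from \<open>P\<close> and \<open>Q\<close> are
  merely permuted. By monotonicity of \<open>R1\<close> and \<open>R2\<close> the subtracted terms
  have equal sums, except in the cases excluded by \<open>R_swap_compatible\<close> and its mirror
  image.\<close>

lemma mu_swap_aux:
  assumes u: "u permutes {1..n}" "sat u" and u': "sat (u \<circ> transpose i j)"
    and ij: "1 \<le> i" "i < j" "j \<le> n" "u i < u j" and k: "1 \<le> k" "k \<le> n" "k \<noteq> i" "k \<noteq> j"
  shows "mu u k i + mu u k j = mu (u \<circ> transpose i j) k i + mu (u \<circ> transpose i j) k j"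
    and "mu u i k + mu u j k = mu (u \<circ> transpose i j) i k + mu (u \<circ> transpose i j) j k"
proof -
  let ?u = "u \<circ> transpose i j"
  have v: "?u i = u j" "?u j = u i" "?u k = u k" using k by auto
  have pu: "?u permutes {1..n}" using u ij by (intro permutes_comp_swap) auto
  have b: "1 \<le> u i" "u j \<le> n" using perm_bounds[OF u(1)] ij by auto
  note c1 = R_swap_compatible[OF u' v(1,2) ij(1-3) b(1) ij(4) b(2)]
  note c2 = R_swap_compatible'[OF u' v(1,2) ij(1-3) b(1) ij(4) b(2)]
  have lab: "R1 (w a) (w c) \<or> R2 a c \<Longrightarrow> P (w a) c \<and> Q a (w c)"
    if "w permutes {1..n}" "sat w" "1 \<le> a" "a \<le> n" "1 \<le> c" "c \<le> n" for w a c
    using sat_R1_label[OF that(2), of a c] sat_R2_label[OF that(2), of a c] perm_bounds[OF that(1)] that by blast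
  have mono1: "R1 (u i) (u k) \<Longrightarrow> R1 (u j) (u k)" "R2 i k \<Longrightarrow> R2 j k"
    using R1_mono[of "u i" "u k" "u j" "u k"] R2_mono[of i k j k] ij b perm_bounds[OF u(1)] k by auto
  have mono2: "R1 (u k) (u j) \<Longrightarrow> R1 (u k) (u i)" "R2 k j \<Longrightarrow> R2 k i"
    using R1_mono[of "u k" "u j" "u k" "u i"] R2_mono[of k j k i] ij b perm_bounds[OF u(1)] k by auto
  have i: "1 \<le> i" "i \<le> n" "1 \<le> j" "j \<le> n" using ij by auto
  show "mu u k i + mu u k j = mu ?u k i + mu ?u k j"
    using c1[of "u k" k] mono1 lab[OF u i(1,2) k(1,2)] lab[OF u i(3,4) k(1,2)]
      lab[OF pu u' i(1,2) k(1,2)] lab[OF pu u' i(3,4) k(1,2)]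
    unfolding mu_def v by (simp split: if_splits)
  show "mu u i k + mu u j k = mu ?u i k + mu ?u j k"
    using c2[of "u k" k] mono2 lab[OF u k(1,2) i(1,2)] lab[OF u k(1,2) i(3,4)]
      lab[OF pu u' k(1,2) i(1,2)] lab[OF pu u' k(1,2) i(3,4)]
    unfolding mu_def v by (simp split: if_splits)
qed

end

section \<open>The candidate product and its congruences\<close>

context inclusion_perm begin

text \<open>The candidate for \<open>loc k n v u\<close>. It is 0 off X_v, like the restriction of
  the class.\<close>

definition psi :: "bool \<Rightarrow> (nat \<Rightarrow> nat) \<Rightarrow> nat laurent" where
  "psi k u = (if sat u then \<Prod>i\<in>{1..n}. \<Prod>j\<in>{1..n}. wt k (u i) (u j) ^ mu u i j else 0)"

lemma prod_mu_swap_ordered: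
  fixes f :: "nat \<Rightarrow> nat \<Rightarrow> 'a::comm_monoid_mult"
  assumes u: "u permutes {1..n}" "sat u" "sat (u \<circ> transpose i j)"
    and ij: "1 \<le> i" "i < j" "j \<le> n" "u i < u j"
    and f: "\<And>a. f a i = f a j" "\<And>b. f i b = f j b"
  shows "(\<Prod>a\<in>{1..n}. \<Prod>b\<in>{1..n}. f a b ^ mu u a b)
    = (\<Prod>a\<in>{1..n}. \<Prod>b\<in>{1..n}. f a b ^ mu (u \<circ> transpose i j) a b)"
proof (rule prod_exponent_swap[of _ i j])
  let ?u = "u \<circ> transpose i j"
  have v: "?u i = u j" "?u j = u i" by auto
  have pu: "?u permutes {1..n}" using u ij by (intro permutes_comp_swap) auto
  have inj: "a \<in> {1..n}" "1 \<le> a" "a \<le> n" if "a \<in> {i, j}" for a using that ij by auto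
  fix a b
  show "mu u a b = mu ?u a b" if "a \<in> {1..n} - {i, j}" "b \<in> {1..n} - {i, j}"
    using that by (simp add: mu_def)
  show "mu u a i + mu u a j = mu ?u a i + mu ?u a j" if "a \<in> {1..n} - {i, j}"
    using mu_swap_aux(1)[OF u ij, of a] that by auto
  show "mu u i b + mu u j b = mu ?u i b + mu ?u j b" if "b \<in> {1..n} - {i, j}"
    using mu_swap_aux(2)[OF u ij, of b] that by auto
  \<comment> \<open>A condition linking \<open>i\<close> and \<open>j\<close> themselves would be
    violated by one of the two permutations, which both satisfy all inclusions.\<close>
  show "mu u a b = 0 \<and> mu ?u a b = 0" if "a \<in> {i, j}" "b \<in> {i, j}"
  proof (rule ccontr)
    assume nz: "\<not> (mu u a b = 0 \<and> mu ?u a b = 0)"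
    note r = inj[OF that(1)] inj[OF that(2)]
    consider "mu u a b > 0" | "mu ?u a b > 0" using nz by auto
    then show False
    proof cases
      case 1
      then have "a < b" using mu_posD[OF u(2,1) r(2,3,5,6)] by blast
      then have ab: "a = i" "b = j" using that ij by auto
      have bi: "1 \<le> j" "i \<le> n" using ij by auto
      have "mu u i j > 0" using 1 ab by simp
      then have "P (u j) i \<or> Q j (u i)" unfolding mu_pos[OF u(2,1) ij(1) bi(2,1) ij(3)] .
      then show False using satD[OF u(3), of "u j" i] satD[OF u(3), of j "u i"] v by auto
    next
      case 2
      then have "a < b" "?u a < ?u b" using mu_posD[OF u(3) pu r(2,3,5,6)] by blast+
      then show False using that ij v by auto
    qed
  qed
qed (use ij f in auto)

lemma prod_mu_swap:
  fixes f :: "nat \<Rightarrow> nat \<Rightarrow> 'a::comm_monoid_mult"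
  assumes u: "u permutes {1..n}" "sat u" "sat (u \<circ> transpose i j)"
    and ij: "i \<in> {1..n}" "j \<in> {1..n}" "i \<noteq> j"
    and f: "\<And>a. f a i = f a j" "\<And>b. f i b = f j b"
  shows "(\<Prod>a\<in>{1..n}. \<Prod>b\<in>{1..n}. f a b ^ mu u a b)
    = (\<Prod>a\<in>{1..n}. \<Prod>b\<in>{1..n}. f a b ^ mu (u \<circ> transpose i j) a b)"
proof -
  have *: "(\<Prod>a\<in>{1..n}. \<Prod>b\<in>{1..n}. f a b ^ mu u a b)
    = (\<Prod>a\<in>{1..n}. \<Prod>b\<in>{1..n}. f a b ^ mu (u \<circ> transpose i j) a b)" if "i < j" "i \<in> {1..n}" "j \<in> {1..n}" "sat (u \<circ> transpose i j)"
    "\<And>a. f a i = f a j" "\<And>b. f i b = f j b" for i j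
  proof (cases "u i < u j")
    case True
    have b: "1 \<le> i" "j \<le> n" using that(2,3) by auto
    show ?thesis by (rule prod_mu_swap_ordered[where f = f, OF u(1,2) that(4) b(1) that(1) b(2) True that(5,6)])
  next
    case False
    let ?u = "u \<circ> transpose i j"
    have invol: "?u \<circ> transpose i j = u" by (auto simp: fun_eq_iff)
    have "u i \<noteq> u j" using perm_range(3)[OF u(1), of i j] that(1) by simp
    then have "?u i < ?u j" using False by simp
    moreover have "?u permutes {1..n}" using u that by (intro permutes_comp_swap) auto
    moreover have b: "1 \<le> i" "j \<le> n" using that(2,3) by auto
    moreover have "sat (?u \<circ> transpose i j)" unfolding invol by (rule u(2))
    ultimately have "(\<Prod>a\<in>{1..n}. \<Prod>b\<in>{1..n}. f a b ^ mu ?u a b)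
        = (\<Prod>a\<in>{1..n}. \<Prod>b\<in>{1..n}. f a b ^ mu (?u \<circ> transpose i j) a b)"
      by (intro prod_mu_swap_ordered[where f = f, OF _ that(4) _ _ that(1) _ _ that(5,6)])
    then show ?thesis unfolding invol by (rule sym)
  qed
  show ?thesis
  proof (cases "i < j")
    case True
    show ?thesis by (rule *[OF True ij(1,2) u(3)]) (rule f)+
  next
    case False
    then have "j < i" using ij by simp
    have c: "transpose i j = transpose j i" by (rule transpose_commute)
    show ?thesis unfolding c by (rule *[OF \<open>j < i\<close> ij(2,1) u(3)[unfolded c]]) (rule f[symmetric])+
  qed
qed

text \<open>The inclusion lost by the exchange contributes a weight of the pair \<open>i\<close>,
  \<open>j\<close> to \<open>psi k u\<close>, and the identification makes this weight 0.\<close>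

lemma psi_identify_boundary:
  assumes u: "u permutes {1..n}" "sat u" "\<not> sat (u \<circ> transpose i j)"
    and ij: "i \<in> {1..n}" "j \<in> {1..n}" "i \<noteq> j"
    and \<kappa>: "\<kappa> (u i) = \<kappa> (u j)"
  shows "lrename \<kappa> (psi k u) = 0"
proof -
  let ?u = "u \<circ> transpose i j"
  have r: "1 \<le> i" "i \<le> n" "1 \<le> j" "j \<le> n" using ij by auto
  have b: "1 \<le> u i" "u i \<le> n" "1 \<le> u j" "u j \<le> n" using perm_bounds[OF u(1)] r by auto
  obtain a c where ac: "P a c \<and> \<not> ?u c < a \<or> Q a c \<and> \<not> c < ?u a"
    using u(3) unfolding sat_def by blast
  have "(P (u j) i \<or> Q j (u i)) \<or> (P (u i) j \<or> Q i (u j))"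
  proof (cases "P a c \<and> \<not> ?u c < a")
    case True
    then have p: "P a c" "\<not> ?u c < a" by auto
    have "u c < a" using satD(1)[OF u(2) p(1)] .
    then consider "c = i" | "c = j" using p by (metis comp_apply transpose_apply_other)
    then show ?thesis
    proof cases
      case 1
      then have "P (u j) i" using p P_mono[of a i "u j" i] r b by auto
      then show ?thesis by blast
    next
      case 2
      then have "P (u i) j" using p P_mono[of a j "u i" j] r b by auto
      then show ?thesis by blast
    qed
  next
    case False
    then have q: "Q a c" "\<not> c < ?u a" using ac by blast+
    have "c < u a" using satD(2)[OF u(2) q(1)] .
    then consider "a = i" | "a = j" using q by (metis comp_apply transpose_apply_other)
    then show ?thesis
    proof cases
      case 1
      then have "Q i (u j)" using q Q_mono[of i c i "u j"] r b by auto
      then show ?thesis by blast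
    next
      case 2
      then have "Q j (u i)" using q Q_mono[of j c j "u i"] r b by auto
      then show ?thesis by blast
    qed
  qed
  then have "mu u i j > 0 \<or> mu u j i > 0"
    unfolding mu_pos[OF u(2,1) r] mu_pos[OF u(2,1) r(3,4,1,2)] .
  then obtain a c where ac: "a \<in> {1..n}" "c \<in> {1..n}" "mu u a c > 0" "\<kappa> (u a) = \<kappa> (u c)"
  proof
    assume "mu u i j > 0" then show thesis by (rule that[OF ij(1,2) _ \<kappa>])
  next
    assume "mu u j i > 0" then show thesis by (rule that[OF ij(2,1) _ \<kappa>[symmetric]])
  qed
  have "(\<Prod>c\<in>{1..n}. wt k (\<kappa> (u a)) (\<kappa> (u c)) ^ mu u a c) = 0"
    using ac by (intro prod_zero bexI[of _ c]) (auto simp: zero_power)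
  then have "(\<Prod>a\<in>{1..n}. \<Prod>c\<in>{1..n}. wt k (\<kappa> (u a)) (\<kappa> (u c)) ^ mu u a c) = 0"
    using ac(1) by (rule prod_zero[OF finite_atLeastAtMost bexI])
  then show ?thesis using u(2) by (simp add: psi_def lrename_prod lrename_power)
qed

lemma psi_identify:
  assumes u: "u permutes {1..n}" and ij: "i \<in> {1..n}" "j \<in> {1..n}" "i \<noteq> j"
    and \<kappa>: "\<kappa> (u i) = \<kappa> (u j)"
  shows "lrename \<kappa> (psi k (u \<circ> transpose i j)) = lrename \<kappa> (psi k u)"
proof -
  let ?u = "u \<circ> transpose i j"
  have invol: "?u \<circ> transpose i j = u" by (auto simp: fun_eq_iff)
  have pu: "?u permutes {1..n}" using u ij by (intro permutes_comp_swap)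
  consider "sat u" "sat ?u" | "sat u" "\<not> sat ?u" | "\<not> sat u" "sat ?u" | "\<not> sat u" "\<not> sat ?u" by blast
  then show ?thesis
  proof cases
    case 1
    have same: "\<kappa> (?u a) = \<kappa> (u a)" for a
      using \<kappa> by (cases "a = i"; cases "a = j") (auto simp: transpose_def)
    let ?f = "\<lambda>a b. wt k (\<kappa> (u a)) (\<kappa> (u b))"
    have "lrename \<kappa> (psi k ?u) = (\<Prod>a\<in>{1..n}. \<Prod>b\<in>{1..n}. ?f a b ^ mu ?u a b)"
      using 1 by (simp only: psi_def if_True lrename_prod lrename_power lrename_wt same)
    also have "\<dots> = (\<Prod>a\<in>{1..n}. \<Prod>b\<in>{1..n}. ?f a b ^ mu u a b)"
      by (rule prod_mu_swap[OF u 1 ij, symmetric]) (simp_all add: \<kappa>)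
    also have "\<dots> = lrename \<kappa> (psi k u)"
      using 1 by (simp only: psi_def if_True lrename_prod lrename_power lrename_wt)
    finally show ?thesis .
  next
    case 2
    then have "lrename \<kappa> (psi k u) = 0" by (intro psi_identify_boundary[of u i j] u ij \<kappa>)
    then show ?thesis using 2 by (simp only: psi_def if_False lrename_zero)
  next
    case 3
    have "lrename \<kappa> (psi k ?u) = 0"
      by (rule psi_identify_boundary[of ?u i j]) (use 3 pu ij \<kappa> in \<open>auto simp: invol\<close>)
    then show ?thesis using 3 by (simp only: psi_def if_False lrename_zero)
  qed (simp only: psi_def if_False)
qed

lemma psi_v: "psi k v = (\<Prod>(i, j) \<in> noninv n v. wt k (v i) (v j))"
proof -
  have "psi k v = (\<Prod>i\<in>{1..n}. \<Prod>j\<in>{1..n}. if (i, j) \<in> noninv n v then wt k (v i) (v j) else 1)"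
    unfolding psi_def using sat_v by (auto intro!: prod.cong simp: mu_v noninv_def)
  also have "\<dots> = (\<Prod>p\<in>{1..n} \<times> {1..n}. if p \<in> noninv n v then wt k (v (fst p)) (v (snd p)) else 1)"
    by (simp add: prod.cartesian_product case_prod_unfold)
  also have "\<dots> = (\<Prod>p\<in>{1..n} \<times> {1..n} \<inter> noninv n v. wt k (v (fst p)) (v (snd p)))"
    by (simp add: prod.inter_restrict)
  also have "{1..n} \<times> {1..n} \<inter> noninv n v = noninv n v"
    by (auto simp: noninv_def)
  finally show ?thesis by (simp add: case_prod_unfold)
qed

text \<open>For a point of X_v, the number of factors of \<open>psi\<close> and thus its degree in
  cohomology.\<close>

definition mu_total :: "(nat \<Rightarrow> nat) \<Rightarrow> nat" where
  "mu_total u = (\<Sum>i\<in>{1..n}. \<Sum>j\<in>{1..n}. mu u i j)"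

lemma mu_total_v: "mu_total v = card (noninv n v)"
proof -
  have "mu_total v = (\<Sum>p\<in>{1..n} \<times> {1..n}. if p \<in> noninv n v then 1 else 0)"
    unfolding mu_total_def sum.cartesian_product
    by (intro sum.cong) (auto simp: mu_v noninv_def split: if_splits)
  also have "\<dots> = card ({1..n} \<times> {1..n} \<inter> noninv n v)"
    by (simp flip: sum.inter_restrict)
  also have "{1..n} \<times> {1..n} \<inter> noninv n v = noninv n v"
    by (auto simp: noninv_def)
  finally show ?thesis .
qed

lemma mu_total_swap:
  assumes "u permutes {1..n}" "sat u" "sat (u \<circ> transpose i j)" "i \<in> {1..n}" "j \<in> {1..n}" "i \<noteq> j"
  shows "mu_total (u \<circ> transpose i j) = mu_total u"
proof -
  \<comment> \<open>The constant function 2 turns the equality of products into one of sums of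
    exponents.\<close>
  have "(\<Prod>a\<in>{1..n}. \<Prod>b\<in>{1..n}. 2 ^ mu u a b)
    = (\<Prod>a\<in>{1..n}. \<Prod>b\<in>{1..n}. (2::nat) ^ mu (u \<circ> transpose i j) a b)"
    by (rule prod_mu_swap[OF assms]) simp_all
  then have "(2::nat) ^ mu_total u = 2 ^ mu_total (u \<circ> transpose i j)"
    by (simp add: mu_total_def power_sum)
  then show ?thesis by simp
qed

end

text \<open>The map \<open>h\<close> transports a noninversion along the transposition if this keeps
  its order and leaves it in place otherwise. It is injective and misses (i, j).\<close>

lemma noninv_swap_less:
  assumes u: "1 \<le> i" "i < j" "j \<le> n" "u i < u j"
  shows "card (noninv n (u \<circ> transpose i j)) < card (noninv n u)"
proof -
  let ?s = "transpose i j" and ?u = "u \<circ> transpose i j"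
  define h where "h p = (case p of (a, b) \<Rightarrow> if ?s a < ?s b then (?s a, ?s b) else (a, b))" for p
  have s: "1 \<le> ?s a \<longleftrightarrow> 1 \<le> a" "?s a \<le> n \<longleftrightarrow> a \<le> n" for a
    using u by (auto simp: transpose_def)
  have "inj_on h (noninv n ?u)"
  proof (rule inj_onI)
    fix p q assume pq: "p \<in> noninv n ?u" "q \<in> noninv n ?u" "h p = h q"
    obtain a b c d where e: "p = (a, b)" "q = (c, d)" by (metis surj_pair)
    have "a < b" "c < d" using pq e by (auto simp: noninv_def)
    have "?s (?s x) = x" for x by simp
    show "p = q"
    proof (cases "?s a < ?s b"; cases "?s c < ?s d")
      assume "?s a < ?s b" "?s c < ?s d"
      then have "?s a = ?s c" "?s b = ?s d" using pq e by (auto simp: h_def)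
      then show ?thesis using e by (metis transpose_involutory)
    next
      assume *: "?s a < ?s b" "\<not> ?s c < ?s d"
      then have "c = ?s a" "d = ?s b" using pq e by (auto simp: h_def)
      then show ?thesis using * \<open>a < b\<close> by simp
    next
      assume *: "\<not> ?s a < ?s b" "?s c < ?s d"
      then have "a = ?s c" "b = ?s d" using pq e by (auto simp: h_def)
      then show ?thesis using * \<open>c < d\<close> by simp
    next
      assume "\<not> ?s a < ?s b" "\<not> ?s c < ?s d"
      then show ?thesis using pq e by (simp add: h_def)
    qed
  qed
  moreover have "h ` noninv n ?u \<subseteq> noninv n u - {(i, j)}"
  proof (rule image_subsetI)
    fix p assume p: "p \<in> noninv n ?u"
    obtain a b where e: "p = (a, b)" by (metis surj_pair)
    have ab: "1 \<le> a" "a < b" "b \<le> n" "u (?s a) < u (?s b)" using p e by (auto simp: noninv_def)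
    show "h p \<in> noninv n u - {(i, j)}"
    proof (cases "?s a < ?s b")
      case True
      have "\<not> (?s a = i \<and> ?s b = j)"
      proof
        assume "?s a = i \<and> ?s b = j"
        then have "a = j" "b = i" by (metis transpose_apply_first transpose_apply_second transpose_involutory)+
        then show False using ab u by simp
      qed
      then show ?thesis using True ab s by (auto simp: h_def e noninv_def)
    next
      case False
      have "a \<noteq> b" using ab by simp
      then have "?s b < ?s a" using False by (metis nat_neq_iff transpose_involutory)
      then consider "a = i" "i < b" "b \<le> j" | "b = j" "i \<le> a" "a < j"
        using ab(2) u(2) by (auto simp: transpose_def split: if_splits)
      then show ?thesis
      proof cases
        case 1
        have "b \<noteq> j" using 1 ab(4) u by auto
        then have "u j < u b" using 1 ab(4) by auto
        then show ?thesis using False 1 \<open>b \<noteq> j\<close> ab u by (auto simp: h_def e noninv_def)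
      next
        case 2
        have "a \<noteq> i" using 2 ab(4) u by auto
        then have "u a < u i" using 2 ab(4) by auto
        then show ?thesis using False 2 \<open>a \<noteq> i\<close> ab u by (auto simp: h_def e noninv_def)
      qed
    qed
  qed
  ultimately have "card (noninv n ?u) \<le> card (noninv n u - {(i, j)})"
    by (intro card_inj_on_le[of h]) auto
  also have "\<dots> < card (noninv n u)"
    using u by (intro card_Diff1_less finite_noninv) (auto simp: noninv_def)
  finally show ?thesis .
qed

context inclusion_perm begin

text \<open>Climbing from \<open>u\<close> to \<open>v\<close> inside X_v by transpositions
  preserves the degree of \<open>psi\<close> and lowers the number of noninversions. The strict
  inequality drives the degree argument in cohomology.\<close>

lemma mu_total_noninv:
  assumes "u permutes {1..n}" "sat u"
  shows "mu_total u = card (noninv n v) \<and> (u \<noteq> v \<longrightarrow> card (noninv n v) < card (noninv n u))"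
  using assms
proof (induction "card (noninv n u)" arbitrary: u rule: less_induct)
  case less
  note u = less.prems
  show ?case
  proof (cases "u = v")
    case True
    then show ?thesis using mu_total_v by simp
  next
    case False
    obtain i j where ij: "1 \<le> i" "i < j" "j \<le> n" "u i < u j" "bruhat_le (u \<circ> transpose i j) v"
      using bruhat_le_swap_up[OF u(1) perm sat_imp_bruhat_le[OF u] False] by blast
    let ?u = "u \<circ> transpose i j"
    have lt: "card (noninv n ?u) < card (noninv n u)" by (rule noninv_swap_less) (use ij in auto)
    have pu: "?u permutes {1..n}" using u ij by (intro permutes_comp_swap) auto
    have su: "sat ?u" by (rule bruhat_le_imp_sat[OF pu ij(5)])
    have IH: "mu_total ?u = card (noninv n v)" "?u \<noteq> v \<longrightarrow> card (noninv n v) < card (noninv n ?u)"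
      using less.hyps[OF lt pu su] by blast+
    have "mu_total ?u = mu_total u" using ij by (intro mu_total_swap u su) auto
    moreover have "card (noninv n v) \<le> card (noninv n ?u)" using IH by (cases "?u = v") auto
    ultimately show ?thesis using IH lt by simp
  qed
qed

section \<open>The candidate at the identity and the boxes of the diagram\<close>

lemma card_diagram: "card (diagram n v) = card (noninv n v)"
proof -
  have "bij_betw (\<lambda>(x, y). (y, vi x)) (diagram n v) (noninv n v)"
  proof (rule bij_betwI[of _ _ _ "\<lambda>(i, j). (v j, i)"])
    show "(\<lambda>(x, y). (y, vi x)) \<in> diagram n v \<rightarrow> noninv n v"
      using diagramD by (auto simp: noninv_def)
    show "(\<lambda>(i, j). (v j, i)) \<in> noninv n v \<rightarrow> diagram n v"
      using v_le_n by (auto simp: noninv_def intro!: diagramI)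
  qed auto
  then show ?thesis by (rule bij_betw_same_card)
qed

lemma finite_diagram [simp]: "finite (diagram n v)"
  by (rule finite_subset[of _ "{1..n} \<times> {1..n}"]) (auto simp: diagram_def)

lemma diagram_rk_0: "(x, y) \<in> diagram n v \<and> rk v x y = 0 \<longleftrightarrow> P x y"
proof
  assume *: "(x, y) \<in> diagram n v \<and> rk v x y = 0"
  then have "{k. 1 \<le> k \<and> k \<le> y \<and> x \<le> v k} = {}" by (simp add: rk_def)
  then show "P x y" using * diagramD[of x y] unfolding P_def by (auto simp: not_le[symmetric])
next
  assume p: "P x y"
  have "y < vi x"
  proof (rule ccontr)
    assume "\<not> y < vi x"
    moreover have "1 \<le> vi x" using P_less[OF p] p vi_range[of x] by (auto simp: P_def)
    ultimately have "v (vi x) < x" using p unfolding P_def by (meson not_less)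
    then show False by simp
  qed
  moreover have "rk v x y = 0" by (rule rk_eq_0) (use p in \<open>auto simp: P_def\<close>)
  ultimately show "(x, y) \<in> diagram n v \<and> rk v x y = 0"
    using p by (auto simp: P_def intro!: diagramI)
qed

lemma diagram_counts:
  assumes xy: "(x, y) \<in> diagram n v"
  shows "card {l. 1 \<le> l \<and> l \<le> y \<and> v l < x} = y - rk v x y" "rk v x y < y"
    "card {l. y < l \<and> l \<le> n \<and> x \<le> v l} = n + 1 - (x + rk v x y)" "x + rk v x y \<le> n"
proof -
  note D = diagramD[OF xy]
  show 1: "card {l. 1 \<le> l \<and> l \<le> y \<and> v l < x} = y - rk v x y"
    using rk_split[of y v x] by simp
  have "y \<in> {l. 1 \<le> l \<and> l \<le> y \<and> v l < x}" using D by simp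
  then have "card {l. 1 \<le> l \<and> l \<le> y \<and> v l < x} > 0" by (subst card_gt_0_iff) auto
  then show "rk v x y < y" using 1 by simp
  have "card {l. 1 \<le> l \<and> l \<le> y \<and> x \<le> v l} + card {l. y < l \<and> l \<le> n \<and> x \<le> v l}
      = card ({l. 1 \<le> l \<and> l \<le> y \<and> x \<le> v l} \<union> {l. y < l \<and> l \<le> n \<and> x \<le> v l})"
    by (rule card_Un_disjoint[symmetric]) auto
  also have "{l. 1 \<le> l \<and> l \<le> y \<and> x \<le> v l} \<union> {l. y < l \<and> l \<le> n \<and> x \<le> v l} = {l. 1 \<le> l \<and> l \<le> n \<and> x \<le> v l}"
    using D by auto
  also have "card {l. 1 \<le> l \<and> l \<le> n \<and> x \<le> v l} = card {x..n}"
  proof -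
    have "card {l. 1 \<le> l \<and> l \<le> n \<and> x \<le> v l} = rk v x n" by (simp add: rk_def)
    also have "\<dots> = card {m. 1 \<le> m \<and> m \<le> n \<and> x \<le> m}" by (rule rk_beyond[OF perm]) simp
    also have "{m. 1 \<le> m \<and> m \<le> n \<and> x \<le> m} = {x..n}" using D by auto
    finally show ?thesis .
  qed
  finally have s: "rk v x y + card {l. y < l \<and> l \<le> n \<and> x \<le> v l} = n + 1 - x" by (simp add: rk_def)
  then show "card {l. y < l \<and> l \<le> n \<and> x \<le> v l} = n + 1 - (x + rk v x y)" by simp
  have "vi x \<in> {l. y < l \<and> l \<le> n \<and> x \<le> v l}" using D by simp
  then have "card {l. y < l \<and> l \<le> n \<and> x \<le> v l} > 0" by (subst card_gt_0_iff) auto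
  then show "x + rk v x y \<le> n" using s by simp
qed

definition Dplus :: "(nat \<times> nat) set" where
  "Dplus = {(x, y). (x, y) \<in> diagram n v \<and> rk v x y > 0}"

definition QR :: "(nat \<times> nat) set" where
  "QR = {(a, b). Q a b \<and> \<not> R1 a b \<and> \<not> R2 a b}"

text \<open>Turns a box of positive rank into the index of an inclusion of E_b in F_{a-1} that no
  chain implies; this is the origin of the indices in the product formula.\<close>

definition shift :: "nat \<times> nat \<Rightarrow> nat \<times> nat" where
  "shift = (\<lambda>(x, y). (x + rk v x y, y - rk v x y))"

text \<open>The inclusion \<open>Q\<close> comes from the essential box of (x, y). Either chain
  would contradict a count of the values below \<open>x\<close> in an initial segment of
  positions.\<close>

lemma shift_in_QR:
  assumes "(x, y) \<in> Dplus"
  shows "shift (x, y) \<in> QR"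
proof -
  let ?r = "rk v x y" let ?a = "x + ?r" and ?b = "y - ?r"
  have xy: "(x, y) \<in> diagram n v" and r: "?r > 0" using assms by (auto simp: Dplus_def)
  note D = diagramD[OF xy] and C = diagram_counts[OF xy]
  obtain p q where pq: "(p, q) \<in> essential_set n v" "p \<le> x" "y \<le> q" "rk v p q = ?r"
    by (rule essential_box[OF xy], rule that, assumption+)
  have r': "rk v p q > 0" unfolding pq(4) by (rule r)
  note e = essential_positive_rank[OF pq(1) r', unfolded pq(4)]
  have p1: "1 \<le> p" using pq(1) by (auto simp: essential_set_def diagram_def)
  have Q: "Q ?a ?b"
    unfolding Q_def
  proof (intro conjI allI impI)
    show "1 \<le> ?b" using C by simp
    show "?a \<le> n" using C by simp
    fix l assume l: "1 \<le> l" "v l \<le> ?b"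
    then have "v l < p" using e(1) pq(3) p1 C(2) by linarith
    then have "l \<le> q" using e(2) l by simp
    then show "l < ?a" using e(1) pq(2,3) p1 C(2) by linarith
  qed
  have card_low: "card {l. 1 \<le> l \<and> l \<le> y \<and> v l < x} = ?b" by (rule C(1))
  have "\<not> R1 ?a ?b"
  proof
    assume "R1 ?a ?b"
    then obtain q' where q': "\<And>l. 1 \<le> l \<Longrightarrow> v l \<le> ?b \<Longrightarrow> l \<le> q'" "\<And>l. 1 \<le> l \<Longrightarrow> l \<le> q' \<Longrightarrow> v l < ?a"
      unfolding R1_def by blast
    have "\<exists>l. 1 \<le> l \<and> l \<le> y \<and> ?a \<le> v l"
    proof (rule ccontr)
      assume no: "\<not> (\<exists>l. 1 \<le> l \<and> l \<le> y \<and> ?a \<le> v l)"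
      have "v ` {l. 1 \<le> l \<and> l \<le> y \<and> x \<le> v l} \<subseteq> {x + 1..?a - 1}"
      proof (rule image_subsetI)
        fix l assume l: "l \<in> {l. 1 \<le> l \<and> l \<le> y \<and> x \<le> v l}"
        then have "v l \<noteq> x" using D(6) by auto
        then have "x < v l" using l by auto
        moreover have "\<not> ?a \<le> v l" using no l by blast
        ultimately show "v l \<in> {x + 1..?a - 1}" by auto
      qed
      then have "card (v ` {l. 1 \<le> l \<and> l \<le> y \<and> x \<le> v l}) \<le> card {x + 1..?a - 1}" by (intro card_mono) auto
      moreover have "card (v ` {l. 1 \<le> l \<and> l \<le> y \<and> x \<le> v l}) = ?r"
        unfolding rk_def by (rule card_image[OF permutes_inj_on[OF perm]])
      ultimately show False using r by simp
    qed
    then obtain l0 where l0: "1 \<le> l0" "l0 \<le> y" "?a \<le> v l0" by blast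
    have "q' < y"
    proof (rule ccontr)
      assume "\<not> q' < y"
      then have "l0 \<le> q'" using l0(2) by linarith
      then show False using q'(2)[OF l0(1)] l0(3) by linarith
    qed
    have sub: "vi ` {1..?b} \<subseteq> {l. 1 \<le> l \<and> l \<le> y \<and> v l < x}"
    proof (rule image_subsetI)
      fix c assume c: "c \<in> {1..?b}"
      have "?b < x"
      proof -
        have "v ` {l. 1 \<le> l \<and> l \<le> y \<and> v l < x} \<subseteq> {1..x - 1}"
        proof (rule image_subsetI)
          fix l assume "l \<in> {l. 1 \<le> l \<and> l \<le> y \<and> v l < x}"
          then show "v l \<in> {1..x - 1}" using v_ge_1[of l] by auto
        qed
        then have "card (v ` {l. 1 \<le> l \<and> l \<le> y \<and> v l < x}) \<le> card {1..x - 1}" by (intro card_mono) auto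
        moreover have "card (v ` {l. 1 \<le> l \<and> l \<le> y \<and> v l < x}) = ?b"
          unfolding card_low[symmetric] by (rule card_image[OF permutes_inj_on[OF perm]])
        ultimately show ?thesis using D by simp
      qed
      moreover have "1 \<le> vi c" using vi_range[of c] c C D by auto
      ultimately show "vi c \<in> {l. 1 \<le> l \<and> l \<le> y \<and> v l < x}"
        using q'(1)[of "vi c"] c \<open>q' < y\<close> by auto
    qed
    moreover have "card (vi ` {1..?b}) = ?b"
      by (subst card_image) (auto intro!: inj_on_inverseI[of _ v])
    ultimately have "vi ` {1..?b} = {l. 1 \<le> l \<and> l \<le> y \<and> v l < x}"
      using card_low by (intro card_subset_eq) auto
    then have "y \<in> vi ` {1..?b}" using D by auto
    then have "v y \<le> ?b" by auto
    then show False using q'(1)[of y] D \<open>q' < y\<close> by simp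
  qed
  moreover have "\<not> R2 ?a ?b"
  proof
    assume "R2 ?a ?b"
    then obtain p' where p': "\<And>l. 1 \<le> l \<Longrightarrow> l \<le> ?b \<Longrightarrow> v l \<le> p'" "\<And>l. 1 \<le> l \<Longrightarrow> v l \<le> p' \<Longrightarrow> l < ?a"
      unfolding R2_def by blast
    have "\<exists>l. 1 \<le> l \<and> l \<le> ?b \<and> x \<le> v l"
    proof (rule ccontr)
      assume no: "\<not> (\<exists>l. 1 \<le> l \<and> l \<le> ?b \<and> x \<le> v l)"
      have "l \<in> {l. 1 \<le> l \<and> l \<le> y \<and> v l < x}" if l: "l \<in> {1..?b}" for l
      proof -
        have "\<not> x \<le> v l" using no l by simp
        moreover have "1 \<le> l" "l \<le> y" using l by (simp, simp, linarith)
        ultimately show ?thesis by simp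
      qed
      then have "insert y {1..?b} \<subseteq> {l. 1 \<le> l \<and> l \<le> y \<and> v l < x}"
        using D by blast
      then have "card (insert y {1..?b}) \<le> ?b" unfolding card_low[symmetric] by (intro card_mono) auto
      then show False using r C(2) by simp
    qed
    then obtain l0 where l0: "1 \<le> l0" "l0 \<le> ?b" "x \<le> v l0" by blast
    have xp: "x \<le> p'" using p'(1)[OF l0(1,2)] l0(3) by linarith
    have low: "l < ?a" if "v l < x" "1 \<le> l" for l
    proof -
      have "v l \<le> p'" using xp that by linarith
      then show ?thesis by (rule p'(2)[OF that(2)])
    qed
    have "card {k. 1 \<le> k \<and> k \<le> ?a - 1 \<and> v k < x} = x - 1"
    proof -
      have "v ` {k. 1 \<le> k \<and> k \<le> ?a - 1 \<and> v k < x} = {1..x - 1}"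
      proof (rule equalityI; rule subsetI)
        fix c assume "c \<in> v ` {k. 1 \<le> k \<and> k \<le> ?a - 1 \<and> v k < x}"
        then obtain k where "c = v k" "1 \<le> k" "v k < x" by blast
        then show "c \<in> {1..x - 1}" using v_ge_1[of k] by auto
      next
        fix c assume c: "c \<in> {1..x - 1}"
        have "1 \<le> vi c" using vi_range[of c] c D by auto
        then have "vi c \<in> {k. 1 \<le> k \<and> k \<le> ?a - 1 \<and> v k < x}" using low[of "vi c"] c
          by (simp, linarith)
        then have "v (vi c) \<in> v ` {k. 1 \<le> k \<and> k \<le> ?a - 1 \<and> v k < x}" by (rule imageI)
        then show "c \<in> v ` {k. 1 \<le> k \<and> k \<le> ?a - 1 \<and> v k < x}" by simp
      qed
      then have "card (v ` {k. 1 \<le> k \<and> k \<le> ?a - 1 \<and> v k < x}) = x - 1" by simp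
      then show ?thesis by (subst (asm) card_image[OF permutes_inj_on[OF perm]])
    qed
    then have ra: "rk v x (?a - 1) = ?r" using rk_split[of "?a - 1" v x] D by linarith
    have "?b \<le> x - 1"
    proof -
      have "card {l. 1 \<le> l \<and> l \<le> y \<and> v l < x} \<le> x - 1"
        by (rule card_small_values[OF perm]) (use D in simp)
      then show ?thesis using card_low by simp
    qed
    then have ya: "y \<le> ?a - 1" using r C(2) D by linarith
    have "vi x < ?a" using p'(2)[of "vi x"] xp D by simp
    have "insert (vi x) {k. 1 \<le> k \<and> k \<le> y \<and> x \<le> v k} \<subseteq> {k. 1 \<le> k \<and> k \<le> ?a - 1 \<and> x \<le> v k}"
      using ya \<open>vi x < ?a\<close> D by auto
    then have "card (insert (vi x) {k. 1 \<le> k \<and> k \<le> y \<and> x \<le> v k}) \<le> rk v x (?a - 1)"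
      unfolding rk_def[of v x "?a - 1"] by (intro card_mono) auto
    then have "card (insert (vi x) {k. 1 \<le> k \<and> k \<le> y \<and> x \<le> v k}) \<le> ?r" unfolding ra .
    moreover have "vi x \<notin> {k. 1 \<le> k \<and> k \<le> y \<and> x \<le> v k}" using D by auto
    ultimately show False by (simp add: rk_def)
  qed
  ultimately show ?thesis using Q by (simp add: QR_def shift_def)
qed

text \<open>Boxes with the same image lie on one antidiagonal. If their ranks differ, comparing the
  counts of \<open>diagram_counts\<close> produces the positions of a forbidden
  configuration.\<close>

lemma shift_inj_aux:
  assumes "(x, y) \<in> Dplus" "(x', y') \<in> Dplus" "shift (x, y) = shift (x', y')"
  shows "\<not> rk v x y < rk v x' y'"
proof
  assume lt: "rk v x y < rk v x' y'"
  let ?r = "rk v x y" and ?r' = "rk v x' y'"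
  have xy: "(x, y) \<in> diagram n v" "?r > 0" and xy': "(x', y') \<in> diagram n v" "?r' > 0"
    using assms by (auto simp: Dplus_def)
  note D = diagramD[OF xy(1)] and D' = diagramD[OF xy'(1)]
  note C = diagram_counts[OF xy(1)] and C' = diagram_counts[OF xy'(1)]
  have e: "x + ?r = x' + ?r'" "y - ?r = y' - ?r'" using assms(3) by (auto simp: shift_def)
  have xx: "x' < x" "y < y'" using e lt C(2) C'(2) by linarith+
  have "{l. 1 \<le> l \<and> l \<le> y \<and> x \<le> v l} \<noteq> {}" using xy(2) by (auto simp: rk_def card_gt_0_iff)
  then obtain l where l: "1 \<le> l" "l \<le> y" "x \<le> v l" by blast
  have "\<exists>i. 1 \<le> i \<and> i \<le> y \<and> x' \<le> v i \<and> v i < x"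
  proof (rule ccontr)
    assume no: "\<not> (\<exists>i. 1 \<le> i \<and> i \<le> y \<and> x' \<le> v i \<and> v i < x)"
    have "insert y' {l. 1 \<le> l \<and> l \<le> y \<and> v l < x} \<subseteq> {l. 1 \<le> l \<and> l \<le> y' \<and> v l < x'}"
      using no xx D' by (auto simp: not_le[symmetric])
    then have "card (insert y' {l. 1 \<le> l \<and> l \<le> y \<and> v l < x}) \<le> card {l. 1 \<le> l \<and> l \<le> y' \<and> v l < x'}"
      by (intro card_mono) auto
    then show False using xx C(1) C'(1) e by simp
  qed
  then obtain i where i: "1 \<le> i" "i \<le> y" "x' \<le> v i" "v i < x" by blast
  have "\<exists>d. y < d \<and> d \<le> y' \<and> x \<le> v d"
  proof (rule ccontr)
    assume no: "\<not> (\<exists>d. y < d \<and> d \<le> y' \<and> x \<le> v d)"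
    have "insert (vi x') {l. y < l \<and> l \<le> n \<and> x \<le> v l} \<subseteq> {l. y' < l \<and> l \<le> n \<and> x' \<le> v l}"
      using no xx D' by (auto simp: not_le[symmetric])
    then have "card (insert (vi x') {l. y < l \<and> l \<le> n \<and> x \<le> v l}) \<le> card {l. y' < l \<and> l \<le> n \<and> x' \<le> v l}"
      by (intro card_mono) auto
    moreover have "vi x' \<notin> {l. y < l \<and> l \<le> n \<and> x \<le> v l}" using xx by auto
    ultimately show False using C(3) C'(3) e by simp
  qed
  then obtain d where d: "y < d" "d \<le> y'" "x \<le> v d" by blast
  have "v i \<noteq> x'" using i D' xx by auto
  then have "x' < v i" using i by simp
  then show False
    using forbidden_configuration[OF xy(1) l i(1,2,4) d(1,3), of "vi x'"] d D' by simp
qed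

lemma inj_on_shift: "inj_on shift Dplus"
proof (rule inj_onI)
  fix p q assume *: "p \<in> Dplus" "q \<in> Dplus" "shift p = shift q"
  obtain x y x' y' where e: "p = (x, y)" "q = (x', y')" by (metis surj_pair)
  have "rk v x y = rk v x' y'"
    using shift_inj_aux[of x y x' y'] shift_inj_aux[of x' y' x y] * e by (metis linorder_neqE_nat)
  then show "p = q" using * e diagram_counts(2)[of x y] diagram_counts(2)[of x' y']
    by (auto simp: shift_def Dplus_def)
qed

definition P_set :: "(nat \<times> nat) set" where "P_set = {(a, b). P a b}"

lemma P_QR_subset: "P_set \<subseteq> {1..n} \<times> {1..n}" "QR \<subseteq> {1..n} \<times> {1..n}"
proof -
  have "1 \<le> b \<and> b < a \<and> a \<le> n" if "P a b" for a b
    using P_less[OF that] that by (simp add: P_def)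
  then show "P_set \<subseteq> {1..n} \<times> {1..n}" by (fastforce simp: P_set_def)
  have "1 \<le> b \<and> b < a \<and> a \<le> n" if "Q a b" for a b
    using Q_less[OF that] that by (simp add: Q_def)
  then show "QR \<subseteq> {1..n} \<times> {1..n}" by (fastforce simp: QR_def)
qed

lemma finite_P_QR: "finite P_set" "finite QR"
proof -
  show "finite P_set" by (rule finite_subset[OF P_QR_subset(1)]) simp
  show "finite QR" by (rule finite_subset[OF P_QR_subset(2)]) simp
qed

lemma mu_id: "mu id i j = of_bool ((j, i) \<in> P_set) + of_bool ((j, i) \<in> QR)"
  using R1_imp[of j i] R2_imp[of j i] by (auto simp: mu_def P_set_def QR_def)

lemma diagram_split: "diagram n v = P_set \<union> Dplus" "P_set \<inter> Dplus = {}"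
  using diagram_rk_0 by (force simp: P_set_def Dplus_def)+

lemma sum_of_bool_pairs:
  assumes "A \<subseteq> {1..n} \<times> {1..n::nat}"
  shows "(\<Sum>i\<in>{1..n}. \<Sum>j\<in>{1..n}. of_bool ((j, i) \<in> A)) = card A"
proof -
  have "(\<Sum>i\<in>{1..n}. \<Sum>j\<in>{1..n}. of_bool ((j, i) \<in> A)) = (\<Sum>j\<in>{1..n}. \<Sum>i\<in>{1..n}. of_bool ((j, i) \<in> A) :: nat)"
    by (rule sum.swap)
  also have "\<dots> = (\<Sum>p\<in>{1..n} \<times> {1..n}. of_bool (p \<in> A))"
    by (simp only: sum.cartesian_product case_prod_unfold prod.collapse)
  also have "\<dots> = (\<Sum>p\<in>{1..n} \<times> {1..n}. if p \<in> A then 1 else 0)"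
    by (simp only: of_bool_def)
  also have "\<dots> = card ({1..n} \<times> {1..n} \<inter> A)"
    by (simp flip: sum.inter_restrict)
  also have "{1..n} \<times> {1..n} \<inter> A = A" using assms by auto
  finally show ?thesis .
qed

text \<open>Surjectivity comes from counting: the factors of \<open>psi\<close> at the identity and
  the boxes of the diagram are both as many as the noninversions of \<open>v\<close>.\<close>

lemma QR_eq_shift: "QR = shift ` Dplus"
proof -
  note P = P_QR_subset(1) and QR = P_QR_subset(2)
  have "mu_total id = card (noninv n v)" using mu_total_noninv[OF permutes_id sat_id] by simp
  moreover have "mu_total id = card P_set + card QR"
  proof -
    have "mu_total id = (\<Sum>i\<in>{1..n}. \<Sum>j\<in>{1..n}. of_bool ((j, i) \<in> P_set) + of_bool ((j, i) \<in> QR))"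
      unfolding mu_total_def by (intro sum.cong refl mu_id)
    then show ?thesis
      unfolding sum.distrib sum_of_bool_pairs[OF P] sum_of_bool_pairs[OF QR] .
  qed
  moreover have fD: "finite Dplus" by (rule finite_subset[OF _ finite_diagram]) (auto simp: Dplus_def)
  moreover have "card (diagram n v) = card P_set + card Dplus"
    unfolding diagram_split(1) by (rule card_Un_disjoint) (use fD finite_P_QR diagram_split(2) in auto)
  ultimately have "card QR = card (shift ` Dplus)"
    using card_diagram card_image[OF inj_on_shift] by simp
  moreover have "shift ` Dplus \<subseteq> QR" using shift_in_QR by auto
  ultimately show ?thesis using finite_P_QR(2) by (metis card_subset_eq)
qed

text \<open>Kept separate from \<open>psi_id\<close>, since these weights are the degrees of the
  generators of the inclusion ideal.\<close>

lemma psi_id_PQ: "psi k id = (\<Prod>(a, b)\<in>P_set. wt k b a) * (\<Prod>(a, b)\<in>QR. wt k b a)"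
proof -
  note P = P_QR_subset(1) and QR = P_QR_subset(2)
  have pairs: "(\<Prod>i\<in>{1..n}. \<Prod>j\<in>{1..n}. wt k i j ^ of_bool ((j, i) \<in> A)) = (\<Prod>(a, b)\<in>A. wt k b a)"
    if "A \<subseteq> {1..n} \<times> {1..n}" for A :: "(nat \<times> nat) set"
  proof -
    have "(\<Prod>i\<in>{1..n}. \<Prod>j\<in>{1..n}. wt k i j ^ of_bool ((j, i) \<in> A))
        = (\<Prod>j\<in>{1..n}. \<Prod>i\<in>{1..n}. wt k i j ^ of_bool ((j, i) \<in> A))"
      by (rule prod.swap)
    also have "\<dots> = (\<Prod>p\<in>{1..n} \<times> {1..n}. wt k (snd p) (fst p) ^ of_bool (p \<in> A))"
      by (simp add: prod.cartesian_product case_prod_unfold)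
    also have "\<dots> = (\<Prod>p\<in>{1..n} \<times> {1..n}. if p \<in> A then wt k (snd p) (fst p) else 1)"
      by (rule prod.cong) auto
    also have "\<dots> = (\<Prod>p\<in>{1..n} \<times> {1..n} \<inter> A. wt k (snd p) (fst p))"
      by (simp add: prod.inter_restrict)
    also have "{1..n} \<times> {1..n} \<inter> A = A" using that by auto
    finally show ?thesis by (simp add: case_prod_unfold)
  qed
  have "psi k id = (\<Prod>i\<in>{1..n}. \<Prod>j\<in>{1..n}. wt k i j ^ mu id i j)"
    using sat_id by (simp only: psi_def if_True id_apply)
  also have "\<dots> = (\<Prod>(a, b)\<in>P_set. wt k b a) * (\<Prod>(a, b)\<in>QR. wt k b a)"
    unfolding mu_id by (simp only: power_add prod.distrib pairs[OF P] pairs[OF QR])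
  finally show ?thesis .
qed

lemma psi_id: "psi k id = (\<Prod>(x, y) \<in> diagram n v. wt k (y - rk v x y) (x + rk v x y))"
proof -
  note psi_id_PQ
  also have "(\<Prod>(a, b)\<in>QR. wt k b a) = (\<Prod>(x, y)\<in>Dplus. wt k (y - rk v x y) (x + rk v x y))"
    unfolding QR_eq_shift by (subst prod.reindex[OF inj_on_shift]) (simp add: shift_def case_prod_unfold)
  also have "(\<Prod>(a, b)\<in>P_set. wt k b a) = (\<Prod>(x, y)\<in>P_set. wt k (y - rk v x y) (x + rk v x y))"
  proof (rule prod.cong[OF refl])
    fix p assume "p \<in> P_set"
    then have "rk v (fst p) (snd p) = 0"
      using diagram_rk_0[of "fst p" "snd p"] by (simp add: P_set_def case_prod_unfold)
    then show "(case p of (a, b) \<Rightarrow> wt k b a) = (case p of (x, y) \<Rightarrow> wt k (y - rk v x y) (x + rk v x y))"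
      by (simp add: case_prod_unfold)
  qed
  also have "\<dots> * (\<Prod>(x, y)\<in>Dplus. wt k (y - rk v x y) (x + rk v x y))
      = (\<Prod>(x, y)\<in>P_set \<union> Dplus. wt k (y - rk v x y) (x + rk v x y))"
    using finite_P_QR diagram_split
    by (intro prod.union_disjoint[symmetric]) (auto intro: finite_subset[OF _ finite_diagram])
  finally show ?thesis unfolding diagram_split(1)[symmetric] .
qed

end

section \<open>Uniqueness of the localizations\<close>

text \<open>An additive functional on exponents. Upper bounds for it act as degree bounds: they add
  up in products and, by \<open>le_cancel\<close>, can be divided out.\<close>

locale weight =
  fixes \<delta> :: "(nat \<Rightarrow>\<^sub>0 int) \<Rightarrow> int"
  assumes add: "\<delta> (a + b) = \<delta> a + \<delta> b"
begin

definition le :: "int \<Rightarrow> nat laurent \<Rightarrow> bool" where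
  "le h f \<longleftrightarrow> (\<forall>m\<in>keys f. \<delta> m \<le> h)"

lemma zero: "\<delta> 0 = 0"
  using add[of 0 0] by simp

lemma diff: "\<delta> (a - b) = \<delta> a - \<delta> b"
  using add[of "a - b" b] by simp

lemma le_zero: "le h 0"
  by (simp add: le_def)

lemma le_one: "0 \<le> h \<Longrightarrow> le h 1"
  by (simp add: le_def zero)

lemma le_mono: "le h f \<Longrightarrow> h \<le> h' \<Longrightarrow> le h' f"
  by (force simp: le_def)

lemma le_diff: "le h f \<Longrightarrow> le h g \<Longrightarrow> le h (f - g)"
  unfolding le_def using keys_diff[of f g] by blast

lemma le_mult:
  assumes "le a f" "le b g" shows "le (a + b) (f * g)"
  unfolding le_def
proof
  fix m assume "m \<in> keys (f * g)"
  then obtain x y where "x \<in> keys f" "y \<in> keys g" "m = x + y"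
    by (rule keys_mult_ex)
  then show "\<delta> m \<le> a + b" using assms unfolding le_def by (simp add: add add_mono)
qed

lemma le_prod: "(\<And>i. i \<in> A \<Longrightarrow> le (t i) (f i)) \<Longrightarrow> le (\<Sum>i\<in>A. t i) (\<Prod>i\<in>A. f i)"
  by (induction A rule: infinite_finite_induct) (auto intro: le_mult le_one)

lemma le_power: "le t f \<Longrightarrow> le (int k * t) (f ^ k)"
  by (induction k) (auto intro: le_one dest: le_mult[of t f] simp: algebra_simps)

lemma le_cancel:
  assumes "le h (f * g)" "le a f" "\<exists>m\<in>keys f. \<delta> m = a"
  shows "le (h - a) g"
proof -
  obtain m0 where m0: "m0 \<in> keys f" "\<delta> m0 = a" using assms(3) by blast
  show ?thesis
    unfolding le_def
  proof
    fix m assume "m \<in> keys g"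
    then show "\<delta> m \<le> h - a"
      using max_weight_mult[OF add, of f g h a m0 m] assms(1,2) m0 unfolding le_def by blast
  qed
qed

lemma le_cancel_prod:
  assumes "finite A" "\<And>i. i \<in> A \<Longrightarrow> le (t i) (f i) \<and> (\<exists>m\<in>keys (f i). \<delta> m = t i)"
    and "le h ((\<Prod>i\<in>A. f i) * g)"
  shows "le (h - (\<Sum>i\<in>A. t i)) g"
  using assms
proof (induction A arbitrary: h)
  case (insert i A)
  have "le h (f i * ((\<Prod>i\<in>A. f i) * g))" using insert by (simp add: mult.assoc)
  then have "le (h - t i) ((\<Prod>i\<in>A. f i) * g)" using insert.prems(1)[of i] by (intro le_cancel[of _ "f i"]) auto
  then have "le (h - t i - (\<Sum>i\<in>A. t i)) g" using insert by blast
  then show ?case using insert by (simp add: algebra_simps)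
qed simp

text \<open>The largest value of the functional on the two terms of a weight with distinct
  indices.\<close>

definition top :: "bool \<Rightarrow> nat \<Rightarrow> nat \<Rightarrow> int" where
  "top k a b = (let x = \<delta> (single a 1); y = \<delta> (single b 1)
     in if k then max 0 (x - y) else max x y)"

lemma keys_wt:
  assumes "a \<noteq> b"
  shows "keys (wt k a b) = (if k then {0, single a 1 - single b 1}
     else {single a 1, single b 1})"
proof -
  have "lookup (single a (1::int)) a \<noteq> lookup (single b 1) a"
    using assms by (simp add: lookup_single)
  then have "single a (1::int) \<noteq> single b 1" by metis
  then have "single a (1::int) \<noteq> single b 1"
    "0 \<noteq> single a (1::int) - single b 1" by auto
  then show ?thesis
    unfolding wt_def lvar_times_lvar_inv unfolding lvar_def
    by (cases k) (auto simp: in_keys_iff lookup_minus lookup_single lookup_one when_def split: if_splits)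
qed

lemma le_wt:
  assumes "a \<noteq> b"
  shows "le (top k a b) (wt k a b)" "\<exists>m\<in>keys (wt k a b). \<delta> m = top k a b"
  unfolding le_def keys_wt[OF assms] top_def Let_def by (cases k; auto simp: zero diff max_def)+

lemma le_cf: "le (if k then \<delta> (single a 1) - \<delta> (single b 1) else 0) (cf k a b)"
  unfolding le_def cf_def lvar_times_lvar_inv by (cases k) (simp_all add: diff zero)

end

text \<open>The weights are pairwise coprime: identifying the variables of one of them leaves the
  others nonzero, so the identification kills the quotient by the others, and this weight divides
  that quotient.\<close>

lemma prod_wt_dvd:
  fixes f :: "nat laurent"
  assumes "finite A" "\<And>p. p \<in> A \<Longrightarrow> fst p < snd p \<and> lrename (id(snd p := fst p)) f = 0"
  shows "(\<Prod>p\<in>A. wt k (fst p) (snd p)) dvd f"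
  using assms
proof (induction A)
  case (insert q A)
  obtain a b where q: "q = (a, b)" by (cases q)
  obtain g where g: "f = (\<Prod>p\<in>A. wt k (fst p) (snd p)) * g" using insert by blast
  let ?r = "lrename (id(b := a))"
  have ab: "a < b" "?r f = 0" using insert.prems[OF insertI1] unfolding q fst_conv snd_conv by blast+
  have "(\<Prod>p\<in>A. wt k ((id(b := a)) (fst p)) ((id(b := a)) (snd p))) * ?r g = 0"
    using ab(2) unfolding g lrename_mult lrename_prod lrename_wt .
  moreover have "(\<Prod>p\<in>A. wt k ((id(b := a)) (fst p)) ((id(b := a)) (snd p))) \<noteq> 0"
  proof -
    have "(id(b := a)) (fst p) \<noteq> (id(b := a)) (snd p)" if "p \<in> A" for p
      using insert.prems[of p] insert.hyps(2) that ab(1) by (cases p) (auto simp: q)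
    then show ?thesis using insert.hyps(1) by (simp del: fun_upd_apply)
  qed
  ultimately have "?r g = 0" by (simp only: mult_eq_0_iff simp_thms)
  then have "wt k a b dvd g" by (rule wt_dvd_of_identify)
  then show ?case unfolding g prod.insert[OF insert.hyps]
    by (simp add: q mult.commute mult_dvd_mono)
qed simp

text \<open>The degree in t_1, ..., t_c of the product of the K-theoretic weights of all
  noninversions of \<open>w\<close>.\<close>

definition crossings :: "nat \<Rightarrow> nat \<Rightarrow> (nat \<Rightarrow> nat) \<Rightarrow> nat" where
  "crossings n c w = (\<Sum>p\<in>noninv n w. of_bool (w (fst p) \<le> c \<and> c < w (snd p)))"

text \<open>The gain of one in the degree bound at \<open>w\<close>, available for every
  \<open>c\<close> that tells \<open>w\<close> from \<open>v\<close>.\<close>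

definition separated :: "nat \<Rightarrow> (nat \<Rightarrow> nat) \<Rightarrow> (nat \<Rightarrow> nat) \<Rightarrow> nat" where
  "separated c v w = of_bool (\<exists>k. (v k \<le> c) \<noteq> (w k \<le> c))"

lemma crossings_swap:
  assumes "ascent n w i"
  shows "crossings n c w = of_bool (w i \<le> c \<and> c < w (i + 1)) + crossings n c (w \<circ> transpose i (i + 1))"
proof -
  have "(2::nat) ^ crossings n c w = (\<Prod>(a, b)\<in>noninv n w. 2 ^ of_bool (w a \<le> c \<and> c < w b))"
    unfolding crossings_def power_sum by (simp add: case_prod_unfold)
  also have "\<dots> = 2 ^ of_bool (w i \<le> c \<and> c < w (i + 1)) * (\<Prod>(a, b) \<in> noninv n (w \<circ> transpose i (i + 1)).
        2 ^ of_bool ((w \<circ> transpose i (i + 1)) a \<le> c \<and> c < (w \<circ> transpose i (i + 1)) b))"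
    by (rule prod_noninv_swap[OF assms])
  also have "\<dots> = 2 ^ (of_bool (w i \<le> c \<and> c < w (i + 1)) + crossings n c (w \<circ> transpose i (i + 1)))"
    unfolding crossings_def power_add power_sum by (simp add: case_prod_unfold)
  finally show ?thesis by simp
qed

text \<open>If \<open>c\<close> does not separate \<open>v\<close> from \<open>w\<close>, then an
  ascent of \<open>v\<close> at a descent of \<open>w\<close> forces the values at \<open>i\<close>
  and \<open>i + 1\<close> onto the same side of \<open>c\<close>, where the exchange has no
  effect.\<close>

lemma separated_swap:
  assumes "v i < v (i + 1)" "w (i + 1) < w i"
  shows "separated c (v \<circ> transpose i (i + 1)) w \<le> separated c v (w \<circ> transpose i (i + 1))"
    "separated c (v \<circ> transpose i (i + 1)) w \<le> separated c v w"
proof -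
  let ?s = "transpose i (i + 1)"
  have "(\<exists>k. (v k \<le> c) \<noteq> (w (?s k) \<le> c))" if "(v (?s k) \<le> c) \<noteq> (w k \<le> c)" for k
    using that by (intro exI[of _ "?s k"]) simp
  then show "separated c (v \<circ> ?s) w \<le> separated c v (w \<circ> ?s)"
    unfolding separated_def of_bool_less_eq_iff comp_apply by blast
  have "(\<exists>k. (v k \<le> c) \<noteq> (w k \<le> c))" if k: "(v (?s k) \<le> c) \<noteq> (w k \<le> c)" for k
  proof (rule ccontr)
    assume "\<not> (\<exists>k. (v k \<le> c) \<noteq> (w k \<le> c))"
    then have eq: "(v k \<le> c) = (w k \<le> c)" for k by blast
    consider "k = i" | "k = i + 1" | "k \<noteq> i" "k \<noteq> i + 1" by blast
    then show False
      using k eq[of k] eq[of i] eq[of "i + 1"] assms by cases auto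
  qed
  then show "separated c (v \<circ> ?s) w \<le> separated c v w"
    unfolding separated_def of_bool_less_eq_iff comp_apply by blast
qed

lemma separated_swap_same:
  assumes "(w i \<le> c) = (w j \<le> c)"
  shows "separated c v (w \<circ> transpose i j) = separated c v w"
proof -
  have "(w (transpose i j k) \<le> c) = (w k \<le> c)" for k
    using assms by (cases "k = i"; cases "k = j") auto
  then show ?thesis by (simp add: separated_def)
qed

text \<open>An estimate of \<open>loc k n v w\<close> in terms of \<open>crossings\<close> and \<open>separated\<close> only has to be
  propagated along \<open>loc_step\<close> when \<open>w\<close> has a descent, as \<open>loc_swap\<close> yields the other case.\<close>

lemma crossing_induct [consumes 2, case_names id step]:
  fixes B :: "nat \<Rightarrow> nat \<Rightarrow> nat laurent \<Rightarrow> bool"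
  assumes v: "v permutes {1..n}" and w: "w permutes {1..n}"
    and zero: "\<And>d e. B d e 0"
    and id: "\<And>e. B (crossings n c id) 0 (loc k n id id)"
    and mono: "\<And>d e d' e' f. B d e f \<Longrightarrow> d + e' \<le> d' + e \<Longrightarrow> B d' e' f"
    and step: "\<And>a b d e f g h. a \<in> {1..n} \<Longrightarrow> b \<in> {1..n} \<Longrightarrow> b < a \<Longrightarrow>
       wt k a b * h = f - cf k a b * g \<Longrightarrow> B d e f \<Longrightarrow>
       B (d + of_bool (b \<le> c \<and> c < a)) e g \<Longrightarrow> B d e h"
  shows "B (crossings n c w) (separated c v w) (loc k n v w)"
  using v w
proof (induction v arbitrary: w rule: permutes_ascent_induct)
  case id
  show ?case
  proof (cases "w = id")
    case True
    have "separated c id id = 0" by (simp add: separated_def)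
    then show ?thesis unfolding True by (simp only: assms(4))
  next
    case False
    have nle: "\<not> bruhat_le w id"
    proof
      assume le: "bruhat_le w id"
      have "w i \<le> i" for i
      proof (rule ccontr)
        assume "\<not> w i \<le> i"
        then have "1 \<le> i" using perm_range(2)[OF id.prems, of i] by (cases i) auto
        then have "i \<in> {k. 1 \<le> k \<and> k \<le> i \<and> i + 1 \<le> w k}" using \<open>\<not> w i \<le> i\<close> by auto
        then have "0 < rk w (i + 1) i" unfolding rk_def by (subst card_gt_0_iff) auto
        moreover have "rk id (i + 1) i = 0" by (rule rk_eq_0) simp
        ultimately show False using le unfolding bruhat_le_def by (metis not_less)
      qed
      moreover have "w i = i" if "\<And>j. w j \<le> j" for i
      proof (induction i rule: less_induct)
        case (less i)
        show ?case
        proof (rule ccontr)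
          assume "w i \<noteq> i"
          then have "w i < i" using that[of i] by simp
          then have "w (w i) = w i" using less by blast
          then show False using perm_range(3)[OF id.prems, of "w i" i] \<open>w i \<noteq> i\<close> by simp
        qed
      qed
      ultimately show False using False by (auto simp: fun_eq_iff)
    qed
    show ?thesis unfolding loc_support[OF permutes_id id.prems nle] by (rule zero)
  qed
next
  case (step v i)
  let ?s = "transpose i (i + 1)"
  note a = step.hyps(2)
  have b: "i \<in> {1..n}" "i + 1 \<in> {1..n}" using ascent_bounds[OF a] by auto
  have va: "v i < v (i + 1)" using a by (simp add: ascent_def)
  have desc: "B (crossings n c w) (separated c (v \<circ> ?s) w) (loc k n (v \<circ> ?s) w)"
    if w: "w permutes {1..n}" "w (i + 1) < w i" for w
  proof -
    have ws: "w \<circ> ?s permutes {1..n}" by (rule permutes_comp_swap[OF w(1) b])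
    have "ascent n (w \<circ> ?s) i" using w b by (auto simp: ascent_def)
    from crossings_swap[OF this, of c]
    have cr: "crossings n c (w \<circ> ?s) = crossings n c w + of_bool (w (i + 1) \<le> c \<and> c < w i)"
      by (simp add: comp_assoc)
    show ?thesis
    proof (rule assms(6)[OF _ _ w(2) loc_step[OF step.hyps(1) a]])
      show "w i \<in> {1..n}" "w (i + 1) \<in> {1..n}" using perm_range(1)[OF w(1)] b by blast+
      show "B (crossings n c w) (separated c (v \<circ> ?s) w) (loc k n v w)"
        using separated_swap(2)[OF va w(2)] by (intro mono[OF step.IH[OF w(1)]]) simp
      show "B (crossings n c w + of_bool (w (i + 1) \<le> c \<and> c < w i)) (separated c (v \<circ> ?s) w) (loc k n v (w \<circ> ?s))"
        unfolding cr[symmetric] using separated_swap(1)[OF va w(2), of c]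
        by (intro mono[OF step.IH[OF ws]] add_left_mono)
    qed
  qed
  show ?case
  proof (cases "w (i + 1) < w i")
    case True
    then show ?thesis by (rule desc[OF step.prems])
  next
    case False
    have "w i \<noteq> w (i + 1)" using perm_range(3)[OF step.prems, of i "i + 1"] by simp
    then have lt: "w i < w (i + 1)" using False by simp
    have ws: "w \<circ> ?s permutes {1..n}" by (rule permutes_comp_swap[OF step.prems b])
    have "ascent n w i" using lt b by (auto simp: ascent_def)
    note cr = crossings_swap[OF this, of c]
    \<comment> \<open>The bound is transferred from the other permutation of the pair; a separation
      that is absent there is paid for by the additional crossing of \<open>w\<close>.\<close>
    have "crossings n c (w \<circ> ?s) + separated c (v \<circ> ?s) w \<le> crossings n c w + separated c (v \<circ> ?s) (w \<circ> ?s)"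
    proof (cases "w i \<le> c \<and> c < w (i + 1)")
      case True
      have "separated c (v \<circ> ?s) w \<le> 1" unfolding separated_def by simp
      then show ?thesis unfolding cr using True by simp
    next
      case False
      then have same: "(w i \<le> c) = (w (i + 1) \<le> c)" using lt by auto
      from separated_swap_same[of w i c "i + 1", OF same] show ?thesis unfolding cr by simp
    qed
    moreover have "B (crossings n c (w \<circ> ?s)) (separated c (v \<circ> ?s) (w \<circ> ?s)) (loc k n (v \<circ> ?s) (w \<circ> ?s))"
      by (rule desc[OF ws]) (use lt in simp)
    ultimately show ?thesis unfolding loc_swap[OF step.hyps(1) a step.prems] by (rule mono[rotated])
  qed
qed

text \<open>All cohomological weights have the same top value, so each divided difference lowers the
  bound by exactly \<open>\<tau>\<close>.\<close>

lemma (in weight) le_loc_cohomology: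
  assumes v: "v permutes {1..n}" and w: "w permutes {1..n}"
    and top: "\<And>a b. a \<in> {1..n} \<Longrightarrow> b \<in> {1..n} \<Longrightarrow> a \<noteq> b \<Longrightarrow> top False a b = \<tau>"
  shows "le (int (card (noninv n v)) * \<tau>) (loc False n v w)"
  using v w
proof (induction v arbitrary: w rule: permutes_ascent_induct)
  case id
  show ?case
  proof (cases "\<exists>(i, j) \<in> noninv n id. w i = j")
    case True
    then have "loc False n id w = 0"
      unfolding loc_id by (intro prod_zero) (auto simp: noninv_def intro: finite_subset[OF _ finite_noninv[of n id]])
    then show ?thesis by (simp only: le_zero)
  next
    case False
    have "loc False n id w = (\<Prod>p\<in>noninv n id. wt False (w (fst p)) (snd p))"
      unfolding loc_id by (auto intro!: prod.cong simp: noninv_def)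
    moreover have "le (\<Sum>p\<in>noninv n id. \<tau>) (\<Prod>p\<in>noninv n id. wt False (w (fst p)) (snd p))"
    proof (rule le_prod)
      fix p assume p: "p \<in> noninv n id"
      obtain i j where ij: "p = (i, j)" by (cases p)
      have "w i \<noteq> j" "w i \<in> {1..n}" "j \<in> {1..n}"
        using p False perm_range(1)[OF id.prems, of i] by (auto simp: ij noninv_def)
      then show "le \<tau> (wt False (w (fst p)) (snd p))" using le_wt(1)[of "w i" j False] top by (simp add: ij)
    qed
    ultimately show ?thesis by (simp only: sum_constant of_nat_mult)
  qed
next
  case (step v i)
  let ?s = "transpose i (i + 1)"
  have b: "i \<in> {1..n}" "i + 1 \<in> {1..n}" using ascent_bounds[OF step.hyps(2)] by auto
  have ws: "w \<circ> ?s permutes {1..n}" by (rule permutes_comp_swap[OF step.prems b])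
  have w: "w i \<in> {1..n}" "w (i + 1) \<in> {1..n}" "w i \<noteq> w (i + 1)"
    using perm_range(1)[OF step.prems] perm_range(3)[OF step.prems, of i "i + 1"] b by (blast, blast, simp)
  have "le (int (card (noninv n v)) * \<tau>) (wt False (w i) (w (i + 1)) * loc False n (v \<circ> ?s) w)"
    unfolding loc_step[OF step.hyps(1,2)] using step.IH[OF step.prems] step.IH[OF ws]
    by (intro le_diff) (simp_all only: cf_def if_False mult_1)
  then have "le (int (card (noninv n v)) * \<tau> - \<tau>) (loc False n (v \<circ> ?s) w)"
    using le_wt[OF w(3), of False] unfolding top[OF w] by (rule le_cancel)
  moreover have "card (noninv n v) = card (noninv n (v \<circ> ?s)) + 1"
  proof -
    have "card (noninv n (v \<circ> ?s)) = card (noninv n v - {(i, i + 1)})"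
      by (rule bij_betw_same_card[OF noninv_swap[OF step.hyps(2)]])
    moreover have "(i, i + 1) \<in> noninv n v" using step.hyps(2) b by (auto simp: ascent_def noninv_def)
    ultimately show ?thesis using card_Suc_Diff1[OF finite_noninv] by fastforce
  qed
  then have "int (card (noninv n v)) * \<tau> - \<tau> = int (card (noninv n (v \<circ> ?s))) * \<tau>"
    by (simp add: algebra_simps)
  ultimately show ?case by (simp only:)
qed

section \<open>Degrees in the first c variables\<close>

definition partial_degree :: "nat \<Rightarrow> (nat \<Rightarrow>\<^sub>0 int) \<Rightarrow> int" where
  "partial_degree c m = (\<Sum>i\<in>{1..c}. lookup m i)"

lemma partial_degree_single [simp]:
  "partial_degree c (single a x) = (if 1 \<le> a \<and> a \<le> c then x else 0)"
  by (simp add: partial_degree_def lookup_single when_def)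

interpretation degree: weight "partial_degree c" for c
  by unfold_locales (simp add: partial_degree_def lookup_add sum.distrib)

text \<open>Upper bounds for the negated functional are lower bounds for the degree. In the same way
  \<open>coexponent\<close> bounds a single exponent from below.\<close>

interpretation codegree: weight "\<lambda>m. - partial_degree c m" for c
  by unfold_locales (simp add: partial_degree_def lookup_add sum.distrib)

interpretation coexponent: weight "\<lambda>m. - lookup m x" for x
  by unfold_locales (simp add: lookup_add)

text \<open>At a descent of \<open>w\<close> the weight has top degree 0 and gives nothing away; the
  second term may have one more crossing, but \<open>cf\<close> lowers its degree by just this
  amount.\<close>

lemma degree_loc:
  assumes v: "v permutes {1..n}" and w: "w permutes {1..n}"
  shows "degree.le c (int (crossings n c w) - int (separated c v w)) (loc True n v w)"
    and "codegree.le c 0 (loc True n v w)"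
proof -
  have "degree.le c (int (crossings n c w) - int (separated c v w)) (loc True n v w)
    \<and> codegree.le c 0 (loc True n v w)"
  proof (rule crossing_induct[where B = "\<lambda>d e f. degree.le c (int d - int e) f \<and> codegree.le c 0 f", OF v w])
    show "degree.le c (int (crossings n c id) - int 0) (loc True n id id) \<and> codegree.le c 0 (loc True n id id)"
    proof
      have "degree.le c (\<Sum>p\<in>noninv n id. degree.top c True (fst p) (snd p)) (loc True n id id)"
        unfolding loc_diag[OF permutes_id] case_prod_unfold id_apply
        by (intro degree.le_prod degree.le_wt) (auto simp: noninv_def)
      moreover have "(\<Sum>p\<in>noninv n id. degree.top c True (fst p) (snd p)) = int (crossings n c id)"
        unfolding crossings_def of_nat_sum by (rule sum.cong) (auto simp: degree.top_def noninv_def)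
      ultimately show "degree.le c (int (crossings n c id) - int 0) (loc True n id id)" by simp
      have "codegree.le c (\<Sum>p\<in>noninv n id. codegree.top c True (fst p) (snd p)) (loc True n id id)"
        unfolding loc_diag[OF permutes_id] case_prod_unfold id_apply
        by (intro codegree.le_prod codegree.le_wt) (auto simp: noninv_def)
      moreover have "(\<Sum>p\<in>noninv n id. codegree.top c True (fst p) (snd p)) = 0"
        by (rule sum.neutral) (auto simp: codegree.top_def noninv_def)
      ultimately show "codegree.le c 0 (loc True n id id)" by simp
    qed
    show "degree.le c (int d' - int e') f \<and> codegree.le c 0 f"
      if "degree.le c (int d - int e) f \<and> codegree.le c 0 f" "d + e' \<le> d' + e" for d e d' e' f
      using that by (auto elim: degree.le_mono)
    fix a b d e f g h
    assume ab: "a \<in> {1..n}" "b \<in> {1..n}" "b < a"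
      and eq: "wt True a b * h = f - cf True a b * g"
      and f: "degree.le c (int d - int e) f \<and> codegree.le c 0 f"
      and g: "degree.le c (int (d + of_bool (b \<le> c \<and> c < a)) - int e) g \<and> codegree.le c 0 g"
    let ?\<chi> = "int (of_bool (b \<le> c \<and> c < a))"
    have ne: "a \<noteq> b" using ab by simp
    have t: "degree.top c True a b = 0" "codegree.top c True a b = ?\<chi>"
      using ab by (auto simp: degree.top_def codegree.top_def)
    have "degree.le c (- ?\<chi> + (int (d + of_bool (b \<le> c \<and> c < a)) - int e)) (cf True a b * g)"
      by (rule degree.le_mult[OF degree.le_mono[OF degree.le_cf]]) (use ab g in auto)
    then have "degree.le c (int d - int e) (cf True a b * g)" by simp
    then have "degree.le c (int d - int e) (wt True a b * h)" unfolding eq using f by (intro degree.le_diff) auto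
    then have "degree.le c (int d - int e - degree.top c True a b) h"
      by (rule degree.le_cancel) (rule degree.le_wt[OF ne])+
    moreover have "codegree.le c (?\<chi> + 0) (cf True a b * g)"
      by (rule codegree.le_mult[OF codegree.le_mono[OF codegree.le_cf]]) (use ab g in auto)
    then have "codegree.le c ?\<chi> (wt True a b * h)" unfolding eq using f
      by (intro codegree.le_diff) (auto elim: codegree.le_mono)
    then have "codegree.le c (?\<chi> - codegree.top c True a b) h"
      by (rule codegree.le_cancel) (rule codegree.le_wt[OF ne])+
    ultimately show "degree.le c (int d - int e) h \<and> codegree.le c 0 h" unfolding t by simp
  qed (simp_all add: degree.le_zero codegree.le_zero)
  then show "degree.le c (int (crossings n c w) - int (separated c v w)) (loc True n v w)"
    "codegree.le c 0 (loc True n v w)" by auto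
qed

text \<open>Moving the first \<open>c\<close> coordinates of a point of the torus far away measures how often
  a product of linear forms crosses \<open>c\<close>.\<close>

definition shifted_eval :: "nat \<Rightarrow> real \<Rightarrow> nat laurent \<Rightarrow> real" where
  "shifted_eval c s = laurent_eval (\<lambda>i. real i + 1 + (if i \<le> c then s else 0))
     (\<lambda>i. inverse (real i + 1 + (if i \<le> c then s else 0)))"

lemma shifted_eval_hom:
  assumes "0 \<le> s"
  shows "laurent_hom (\<lambda>i. real i + 1 + (if i \<le> c then s else 0))
     (\<lambda>i. inverse (real i + 1 + (if i \<le> c then s else 0)))"
proof
  fix x
  have "real x + 1 + (if x \<le> c then s else 0) > 0" using assms by (simp add: add_pos_nonneg)
  then show "(real x + 1 + (if x \<le> c then s else 0)) * inverse (real x + 1 + (if x \<le> c then s else 0)) = 1"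
    by simp
qed

text \<open>For s \<ge> 2n + 2 the shift dominates the difference of the unshifted coordinates,
  which is less than n.\<close>

lemma shifted_eval_wt:
  assumes "a \<in> {1..n}" "b \<in> {1..n}" "a \<noteq> b" "2 * real n + 2 \<le> s"
  shows "(if (a \<le> c) = (b \<le> c) then 1 else s / 2) \<le> \<bar>shifted_eval c s (wt False a b)\<bar>"
proof -
  interpret laurent_hom "\<lambda>i. real i + 1 + (if i \<le> c then s else 0)"
     "\<lambda>i. inverse (real i + 1 + (if i \<le> c then s else 0))"
    by (rule shifted_eval_hom) (use assms in simp)
  have "shifted_eval c s (wt False a b)
      = real a + (if a \<le> c then s else 0) - (real b + (if b \<le> c then s else 0))"
    unfolding shifted_eval_def wt_def by (simp add: diff)
  moreover have "1 \<le> \<bar>real a - real b\<bar>" using assms(3) by linarith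
  ultimately show ?thesis using assms by (auto simp: abs_if split: if_splits)
qed

text \<open>The degree bound as a bound on growth: a divided difference divides by a number of size
  at least s/2 or 1. The power for \<open>separated\<close> stands on the left to avoid negative
  exponents.\<close>

lemma shifted_eval_loc:
  assumes v: "v permutes {1..n}" and w: "w permutes {1..n}"
  shows "\<exists>C\<ge>0. \<forall>s\<ge>2 * real n + 2.
    \<bar>shifted_eval c s (loc False n v w)\<bar> * s ^ separated c v w \<le> C * s ^ crossings n c w"
proof (rule crossing_induct[where B = "\<lambda>d e f. \<exists>C\<ge>0. \<forall>s\<ge>2 * real n + 2.
    \<bar>shifted_eval c s f\<bar> * s ^ e \<le> C * s ^ d" and k = False, OF v w])
  show "\<exists>C\<ge>0. \<forall>s\<ge>2 * real n + 2. \<bar>shifted_eval c s 0\<bar> * s ^ e \<le> C * s ^ d" for d e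
    by (rule exI[of _ 0]) (simp add: shifted_eval_def laurent_eval_def)
  show "\<exists>C\<ge>0. \<forall>s\<ge>2 * real n + 2. \<bar>shifted_eval c s (loc False n id id)\<bar> * s ^ 0 \<le> C * s ^ crossings n c id"
  proof (intro exI conjI allI impI)
    show "0 \<le> (real n + 1) ^ card (noninv n id)" by simp
    fix s assume s: "2 * real n + 2 \<le> s"
    interpret laurent_hom "\<lambda>i. real i + 1 + (if i \<le> c then s else 0)"
      "\<lambda>i. inverse (real i + 1 + (if i \<le> c then s else 0))"
      by (rule shifted_eval_hom) (use s in simp)
    have "\<bar>shifted_eval c s (loc False n id id)\<bar> = (\<Prod>p\<in>noninv n id. \<bar>shifted_eval c s (wt False (fst p) (snd p))\<bar>)"
      unfolding loc_diag[OF permutes_id] shifted_eval_def prod abs_prod case_prod_unfold id_apply ..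
    also have "\<dots> \<le> (\<Prod>p\<in>noninv n id. (real n + 1) * s ^ of_bool (fst p \<le> c \<and> c < snd p))"
    proof (intro prod_mono conjI abs_ge_zero)
      fix p assume "p \<in> noninv n id"
      then obtain a b where p: "p = (a, b)" "1 \<le> a" "a < b" "b \<le> n" by (cases p) (auto simp: noninv_def)
      have e: "shifted_eval c s (wt False a b)
          = real a + (if a \<le> c then s else 0) - (real b + (if b \<le> c then s else 0))"
        unfolding shifted_eval_def wt_def by (simp add: diff)
      have ab: "real a < real b" "real b \<le> real n" "0 \<le> real a" using p by auto
      show "\<bar>shifted_eval c s (wt False (fst p) (snd p))\<bar> \<le> (real n + 1) * s ^ of_bool (fst p \<le> c \<and> c < snd p)"
      proof (cases "a \<le> c \<and> c < b")
        case True
        have "s \<le> (real n + 1) * s" using s by (simp add: algebra_simps)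
        then have "real a + s - real b \<le> (real n + 1) * s" "0 \<le> real a + s - real b"
          using ab s by linarith+
        then show ?thesis using True unfolding p(1) fst_conv snd_conv e by simp
      next
        case False
        then have "\<bar>real a + (if a \<le> c then s else 0) - (real b + (if b \<le> c then s else 0))\<bar> = real b - real a"
          using ab p by (auto simp: abs_if)
        then show ?thesis using False ab unfolding p(1) fst_conv snd_conv e by auto
      qed
    qed
    also have "\<dots> = (real n + 1) ^ card (noninv n id) * s ^ crossings n c id"
      by (simp only: prod.distrib crossings_def power_sum prod_constant id_apply)
    finally show "\<bar>shifted_eval c s (loc False n id id)\<bar> * s ^ 0 \<le> (real n + 1) ^ card (noninv n id) * s ^ crossings n c id"
      by simp
  qed
next
  fix d e d' e' f
  assume "\<exists>C\<ge>0. \<forall>s\<ge>2 * real n + 2. \<bar>shifted_eval c s f\<bar> * s ^ e \<le> C * s ^ d" and le: "d + e' \<le> d' + e"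
  then obtain C where C: "C \<ge> 0" "\<And>s. s \<ge> 2 * real n + 2 \<Longrightarrow> \<bar>shifted_eval c s f\<bar> * s ^ e \<le> C * s ^ d" by blast
  show "\<exists>C\<ge>0. \<forall>s\<ge>2 * real n + 2. \<bar>shifted_eval c s f\<bar> * s ^ e' \<le> C * s ^ d'"
  proof (intro exI[of _ C] conjI C allI impI)
    fix s assume s: "2 * real n + 2 \<le> s"
    have "\<bar>shifted_eval c s f\<bar> * s ^ e' * s ^ e \<le> C * s ^ d * s ^ e'"
      using mult_right_mono[OF C(2)[OF s], of "s ^ e'"] s by (simp add: mult_ac)
    also have "\<dots> \<le> C * s ^ (d' + e)"
      using power_increasing[OF le, of s] s C(1) by (simp add: mult.assoc mult_left_mono flip: power_add)
    finally have "\<bar>shifted_eval c s f\<bar> * s ^ e' * s ^ e \<le> C * s ^ d' * s ^ e" by (simp add: power_add mult_ac)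
    then show "\<bar>shifted_eval c s f\<bar> * s ^ e' \<le> C * s ^ d'" using s by (simp add: mult_le_cancel_right)
  qed
next
  fix a b d e f g h
  assume ab: "a \<in> {1..n}" "b \<in> {1..n}" "b < a"
    and eq: "wt False a b * h = f - cf False a b * g"
    and "\<exists>C\<ge>0. \<forall>s\<ge>2 * real n + 2. \<bar>shifted_eval c s f\<bar> * s ^ e \<le> C * s ^ d"
    and "\<exists>C\<ge>0. \<forall>s\<ge>2 * real n + 2. \<bar>shifted_eval c s g\<bar> * s ^ e \<le> C * s ^ (d + of_bool (b \<le> c \<and> c < a))"
  then obtain C C' where C: "C \<ge> 0" "\<And>s. s \<ge> 2 * real n + 2 \<Longrightarrow> \<bar>shifted_eval c s f\<bar> * s ^ e \<le> C * s ^ d"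
    and C': "C' \<ge> 0" "\<And>s. s \<ge> 2 * real n + 2 \<Longrightarrow> \<bar>shifted_eval c s g\<bar> * s ^ e \<le> C' * s ^ (d + of_bool (b \<le> c \<and> c < a))"
    by blast
  show "\<exists>C\<ge>0. \<forall>s\<ge>2 * real n + 2. \<bar>shifted_eval c s h\<bar> * s ^ e \<le> C * s ^ d"
  proof (intro exI[of _ "2 * (C + C')"] conjI allI impI)
    show "0 \<le> 2 * (C + C')" using C C' by simp
    fix s assume s: "2 * real n + 2 \<le> s"
    interpret laurent_hom "\<lambda>i. real i + 1 + (if i \<le> c then s else 0)"
      "\<lambda>i. inverse (real i + 1 + (if i \<le> c then s else 0))"
      by (rule shifted_eval_hom) (use s in simp)
    let ?W = "\<bar>shifted_eval c s (wt False a b)\<bar>" and ?H = "\<bar>shifted_eval c s h\<bar> * s ^ e"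
    let ?\<chi> = "of_bool (b \<le> c \<and> c < a)"
    have s1: "1 \<le> s" "0 \<le> s" using s by auto
    have "shifted_eval c s (wt False a b) * shifted_eval c s h = shifted_eval c s f - shifted_eval c s g"
      using arg_cong[OF eq, of "shifted_eval c s"] unfolding shifted_eval_def mult diff cf_def by simp
    then have WH: "?W * \<bar>shifted_eval c s h\<bar> \<le> \<bar>shifted_eval c s f\<bar> + \<bar>shifted_eval c s g\<bar>"
      by (simp flip: abs_mult add: abs_triangle_ineq4)
    have "?W * ?H \<le> \<bar>shifted_eval c s f\<bar> * s ^ e + \<bar>shifted_eval c s g\<bar> * s ^ e"
      using mult_right_mono[OF WH, of "s ^ e"] s1 by (simp add: algebra_simps)
    also have "\<dots> \<le> C * s ^ d + C' * s ^ (d + ?\<chi>)" by (intro add_mono C C' s)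
    also have "\<dots> \<le> (C + C') * s ^ (d + ?\<chi>)"
      using C(1) mult_left_mono[OF power_increasing[of d "d + ?\<chi>" s], of C] s1 by (simp add: algebra_simps)
    finally have "?W * ?H \<le> (C + C') * s ^ (d + ?\<chi>)" .
    moreover have "s ^ ?\<chi> / 2 \<le> ?W"
      using shifted_eval_wt[OF ab(1,2) _ s, of c] ab(3) by (auto split: if_splits)
    then have "s ^ ?\<chi> / 2 * ?H \<le> ?W * ?H" using s1 by (intro mult_right_mono) auto
    moreover have "s ^ ?\<chi> * ?H = 2 * (s ^ ?\<chi> / 2 * ?H)" by simp
    moreover have "s ^ ?\<chi> * (2 * (C + C') * s ^ d) = 2 * ((C + C') * s ^ (d + ?\<chi>))"
      unfolding power_add by (simp only: mult_ac)
    ultimately have "s ^ ?\<chi> * ?H \<le> s ^ ?\<chi> * (2 * (C + C') * s ^ d)" by linarith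
    then show "?H \<le> 2 * (C + C') * s ^ d" using s by (simp add: mult_le_cancel_left)
  qed
qed

context inclusion_perm begin

text \<open>Both families satisfy the congruence between \<open>u\<close> and each point above it.
  If they agree at these points, their difference at \<open>u\<close> vanishes whenever the two
  variables concerned are identified.\<close>

lemma diff_divisible:
  assumes u: "u permutes {1..n}"
    and eq: "\<And>i j. (i, j) \<in> noninv n u \<Longrightarrow> loc k n v (u \<circ> transpose i j) = psi k (u \<circ> transpose i j)"
  shows "(\<Prod>(i, j)\<in>noninv n u. wt k (u i) (u j)) dvd loc k n v u - psi k u"
proof -
  let ?A = "(\<lambda>(i, j). (u i, u j)) ` noninv n u"
  have inj: "inj_on (\<lambda>(i, j). (u i, u j)) (noninv n u)"
    using perm_range(3)[OF u] by (auto intro!: inj_onI)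
  have "(\<Prod>p\<in>?A. wt k (fst p) (snd p)) dvd loc k n v u - psi k u"
  proof (rule prod_wt_dvd)
    fix p assume "p \<in> ?A"
    then obtain i j where p: "p = (u i, u j)" and ij: "(i, j) \<in> noninv n u" by auto
    let ?r = "lrename (id(u j := u i))"
    have b: "i \<in> {1..n}" "j \<in> {1..n}" "i \<noteq> j" using ij by (auto simp: noninv_def)
    have "?r (loc k n v (u \<circ> transpose i j)) = ?r (loc k n v u)"
      unfolding swap_fun_eq[OF u] by (rule loc_identify)
    moreover have "?r (psi k (u \<circ> transpose i j)) = ?r (psi k u)"
      by (rule psi_identify[OF u b]) simp
    ultimately have "?r (loc k n v u - psi k u) = 0" unfolding lrename_diff eq[OF ij] by simp
    moreover have "u i < u j" using ij by (simp add: noninv_def)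
    ultimately show "fst p < snd p \<and> lrename (id(snd p := fst p)) (loc k n v u - psi k u) = 0"
      unfolding p fst_conv snd_conv by blast
  qed simp
  then show ?thesis unfolding prod.reindex[OF inj] by (simp add: case_prod_unfold)
qed

lemma loc_eq_psi_not_sat: "u permutes {1..n} \<Longrightarrow> \<not> sat u \<Longrightarrow> loc k n v u = psi k u"
  using loc_support[OF perm, of u k] by (simp add: psi_def sat_iff_bruhat_le)

text \<open>Induction from the large points downwards. The two theories then differ only in the
  reason why the quotient \<open>g\<close> is 0.\<close>

lemma loc_eq_psiI:
  assumes u: "u permutes {1..n}"
    and step: "\<And>u g. u permutes {1..n} \<Longrightarrow> sat u \<Longrightarrow> u \<noteq> v \<Longrightarrow>
      loc k n v u - psi k u = (\<Prod>p\<in>noninv n u. wt k (u (fst p)) (u (snd p))) * g \<Longrightarrow> g = 0"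
  shows "loc k n v u = psi k u"
  using u
proof (induction "pos_sum n u" arbitrary: u rule: less_induct)
  case less
  show ?case
  proof (cases "sat u \<and> u \<noteq> v")
    case True
    have "(\<Prod>(i, j)\<in>noninv n u. wt k (u i) (u j)) dvd loc k n v u - psi k u"
    proof (rule diff_divisible[OF less.prems])
      fix i j assume ij: "(i, j) \<in> noninv n u"
      then have b: "i \<in> {1..n}" "j \<in> {1..n}" "i < j" "u i < u j" by (auto simp: noninv_def)
      show "loc k n v (u \<circ> transpose i j) = psi k (u \<circ> transpose i j)"
        by (rule less.hyps[OF pos_sum_swap[of i n j u, OF b] permutes_comp_swap[OF less.prems b(1,2)]])
    qed
    then obtain g where g: "loc k n v u - psi k u = (\<Prod>p\<in>noninv n u. wt k (u (fst p)) (u (snd p))) * g"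
      by (auto simp: case_prod_unfold)
    have "g = 0" using step[OF less.prems _ _ g] True by blast
    then show ?thesis using g by simp
  next
    case False
    then consider "\<not> sat u" | "u = v" by blast
    then show ?thesis
    proof cases
      case 1
      then show ?thesis by (rule loc_eq_psi_not_sat[OF less.prems])
    next
      case 2
      show ?thesis unfolding 2 loc_diag[OF perm] psi_v ..
    qed
  qed
qed

text \<open>By \<open>coexponent\<close> the quotient has no negative exponents, and its total
  degree is at most the difference of two numbers of noninversions, which is negative.\<close>

lemma loc_eq_psi_cohomology:
  assumes "u permutes {1..n}"
  shows "loc False n v u = psi False u"
  using assms
proof (rule loc_eq_psiI)
  fix u g
  assume step: "u permutes {1..n}" "sat u" "u \<noteq> v"
    "loc False n v u - psi False u = (\<Prod>p\<in>noninv n u. wt False (u (fst p)) (u (snd p))) * g"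
  have key: "weight.le \<delta> (int (card (noninv n v)) * \<tau> - int (card (noninv n u)) * \<tau>) g"
    if "weight \<delta>" and top: "\<And>a b. a \<in> {1..n} \<Longrightarrow> b \<in> {1..n} \<Longrightarrow> a \<noteq> b \<Longrightarrow> weight.top \<delta> False a b = \<tau>"
    for \<delta> \<tau>
  proof -
    interpret weight \<delta> by fact
    have ub: "u a \<in> {1..n}" if "a \<in> {1..n}" for a using perm_range(1)[OF step(1)] that by blast
    have une: "u a \<noteq> u b" if "a \<noteq> b" for a b using perm_range(3)[OF step(1)] that by simp
    have "le (\<Sum>i\<in>{1..n}. \<Sum>j\<in>{1..n}. int (mu u i j) * \<tau>) (psi False u)"
    proof -
      have "le (int (mu u i j) * \<tau>) (wt False (u i) (u j) ^ mu u i j)"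
        if ij: "i \<in> {1..n}" "j \<in> {1..n}" for i j
      proof (cases "i = j")
        case True
        have "mu u i i = 0" using mu_posD(1)[OF step(2,1), of i i] ij True by auto
        then show ?thesis using True le_one[of 0] by simp
      next
        case False
        show ?thesis using le_power[OF le_wt(1)[OF une[OF False]]] top[OF ub[OF ij(1)] ub[OF ij(2)] une[OF False]] by metis
      qed
      then show ?thesis using step(2) unfolding psi_def by (simp only: if_True) (intro le_prod)
    qed
    moreover have "(\<Sum>i\<in>{1..n}. \<Sum>j\<in>{1..n}. int (mu u i j) * \<tau>) = int (mu_total u) * \<tau>"
      by (simp only: mu_total_def of_nat_sum sum_distrib_right)
    moreover have "mu_total u = card (noninv n v)" using mu_total_noninv[OF step(1,2)] by blast
    ultimately have "le (int (card (noninv n v)) * \<tau>) (psi False u)" by simp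
    then have "le (int (card (noninv n v)) * \<tau>) ((\<Prod>p\<in>noninv n u. wt False (u (fst p)) (u (snd p))) * g)"
      unfolding step(4)[symmetric] by (intro le_diff le_loc_cohomology perm step(1) top)
    then have "le (int (card (noninv n v)) * \<tau> - (\<Sum>p\<in>noninv n u. \<tau>)) g"
    proof (rule le_cancel_prod[OF finite_noninv, rotated])
      fix p assume p: "p \<in> noninv n u"
      obtain a b where ab: "p = (a, b)" by (cases p)
      have "a \<in> {1..n}" "b \<in> {1..n}" "a \<noteq> b" using p by (auto simp: ab noninv_def)
      then have t: "top False (u a) (u b) = \<tau>" "u a \<noteq> u b" using top ub une by blast+
      show "le \<tau> (wt False (u (fst p)) (u (snd p)))
        \<and> (\<exists>m\<in>keys (wt False (u (fst p)) (u (snd p))). \<delta> m = \<tau>)"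
        using le_wt[OF t(2), of False] unfolding t(1) ab by simp
    qed
    then show ?thesis by simp
  qed
  have "degree.le n (int (card (noninv n v)) * 1 - int (card (noninv n u)) * 1) g"
    by (rule key[OF degree.weight_axioms]) (auto simp: degree.top_def)
  moreover have "coexponent.le x (int (card (noninv n v)) * 0 - int (card (noninv n u)) * 0) g" for x
    by (rule key[OF coexponent.weight_axioms]) (auto simp: coexponent.top_def lookup_single when_def)
  moreover have "card (noninv n v) < card (noninv n u)"
    using mu_total_noninv[OF step(1,2)] step(3) by blast
  ultimately have False if "m \<in> keys g" for m
    using that sum_nonneg[of "{1..n}" "lookup m"]
    by (force simp: degree.le_def coexponent.le_def partial_degree_def)
  then have "keys g = {}" by blast
  then show "g = 0" by simp
qed

definition psi_crossings :: "nat \<Rightarrow> (nat \<Rightarrow> nat) \<Rightarrow> nat" where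
  "psi_crossings c u = (\<Sum>i\<in>{1..n}. \<Sum>j\<in>{1..n}. mu u i j * of_bool (u i \<le> c \<and> c < u j))"

text \<open>A combinatorial inequality read off from cohomology: at shifted points
  \<open>psi False u\<close> is at least (s/2) to the power \<open>psi_crossings\<close>, while
  \<open>loc\<close> has growth exponent at most \<open>crossings\<close> minus
  \<open>separated\<close>.\<close>

lemma psi_crossings_le:
  assumes u: "u permutes {1..n}" and sat: "sat u"
  shows "psi_crossings c u + separated c v u \<le> crossings n c u"
proof (rule ccontr)
  assume "\<not> ?thesis"
  then have gt: "crossings n c u + 1 \<le> psi_crossings c u + separated c v u" by simp
  obtain C where C: "C \<ge> 0" "\<And>s. s \<ge> 2 * real n + 2 \<Longrightarrow>
      \<bar>shifted_eval c s (psi False u)\<bar> * s ^ separated c v u \<le> C * s ^ crossings n c u"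
    using shifted_eval_loc[OF perm u, of c] unfolding loc_eq_psi_cohomology[OF u] by blast
  \<comment> \<open>Large enough for \<open>shifted_eval_wt\<close>, and larger than the constant
    left over in the final comparison.\<close>
  define s where "s = 2 * real n + 2 + C * 2 ^ psi_crossings c u"
  have s: "2 * real n + 2 \<le> s" "1 \<le> s" "0 < s"
  proof -
    have "0 \<le> C * 2 ^ psi_crossings c u" using C(1) by simp
    then show "2 * real n + 2 \<le> s" "1 \<le> s" "0 < s" unfolding s_def by linarith+
  qed
  interpret laurent_hom "\<lambda>i. real i + 1 + (if i \<le> c then s else 0)"
    "\<lambda>i. inverse (real i + 1 + (if i \<le> c then s else 0))"
    by (rule shifted_eval_hom) (use s in simp)
  have "(s / 2) ^ psi_crossings c u
      = (\<Prod>i\<in>{1..n}. \<Prod>j\<in>{1..n}. ((s / 2) ^ of_bool (u i \<le> c \<and> c < u j)) ^ mu u i j)"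
    unfolding psi_crossings_def by (simp only: power_sum power_mult[symmetric] mult.commute)
  also have "\<dots> \<le> (\<Prod>i\<in>{1..n}. \<Prod>j\<in>{1..n}. \<bar>shifted_eval c s (wt False (u i) (u j))\<bar> ^ mu u i j)"
  proof (intro prod_mono conjI prod_nonneg zero_le_power)
    fix i j assume ij: "i \<in> {1..n}" "j \<in> {1..n}"
    show "((s / 2) ^ of_bool (u i \<le> c \<and> c < u j)) ^ mu u i j \<le> \<bar>shifted_eval c s (wt False (u i) (u j))\<bar> ^ mu u i j"
    proof (cases "mu u i j = 0")
      case False
      then have lt: "u i < u j" using mu_posD(2)[OF sat u, of i j] ij by auto
      have ub: "u i \<in> {1..n}" "u j \<in> {1..n}" using perm_range(1)[OF u] ij by blast+
      have "(s / 2) ^ of_bool (u i \<le> c \<and> c < u j) \<le> \<bar>shifted_eval c s (wt False (u i) (u j))\<bar>"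
        using shifted_eval_wt[OF ub _ s(1), of c] lt by (auto split: if_splits)
      then show ?thesis by (rule power_mono) (use s in simp)
    qed simp
  qed (use s in auto)
  also have "\<dots> = \<bar>shifted_eval c s (psi False u)\<bar>"
    using sat unfolding psi_def by (simp only: if_True shifted_eval_def prod power abs_prod power_abs)
  finally have "(s / 2) ^ psi_crossings c u * s ^ separated c v u
      \<le> \<bar>shifted_eval c s (psi False u)\<bar> * s ^ separated c v u"
    by (rule mult_right_mono) (use s in simp)
  also have "\<dots> \<le> C * s ^ crossings n c u" by (rule C(2)[OF s(1)])
  finally have "s ^ (psi_crossings c u + separated c v u) \<le> C * 2 ^ psi_crossings c u * s ^ crossings n c u"
    by (simp add: power_divide field_simps power_add)
  moreover have "s ^ crossings n c u * s \<le> s ^ (psi_crossings c u + separated c v u)"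
    using power_increasing[OF gt s(2)] by (simp add: mult.commute)
  ultimately have "s ^ crossings n c u * s \<le> s ^ crossings n c u * (C * 2 ^ psi_crossings c u)"
    by (simp add: mult_ac)
  then have "s \<le> C * 2 ^ psi_crossings c u" using s(3) by (simp add: mult_le_cancel_left_pos)
  then show False unfolding s_def by simp
qed

lemma degree_psi:
  assumes u: "u permutes {1..n}" and sat: "sat u"
  shows "degree.le c (int (psi_crossings c u)) (psi True u)" "codegree.le c 0 (psi True u)"
proof -
  have "degree.le c (int (mu u i j * of_bool (u i \<le> c \<and> c < u j))) (wt True (u i) (u j) ^ mu u i j)
    \<and> codegree.le c 0 (wt True (u i) (u j) ^ mu u i j)"
    if ij: "i \<in> {1..n}" "j \<in> {1..n}" for i j
  proof (cases "mu u i j = 0")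
    case True
    then show ?thesis by (simp add: degree.le_one codegree.le_one)
  next
    case False
    then have lt: "u i < u j" using mu_posD(2)[OF sat u, of i j] ij by auto
    have ub: "u i \<in> {1..n}" "u j \<in> {1..n}" using perm_range(1)[OF u] ij by blast+
    have "degree.top c True (u i) (u j) = of_bool (u i \<le> c \<and> c < u j)" "codegree.top c True (u i) (u j) = 0"
      using lt ub by (auto simp: degree.top_def codegree.top_def)
    then show ?thesis
      using degree.le_power[OF degree.le_wt(1)[of "u i" "u j" c True], of "mu u i j"]
        codegree.le_power[OF codegree.le_wt(1)[of "u i" "u j" c True], of "mu u i j"] lt by simp
  qed
  then have "degree.le c (\<Sum>i\<in>{1..n}. \<Sum>j\<in>{1..n}. int (mu u i j * of_bool (u i \<le> c \<and> c < u j))) (psi True u)"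
    "codegree.le c (\<Sum>i\<in>{1..n}. \<Sum>j\<in>{1..n}. 0) (psi True u)"
    using sat unfolding psi_def by (simp_all only: if_True) (intro degree.le_prod codegree.le_prod; blast)+
  then show "degree.le c (int (psi_crossings c u)) (psi True u)" "codegree.le c 0 (psi True u)"
    unfolding psi_crossings_def of_nat_sum by (simp_all only: sum.neutral_const)
qed

text \<open>Both families have degree in t_1, ..., t_c one less than the product of weights dividing
  their difference, so every term of the quotient has negative degree; the lower bound on degrees
  excludes such terms.\<close>

lemma loc_eq_psi_K_theory:
  assumes "u permutes {1..n}"
  shows "loc True n v u = psi True u"
  using assms
proof (rule loc_eq_psiI)
  fix u g
  assume step: "u permutes {1..n}" "sat u" "u \<noteq> v"
    "loc True n v u - psi True u = (\<Prod>p\<in>noninv n u. wt True (u (fst p)) (u (snd p))) * g"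
  obtain k where k: "u k \<noteq> v k" using step(3) by (auto simp: fun_eq_iff)
  \<comment> \<open>Exactly one of u(k) and v(k) is at most this \<open>c\<close>, so it separates
    the two permutations.\<close>
  define c where "c = min (u k) (v k)"
  have sep: "separated c v u = 1"
    unfolding separated_def using k by (simp add: c_def) (intro exI[of _ k], auto simp: min_def)
  have "degree.le c (int (crossings n c u) - 1) (loc True n v u)"
    using degree_loc(1)[OF perm step(1), of c] sep by simp
  moreover have "degree.le c (int (crossings n c u) - 1) (psi True u)"
    using degree_psi(1)[OF step(1,2)] by (rule degree.le_mono)
      (use psi_crossings_le[OF step(1,2), of c] sep in linarith)
  ultimately have "degree.le c (int (crossings n c u) - 1) ((\<Prod>p\<in>noninv n u. wt True (u (fst p)) (u (snd p))) * g)"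
    unfolding step(4)[symmetric] by (rule degree.le_diff)
  then have "degree.le c (int (crossings n c u) - 1 - (\<Sum>p\<in>noninv n u. degree.top c True (u (fst p)) (u (snd p)))) g"
    by (rule degree.le_cancel_prod[OF finite_noninv, rotated]) (intro conjI degree.le_wt; auto simp: noninv_def)
  moreover have "(\<Sum>p\<in>noninv n u. degree.top c True (u (fst p)) (u (snd p))) = int (crossings n c u)"
    unfolding crossings_def of_nat_sum
  proof (rule sum.cong[OF refl])
    fix p assume p: "p \<in> noninv n u"
    obtain a b where ab: "p = (a, b)" by (cases p)
    have "1 \<le> u a" "u a < u b" using p perm_bounds(1)[OF step(1), of a] by (auto simp: ab noninv_def)
    then show "degree.top c True (u (fst p)) (u (snd p)) = int (of_bool (u (fst p) \<le> c \<and> c < u (snd p)))"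
      unfolding ab by (auto simp: degree.top_def)
  qed
  ultimately have 1: "degree.le c (- 1) g" by simp
  have "codegree.le c 0 ((\<Prod>p\<in>noninv n u. wt True (u (fst p)) (u (snd p))) * g)"
    unfolding step(4)[symmetric]
    by (rule codegree.le_diff[OF degree_loc(2)[OF perm step(1)] degree_psi(2)[OF step(1,2)]])
  then have "codegree.le c (0 - (\<Sum>p\<in>noninv n u. codegree.top c True (u (fst p)) (u (snd p)))) g"
    by (rule codegree.le_cancel_prod[OF finite_noninv, rotated]) (intro conjI codegree.le_wt; auto simp: noninv_def)
  moreover have "(\<Sum>p\<in>noninv n u. codegree.top c True (u (fst p)) (u (snd p))) = 0"
  proof (rule sum.neutral, rule ballI)
    fix p assume p: "p \<in> noninv n u"
    obtain a b where ab: "p = (a, b)" by (cases p)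
    have "1 \<le> u a" "u a < u b" using p perm_bounds(1)[OF step(1), of a] by (auto simp: ab noninv_def)
    then show "codegree.top c True (u (fst p)) (u (snd p)) = 0"
      unfolding ab by (auto simp: codegree.top_def)
  qed
  ultimately have 2: "codegree.le c 0 g" by simp
  have "keys g = {}"
  proof (rule equals0I)
    fix m assume "m \<in> keys g"
    then have "partial_degree c m \<le> - 1" "- partial_degree c m \<le> 0"
      using 1 2 unfolding degree.le_def codegree.le_def by blast+
    then show False by simp
  qed
  then show "g = 0" by simp
qed

theorem loc_id_eq: "loc k n v id = (\<Prod>(x, y) \<in> diagram n v. wt k (y - rk v x y) (x + rk v x y))"
  using loc_eq_psi_K_theory[OF permutes_id] loc_eq_psi_cohomology[OF permutes_id] psi_id
  by (cases k) simp_all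

end

section \<open>Formal series\<close>

lemma laurent_times_series_superset:
  assumes "finite A" "keys P \<subseteq> A"
  shows "laurent_times_series P h \<mu> = (\<Sum>\<nu>\<in>A. lookup P \<nu> * h (\<mu> - \<nu>))"
  unfolding laurent_times_series_def
  by (rule sum.mono_neutral_left) (use assms in \<open>auto simp: in_keys_iff\<close>)

lemma laurent_times_series_add:
  "laurent_times_series (P + Q) h \<mu> = laurent_times_series P h \<mu> + laurent_times_series Q h \<mu>"
  using laurent_times_series_superset[of "keys P \<union> keys Q" _ h \<mu>] Poly_Mapping.keys_add[of P Q]
  by (simp add: lookup_add algebra_simps sum.distrib)

lemma laurent_times_series_zero [simp]: "laurent_times_series 0 h = (\<lambda>_. 0)"
  by (simp add: laurent_times_series_def fun_eq_iff)

lemma laurent_times_series_sum: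
  "laurent_times_series (\<Sum>a\<in>A. P a) h \<mu> = (\<Sum>a\<in>A. laurent_times_series (P a) h \<mu>)"
  by (induction A rule: infinite_finite_induct) (simp_all add: laurent_times_series_add)

lemma laurent_times_series_single:
  "laurent_times_series (single \<nu> c) h \<mu> = c * h (\<mu> - \<nu>)"
  by (cases "c = 0") (simp_all add: laurent_times_series_def)

lemma laurent_times_series_one [simp]: "laurent_times_series 1 h = h"
  using laurent_times_series_single[of 0 1 h] by (simp add: fun_eq_iff)

lemma laurent_times_series_diff:
  "laurent_times_series (P - Q) h \<mu> = laurent_times_series P h \<mu> - laurent_times_series Q h \<mu>"
  using laurent_times_series_add[of "P - Q" Q h \<mu>] by simp

lemma laurent_times_series_add_right:
  "laurent_times_series P (\<lambda>\<mu>. g \<mu> + h \<mu>) = (\<lambda>\<mu>. laurent_times_series P g \<mu> + laurent_times_series P h \<mu>)"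
  by (simp add: laurent_times_series_def algebra_simps sum.distrib fun_eq_iff)

lemma laurent_times_series_mult:
  "laurent_times_series (P * Q) h = laurent_times_series P (laurent_times_series Q h)"
proof
  fix \<mu>
  have "P * Q = (\<Sum>a\<in>keys P. \<Sum>b\<in>keys Q.
      single (a + b) (lookup P a * lookup Q b))"
    by (subst poly_mapping_expand[of P], subst poly_mapping_expand[of Q]) (simp add: sum_product mult_single)
  then have "laurent_times_series (P * Q) h \<mu> = (\<Sum>a\<in>keys P. \<Sum>b\<in>keys Q.
      lookup P a * lookup Q b * h (\<mu> - (a + b)))"
    by (simp only: laurent_times_series_sum laurent_times_series_single)
  then show "laurent_times_series (P * Q) h \<mu> = laurent_times_series P (laurent_times_series Q h) \<mu>"
    unfolding laurent_times_series_def by (simp add: sum_distrib_left mult.assoc diff_diff_add)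
qed

lemma laurent_times_series_delta:
  "laurent_times_series P (\<lambda>\<mu>. if \<mu> = 0 then 1 else 0) = lookup P"
proof
  fix \<mu>
  have "laurent_times_series P (\<lambda>\<mu>. if \<mu> = 0 then 1 else 0) \<mu>
      = (\<Sum>\<nu>\<in>keys P. if \<mu> = \<nu> then lookup P \<nu> else 0)"
    unfolding laurent_times_series_def by (intro sum.cong) auto
  then show "laurent_times_series P (\<lambda>\<mu>. if \<mu> = 0 then 1 else 0) \<mu> = lookup P \<mu>"
    by (simp add: in_keys_iff)
qed

lemma laurent_times_series_lookup:
  "laurent_times_series P (lookup Q) = lookup (P * Q)"
  using laurent_times_series_mult[of P Q "\<lambda>\<mu>. if \<mu> = 0 then 1 else 0"]
  unfolding laurent_times_series_delta by (rule sym)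

text \<open>The height is positive on the degrees of the variables, so formal series whose support has
  nonnegative height can be cancelled by factors \<open>1 - t\<^sup>\<delta>\<close>.\<close>

definition height :: "(nat \<Rightarrow>\<^sub>0 int) \<Rightarrow> int" where
  "height \<mu> = - (\<Sum>i\<in>keys \<mu>. int i * lookup \<mu> i)"

lemma height_superset:
  "finite A \<Longrightarrow> keys \<mu> \<subseteq> A \<Longrightarrow> height \<mu> = - (\<Sum>i\<in>A. int i * lookup \<mu> i)"
  unfolding height_def by (simp, rule sum.mono_neutral_left) (auto simp: in_keys_iff)

lemma height_add: "height (\<mu> + \<nu>) = height \<mu> + height \<nu>"
  using height_superset[of "keys \<mu> \<union> keys \<nu>"] Poly_Mapping.keys_add[of \<mu> \<nu>]
  by (simp add: lookup_add algebra_simps sum.distrib)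

lemma height_zero [simp]: "height 0 = 0"
  by (simp add: height_def)

lemma height_diff: "height (\<mu> - \<nu>) = height \<mu> - height \<nu>"
  using height_add[of "\<mu> - \<nu>" \<nu>] by simp

lemma height_sum: "height (\<Sum>a\<in>A. f a) = (\<Sum>a\<in>A. height (f a))"
  by (induction A rule: infinite_finite_induct) (simp_all add: height_add)

lemma height_of_nat_mult: "height (of_nat k * \<mu>) = int k * height \<mu>"
  by (induction k) (simp_all add: height_add algebra_simps)

lemma height_single [simp]: "height (single i c) = - int i * c"
  by (cases "c = 0") (simp_all add: height_def)

definition bounded_series :: "((nat \<Rightarrow>\<^sub>0 int) \<Rightarrow> int) \<Rightarrow> bool" where
  "bounded_series h \<longleftrightarrow> (\<forall>\<mu>. height \<mu> < 0 \<longrightarrow> h \<mu> = 0)"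

lemma bounded_series_times:
  assumes "bounded_series h" "\<And>\<nu>. \<nu> \<in> keys P \<Longrightarrow> 0 \<le> height \<nu>"
  shows "bounded_series (laurent_times_series P h)"
  unfolding bounded_series_def laurent_times_series_def
proof (intro allI impI sum.neutral ballI)
  fix \<mu> \<nu> assume "height \<mu> < 0" "\<nu> \<in> keys P"
  then have "height (\<mu> - \<nu>) < 0" using assms(2)[of \<nu>] by (simp add: height_diff)
  then have "h (\<mu> - \<nu>) = 0" using assms(1) unfolding bounded_series_def by blast
  then show "lookup P \<nu> * h (\<mu> - \<nu>) = 0" by simp
qed

abbreviation factor :: "(nat \<Rightarrow>\<^sub>0 int) \<Rightarrow> nat laurent" where
  "factor \<delta> \<equiv> 1 - single \<delta> 1"

lemma times_factor: "laurent_times_series (factor \<delta>) h \<mu> = h \<mu> - h (\<mu> - \<delta>)"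
  by (simp add: laurent_times_series_diff laurent_times_series_single)

lemma keys_factor: "keys (factor \<delta>) \<subseteq> {0, \<delta>}"
  using keys_diff[of 1 "single \<delta> (1::int)"] by auto

text \<open>The difference of the two series is invariant under shifts by \<open>\<delta>\<close>,
  and enough shifts lead to negative height, where both vanish.\<close>

lemma factor_cancel:
  assumes b: "bounded_series g" "bounded_series h" and \<delta>: "0 < height \<delta>"
    and eq: "laurent_times_series (factor \<delta>) g = laurent_times_series (factor \<delta>) h"
  shows "g = h"
proof
  fix \<mu>
  have step: "g \<mu> - h \<mu> = g (\<mu> - \<delta>) - h (\<mu> - \<delta>)" for \<mu>
    using fun_cong[OF eq, of \<mu>] by (simp add: times_factor)
  have "g \<mu> = h \<mu>" if "height \<mu> < int k * height \<delta>" for k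
    using that
  proof (induction k arbitrary: \<mu>)
    case 0
    then show ?case using b by (simp add: bounded_series_def)
  next
    case (Suc k)
    then show ?case using step[of \<mu>] Suc.IH[of "\<mu> - \<delta>"] by (simp add: height_diff algebra_simps)
  qed
  moreover have "height \<mu> < int (nat (height \<mu>) + 1) * height \<delta>"
  proof -
    have "height \<mu> < int (nat (height \<mu>) + 1) * 1" by simp
    also have "\<dots> \<le> int (nat (height \<mu>) + 1) * height \<delta>" using \<delta> by (intro mult_left_mono) auto
    finally show ?thesis .
  qed
  ultimately show "g \<mu> = h \<mu>" by blast
qed

lemma factor_prod_cancel:
  assumes "finite I" "\<And>x. x \<in> I \<Longrightarrow> 0 < height (\<delta> x)" and b: "bounded_series g" "bounded_series h"
    and "laurent_times_series (\<Prod>x\<in>I. factor (\<delta> x)) g = laurent_times_series (\<Prod>x\<in>I. factor (\<delta> x)) h"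
  shows "g = h"
  using assms
proof (induction I arbitrary: g h)
  case (insert x I)
  have "bounded_series (laurent_times_series (factor (\<delta> x)) f)" if "bounded_series f" for f
    using keys_factor[of "\<delta> x"] insert.prems(1)[of x] by (intro bounded_series_times[OF that]) fastforce
  note bs = this[OF insert.prems(2)] this[OF insert.prems(3)]
  have "laurent_times_series (factor (\<delta> x)) g = laurent_times_series (factor (\<delta> x)) h"
  proof (rule insert.IH[OF _ bs])
    have "(\<Prod>y\<in>insert x I. factor (\<delta> y)) = (\<Prod>y\<in>I. factor (\<delta> y)) * factor (\<delta> x)"
      using insert.hyps by (simp add: mult.commute)
    then show "laurent_times_series (\<Prod>y\<in>I. factor (\<delta> y)) (laurent_times_series (factor (\<delta> x)) g)
      = laurent_times_series (\<Prod>y\<in>I. factor (\<delta> y)) (laurent_times_series (factor (\<delta> x)) h)"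
      using insert.prems(4) by (simp only: laurent_times_series_mult)
  qed (use insert.prems in auto)
  then show ?case using insert.prems by (intro factor_cancel[of g h "\<delta> x"]) auto
qed simp

section \<open>Generating functions of graded sets\<close>

definition counting :: "'a set \<Rightarrow> ('a \<Rightarrow> (nat \<Rightarrow>\<^sub>0 int)) \<Rightarrow> (nat \<Rightarrow>\<^sub>0 int) \<Rightarrow> int" where
  "counting A d \<mu> = int (card {a \<in> A. d a = \<mu>})"

definition finitely_graded :: "'a set \<Rightarrow> ('a \<Rightarrow> (nat \<Rightarrow>\<^sub>0 int)) \<Rightarrow> bool" where
  "finitely_graded A d \<longleftrightarrow> (\<forall>\<mu>. finite {a \<in> A. d a = \<mu>}) \<and> (\<forall>a\<in>A. 0 \<le> height (d a))"

lemma finitely_graded_subset: "finitely_graded A d \<Longrightarrow> B \<subseteq> A \<Longrightarrow> finitely_graded B d"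
  unfolding finitely_graded_def
proof (intro conjI allI ballI)
  assume *: "(\<forall>\<mu>. finite {a \<in> A. d a = \<mu>}) \<and> (\<forall>a\<in>A. 0 \<le> height (d a))" "B \<subseteq> A"
  fix \<mu>
  have "finite {a \<in> A. d a = \<mu>}" using * by blast
  then show "finite {a \<in> B. d a = \<mu>}" by (rule rev_finite_subset) (use * in blast)
qed blast

lemma bounded_counting: "finitely_graded A d \<Longrightarrow> bounded_series (counting A d)"
  unfolding bounded_series_def counting_def finitely_graded_def by (auto simp: card_eq_0_iff not_le[symmetric])

lemma counting_Un:
  assumes "finitely_graded (A \<union> B) d" "A \<inter> B = {}"
  shows "counting (A \<union> B) d = (\<lambda>\<mu>. counting A d \<mu> + counting B d \<mu>)"
proof
  fix \<mu>
  have "{a \<in> A \<union> B. d a = \<mu>} = {a \<in> A. d a = \<mu>} \<union> {a \<in> B. d a = \<mu>}" by auto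
  moreover have "finite {a \<in> A. d a = \<mu>}" "finite {a \<in> B. d a = \<mu>}"
    using finitely_graded_subset[OF assms(1), of A] finitely_graded_subset[OF assms(1), of B]
    by (auto simp: finitely_graded_def)
  ultimately show "counting (A \<union> B) d \<mu> = counting A d \<mu> + counting B d \<mu>"
    using assms(2) unfolding counting_def by (simp add: card_Un_disjoint disjoint_iff)
qed

lemma counting_image:
  assumes "inj_on s A" "\<And>a. a \<in> A \<Longrightarrow> d (s a) = d' a + \<delta>"
  shows "counting (s ` A) d \<mu> = counting A d' (\<mu> - \<delta>)"
proof -
  have "{a \<in> s ` A. d a = \<mu>} = s ` {a \<in> A. d' a = \<mu> - \<delta>}"
    using assms(2) by (auto simp: algebra_simps)
  moreover have "inj_on s {a \<in> A. d' a = \<mu> - \<delta>}" using assms(1) by (rule inj_on_subset) auto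
  ultimately show ?thesis unfolding counting_def by (simp add: card_image)
qed

text \<open>A set consisting of \<open>B\<close> and a shifted copy of itself has a geometric series
  as generating function.\<close>

lemma counting_shift:
  assumes fg: "finitely_graded A d" and inj: "inj_on s A" "\<And>a. a \<in> A \<Longrightarrow> d (s a) = d a + \<delta>"
    and A: "A = B \<union> s ` A" "B \<inter> s ` A = {}"
  shows "laurent_times_series (factor \<delta>) (counting A d) = counting B d"
proof
  fix \<mu>
  have "finitely_graded (B \<union> s ` A) d" using fg A(1) by simp
  from counting_Un[OF this A(2)]
  have "counting A d \<mu> = counting B d \<mu> + counting (s ` A) d \<mu>" using A(1) by simp
  then show "laurent_times_series (factor \<delta>) (counting A d) \<mu> = counting B d \<mu>"
    by (simp add: times_factor counting_image[of s A d d, OF inj])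
qed

definition exponents :: "'x set \<Rightarrow> ('x \<Rightarrow>\<^sub>0 nat) set" where
  "exponents I = {\<alpha>. keys \<alpha> \<subseteq> I}"

text \<open>The product with \<open>of_nat\<close> is convolution with a constant and thus
  multiplies every coefficient.\<close>

definition exponent_degree :: "('x \<Rightarrow> (nat \<Rightarrow>\<^sub>0 int)) \<Rightarrow> ('x \<Rightarrow>\<^sub>0 nat) \<Rightarrow> (nat \<Rightarrow>\<^sub>0 int)" where
  "exponent_degree \<delta> \<alpha> = (\<Sum>x\<in>keys \<alpha>. of_nat (lookup \<alpha> x) * \<delta> x)"

lemma exponent_degree_superset:
  "finite A \<Longrightarrow> keys \<alpha> \<subseteq> A \<Longrightarrow> exponent_degree \<delta> \<alpha> = (\<Sum>x\<in>A. of_nat (lookup \<alpha> x) * \<delta> x)"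
  unfolding exponent_degree_def by (rule sum.mono_neutral_left) (auto simp: in_keys_iff)

lemma exponent_degree_add: "exponent_degree \<delta> (\<alpha> + \<beta>) = exponent_degree \<delta> \<alpha> + exponent_degree \<delta> \<beta>"
  using exponent_degree_superset[of "keys \<alpha> \<union> keys \<beta>" _ \<delta>] Poly_Mapping.keys_add[of \<alpha> \<beta>]
  by (simp add: lookup_add algebra_simps sum.distrib)

lemma exponent_degree_zero [simp]: "exponent_degree \<delta> 0 = 0"
  by (simp add: exponent_degree_def)

lemma exponent_degree_single [simp]: "exponent_degree \<delta> (single x k) = of_nat k * \<delta> x"
  by (cases "k = 0") (simp_all add: exponent_degree_def)

lemma zdeg_eq: "zdeg m = exponent_degree (\<lambda>(i, j). single j 1 - single i 1) m"
proof -
  have "of_nat k * single i (1::int) = single i (int k)" for k and i :: nat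
    by (simp add: mult_single flip: single_of_nat)
  then show ?thesis unfolding zdeg_def exponent_degree_def by (simp add: case_prod_unfold right_diff_distrib)
qed

lemma zdeg_add: "zdeg (m + m') = zdeg m + zdeg m'"
  by (simp add: zdeg_eq exponent_degree_add)

lemma zdeg_zero [simp]: "zdeg 0 = 0"
  by (simp add: zdeg_eq)

lemma zdeg_single: "zdeg (single (i, j) k) = of_nat k * (single j 1 - single i 1)"
  by (simp add: zdeg_eq)

lemma finite_exponents_bounded:
  assumes "finite I"
  shows "finite {\<alpha> \<in> exponents I. \<forall>x. lookup \<alpha> x \<le> N}"
proof -
  have "finite {f. \<forall>x. (x \<in> I \<longrightarrow> f x \<in> {..N}) \<and> (x \<notin> I \<longrightarrow> f x = 0)}"
    using assms by (rule finite_set_of_finite_funs) simp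
  then have "finite (lookup -` {f. \<forall>x. (x \<in> I \<longrightarrow> f x \<in> {..N}) \<and> (x \<notin> I \<longrightarrow> f x = 0)})"
    by (rule finite_vimageI) (simp add: lookup_inject inj_def)
  then show ?thesis by (rule rev_finite_subset) (auto simp: exponents_def in_keys_iff)
qed

text \<open>Each generator has height at least 1, so the height bounds every exponent; this makes
  the graded pieces finite.\<close>

lemma height_exponent_degree:
  assumes "\<And>x. x \<in> I \<Longrightarrow> 0 < height (\<delta> x)" "\<alpha> \<in> exponents I"
  shows "int (lookup \<alpha> x) \<le> height (exponent_degree \<delta> \<alpha>)"
proof -
  have pos: "int (lookup \<alpha> y) \<le> int (lookup \<alpha> y) * height (\<delta> y)"
    if "y \<in> keys \<alpha>" for y
    using mult_left_mono[of 1 "height (\<delta> y)" "int (lookup \<alpha> y)"] assms that by (force simp: exponents_def)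
  have h: "height (exponent_degree \<delta> \<alpha>) = (\<Sum>y\<in>keys \<alpha>. int (lookup \<alpha> y) * height (\<delta> y))"
    by (simp add: exponent_degree_def height_sum height_of_nat_mult)
  show ?thesis
  proof (cases "x \<in> keys \<alpha>")
    case True
    have "int (lookup \<alpha> x) \<le> (\<Sum>y\<in>{x}. int (lookup \<alpha> y) * height (\<delta> y))" using pos[OF True] by simp
    also have "\<dots> \<le> (\<Sum>y\<in>keys \<alpha>. int (lookup \<alpha> y) * height (\<delta> y))"
      using True by (intro sum_mono2) (auto intro: order_trans[OF _ pos])
    finally show ?thesis unfolding h .
  next
    case False
    have "0 \<le> (\<Sum>y\<in>keys \<alpha>. int (lookup \<alpha> y) * height (\<delta> y))"
      by (intro sum_nonneg) (auto intro: order_trans[OF _ pos])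
    then show ?thesis using False unfolding h by (simp add: in_keys_iff)
  qed
qed

lemma finitely_graded_exponents:
  fixes d :: "'a \<Rightarrow> (nat \<Rightarrow>\<^sub>0 int)"
  assumes T: "finitely_graded T d"
    and I: "finite I" "\<And>x. x \<in> I \<Longrightarrow> 0 < height (\<delta> x)"
  shows "finitely_graded (T \<times> exponents I) (\<lambda>(a, \<alpha>). d a + exponent_degree \<delta> \<alpha>)"
  unfolding finitely_graded_def
proof (intro conjI allI ballI)
  fix \<mu>
  let ?E = "{\<alpha> \<in> exponents I. \<forall>x. lookup \<alpha> x \<le> nat (height \<mu>)}"
  have "finite (\<Union>\<alpha>\<in>?E. {a \<in> T. d a = \<mu> - exponent_degree \<delta> \<alpha>} \<times> {\<alpha>})"
    using finite_exponents_bounded[OF I(1)] T by (auto simp: finitely_graded_def)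
  moreover have "{p \<in> T \<times> exponents I. (case p of (a, \<alpha>) \<Rightarrow> d a + exponent_degree \<delta> \<alpha>) = \<mu>}
      \<subseteq> (\<Union>\<alpha>\<in>?E. {a \<in> T. d a = \<mu> - exponent_degree \<delta> \<alpha>} \<times> {\<alpha>})"
  proof (rule subsetI)
    fix p assume p: "p \<in> {p \<in> T \<times> exponents I. (case p of (a, \<alpha>) \<Rightarrow> d a + exponent_degree \<delta> \<alpha>) = \<mu>}"
    obtain a \<alpha> where a: "p = (a, \<alpha>)" by (cases p)
    have *: "a \<in> T" "\<alpha> \<in> exponents I" "d a + exponent_degree \<delta> \<alpha> = \<mu>" using p a by auto
    have "height \<mu> = height (d a) + height (exponent_degree \<delta> \<alpha>)" by (simp add: height_add flip: *(3))
    moreover have "0 \<le> height (d a)" using T *(1) by (simp add: finitely_graded_def)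
    ultimately have "int (lookup \<alpha> x) \<le> height \<mu>" for x
      using height_exponent_degree[of I \<delta> \<alpha> x, OF I(2) *(2)] by simp
    from nat_mono[OF this] have "lookup \<alpha> x \<le> nat (height \<mu>)" for x by simp
    moreover have "d a = \<mu> - exponent_degree \<delta> \<alpha>" using *(3) by (simp add: algebra_simps)
    ultimately show "p \<in> (\<Union>\<alpha>\<in>?E. {a \<in> T. d a = \<mu> - exponent_degree \<delta> \<alpha>} \<times> {\<alpha>})"
      using * unfolding a by (intro UN_I[of \<alpha>]) auto
  qed
  ultimately show "finite {p \<in> T \<times> exponents I. (case p of (a, \<alpha>) \<Rightarrow> d a + exponent_degree \<delta> \<alpha>) = \<mu>}"
    by (rule rev_finite_subset)
next
  fix p assume "p \<in> T \<times> exponents I"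
  then obtain a \<alpha> where a: "p = (a, \<alpha>)" "a \<in> T" "\<alpha> \<in> exponents I" by auto
  have "0 \<le> height (d a)" using T a(2) by (simp add: finitely_graded_def)
  moreover have "0 \<le> height (exponent_degree \<delta> \<alpha>)"
    using height_exponent_degree[of I \<delta> \<alpha> undefined, OF I(2) a(3)] by simp
  ultimately show "0 \<le> height (case p of (a, \<alpha>) \<Rightarrow> d a + exponent_degree \<delta> \<alpha>)" using a by (simp add: height_add)
qed

text \<open>The exponents of one further generator contribute a geometric series, which its factor
  cancels.\<close>

lemma counting_exponents:
  fixes d :: "'a \<Rightarrow> (nat \<Rightarrow>\<^sub>0 int)"
  assumes T: "finitely_graded T d" and I: "finite I" "\<And>x. x \<in> I \<Longrightarrow> 0 < height (\<delta> x)"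
  shows "laurent_times_series (\<Prod>x\<in>I. factor (\<delta> x))
    (counting (T \<times> exponents I) (\<lambda>(a, \<alpha>). d a + exponent_degree \<delta> \<alpha>)) = counting T d"
  using I
proof (induction I)
  case empty
  have "{p \<in> T \<times> exponents {}. (case p of (a, \<alpha>) \<Rightarrow> d a + exponent_degree \<delta> \<alpha>) = \<mu>} = (\<lambda>a. (a, 0)) ` {a \<in> T. d a = \<mu>}" for \<mu>
    by (auto simp: exponents_def)
  then show ?case by (simp add: counting_def fun_eq_iff card_image inj_on_def)
next
  case (insert x I)
  let ?d = "\<lambda>(a, \<alpha>). d a + exponent_degree \<delta> \<alpha>" and ?s = "\<lambda>(a::'a, \<alpha>). (a, \<alpha> + single x (1::nat))"
  have "laurent_times_series (factor (\<delta> x)) (counting (T \<times> exponents (insert x I)) ?d) = counting (T \<times> exponents I) ?d"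
  proof (rule counting_shift[of _ _ ?s])
    show "finitely_graded (T \<times> exponents (insert x I)) ?d"
      by (rule finitely_graded_exponents) (use insert T in auto)
    show "inj_on ?s (T \<times> exponents (insert x I))" by (auto simp: inj_on_def)
    show "?d (?s p) = ?d p + \<delta> x" for p
      by (simp add: case_prod_unfold exponent_degree_add algebra_simps)
    show "T \<times> exponents I \<inter> ?s ` (T \<times> exponents (insert x I)) = {}"
    proof (rule equals0I)
      fix p assume p: "p \<in> T \<times> exponents I \<inter> ?s ` (T \<times> exponents (insert x I))"
      then obtain a \<alpha> where a: "p = (a, \<alpha> + single x 1)" by auto
      have "x \<in> keys (\<alpha> + single x 1)" by (simp add: in_keys_iff lookup_add)
      then show False using p insert.hyps(2) unfolding a by (auto simp: exponents_def)
    qed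
    show "T \<times> exponents (insert x I) = T \<times> exponents I \<union> ?s ` (T \<times> exponents (insert x I))"
    proof (rule equalityI; rule subsetI)
      fix p assume p: "p \<in> T \<times> exponents (insert x I)"
      obtain a \<alpha> where a: "p = (a, \<alpha>)" by (cases p)
      show "p \<in> T \<times> exponents I \<union> ?s ` (T \<times> exponents (insert x I))"
      proof (cases "lookup \<alpha> x = 0")
        case True
        then have "keys \<alpha> \<subseteq> I" using p a by (auto simp: exponents_def in_keys_iff)
        then show ?thesis using p a by (auto simp: exponents_def)
      next
        case False
        let ?b = "\<alpha> - single x 1"
        have "\<alpha> = ?b + single x 1"
          using False by (intro poly_mapping_eqI) (auto simp: lookup_add lookup_minus lookup_single when_def)
        moreover have "keys ?b \<subseteq> keys \<alpha>"
          by (auto simp: in_keys_iff lookup_minus)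
        ultimately have "p = ?s (a, ?b)" "(a, ?b) \<in> T \<times> exponents (insert x I)"
          using p a by (auto simp: exponents_def)
        then show ?thesis by blast
      qed
    next
      fix p assume "p \<in> T \<times> exponents I \<union> ?s ` (T \<times> exponents (insert x I))"
      then show "p \<in> T \<times> exponents (insert x I)"
        using Poly_Mapping.keys_add by (fastforce simp: exponents_def)
    qed
  qed
  then show ?case using insert by (simp add: laurent_times_series_mult mult.commute[of "factor (\<delta> x)"])
qed

section \<open>Ideals and minors\<close>

text \<open>The coefficients need not form a ring: a subring gives the ideal generated by
  \<open>G\<close>, the set \<open>constants\<close> gives the linear span.\<close>

inductive_set combinations :: "'a::comm_ring_1 set \<Rightarrow> 'a set \<Rightarrow> 'a set" for R G where
  zero: "0 \<in> combinations R G"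
| step: "r \<in> R \<Longrightarrow> g \<in> G \<Longrightarrow> x \<in> combinations R G \<Longrightarrow> r * g + x \<in> combinations R G"

lemma combinations_add:
  assumes "x \<in> combinations R G" "y \<in> combinations R G"
  shows "x + y \<in> combinations R G"
  using assms by (induction x rule: combinations.induct) (auto simp: add.assoc intro: combinations.step)

lemma combinations_mult:
  assumes "x \<in> combinations R G" "\<And>r. r \<in> R \<Longrightarrow> s * r \<in> R'"
  shows "s * x \<in> combinations R' G"
  using assms(1)
proof (induction x rule: combinations.induct)
  case (step r g x)
  then have "(s * r) * g + s * x \<in> combinations R' G" by (intro combinations.step assms(2))
  then show ?case by (simp add: algebra_simps)
qed (simp add: combinations.zero)

lemma combinations_mono:
  assumes "x \<in> combinations R G" "R \<subseteq> R'" "G \<subseteq> G'"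
  shows "x \<in> combinations R' G'"
  using assms by (induction x rule: combinations.induct) (auto intro: combinations.intros)

lemma combinations_base: "1 \<in> R \<Longrightarrow> g \<in> G \<Longrightarrow> g \<in> combinations R G"
  using combinations.step[of 1 R g G 0, OF _ _ combinations.zero] by simp

text \<open>An ideal over a subring of a fixed ring type. Interpretations with J = {0} supply the
  closure properties of \<open>R\<close> and turn congruences of determinants into
  equations.\<close>

locale ideal_in =
  fixes R J :: "'a::comm_ring_1 set"
  assumes R_one: "1 \<in> R" and R_add: "x \<in> R \<Longrightarrow> y \<in> R \<Longrightarrow> x + y \<in> R"
    and R_mult: "x \<in> R \<Longrightarrow> y \<in> R \<Longrightarrow> x * y \<in> R" and R_uminus: "x \<in> R \<Longrightarrow> - x \<in> R"
    and J_zero: "0 \<in> J" and J_add: "x \<in> J \<Longrightarrow> y \<in> J \<Longrightarrow> x + y \<in> J"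
    and J_mult: "r \<in> R \<Longrightarrow> x \<in> J \<Longrightarrow> r * x \<in> J"
begin

lemma R_zero: "0 \<in> R"
  using R_add[OF R_one R_uminus[OF R_one]] by simp

lemma R_diff: "x \<in> R \<Longrightarrow> y \<in> R \<Longrightarrow> x - y \<in> R"
  using R_add[OF _ R_uminus, of x y] by simp

lemma J_uminus: "x \<in> J \<Longrightarrow> - x \<in> J"
  using J_mult[OF R_uminus[OF R_one], of x] by simp

lemma J_diff: "x \<in> J \<Longrightarrow> y \<in> J \<Longrightarrow> x - y \<in> J"
  using J_add[OF _ J_uminus, of x y] by simp

lemma J_mult_right: "x \<in> J \<Longrightarrow> r \<in> R \<Longrightarrow> x * r \<in> J"
  using J_mult[of r x] by (simp add: mult.commute)

lemma R_sum: "(\<And>a. a \<in> A \<Longrightarrow> f a \<in> R) \<Longrightarrow> sum f A \<in> R"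
  by (induction A rule: infinite_finite_induct) (auto intro: R_zero R_add)

lemma R_prod: "(\<And>a. a \<in> A \<Longrightarrow> f a \<in> R) \<Longrightarrow> prod f A \<in> R"
  by (induction A rule: infinite_finite_induct) (auto intro: R_one R_mult)

lemma R_power: "x \<in> R \<Longrightarrow> x ^ k \<in> R"
  by (induction k) (auto intro: R_one R_mult)

lemma J_sum: "(\<And>a. a \<in> A \<Longrightarrow> f a \<in> J) \<Longrightarrow> sum f A \<in> J"
  by (induction A rule: infinite_finite_induct) (auto intro: J_zero J_add)

lemma combinations_in_J: "x \<in> combinations R G \<Longrightarrow> G \<subseteq> J \<Longrightarrow> x \<in> J"
  by (induction x rule: combinations.induct) (auto intro: J_zero J_add J_mult)

lemma R_det:
  assumes "\<And>i j. i < k \<Longrightarrow> j < k \<Longrightarrow> f i j \<in> R"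
  shows "det (mat k k (\<lambda>(i, j). f i j)) \<in> R"
proof -
  have "signof p * (\<Prod>i = 0..<k. f i (p i)) \<in> R" if "p permutes {0..<k}" for p
  proof (intro R_mult R_prod)
    show "signof p \<in> R" using R_one R_uminus[OF R_one] by (simp add: sign_def)
    fix i assume "i \<in> {0..<k}"
    then show "f i (p i) \<in> R" using permutes_in_image[OF that, of i] by (intro assms) auto
  qed
  moreover have "det (mat k k (\<lambda>(i, j). f i j)) = (\<Sum>p | p permutes {0..<k}. signof p * (\<Prod>i = 0..<k. f i (p i)))"
    unfolding det_def using permutes_in_image by (fastforce intro!: sum.cong prod.cong)
  ultimately show ?thesis by (auto intro!: R_sum)
qed

lemma det_column_expand:
  assumes l: "l < k" and f: "\<And>i j. i < k \<Longrightarrow> j < k \<Longrightarrow> f i j \<in> R"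
    and eq: "\<And>i. i < k \<Longrightarrow> f i l - (\<Sum>c\<in>C. u c * g i c) \<in> J"
  shows "det (mat k k (\<lambda>(i, j). f i j))
    - (\<Sum>c\<in>C. u c * det (mat k k (\<lambda>(i, j). if j = l then g i c else f i j))) \<in> J"
proof -
  let ?A = "mat k k (\<lambda>(i, j). f i j)" and ?B = "\<lambda>c. mat k k (\<lambda>(i, j). if j = l then g i c else f i j)"
  have del: "mat_delete (?B c) i l = mat_delete ?A i l" for c i
    by (rule eq_matI) (auto simp: mat_delete_def insert_index_def)
  have cof: "cofactor ?A i l \<in> R" if "i < k" for i
  proof -
    have "mat_delete ?A i l = mat (k - 1) (k - 1) (\<lambda>(a, b). f (insert_index i a) (insert_index l b))"
      by (rule eq_matI) (auto simp: mat_delete_def insert_index_def)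
    then have "det (mat_delete ?A i l) \<in> R" using f by (auto intro!: R_det simp: insert_index_def)
    then show ?thesis unfolding cofactor_def using R_one R_uminus by (intro R_mult R_power) auto
  qed
  have A: "det ?A = (\<Sum>i<k. f i l * cofactor ?A i l)"
    using l by (subst laplace_expansion_column[of _ k l]) auto
  have B: "det (?B c) = (\<Sum>i<k. g i c * cofactor ?A i l)" for c
    using l by (subst laplace_expansion_column[of _ k l]) (auto simp: cofactor_def del)
  have "det ?A - (\<Sum>c\<in>C. u c * det (?B c)) = (\<Sum>i<k. (f i l - (\<Sum>c\<in>C. u c * g i c)) * cofactor ?A i l)"
  proof -
    have "(\<Sum>c\<in>C. u c * det (?B c)) = (\<Sum>i<k. (\<Sum>c\<in>C. u c * g i c) * cofactor ?A i l)"
      unfolding B sum_distrib_left sum_distrib_right by (subst sum.swap) (simp only: mult.assoc)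
    then show ?thesis unfolding A by (simp add: left_diff_distrib sum_subtractf)
  qed
  also have "\<dots> \<in> J" by (intro J_sum J_mult_right eq cof) auto
  finally show ?thesis .
qed

lemma det_column_replace:
  assumes l: "l < k" and f: "\<And>i j. i < k \<Longrightarrow> j < k \<Longrightarrow> f i j \<in> R"
    and u: "\<And>c. c \<in> C \<Longrightarrow> u c \<in> R"
    and eq: "\<And>i. i < k \<Longrightarrow> f i l - (\<Sum>c\<in>C. u c * g i c) \<in> J"
    and det: "\<And>c. c \<in> C \<Longrightarrow> det (mat k k (\<lambda>(i, j). if j = l then g i c else f i j)) \<in> J"
  shows "det (mat k k (\<lambda>(i, j). f i j)) \<in> J"
proof -
  let ?S = "\<Sum>c\<in>C. u c * det (mat k k (\<lambda>(i, j). if j = l then g i c else f i j))"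
  have "det (mat k k (\<lambda>(i, j). f i j)) - ?S \<in> J"
    by (rule det_column_expand[where f = f and g = g and u = u and C = C, OF l]) (use f eq in auto)
  moreover have "?S \<in> J" by (intro J_sum J_mult u det)
  ultimately have "det (mat k k (\<lambda>(i, j). f i j)) - ?S + ?S \<in> J" by (rule J_add)
  then show ?thesis by simp
qed

lemma det_columns_replace:
  assumes f: "\<And>i j. i < k \<Longrightarrow> j < k \<Longrightarrow> f i j \<in> R"
    and g: "\<And>i c. i < k \<Longrightarrow> c \<in> C \<Longrightarrow> g i c \<in> R"
    and u: "\<And>j c. j < k \<Longrightarrow> c \<in> C \<Longrightarrow> u j c \<in> R"
    and eq: "\<And>i j. i < k \<Longrightarrow> j < k \<Longrightarrow> f i j - (\<Sum>c\<in>C. u j c * g i c) \<in> J"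
    and det: "\<And>\<beta>. (\<And>j. j < k \<Longrightarrow> \<beta> j \<in> C) \<Longrightarrow> det (mat k k (\<lambda>(i, j). g i (\<beta> j))) \<in> J"
  shows "det (mat k k (\<lambda>(i, j). f i j)) \<in> J"
proof -
  \<comment> \<open>The first \<open>m\<close> columns are original and the others already replaced;
    the induction starts with all columns replaced.\<close>
  have "det (mat k k (\<lambda>(i, j). if j < m then f i j else g i (\<beta> j))) \<in> J"
    if "m \<le> k" "\<And>j. m \<le> j \<Longrightarrow> j < k \<Longrightarrow> \<beta> j \<in> C" for m \<beta>
    using that
  proof (induction m arbitrary: \<beta>)
    case 0
    then show ?case using det[of \<beta>] by simp
  next
    case (Suc m)
    show ?case
    proof (rule det_column_replace[of m k _ C "u m" g])
      show "m < k" using Suc.prems by simp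
      show "(if j < Suc m then f i j else g i (\<beta> j)) \<in> R" if "i < k" "j < k" for i j
        using f[OF that] g[OF that(1) Suc.prems(2)[OF _ that(2)]] by simp
      show "u m c \<in> R" if "c \<in> C" for c by (rule u[OF \<open>m < k\<close> that])
      show "(if m < Suc m then f i m else g i (\<beta> m)) - (\<Sum>c\<in>C. u m c * g i c) \<in> J" if "i < k" for i
        using eq[OF that \<open>m < k\<close>] by simp
      fix c assume c: "c \<in> C"
      have "det (mat k k (\<lambda>(i, j). if j < m then f i j else g i ((\<beta>(m := c)) j))) \<in> J"
        by (rule Suc.IH) (use Suc.prems c in auto)
      moreover have "mat k k (\<lambda>(i, j). if j = m then g i c else if j < Suc m then f i j else g i (\<beta> j))
          = mat k k (\<lambda>(i, j). if j < m then f i j else g i ((\<beta>(m := c)) j))"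
        by (rule eq_matI) auto
      ultimately show "det (mat k k (\<lambda>(i, j). if j = m then g i c else if j < Suc m then f i j else g i (\<beta> j))) \<in> J"
        by simp
    qed
  qed
  from this[of k "\<lambda>_. undefined"]
  have "det (mat k k (\<lambda>(i, j). if j < k then f i j else g i undefined)) \<in> J" by simp
  moreover have "mat k k (\<lambda>(i, j). if j < k then f i j else g i undefined) = mat k k (\<lambda>(i, j). f i j)"
    by (rule eq_matI) auto
  ultimately show ?thesis by simp
qed

end

text \<open>Minors are taken for arbitrary sequences of rows and columns, so that no reordering is needed
  when columns are replaced; repeated rows or columns give \<open>0\<close>.\<close>

definition gminor :: "(nat \<Rightarrow> nat \<Rightarrow> 'a::comm_ring_1) \<Rightarrow> nat \<Rightarrow> (nat \<Rightarrow> nat) \<Rightarrow> (nat \<Rightarrow> nat) \<Rightarrow> 'a" where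
  "gminor M k \<alpha> \<beta> = det (mat k k (\<lambda>(i, j). M (\<alpha> i) (\<beta> j)))"

definition minors_in :: "(nat \<Rightarrow> nat \<Rightarrow> 'a::comm_ring_1) \<Rightarrow> 'a set \<Rightarrow> nat set \<Rightarrow> nat set \<Rightarrow> nat \<Rightarrow> bool" where
  "minors_in M J A B k \<longleftrightarrow> (\<forall>\<alpha> \<beta>. (\<forall>i<k. \<alpha> i \<in> A) \<and> (\<forall>j<k. \<beta> j \<in> B) \<longrightarrow> gminor M k \<alpha> \<beta> \<in> J)"

lemma minors_inD: "minors_in M J A B k \<Longrightarrow> (\<And>i. i < k \<Longrightarrow> \<alpha> i \<in> A) \<Longrightarrow> (\<And>j. j < k \<Longrightarrow> \<beta> j \<in> B) \<Longrightarrow> gminor M k \<alpha> \<beta> \<in> J"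
  unfolding minors_in_def by blast

lemma minors_inI: "(\<And>\<alpha> \<beta>. (\<And>i. i < k \<Longrightarrow> \<alpha> i \<in> A) \<Longrightarrow> (\<And>j. j < k \<Longrightarrow> \<beta> j \<in> B) \<Longrightarrow> gminor M k \<alpha> \<beta> \<in> J)
  \<Longrightarrow> minors_in M J A B k"
  unfolding minors_in_def by blast

lemma minors_in_mono: "minors_in M J A B k \<Longrightarrow> A' \<subseteq> A \<Longrightarrow> B' \<subseteq> B \<Longrightarrow> minors_in M J A' B' k"
  unfolding minors_in_def by blast

lemma gminor_cong:
  "(\<And>i j. i < k \<Longrightarrow> j < k \<Longrightarrow> M (\<alpha> i) (\<beta> j) = M' (\<alpha>' i) (\<beta>' j)) \<Longrightarrow> gminor M k \<alpha> \<beta> = gminor M' k \<alpha>' \<beta>'"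
  unfolding gminor_def by (rule arg_cong[of _ _ det], rule eq_matI) auto

lemma gminor_transpose: "gminor (\<lambda>a b. M b a) k \<beta> \<alpha> = gminor M k \<alpha> \<beta>"
proof -
  have "gminor (\<lambda>a b. M b a) k \<beta> \<alpha> = det (transpose_mat (mat k k (\<lambda>(i, j). M (\<alpha> i) (\<beta> j))))"
    unfolding gminor_def by (rule arg_cong[of _ _ det], rule eq_matI) auto
  then show ?thesis by (simp add: gminor_def det_transpose[of _ k])
qed

lemma minors_in_transpose: "minors_in (\<lambda>a b. M b a) J B A k \<longleftrightarrow> minors_in M J A B k"
proof -
  have "gminor (\<lambda>a b. M b a) k \<beta> \<alpha> = gminor M k \<alpha> \<beta>" for \<alpha> \<beta> by (rule gminor_transpose)
  then show ?thesis unfolding minors_in_def by (metis (no_types, lifting))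
qed

lemma gminor_repeated_column:
  assumes "j < k" "j' < k" "j \<noteq> j'" "\<beta> j = \<beta> j'"
  shows "gminor M k \<alpha> \<beta> = 0"
  unfolding gminor_def
  by (rule det_identical_columns[of _ k j j']) (use assms in \<open>auto intro!: eq_vecI\<close>)

context ideal_in begin

lemma gminor_laplace:
  assumes "l < Suc k" "\<And>i. i < Suc k \<Longrightarrow> M (\<alpha> i) (\<beta> l) \<in> R"
    and "\<And>i. i < Suc k \<Longrightarrow> gminor M k (\<lambda>a. \<alpha> (insert_index i a)) (\<lambda>b. \<beta> (insert_index l b)) \<in> J"
  shows "gminor M (Suc k) \<alpha> \<beta> \<in> J"
proof -
  let ?A = "mat (Suc k) (Suc k) (\<lambda>(i, j). M (\<alpha> i) (\<beta> j))"
  have "cofactor ?A i l \<in> J" if "i < Suc k" for i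
  proof -
    have "mat_delete ?A i l = mat k k (\<lambda>(a, b). M (\<alpha> (insert_index i a)) (\<beta> (insert_index l b)))"
      by (rule eq_matI) (auto simp: mat_delete_def insert_index_def)
    then show ?thesis using assms(3)[OF that] R_one R_uminus unfolding cofactor_def gminor_def
      by (auto intro!: J_mult R_power)
  qed
  moreover have "gminor M (Suc k) \<alpha> \<beta> = (\<Sum>i<Suc k. M (\<alpha> i) (\<beta> l) * cofactor ?A i l)"
    unfolding gminor_def using assms(1) by (subst laplace_expansion_column[of _ "Suc k" l]) auto
  ultimately show ?thesis using assms(2) by (auto intro!: J_sum J_mult simp del: sum.lessThan_Suc)
qed

text \<open>Expansion along the new column; the complementary minors use only old columns.\<close>

lemma minors_in_insert_column:
  assumes R: "\<And>a b. a \<in> A \<Longrightarrow> b \<in> insert q B \<Longrightarrow> M a b \<in> R" and "minors_in M J A B k"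
  shows "minors_in M J A (insert q B) (Suc k)"
proof (rule minors_inI)
  fix \<alpha> \<beta> assume \<alpha>: "\<And>i. i < Suc k \<Longrightarrow> \<alpha> i \<in> A" and \<beta>: "\<And>j. j < Suc k \<Longrightarrow> \<beta> j \<in> insert q B"
  show "gminor M (Suc k) \<alpha> \<beta> \<in> J"
  proof (cases "inj_on \<beta> {..<Suc k}")
    case False
    then obtain j j' where "j < Suc k" "j' < Suc k" "j \<noteq> j'" "\<beta> j = \<beta> j'" by (auto simp: inj_on_def)
    then have "gminor M (Suc k) \<alpha> \<beta> = 0" by (rule gminor_repeated_column)
    then show ?thesis using J_zero by simp
  next
    case True
    \<comment> \<open>If the new column does not occur, every column is an old one and the expansion
      may use column 0.\<close>
    define l where "l = (if \<exists>l<Suc k. \<beta> l = q then SOME l. l < Suc k \<and> \<beta> l = q else 0)"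
    have l: "l < Suc k" "\<And>j. j < Suc k \<Longrightarrow> \<beta> j = q \<Longrightarrow> j = l"
    proof -
      show "l < Suc k"
        unfolding l_def using someI_ex[of "\<lambda>l. l < Suc k \<and> \<beta> l = q"] by auto
      fix j assume j: "j < Suc k" "\<beta> j = q"
      then have "l < Suc k \<and> \<beta> l = q"
        unfolding l_def using someI[of "\<lambda>l. l < Suc k \<and> \<beta> l = q" j] by auto
      then show "j = l" using True j by (auto dest: inj_onD)
    qed
    show ?thesis
    proof (rule gminor_laplace[OF l(1)])
      show "M (\<alpha> i) (\<beta> l) \<in> R" if "i < Suc k" for i using R \<alpha> \<beta> l that by blast
      fix i assume i: "i < Suc k"
      show "gminor M k (\<lambda>a. \<alpha> (insert_index i a)) (\<lambda>b. \<beta> (insert_index l b)) \<in> J"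
      proof (rule minors_inD[OF assms(2)])
        show "\<alpha> (insert_index i a) \<in> A" if "a < k" for a using that by (intro \<alpha>) (auto simp: insert_index_def)
        fix b assume b: "b < k"
        have "insert_index l b < Suc k" "insert_index l b \<noteq> l" using b by (auto simp: insert_index_def)
        then show "\<beta> (insert_index l b) \<in> B" using \<beta>[of "insert_index l b"] l(2)[of "insert_index l b"] by blast
      qed
    qed
  qed
qed

lemma minors_in_insert_row:
  assumes "\<And>a b. a \<in> insert p A \<Longrightarrow> b \<in> B \<Longrightarrow> M a b \<in> R" "minors_in M J A B k"
  shows "minors_in M J (insert p A) B (Suc k)"
proof -
  have "minors_in (\<lambda>a b. M b a) J B A k" using assms(2) by (simp only: minors_in_transpose[of M])
  then have "minors_in (\<lambda>a b. M b a) J B (insert p A) (Suc k)"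
    by (intro minors_in_insert_column assms(1))
  then show ?thesis by (simp only: minors_in_transpose[of M])
qed

end

section \<open>Slices at the fixed points\<close>

abbreviation constants :: "zpoly set" where
  "constants \<equiv> range (single 0)"

inductive_set algebra_of :: "zpoly set \<Rightarrow> zpoly set" for G where
  const: "single 0 c \<in> algebra_of G"
| gen: "g \<in> G \<Longrightarrow> g \<in> algebra_of G"
| add: "f \<in> algebra_of G \<Longrightarrow> g \<in> algebra_of G \<Longrightarrow> f + g \<in> algebra_of G"
| mult: "f \<in> algebra_of G \<Longrightarrow> g \<in> algebra_of G \<Longrightarrow> f * g \<in> algebra_of G"

lemma algebra_of_uminus: "f \<in> algebra_of G \<Longrightarrow> - f \<in> algebra_of G"
  using algebra_of.mult[OF algebra_of.const[of "- 1"], of f G] by (simp add: single_uminus)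

lemma algebra_of_one: "1 \<in> algebra_of G"
  using algebra_of.const[of 1 G] by simp

lemma algebra_of_zero: "0 \<in> algebra_of G"
  using algebra_of.const[of 0 G] by simp

lemma algebra_of_subset:
  assumes "G \<subseteq> algebra_of H" shows "algebra_of G \<subseteq> algebra_of H"
proof
  fix f assume "f \<in> algebra_of G"
  then show "f \<in> algebra_of H" by induction (use assms in \<open>auto intro: algebra_of.intros\<close>)
qed

lemma ideal_in_algebra_of: "ideal_in (algebra_of G) (combinations (algebra_of G) H)"
  by unfold_locales
    (auto intro: algebra_of.intros algebra_of_one algebra_of_uminus combinations.zero combinations_add combinations_mult)

lemma constants_subset: "constants \<subseteq> algebra_of G"
  by (auto intro: algebra_of.const)

section \<open>Homogeneous elements and spans modulo an ideal\<close>

definition homogeneous :: "(nat \<Rightarrow>\<^sub>0 int) \<Rightarrow> zpoly \<Rightarrow> bool" where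
  "homogeneous \<mu> f \<longleftrightarrow> (\<forall>m\<in>keys f. zdeg m = \<mu>)"

lemma homogeneous_zero: "homogeneous \<mu> 0"
  by (simp add: homogeneous_def)

lemma homogeneous_const: "homogeneous 0 (single 0 c)"
  by (auto simp: homogeneous_def)

lemma homogeneous_one: "homogeneous 0 1"
  using homogeneous_const[of 1] by simp

lemma homogeneous_add: "homogeneous \<mu> f \<Longrightarrow> homogeneous \<mu> g \<Longrightarrow> homogeneous \<mu> (f + g)"
  unfolding homogeneous_def using Poly_Mapping.keys_add[of f g] by blast

lemma homogeneous_uminus: "homogeneous \<mu> f \<Longrightarrow> homogeneous \<mu> (- f)"
  by (simp add: homogeneous_def)

lemma homogeneous_diff: "homogeneous \<mu> f \<Longrightarrow> homogeneous \<mu> g \<Longrightarrow> homogeneous \<mu> (f - g)"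
  unfolding homogeneous_def using keys_diff[of f g] by blast

lemma homogeneous_sum: "(\<And>a. a \<in> A \<Longrightarrow> homogeneous \<mu> (f a)) \<Longrightarrow> homogeneous \<mu> (sum f A)"
  by (induction A rule: infinite_finite_induct) (auto intro: homogeneous_zero homogeneous_add)

lemma homogeneous_mult:
  assumes "homogeneous \<mu> f" "homogeneous \<nu> g" shows "homogeneous (\<mu> + \<nu>) (f * g)"
  unfolding homogeneous_def
proof
  fix m assume "m \<in> keys (f * g)"
  then obtain x y where "x \<in> keys f" "y \<in> keys g" "m = x + y"
    by (rule keys_mult_ex)
  then show "zdeg m = \<mu> + \<nu>" using assms by (simp add: homogeneous_def zdeg_add)
qed

lemma homogeneous_power: "homogeneous \<mu> f \<Longrightarrow> homogeneous (of_nat k * \<mu>) (f ^ k)"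
  by (induction k) (auto simp: algebra_simps intro: homogeneous_one dest: homogeneous_mult)

definition spanned :: "zpoly set \<Rightarrow> zpoly set \<Rightarrow> zpoly \<Rightarrow> bool" where
  "spanned B J f \<longleftrightarrow> (\<exists>s\<in>combinations constants B. f - s \<in> J)"

lemma spannedE:
  assumes "spanned B J f" obtains s where "s \<in> combinations constants B" "f - s \<in> J"
  using assms unfolding spanned_def by blast

lemma spanned_mono: "spanned B J f \<Longrightarrow> B \<subseteq> B' \<Longrightarrow> J \<subseteq> J' \<Longrightarrow> spanned B' J' f"
  unfolding spanned_def using combinations_mono[of _ constants B constants B'] by blast

context
  fixes R J :: "zpoly set"
  assumes ideal: "ideal_in R J"
begin

interpretation ideal_in R J by (rule ideal)

lemma spanned_in: "f \<in> J \<Longrightarrow> spanned B J f"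
  unfolding spanned_def by (intro bexI[of _ 0]) (auto intro: combinations.zero)

lemma spanned_combination: "f \<in> combinations constants B \<Longrightarrow> spanned B J f"
  unfolding spanned_def by (intro bexI[of _ f]) (auto intro: J_zero)

lemma spanned_add: "spanned B J f \<Longrightarrow> spanned B J g \<Longrightarrow> spanned B J (f + g)"
  unfolding spanned_def
proof (elim bexE)
  fix s t assume "s \<in> combinations constants B" "t \<in> combinations constants B" "f - s \<in> J" "g - t \<in> J"
  then show "\<exists>s\<in>combinations constants B. f + g - s \<in> J"
    using J_add[of "f - s" "g - t"] by (intro bexI[of _ "s + t"]) (auto intro: combinations_add simp: algebra_simps)
qed

lemma spanned_uminus: "spanned B J f \<Longrightarrow> spanned B J (- f)"
  unfolding spanned_def
proof (elim bexE)
  fix s assume s: "s \<in> combinations constants B" "f - s \<in> J"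
  have "single 0 (- 1) * s \<in> combinations constants B"
    by (rule combinations_mult[OF s(1)]) (auto simp: mult_single)
  then show "\<exists>s\<in>combinations constants B. - f - s \<in> J"
    using J_uminus[OF s(2)] by (intro bexI[of _ "- s"]) (auto simp: single_uminus)
qed

end

abbreviation var_degree :: "nat \<Rightarrow> nat \<Rightarrow> (nat \<Rightarrow>\<^sub>0 int)" where
  "var_degree a b \<equiv> single b 1 - single a 1"

text \<open>The coordinate matrix \<open>M\<close> of an affine slice through the fixed point \<open>w\<close> that is transversal to
  the orbit of \<open>w\<close>. The columns of \<open>M\<close> span the flag.\<close>

definition slice :: "nat \<Rightarrow> (nat \<Rightarrow> nat) \<Rightarrow> (nat \<Rightarrow> nat \<Rightarrow> zpoly) \<Rightarrow> bool" where
  "slice n w M \<longleftrightarrow> (\<forall>j\<in>{1..n}. M (w j) j = 1 \<and> (\<forall>j'\<in>{1..n}. j < j' \<longrightarrow> M (w j) j' = 0) \<and>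
     (\<forall>a\<in>{1..n}. a < w j \<longrightarrow> M a j = 0) \<and> (\<forall>a\<in>{1..n}. homogeneous (var_degree a (w j)) (M a j)))"

lemma sliceD:
  assumes "slice n w M" "j \<in> {1..n}"
  shows "M (w j) j = 1" "j' \<in> {1..n} \<Longrightarrow> j < j' \<Longrightarrow> M (w j) j' = 0"
    "a \<in> {1..n} \<Longrightarrow> a < w j \<Longrightarrow> M a j = 0" "a \<in> {1..n} \<Longrightarrow> homogeneous (var_degree a (w j)) (M a j)"
  using assms unfolding slice_def by blast+

definition entries :: "nat \<Rightarrow> (nat \<Rightarrow> nat \<Rightarrow> zpoly) \<Rightarrow> zpoly set" where
  "entries n M = {M a j | a j. a \<in> {1..n} \<and> j \<in> {1..n}}"

abbreviation coordinate_ring :: "nat \<Rightarrow> (nat \<Rightarrow> nat \<Rightarrow> zpoly) \<Rightarrow> zpoly set" where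
  "coordinate_ring n M \<equiv> algebra_of (entries n M)"

lemma entry_in: "a \<in> {1..n} \<Longrightarrow> j \<in> {1..n} \<Longrightarrow> M a j \<in> coordinate_ring n M"
  by (rule algebra_of.gen) (auto simp: entries_def)

text \<open>All boxes occur, because ideals of different permutations are compared box by box, while
  the essential set changes from step to step.\<close>

definition rank_minors :: "nat \<Rightarrow> (nat \<Rightarrow> nat) \<Rightarrow> (nat \<Rightarrow> nat \<Rightarrow> zpoly) \<Rightarrow> zpoly set" where
  "rank_minors n v M = {gminor M (Suc (rk v p q)) \<alpha> \<beta> | p q \<alpha> \<beta>. p \<in> {1..n} \<and> q \<in> {1..n} \<and>
     (\<forall>i<Suc (rk v p q). \<alpha> i \<in> {p..n}) \<and> (\<forall>j<Suc (rk v p q). \<beta> j \<in> {1..q})}"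

definition schubert_ideal :: "nat \<Rightarrow> (nat \<Rightarrow> nat) \<Rightarrow> (nat \<Rightarrow> nat \<Rightarrow> zpoly) \<Rightarrow> zpoly set" where
  "schubert_ideal n v M = combinations (coordinate_ring n M) (rank_minors n v M)"

lemma ideal_in_schubert_ideal: "ideal_in (coordinate_ring n M) (schubert_ideal n v M)"
  unfolding schubert_ideal_def by (rule ideal_in_algebra_of)

lemma rank_minors_in_schubert_ideal: "rank_minors n v M \<subseteq> schubert_ideal n v M"
  unfolding schubert_ideal_def using combinations_base[OF algebra_of_one] by blast

lemma minors_in_schubert_ideal:
  assumes "p \<in> {1..n}" "q \<le> n"
  shows "minors_in M (schubert_ideal n v M) {p..n} {1..q} (Suc (rk v p q))"
proof (rule minors_inI)
  fix \<alpha> \<beta> assume *: "\<And>i. i < Suc (rk v p q) \<Longrightarrow> \<alpha> i \<in> {p..n}" "\<And>j. j < Suc (rk v p q) \<Longrightarrow> \<beta> j \<in> {1..q}"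
  have "q \<in> {1..n}" using *(2)[of 0] assms by auto
  then have "gminor M (Suc (rk v p q)) \<alpha> \<beta> \<in> rank_minors n v M"
    unfolding rank_minors_def using assms * by blast
  then show "gminor M (Suc (rk v p q)) \<alpha> \<beta> \<in> schubert_ideal n v M"
    using rank_minors_in_schubert_ideal by blast
qed

text \<open>The free coordinate in row w(j) and column i of the slice has the degree of the variable
  (w j, w i). Monomials in these variables serve as labels carrying degrees.\<close>

definition slice_vars :: "nat \<Rightarrow> (nat \<Rightarrow> nat) \<Rightarrow> (nat \<times> nat) set" where
  "slice_vars n w = (\<lambda>(i, j). (w j, w i)) ` noninv n w"

definition slice_denom :: "nat \<Rightarrow> (nat \<Rightarrow> nat) \<Rightarrow> nat laurent" where
  "slice_denom n w = (\<Prod>(i, j)\<in>noninv n w. wt True (w i) (w j))"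

lemma wt_True_eq_factor: "wt True a b = factor (var_degree b a)"
  by (simp add: wt_def lvar_times_lvar_inv)

lemma cf_True_eq: "cf True a b = single (var_degree b a) 1"
  by (simp add: cf_def lvar_times_lvar_inv)

lemma finitely_graded_monomials: "finitely_graded (exponents (zvars n)) zdeg"
proof -
  let ?\<delta> = "\<lambda>(i, j). var_degree i j"
  have fin: "finite (zvars n)"
    by (rule finite_subset[of _ "{1..n} \<times> {1..n}"]) (auto simp: zvars_def)
  have pos: "0 < height (?\<delta> x)" if "x \<in> zvars n" for x
    using that by (auto simp: zvars_def height_diff)
  have h: "int (lookup m x) \<le> height (zdeg m)" if "m \<in> exponents (zvars n)" for m x
    unfolding zdeg_eq by (rule height_exponent_degree[of "zvars n" ?\<delta> m x, OF pos that])
  show ?thesis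
    unfolding finitely_graded_def
  proof (intro conjI allI ballI)
    fix \<mu>
    show "finite {m \<in> exponents (zvars n). zdeg m = \<mu>}"
    proof (rule finite_subset[OF _ finite_exponents_bounded[OF fin, of "nat (height \<mu>)"]])
      show "{m \<in> exponents (zvars n). zdeg m = \<mu>}
        \<subseteq> {\<alpha> \<in> exponents (zvars n). \<forall>x. lookup \<alpha> x \<le> nat (height \<mu>)}"
      proof clarify
        fix m x assume "m \<in> exponents (zvars n)" "\<mu> = zdeg m"
        then show "lookup m x \<le> nat (height (zdeg m))" using nat_mono[OF h, of m x] by simp
      qed
    qed
    fix m assume m: "m \<in> exponents (zvars n)"
    show "0 \<le> height (zdeg m)" using h[OF m, of undefined] by linarith
  qed
qed

lemma slice_vars_subset: "w permutes {1..n} \<Longrightarrow> slice_vars n w \<subseteq> zvars n"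
  using perm_bounds[of w n] by (force simp: slice_vars_def noninv_def zvars_def)

text \<open>The column operation behind the descent: \<open>z\<close> times column i + 1 is
  subtracted from column i and the two columns are exchanged. The cleared entry \<open>z\<close> is
  the additional coordinate of the slice at \<open>w\<close>.\<close>

locale slice_step =
  fixes n :: nat and w :: "nat \<Rightarrow> nat" and i :: nat and M :: "nat \<Rightarrow> nat \<Rightarrow> zpoly"
  assumes w: "w permutes {1..n}" and asc: "ascent n w i" and slice: "slice n w M"
begin

definition z :: zpoly where "z = M (w (i + 1)) i"

definition M' :: "nat \<Rightarrow> nat \<Rightarrow> zpoly" where
  "M' a j = (if j = i then M a (i + 1) else if j = i + 1 then M a i - z * M a (i + 1) else M a j)"

abbreviation "w' \<equiv> w \<circ> transpose i (i + 1)"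

lemma bounds: "i \<in> {1..n}" "i + 1 \<in> {1..n}" "w i < w (i + 1)" "w i \<in> {1..n}" "w (i + 1) \<in> {1..n}"
  using ascent_bounds[OF asc] asc perm_range(1)[OF w, of i] perm_range(1)[OF w, of "i + 1"]
  by (auto simp: ascent_def)

lemma homogeneous_z: "homogeneous (var_degree (w (i + 1)) (w i)) z"
  unfolding z_def using sliceD(4)[OF slice bounds(1,5)] .

lemma slice': "slice n w' M'"
  unfolding slice_def
proof (intro ballI conjI impI)
  fix j assume j: "j \<in> {1..n}"
  consider "j = i" | "j = i + 1" | "j \<noteq> i" "j \<noteq> i + 1" by blast
  note cs = this
  have wj: "w j \<in> {1..n}" using perm_range(1)[OF w] j by blast
  show "M' (w' j) j = 1"
    using cs
  proof cases
    case 1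
    then show ?thesis using sliceD(1)[OF slice bounds(2)] by (simp add: M'_def)
  next
    case 2
    then show ?thesis
      using sliceD(1)[OF slice bounds(1)] sliceD(2)[OF slice bounds(1,2)] by (simp add: M'_def)
  next
    case 3
    then show ?thesis using sliceD(1)[OF slice j] by (simp add: M'_def)
  qed
  show "M' (w' j) j' = 0" if j': "j' \<in> {1..n}" "j < j'" for j'
    using cs
  proof cases
    case 1
    then show ?thesis
      using sliceD(1)[OF slice bounds(2)] sliceD(2)[OF slice bounds(2), of j'] j' by (auto simp: M'_def z_def)
  next
    case 2
    then show ?thesis using sliceD(2)[OF slice bounds(1), of j'] j' by (auto simp: M'_def)
  next
    case 3
    then have "w' j = w j" by simp
    then show ?thesis
      using 3 j' sliceD(2)[OF slice j, of j'] sliceD(2)[OF slice j, of i] sliceD(2)[OF slice j, of "i + 1"] bounds(1,2)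
      unfolding M'_def by (auto simp del: One_nat_def)
  qed
  show "M' a j = 0" if a: "a \<in> {1..n}" "a < w' j" for a
    using cs
  proof cases
    case 1
    then show ?thesis using sliceD(3)[OF slice bounds(2) a(1)] a(2) by (simp add: M'_def)
  next
    case 2
    then show ?thesis
      using sliceD(3)[OF slice bounds(1) a(1)] sliceD(3)[OF slice bounds(2) a(1)] a(2) bounds(3) by (simp add: M'_def)
  next
    case 3
    then show ?thesis using sliceD(3)[OF slice j a(1)] a(2) by (simp add: M'_def)
  qed
  show "homogeneous (var_degree a (w' j)) (M' a j)" if a: "a \<in> {1..n}" for a
    using cs
  proof cases
    case 1
    then show ?thesis using sliceD(4)[OF slice bounds(2) a] by (simp add: M'_def)
  next
    case 2
    have "homogeneous (var_degree (w (i + 1)) (w i) + var_degree a (w (i + 1))) (z * M a (i + 1))"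
      by (rule homogeneous_mult[OF homogeneous_z sliceD(4)[OF slice bounds(2) a]])
    then have "homogeneous (var_degree a (w i)) (z * M a (i + 1))" by (simp add: algebra_simps)
    then show ?thesis using sliceD(4)[OF slice bounds(1) a] 2 by (simp add: M'_def homogeneous_diff)
  next
    case 3
    then show ?thesis using sliceD(4)[OF slice j a] by (simp add: M'_def)
  qed
qed

interpretation Z: ideal_in "coordinate_ring n M" "{0}"
  by unfold_locales (auto intro: algebra_of.intros algebra_of_one algebra_of_uminus)

lemma z_in: "z \<in> coordinate_ring n M"
  unfolding z_def by (rule entry_in) (use bounds in auto)

lemma M'_in: "a \<in> {1..n} \<Longrightarrow> j \<in> {1..n} \<Longrightarrow> M' a j \<in> coordinate_ring n M"
  unfolding M'_def using bounds(1,2)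
  by (auto intro!: entry_in Z.R_diff Z.R_mult z_in simp del: One_nat_def)

lemma coordinate_ring_subset: "coordinate_ring n M' \<subseteq> coordinate_ring n M"
  by (rule algebra_of_subset, unfold entries_def[of n M']) (blast intro: M'_in)

lemma M_eq: "M a i = z * M' a i + M' a (i + 1)"
  by (simp add: M'_def)

text \<open>The operation is undone with the help of \<open>z\<close> alone, so \<open>z\<close>
  generates the larger ring over the smaller one.\<close>

lemma coordinate_ring_expand:
  assumes "f \<in> coordinate_ring n M"
  shows "f \<in> combinations (coordinate_ring n M') (range (\<lambda>k. z ^ k))" (is "_ \<in> ?C")
  using assms
proof induction
  have base: "r \<in> ?C" if "r \<in> coordinate_ring n M'" for r
  proof -
    have "r * z ^ 0 + 0 \<in> ?C" by (rule combinations.step[OF that rangeI combinations.zero])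
    then show ?thesis by simp
  qed
  have shift: "z ^ k * y \<in> ?C" if "y \<in> ?C" for k y
    using that
  proof induction
    case (step r g x)
    then obtain l where "g = z ^ l" by auto
    have "r * z ^ (k + l) + z ^ k * x \<in> ?C" using step by (intro combinations.step) auto
    then show ?case by (simp add: \<open>g = z ^ l\<close> algebra_simps power_add)
  qed (simp add: combinations.zero)
  {
    case (const c)
    show ?case by (rule base[OF algebra_of.const])
  next
    case (gen g)
    then obtain a j where g: "g = M a j" "a \<in> {1..n}" "j \<in> {1..n}" by (auto simp: entries_def)
    consider "j = i" | "j = i + 1" | "j \<noteq> i" "j \<noteq> i + 1" by blast
    then show ?case
    proof cases
      case 1
      have "M' a i \<in> coordinate_ring n M'" "M' a (i + 1) \<in> coordinate_ring n M'"
        by (rule entry_in[OF g(2) bounds(1)], rule entry_in[OF g(2) bounds(2)])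
      then have "z ^ 1 * M' a i + M' a (i + 1) \<in> ?C" by (intro combinations_add shift base)
      then show ?thesis unfolding g 1 M_eq[of a] by (simp only: power_one_right)
    next
      case 2
      then have "g = M' a i" using g by (simp add: M'_def)
      then show ?thesis using base[OF entry_in[OF g(2) bounds(1)]] by simp
    next
      case 3
      then have "g = M' a j" using g by (simp add: M'_def)
      then show ?thesis using base[OF entry_in[OF g(2,3)]] by simp
    qed
  next
    case (add f g)
    then show ?case by (intro combinations_add)
  next
    case (mult f g)
    have "f * g \<in> ?C" if "f \<in> ?C" for f
      using that
    proof induction
      case (step r h x)
      then obtain k where h: "h = z ^ k" by auto
      have "r * (z ^ k * g) \<in> ?C"
        by (rule combinations_mult[OF shift[OF mult.IH(2)]]) (auto intro: algebra_of.mult step.hyps)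
      then have "r * (z ^ k * g) + x * g \<in> ?C" using step by (intro combinations_add)
      then show ?case by (simp add: h algebra_simps)
    qed (simp add: combinations.zero)
    then show ?case using mult.IH(1) by blast
  }
qed

end

context slice_step begin

text \<open>For q \<noteq> i the columns i and i + 1 are both among the first \<open>q\<close> or
  both beyond, so the operation does not leave the span of the first \<open>q\<close>
  columns.\<close>

lemma minors_in_other:
  assumes "p \<in> {1..n}" "q \<le> n" "q \<noteq> i"
  shows "minors_in M' (schubert_ideal n v M) {p..n} {1..q} (Suc (rk v p q))"
proof (rule minors_inI)
  interpret J: ideal_in "coordinate_ring n M" "schubert_ideal n v M" by (rule ideal_in_schubert_ideal)
  let ?k = "Suc (rk v p q)"
  fix \<alpha> \<beta> assume \<alpha>: "\<And>i. i < ?k \<Longrightarrow> \<alpha> i \<in> {p..n}" and \<beta>: "\<And>j. j < ?k \<Longrightarrow> \<beta> j \<in> {1..q}"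
  have \<alpha>n: "\<alpha> x \<in> {1..n}" if "x < ?k" for x using \<alpha>[OF that] assms(1) by auto
  have \<beta>n: "\<beta> x \<in> {1..n}" if "x < ?k" for x using \<beta>[OF that] assms(2) by auto
  \<comment> \<open>Coefficients of the columns of \<open>M'\<close> in terms of those of
    \<open>M\<close>.\<close>
  define u where "u y c = (if \<beta> y = i then if c = i + 1 then 1 else 0
    else if \<beta> y = i + 1 then if c = i then 1 else if c = i + 1 then - z else 0
    else if c = \<beta> y then 1 else 0)" for y c
  show "gminor M' ?k \<alpha> \<beta> \<in> schubert_ideal n v M"
    unfolding gminor_def
  proof (rule J.det_columns_replace[of ?k "\<lambda>x y. M' (\<alpha> x) (\<beta> y)" "{1..q}" "\<lambda>x c. M (\<alpha> x) c" u])
    show "M' (\<alpha> x) (\<beta> y) \<in> coordinate_ring n M" if "x < ?k" "y < ?k" for x y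
      using that by (intro M'_in \<alpha>n \<beta>n)
    show "M (\<alpha> x) c \<in> coordinate_ring n M" if "x < ?k" "c \<in> {1..q}" for x c
      using that assms(2) by (intro entry_in \<alpha>n) auto
    show "u y c \<in> coordinate_ring n M" for y c
      unfolding u_def using J.R_zero J.R_one J.R_uminus[OF z_in] by auto
    show "det (mat ?k ?k (\<lambda>(x, y). M (\<alpha> x) (\<beta>' y))) \<in> schubert_ideal n v M"
      if "\<And>y. y < ?k \<Longrightarrow> \<beta>' y \<in> {1..q}" for \<beta>'
      using minors_inD[OF minors_in_schubert_ideal[OF assms(1,2)] \<alpha> that] unfolding gminor_def .
    fix x y assume xy: "x < ?k" "y < ?k"
    have 1: "(\<Sum>c\<in>{1..q}. (if c = d then 1 else 0) * M (\<alpha> x) c) = M (\<alpha> x) d" if "d \<in> {1..q}" for d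
      using that by (simp add: if_distrib[of "\<lambda>t. t * _"] cong: if_cong)
    have "M' (\<alpha> x) (\<beta> y) = (\<Sum>c\<in>{1..q}. u y c * M (\<alpha> x) c)"
    proof (cases "\<beta> y = i \<or> \<beta> y = i + 1")
      case True
      then have iq: "i \<in> {1..q}" "i + 1 \<in> {1..q}" using \<beta>[OF xy(2)] assms(3) bounds(1) by auto
      show ?thesis
      proof (cases "\<beta> y = i")
        case True
        then show ?thesis using 1[OF iq(2)] by (simp add: u_def M'_def)
      next
        case False
        then have "\<beta> y = i + 1" using True by blast
        then have "u y c = (if c = i then 1 else 0) - z * (if c = i + 1 then 1 else 0)" for c
          by (simp add: u_def)
        then have "(\<Sum>c\<in>{1..q}. u y c * M (\<alpha> x) c)
            = (\<Sum>c\<in>{1..q}. (if c = i then 1 else 0) * M (\<alpha> x) c) - z * (\<Sum>c\<in>{1..q}. (if c = i + 1 then 1 else 0) * M (\<alpha> x) c)"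
          by (simp only: left_diff_distrib sum_subtractf sum_distrib_left mult.assoc)
        then show ?thesis unfolding 1[OF iq(1)] 1[OF iq(2)] using \<open>\<beta> y = i + 1\<close> by (simp add: M'_def)
      qed
    next
      case False
      then have "M' (\<alpha> x) (\<beta> y) = M (\<alpha> x) (\<beta> y)" "u y = (\<lambda>c. if c = \<beta> y then 1 else 0)"
        by (auto simp: M'_def u_def fun_eq_iff)
      then show ?thesis using 1[OF \<beta>[OF xy(2)]] by simp
    qed
    then show "M' (\<alpha> x) (\<beta> y) - (\<Sum>c\<in>{1..q}. u y c * M (\<alpha> x) c) \<in> schubert_ideal n v M"
      using J.J_zero by simp
  qed
qed

text \<open>At a descent of \<open>v'\<close> the rank condition in column \<open>i\<close> follows
  from the one in column i - 1 or i + 1, where the operation is harmless.\<close>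

lemma minors_in_descent:
  assumes desc: "v' (i + 1) < v' i" and rk: "\<And>p q. q \<noteq> i \<Longrightarrow> rk v' p q = rk v p q"
    and p: "p \<in> {1..n}"
  shows "minors_in M' (schubert_ideal n v M) {p..n} {1..i} (Suc (rk v' p i))"
proof -
  interpret J: ideal_in "coordinate_ring n M" "schubert_ideal n v M" by (rule ideal_in_schubert_ideal)
  obtain j where j: "i = Suc j" using bounds(1) by (cases i) auto
  show ?thesis
  proof (cases "p \<le> v' i")
    case True
    have "minors_in M' (schubert_ideal n v M) {p..n} {1..j} (Suc (rk v p j))"
      by (rule minors_in_other) (use p bounds(1) in \<open>auto simp: j\<close>)
    moreover have "M' a b \<in> coordinate_ring n M" if "a \<in> {p..n}" "b \<in> insert i {1..j}" for a b
      using that p bounds(1) j by (intro M'_in) auto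
    ultimately have "minors_in M' (schubert_ideal n v M) {p..n} (insert i {1..j}) (Suc (Suc (rk v p j)))"
      by (intro J.minors_in_insert_column)
    moreover have "rk v' p i = Suc (rk v p j)" using True rk[of j p] by (simp add: j rk_Suc)
    moreover have "{1..i} = insert i {1..j}" by (auto simp: j)
    ultimately show ?thesis by (simp only:)
  next
    case False
    then have "rk v' p (i + 1) = rk v' p i" using desc by (simp add: rk_Suc)
    then have "rk v p (i + 1) = rk v' p i" using rk[of "i + 1" p] by simp
    moreover have "minors_in M' (schubert_ideal n v M) {p..n} {1..i + 1} (Suc (rk v p (i + 1)))"
      by (rule minors_in_other) (use p bounds(2) in auto)
    ultimately show ?thesis by (auto elim: minors_in_mono)
  qed
qed

lemma schubert_ideal_subset:
  assumes desc: "v' (i + 1) < v' i" and rk: "\<And>p q. q \<noteq> i \<Longrightarrow> rk v' p q = rk v p q"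
  shows "schubert_ideal n v' M' \<subseteq> schubert_ideal n v M"
proof
  interpret J: ideal_in "coordinate_ring n M" "schubert_ideal n v M" by (rule ideal_in_schubert_ideal)
  have "rank_minors n v' M' \<subseteq> schubert_ideal n v M"
  proof
    fix g assume "g \<in> rank_minors n v' M'"
    then obtain p q \<alpha> \<beta> where g: "g = gminor M' (Suc (rk v' p q)) \<alpha> \<beta>" and pq: "p \<in> {1..n}" "q \<in> {1..n}"
      and \<alpha>: "\<And>i. i < Suc (rk v' p q) \<Longrightarrow> \<alpha> i \<in> {p..n}" and \<beta>: "\<And>j. j < Suc (rk v' p q) \<Longrightarrow> \<beta> j \<in> {1..q}"
      unfolding rank_minors_def by blast
    have "minors_in M' (schubert_ideal n v M) {p..n} {1..q} (Suc (rk v' p q))"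
    proof (cases "q = i")
      case True
      then show ?thesis using minors_in_descent[OF desc rk pq(1)] by simp
    next
      case False
      then show ?thesis using minors_in_other[of p q v] rk[of q p] pq by simp
    qed
    then show "g \<in> schubert_ideal n v M" unfolding g by (rule minors_inD) (use \<alpha> \<beta> in auto)
  qed
  moreover fix x assume "x \<in> schubert_ideal n v' M'"
  then have "x \<in> combinations (coordinate_ring n M) (rank_minors n v' M')"
    unfolding schubert_ideal_def using coordinate_ring_subset by (auto elim: combinations_mono)
  ultimately show "x \<in> schubert_ideal n v M" by (intro J.combinations_in_J)
qed

text \<open>Only q = i with column \<open>i\<close> among the chosen ones is new. There column
  \<open>i\<close> of \<open>M\<close> is \<open>z\<close> times one column of \<open>M'\<close>
  plus the next, and expanding the minor of \<open>M\<close> in it gives the two terms.\<close>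

lemma gminor_lift:
  assumes pq: "p \<in> {1..n}" "q \<in> {1..n}"
    and \<alpha>: "\<And>i. i < Suc (rk v p q) \<Longrightarrow> \<alpha> i \<in> {p..n}" and \<beta>: "\<And>j. j < Suc (rk v p q) \<Longrightarrow> \<beta> j \<in> {1..q}"
  shows "\<exists>g\<in>coordinate_ring n M'. z * gminor M' (Suc (rk v p q)) \<alpha> \<beta> + g \<in> schubert_ideal n v M"
proof -
  interpret J: ideal_in "coordinate_ring n M" "schubert_ideal n v M" by (rule ideal_in_schubert_ideal)
  interpret R': ideal_in "coordinate_ring n M'" "{0}"
    by unfold_locales (auto intro: algebra_of.intros algebra_of_one algebra_of_uminus)
  interpret U: ideal_in UNIV "{0::zpoly}" by unfold_locales auto
  let ?k = "Suc (rk v p q)" and ?J = "schubert_ideal n v M"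
  have trivial: ?thesis if "gminor M' ?k \<alpha> \<beta> \<in> ?J"
    using J.J_mult[OF z_in that] algebra_of_zero by (intro bexI[of _ 0]) auto
  have min: "gminor M ?k \<alpha> \<beta> \<in> ?J" by (rule minors_inD[OF minors_in_schubert_ideal]) (use pq \<alpha> \<beta> in auto)
  show ?thesis
  proof (cases "q = i")
    case False
    then show ?thesis using pq \<alpha> \<beta> by (intro trivial minors_inD[OF minors_in_other]) auto
  next
    case q: True
    show ?thesis
    proof (cases "inj_on \<beta> {..<?k}")
      case False
      then obtain j j' where "j < ?k" "j' < ?k" "j \<noteq> j'" "\<beta> j = \<beta> j'" by (auto simp: inj_on_def)
      then have "gminor M' ?k \<alpha> \<beta> = 0" by (rule gminor_repeated_column)
      then show ?thesis using J.J_zero by (intro trivial) simp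
    next
      case inj: True
      show ?thesis
      proof (cases "\<exists>l<?k. \<beta> l = i")
        case False
        have "gminor M' ?k \<alpha> \<beta> = gminor M ?k \<alpha> \<beta>"
        proof (rule gminor_cong)
          fix x y assume "x < ?k" "y < ?k"
          then have "\<beta> y < i" using False \<beta>[of y] q by (metis atLeastAtMost_iff le_neq_implies_less)
          then show "M' (\<alpha> x) (\<beta> y) = M (\<alpha> x) (\<beta> y)" by (simp add: M'_def)
        qed
        then show ?thesis using min by (intro trivial) simp
      next
        case True
        then obtain l where l: "l < ?k" "\<beta> l = i" by blast
        have other: "\<beta> y < i" if "y < ?k" "y \<noteq> l" for y
          using inj_onD[OF inj, of y l] that l \<beta>[of y] q by (auto simp: order.order_iff_strict)
        define g where "g = gminor M' ?k \<alpha> (\<beta>(l := i + 1))"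
        have "det (mat ?k ?k (\<lambda>(x, y). M (\<alpha> x) (\<beta> y)))
            - (\<Sum>c\<in>{i, i + 1}. (if c = i then z else 1) * det (mat ?k ?k (\<lambda>(x, y). if y = l then M' (\<alpha> x) c else M (\<alpha> x) (\<beta> y)))) \<in> {0}"
          by (rule U.det_column_expand[OF l(1)]) (auto simp: l(2) M_eq)
        moreover have "det (mat ?k ?k (\<lambda>(x, y). if y = l then M' (\<alpha> x) c else M (\<alpha> x) (\<beta> y))) = gminor M' ?k \<alpha> (\<beta>(l := c))" for c
          unfolding gminor_def by (rule arg_cong[of _ _ det], rule eq_matI) (use other in \<open>fastforce simp: M'_def\<close>)+
        moreover have "\<beta>(l := i) = \<beta>" using l(2) by auto
        ultimately have "gminor M ?k \<alpha> \<beta> = z * gminor M' ?k \<alpha> \<beta> + g"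
          by (simp add: gminor_def[of M] g_def)
        moreover have "g \<in> coordinate_ring n M'"
          unfolding g_def gminor_def
        proof (rule R'.R_det)
          fix x y assume "x < ?k" "y < ?k"
          then show "M' (\<alpha> x) ((\<beta>(l := i + 1)) y) \<in> coordinate_ring n M'"
            using \<alpha>[of x] \<beta>[of y] pq bounds(2) by (intro entry_in) auto
        qed
        ultimately show ?thesis using min by auto
      qed
    qed
  qed
qed

text \<open>Allows a factor \<open>z\<close> to be traded for an element of the smaller ring, which
  lowers the power of \<open>z\<close> by one.\<close>

lemma schubert_ideal_lift:
  assumes "g \<in> schubert_ideal n v M'"
  shows "\<exists>h\<in>coordinate_ring n M'. z * g + h \<in> schubert_ideal n v M"
  using assms unfolding schubert_ideal_def[of n v M']
proof induction
  case zero
  then show ?case using algebra_of_zero by (auto simp: schubert_ideal_def intro: combinations.zero)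
next
  case (step r g x)
  interpret J: ideal_in "coordinate_ring n M" "schubert_ideal n v M" by (rule ideal_in_schubert_ideal)
  obtain h where h: "h \<in> coordinate_ring n M'" "z * x + h \<in> schubert_ideal n v M" using step.IH by blast
  obtain h' where h': "h' \<in> coordinate_ring n M'" "z * g + h' \<in> schubert_ideal n v M"
    using step.hyps(2) gminor_lift unfolding rank_minors_def by blast
  have "r * (z * g + h') + (z * x + h) \<in> schubert_ideal n v M"
    using step.hyps(1) coordinate_ring_subset by (intro J.J_add J.J_mult h h') auto
  then have "z * (r * g + x) + (r * h' + h) \<in> schubert_ideal n v M" by (simp add: algebra_simps)
  moreover have "r * h' + h \<in> coordinate_ring n M'" by (intro algebra_of.add algebra_of.mult step.hyps(1) h h')
  ultimately show ?case by blast
qed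

end

text \<open>The elements \<open>\<beta> e\<close> need not be monomials; they only have the degrees of the monomials \<open>e\<close>.\<close>

definition spanning_monomials ::
    "nat \<Rightarrow> (nat \<Rightarrow> nat) \<Rightarrow> (nat \<Rightarrow> nat) \<Rightarrow> (nat \<Rightarrow> nat \<Rightarrow> zpoly) \<Rightarrow> zexp set \<Rightarrow> (zexp \<Rightarrow> zpoly) \<Rightarrow> bool" where
  "spanning_monomials n v w M T \<beta> \<longleftrightarrow> T \<subseteq> exponents (slice_vars n w) \<and>
     laurent_times_series (slice_denom n w) (counting T zdeg) = lookup (loc True n v w) \<and>
     (\<forall>e\<in>T. homogeneous (zdeg e) (\<beta> e)) \<and> (\<forall>e\<in>T. \<beta> e \<in> coordinate_ring n M) \<and>
     (\<forall>f\<in>coordinate_ring n M. spanned (\<beta> ` T) (schubert_ideal n v M) f)"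

section \<open>Passing spanning sets from one slice to the next\<close>

lemma spanning_monomialsD:
  assumes "spanning_monomials n v w M T \<beta>"
  shows "T \<subseteq> exponents (slice_vars n w)"
    "laurent_times_series (slice_denom n w) (counting T zdeg) = lookup (loc True n v w)"
    "e \<in> T \<Longrightarrow> homogeneous (zdeg e) (\<beta> e)"
    "f \<in> coordinate_ring n M \<Longrightarrow> spanned (\<beta> ` T) (schubert_ideal n v M) f"
    "e \<in> T \<Longrightarrow> \<beta> e \<in> coordinate_ring n M"
  using assms unfolding spanning_monomials_def by blast+

lemma slice_denom_step:
  assumes "ascent n w i"
  shows "slice_denom n w = wt True (w i) (w (i + 1)) * slice_denom n (w \<circ> transpose i (i + 1))"
  unfolding slice_denom_def by (rule prod_noninv_swap[OF assms])

lemma slice_vars_step: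
  assumes w: "w permutes {1..n}" and asc: "ascent n w i"
  shows "slice_vars n w = insert (w (i + 1), w i) (slice_vars n (w \<circ> transpose i (i + 1)))"
    and "(w (i + 1), w i) \<notin> slice_vars n (w \<circ> transpose i (i + 1))"
proof -
  let ?s = "transpose i (i + 1)"
  have "slice_vars n (w \<circ> ?s) = (\<lambda>(i, j). (w j, w i)) ` (map_prod ?s ?s ` noninv n (w \<circ> ?s))"
    by (simp add: slice_vars_def image_image case_prod_unfold)
  also have "map_prod ?s ?s ` noninv n (w \<circ> ?s) = noninv n w - {(i, i + 1)}"
    using noninv_swap[OF asc] by (simp add: bij_betw_def)
  finally have eq: "slice_vars n (w \<circ> ?s) = (\<lambda>(i, j). (w j, w i)) ` (noninv n w - {(i, i + 1)})" .
  have "(i, i + 1) \<in> noninv n w" using asc by (auto simp: noninv_def ascent_def)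
  then show "slice_vars n w = insert (w (i + 1), w i) (slice_vars n (w \<circ> ?s))"
    unfolding eq slice_vars_def[of n w] by (subst insert_Diff[symmetric], assumption, simp only: image_insert prod.case)
  show "(w (i + 1), w i) \<notin> slice_vars n (w \<circ> ?s)"
    unfolding eq using perm_range(3)[OF w] by auto
qed

definition multiples :: "'x \<Rightarrow> ('x \<Rightarrow>\<^sub>0 nat) set \<Rightarrow> ('x \<Rightarrow>\<^sub>0 nat) set" where
  "multiples x T = {e + single x k | e k. e \<in> T}"

lemma multiples_split:
  assumes "\<And>e. e \<in> T \<Longrightarrow> x \<notin> keys e"
  shows "multiples x T = T \<union> (\<lambda>e. e + single x 1) ` multiples x T"
    "T \<inter> (\<lambda>e. e + single x 1) ` multiples x U = {}"
proof -
  show "multiples x T = T \<union> (\<lambda>e. e + single x 1) ` multiples x T"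
  proof (rule equalityI; rule subsetI)
    fix m assume "m \<in> multiples x T"
    then obtain e k where m: "m = e + single x k" "e \<in> T" by (auto simp: multiples_def)
    show "m \<in> T \<union> (\<lambda>e. e + single x 1) ` multiples x T"
    proof (cases k)
      case 0
      then show ?thesis using m by simp
    next
      case (Suc l)
      then have "m = (e + single x l) + single x 1"
        using m(1) single_add[of x l 1] by (simp add: add.assoc)
      then show ?thesis using m(2) by (auto simp: multiples_def)
    qed
  next
    fix m assume "m \<in> T \<union> (\<lambda>e. e + single x 1) ` multiples x T"
    then show "m \<in> multiples x T"
    proof
      assume "m \<in> T"
      then show ?thesis unfolding multiples_def by (intro CollectI exI[of _ m] exI[of _ 0]) simp
    next
      assume "m \<in> (\<lambda>e. e + single x 1) ` multiples x T"
      then obtain e k where "m = e + single x k + single x 1" "e \<in> T"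
        by (auto simp: multiples_def)
      then have "m = e + single x (k + 1)" "e \<in> T"
        using single_add[of x k 1] by (simp_all only: add.assoc)
      then show ?thesis unfolding multiples_def by blast
    qed
  qed
  have "x \<in> keys (e + single x 1)" for e :: "'a \<Rightarrow>\<^sub>0 nat"
    by (simp add: in_keys_iff lookup_add)
  then show "T \<inter> (\<lambda>e. e + single x 1) ` multiples x U = {}" using assms by blast
qed

lemma multiples_exponents:
  "T \<subseteq> exponents V \<Longrightarrow> multiples x T \<subseteq> exponents (insert x V)"
  using Poly_Mapping.keys_add by (fastforce simp: multiples_def exponents_def split: if_splits)

context slice_step begin

abbreviation "x \<equiv> (w (i + 1), w i)"

lemma zdeg_x: "zdeg (single x k) = of_nat k * var_degree (w (i + 1)) (w i)"
  by (rule zdeg_single)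

lemma zdeg_add_x: "zdeg (e + single x 1) = zdeg e + var_degree (w (i + 1)) (w i)"
  by (simp only: zdeg_add zdeg_x of_nat_1 mult_1)

lemma T_notin: "T \<subseteq> exponents (slice_vars n w') \<Longrightarrow> e \<in> T \<Longrightarrow> x \<notin> keys e"
  using slice_vars_step(2)[OF w asc] by (auto simp: exponents_def)

lemma multiples_graded:
  assumes "T \<subseteq> exponents (slice_vars n w')"
  shows "multiples x T \<subseteq> exponents (slice_vars n w)" "finitely_graded (multiples x T) zdeg"
proof -
  show 1: "multiples x T \<subseteq> exponents (slice_vars n w)"
    unfolding slice_vars_step(1)[OF w asc] by (rule multiples_exponents[OF assms])
  have "exponents (slice_vars n w) \<subseteq> exponents (zvars n)"
    using slice_vars_subset[OF w] by (auto simp: exponents_def)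
  with 1 show "finitely_graded (multiples x T) zdeg"
    by (intro finitely_graded_subset[OF finitely_graded_monomials]) auto
qed

lemma counting_multiples:
  assumes "T \<subseteq> exponents (slice_vars n w')"
  shows "laurent_times_series (wt True (w i) (w (i + 1))) (counting (multiples x T) zdeg) = counting T zdeg"
  unfolding wt_True_eq_factor
proof (rule counting_shift[where s = "\<lambda>e. e + single x 1"])
  show "finitely_graded (multiples x T) zdeg" by (rule multiples_graded(2)[OF assms])
  show "multiples x T = T \<union> (\<lambda>e. e + single x 1) ` multiples x T"
    "T \<inter> (\<lambda>e. e + single x 1) ` multiples x T = {}"
    using multiples_split[OF T_notin[OF assms]] by blast+
qed (simp add: inj_on_def, rule zdeg_add_x)

lemma loc_descent:
  assumes v: "v permutes {1..n}" and d: "v (i + 1) < v i"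
  shows "loc True n v w' = loc True n v w"
proof -
  let ?s = "transpose i (i + 1)"
  have vs: "v \<circ> ?s permutes {1..n}" "ascent n (v \<circ> ?s) i"
    using permutes_comp_swap[OF v bounds(1,2)] d bounds(1,2) by (auto simp: ascent_def)
  have invol: "v \<circ> ?s \<circ> ?s = v" by (auto simp: fun_eq_iff)
  show ?thesis using loc_swap[OF vs w, of True] unfolding invol .
qed

text \<open>If \<open>\<beta>\<close> parametrizes spanning elements for the smaller slice, then \<open>z\<^sup>k\<close> times these elements
  parametrizes the candidates for the larger slice.\<close>

definition lifted :: "(zexp \<Rightarrow> zpoly) \<Rightarrow> zexp \<Rightarrow> zpoly" where
  "lifted \<beta> m = z ^ lookup m x * \<beta> (m - single x (lookup m x))"

lemma lifted_eq:
  assumes "T \<subseteq> exponents (slice_vars n w')" "e \<in> T"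
  shows "lifted \<beta> (e + single x k) = z ^ k * \<beta> e"
proof -
  have "lookup e x = 0" using T_notin[OF assms] by (simp add: in_keys_iff)
  then show ?thesis by (simp add: lifted_def lookup_add)
qed

lemma homogeneous_lifted:
  assumes "homogeneous (zdeg e) (\<beta> e)"
  shows "homogeneous (zdeg (e + single x k)) (z ^ k * \<beta> e)"
  using homogeneous_mult[OF homogeneous_power[OF homogeneous_z, of k] assms]
  unfolding zdeg_add zdeg_x by (simp only: add.commute)

text \<open>At a descent of \<open>v\<close> the smaller ideal is contained in the larger one, so
  powers of \<open>z\<close> times the old elements still span; correspondingly \<open>loc\<close>
  is unchanged between the two points.\<close>

lemma spanning_descent:
  assumes v: "v permutes {1..n}" and d: "v (i + 1) < v i" and T: "spanning_monomials n v w' M' T \<beta>"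
  shows "spanning_monomials n v w M (multiples x T) (lifted \<beta>)"
  unfolding spanning_monomials_def
proof (intro conjI ballI)
  let ?J = "schubert_ideal n v M"
  note id = ideal_in_schubert_ideal[of n M v]
  interpret J: ideal_in "coordinate_ring n M" ?J by (rule id)
  have Tv: "T \<subseteq> exponents (slice_vars n w')" using T by (simp add: spanning_monomials_def)
  show "multiples x T \<subseteq> exponents (slice_vars n w)" by (rule multiples_graded(1)[OF Tv])
  have "laurent_times_series (slice_denom n w) (counting (multiples x T) zdeg)
      = laurent_times_series (slice_denom n w') (counting T zdeg)"
    unfolding slice_denom_step[OF asc] mult.commute[of "wt _ _ _"] laurent_times_series_mult counting_multiples[OF Tv] ..
  then show "laurent_times_series (slice_denom n w) (counting (multiples x T) zdeg) = lookup (loc True n v w)"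
    using T loc_descent[OF v d] by (simp add: spanning_monomials_def)
  show "homogeneous (zdeg m) (lifted \<beta> m)" if mT: "m \<in> multiples x T" for m
  proof -
    obtain e k where m: "m = e + single x k" "e \<in> T" using mT by (auto simp: multiples_def)
    note hom = spanning_monomialsD(3)[OF T m(2)]
    show ?thesis unfolding m(1) lifted_eq[OF Tv m(2)] by (rule homogeneous_lifted[where \<beta> = \<beta>, OF hom])
  qed
  show "lifted \<beta> m \<in> coordinate_ring n M" if mT: "m \<in> multiples x T" for m
  proof -
    obtain e k where m: "m = e + single x k" "e \<in> T" using mT by (auto simp: multiples_def)
    show ?thesis unfolding m(1) lifted_eq[OF Tv m(2)]
      using spanning_monomialsD(5)[OF T m(2)] coordinate_ring_subset by (intro J.R_mult J.R_power z_in) blast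
  qed
  have power: "spanned (lifted \<beta> ` multiples x T) ?J (r * z ^ k)" if r: "r \<in> coordinate_ring n M'" for r k
  proof -
    obtain s where s: "s \<in> combinations constants (\<beta> ` T)" "r - s \<in> schubert_ideal n v M'"
      by (rule spannedE[OF spanning_monomialsD(4)[OF T r]])
    have "z ^ k * s \<in> combinations constants (lifted \<beta> ` multiples x T)"
      using s(1)
    proof induction
      case (step c g y)
      then obtain e where e: "e \<in> T" "g = \<beta> e" by blast
      have "lifted \<beta> (e + single x k) \<in> lifted \<beta> ` multiples x T"
        using e(1) by (auto simp: multiples_def)
      then have "c * (z ^ k * g) + z ^ k * y \<in> combinations constants (lifted \<beta> ` multiples x T)"
        unfolding lifted_eq[OF Tv e(1)] e(2) using step by (intro combinations.step)
      then show ?case by (simp add: algebra_simps)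
    qed (simp add: combinations.zero)
    moreover have "z ^ k * (r - s) \<in> ?J"
      using s(2) schubert_ideal_subset[of v v, OF d] by (intro J.J_mult J.R_power z_in) auto
    ultimately show ?thesis unfolding spanned_def by (intro bexI[of _ "z ^ k * s"]) (simp_all add: algebra_simps)
  qed
  fix f assume "f \<in> coordinate_ring n M"
  from coordinate_ring_expand[OF this] show "spanned (lifted \<beta> ` multiples x T) ?J f"
  proof induction
    case zero
    show ?case by (rule spanned_in[OF id J.J_zero])
  next
    case (step r g y)
    then show ?case using power by (auto intro!: spanned_add[OF id])
  qed
qed

text \<open>Elements free of \<open>z\<close> are reduced modulo the ideal of the raised
  permutation. Multiples of \<open>z\<close> are reduced modulo the ideal of \<open>v\<close> in the
  smaller slice, at the price of lower powers of \<open>z\<close>. The sizes of the two families are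
  the two terms of \<open>loc_step\<close>.\<close>

lemma spanning_ascent:
  assumes v: "v permutes {1..n}" and a: "v i < v (i + 1)"
    and T: "spanning_monomials n v w' M' T \<beta>"
    and T': "spanning_monomials n (v \<circ> transpose i (i + 1)) w' M' T' \<beta>'"
  shows "spanning_monomials n v w M (T' \<union> (\<lambda>e. e + single x 1) ` multiples x T)
    (\<lambda>m. if x \<in> keys m then lifted \<beta> m else \<beta>' m)"
  (is "spanning_monomials n v w M (T' \<union> ?U) ?\<gamma>")
  unfolding spanning_monomials_def
proof (intro conjI ballI)
  let ?J = "schubert_ideal n v M" and ?v' = "v \<circ> transpose i (i + 1)"
  note id = ideal_in_schubert_ideal[of n M v]
  interpret J: ideal_in "coordinate_ring n M" ?J by (rule id)
  have asc_v: "ascent n v i" using a bounds(1,2) by (auto simp: ascent_def)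
  have Tv: "T \<subseteq> exponents (slice_vars n w')" and Tv': "T' \<subseteq> exponents (slice_vars n w')"
    using T T' by (simp_all add: spanning_monomials_def)
  have U: "?U \<subseteq> multiples x T" using multiples_split(1)[OF T_notin[OF Tv]] by blast
  have T'm: "T' \<subseteq> multiples x T'" using multiples_split(1)[OF T_notin[OF Tv']] by blast
  show sub: "T' \<union> ?U \<subseteq> exponents (slice_vars n w)"
    using U T'm multiples_graded(1)[OF Tv] multiples_graded(1)[OF Tv'] by blast
  have disj: "T' \<inter> ?U = {}" by (rule multiples_split(2)[OF T_notin[OF Tv']])
  have "finitely_graded (T' \<union> ?U) zdeg"
    using sub slice_vars_subset[OF w]
    by (intro finitely_graded_subset[OF finitely_graded_monomials]) (auto simp: exponents_def)
  note cU = counting_Un[OF this disj]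
  have shift: "counting ?U zdeg = laurent_times_series (cf True (w i) (w (i + 1))) (counting (multiples x T) zdeg)"
  proof
    fix \<mu>
    have "counting ?U zdeg \<mu> = counting (multiples x T) zdeg (\<mu> - var_degree (w (i + 1)) (w i))"
      by (rule counting_image) (simp add: inj_on_def, rule zdeg_add_x)
    then show "counting ?U zdeg \<mu> = laurent_times_series (cf True (w i) (w (i + 1))) (counting (multiples x T) zdeg) \<mu>"
      by (simp add: cf_True_eq laurent_times_series_single)
  qed
  show "laurent_times_series (slice_denom n w) (counting (T' \<union> ?U) zdeg) = lookup (loc True n v w)"
  proof
    fix \<mu>
    let ?W = "wt True (w i) (w (i + 1))" and ?C = "cf True (w i) (w (i + 1))" and ?D = "slice_denom n w'"
    have 1: "laurent_times_series (slice_denom n w) (counting T' zdeg)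
        = lookup (?W * loc True n ?v' w)"
    proof -
      have "laurent_times_series (slice_denom n w) (counting T' zdeg)
          = laurent_times_series ?W (laurent_times_series ?D (counting T' zdeg))"
        unfolding slice_denom_step[OF asc] laurent_times_series_mult ..
      also have "laurent_times_series ?D (counting T' zdeg) = lookup (loc True n ?v' w')"
        using T' by (simp only: spanning_monomials_def)
      also have "loc True n ?v' w' = loc True n ?v' w" by (rule loc_swap[OF v asc_v w])
      finally show ?thesis unfolding laurent_times_series_lookup .
    qed
    have 2: "laurent_times_series (slice_denom n w) (counting ?U zdeg) = lookup (?C * loc True n v w')"
    proof -
      have "slice_denom n w * ?C = (?C * ?D) * ?W" unfolding slice_denom_step[OF asc] by (simp only: mult_ac)
      then have "laurent_times_series (slice_denom n w) (counting ?U zdeg)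
          = laurent_times_series ((?C * ?D) * ?W) (counting (multiples x T) zdeg)"
        unfolding shift laurent_times_series_mult[symmetric] by (rule arg_cong)
      also have "\<dots> = laurent_times_series ?C (laurent_times_series ?D (counting T zdeg))"
        unfolding laurent_times_series_mult counting_multiples[OF Tv] ..
      also have "laurent_times_series ?D (counting T zdeg) = lookup (loc True n v w')"
        using T by (simp only: spanning_monomials_def)
      finally show ?thesis unfolding laurent_times_series_lookup .
    qed
    have "?W * loc True n ?v' w + ?C * loc True n v w' = loc True n v w"
      using loc_step[OF v asc_v, of True w] by (simp only: diff_add_cancel)
    then show "laurent_times_series (slice_denom n w) (counting (T' \<union> ?U) zdeg) \<mu> = lookup (loc True n v w) \<mu>"
      unfolding cU laurent_times_series_add_right 1 2 lookup_add[symmetric] by simp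
  qed
  have \<gamma>U: "?\<gamma> (e + single x (Suc k)) = z ^ Suc k * \<beta> e"
    "e + single x (Suc k) \<in> ?U" if "e \<in> T" for e k
  proof -
    have "x \<in> keys (e + single x (Suc k))" by (simp add: in_keys_iff lookup_add)
    then show "?\<gamma> (e + single x (Suc k)) = z ^ Suc k * \<beta> e"
      unfolding if_P lifted_eq[OF Tv that] by simp
    have "e + single x (Suc k) = (e + single x k) + single x 1"
      using single_add[of x k 1] by (simp add: add.assoc)
    then show "e + single x (Suc k) \<in> ?U" using that unfolding multiples_def by blast
  qed
  have \<gamma>T': "?\<gamma> e = \<beta>' e" if "e \<in> T'" for e using T_notin[OF Tv' that] by simp
  show "homogeneous (zdeg m) (?\<gamma> m)" if "m \<in> T' \<union> ?U" for m
    using that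
  proof
    assume "m \<in> T'"
    then show ?thesis using \<gamma>T' spanning_monomialsD(3)[OF T'] by simp
  next
    assume "m \<in> ?U"
    then obtain e k where m: "m = e + single x k + single x 1" "e \<in> T" by (auto simp: multiples_def)
    then have m': "m = e + single x (Suc k)" using single_add[of x k 1] by (simp add: add.assoc)
    note hom = spanning_monomialsD(3)[OF T m(2)]
    show ?thesis unfolding m' \<gamma>U(1)[OF m(2)] by (rule homogeneous_lifted[where \<beta> = \<beta>, OF hom])
  qed
  show "?\<gamma> m \<in> coordinate_ring n M" if "m \<in> T' \<union> ?U" for m
    using that
  proof
    assume m: "m \<in> T'"
    show ?thesis unfolding \<gamma>T'[OF m] using spanning_monomialsD(5)[OF T' m] coordinate_ring_subset by blast
  next
    assume "m \<in> ?U"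
    then obtain e k where m: "m = e + single x k + single x 1" "e \<in> T" by (auto simp: multiples_def)
    then have m': "m = e + single x (Suc k)" using single_add[of x k 1] by (simp add: add.assoc)
    show ?thesis unfolding m' \<gamma>U(1)[OF m(2)]
      using spanning_monomialsD(5)[OF T m(2)] coordinate_ring_subset by (intro J.R_mult J.R_power z_in) blast
  qed
  define G where "G = ?\<gamma> ` (T' \<union> ?U)"
  have GU: "z ^ Suc k * \<beta> e \<in> G" if "e \<in> T" for e k
  proof -
    have "?\<gamma> (e + single x (Suc k)) \<in> G" unfolding G_def by (rule imageI[OF UnI2[OF \<gamma>U(2)[OF that]]])
    then show ?thesis unfolding \<gamma>U(1)[OF that] .
  qed
  have GT: "\<beta>' ` T' \<subseteq> G"
  proof (rule image_subsetI)
    fix e assume e: "e \<in> T'"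
    have "?\<gamma> e \<in> G" unfolding G_def by (rule imageI[OF UnI1[OF e]])
    then show "\<beta>' e \<in> G" unfolding \<gamma>T'[OF e] .
  qed
  have base: "spanned G ?J r" if r: "r \<in> coordinate_ring n M'" for r
  proof -
    have d: "?v' (i + 1) < ?v' i" using a by simp
    have "rk ?v' p q = rk v p q" if "q \<noteq> i" for p q using rk_swap_other[of i q v p] that bounds(1) by simp
    then have "schubert_ideal n ?v' M' \<subseteq> ?J" by (rule schubert_ideal_subset[OF d])
    with spanning_monomialsD(4)[OF T' r] GT show ?thesis by (rule spanned_mono)
  qed
  \<comment> \<open>Induction on the power of \<open>z\<close>: the remainder r - s, multiplied by
    \<open>z\<close>, becomes -h modulo the ideal, and the hypothesis for \<open>k\<close> applies
    to \<open>h\<close>.\<close>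
  have power: "\<forall>r\<in>coordinate_ring n M'. spanned G ?J (r * z ^ k)" for k
  proof (induction k)
    case 0
    show ?case using base by simp
  next
    case (Suc k)
    show ?case
    proof
      fix r assume r: "r \<in> coordinate_ring n M'"
      obtain s where s: "s \<in> combinations constants (\<beta> ` T)" "r - s \<in> schubert_ideal n v M'"
        by (rule spannedE[OF spanning_monomialsD(4)[OF T r]])
      obtain h where h: "h \<in> coordinate_ring n M'" "z * (r - s) + h \<in> ?J"
        by (rule bexE[OF schubert_ideal_lift[OF s(2)]])
      have "z ^ Suc k * s \<in> combinations constants G"
        using s(1)
      proof induction
        case (step c g y)
        then obtain e where e: "e \<in> T" "g = \<beta> e" by blast
        have "c * (z ^ Suc k * g) + z ^ Suc k * y \<in> combinations constants G"
          unfolding e(2) by (intro combinations.step step.hyps(1) step.IH GU e(1))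
        moreover have "c * (z ^ Suc k * g) + z ^ Suc k * y = z ^ Suc k * (c * g + y)" by (simp add: algebra_simps)
        ultimately show ?case by (simp only:)
      qed (simp add: combinations.zero)
      then have 1: "spanned G ?J (z ^ Suc k * s)" by (rule spanned_combination[OF id])
      have 2: "spanned G ?J (z ^ k * (z * (r - s) + h))"
        by (intro spanned_in[OF id] J.J_mult J.R_power z_in h)
      have 3: "spanned G ?J (- (h * z ^ k))"
        using Suc.IH h(1) by (intro spanned_uminus[OF id]) blast
      have "z ^ Suc k * s + (z ^ k * (z * (r - s) + h) + - (h * z ^ k)) = r * z ^ Suc k"
        by (simp add: algebra_simps)
      then show "spanned G ?J (r * z ^ Suc k)"
        using spanned_add[OF id 1 spanned_add[OF id 2 3]] by (simp only:)
    qed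
  qed
  fix f assume "f \<in> coordinate_ring n M"
  from coordinate_ring_expand[OF this] have "spanned G ?J f"
  proof induction
    case zero
    show ?case by (rule spanned_in[OF id J.J_zero])
  next
    case (step r g y)
    then obtain k where k: "g = z ^ k" by blast
    have "spanned G ?J (r * z ^ k)" using power step.hyps(1) by blast
    then show ?case unfolding k by (rule spanned_add[OF id _ step.IH])
  qed
  then show "spanned (?\<gamma> ` (T' \<union> ?U)) ?J f" unfolding G_def .
qed

end

text \<open>For every \<open>q\<close> the first \<open>q\<close> values are at least n + 1 - q, and
  the larger ones are already taken, so the values are forced one after the other.\<close>

lemma w0_unique_of_rank:
  assumes v: "v permutes {1..n}" and full: "\<And>q. q \<in> {1..n} \<Longrightarrow> q \<le> rk v (n + 1 - q) q"
  shows "v = w0 n"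
proof
  have ge: "n + 1 - q \<le> v k" if "q \<in> {1..n}" "1 \<le> k" "k \<le> q" for q k
  proof (rule ccontr)
    assume "\<not> n + 1 - q \<le> v k"
    then have "{k. 1 \<le> k \<and> k \<le> q \<and> n + 1 - q \<le> v k} \<subseteq> {1..q} - {k}" by auto
    then have "rk v (n + 1 - q) q \<le> card ({1..q} - {k})" unfolding rk_def by (intro card_mono) auto
    also have "\<dots> < q" using that by simp
    finally show False using full[OF that(1)] by simp
  qed
  have eq: "v q = n + 1 - q" if "q \<in> {1..n}" for q
    using that
  proof (induction q rule: less_induct)
    case (less q)
    show ?case
    proof (rule ccontr)
      assume "v q \<noteq> n + 1 - q"
      then have gt: "n + 1 - q < v q" using ge[of q q] less.prems by auto
      have le: "v q \<le> n" using perm_bounds(2)[OF v] less.prems by auto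
      let ?k = "n + 1 - v q"
      have "?k \<in> {1..n}" "?k < q" using gt le less.prems by auto
      then have "v ?k = n + 1 - ?k" by (intro less.IH)
      also have "\<dots> = v q" using le by simp
      finally show False using perm_range(3)[OF v, of ?k q] \<open>?k < q\<close> by simp
    qed
  qed
  fix q show "v q = w0 n q"
  proof (cases "q \<in> {1..n}")
    case True
    then show ?thesis unfolding eq[OF True] w0_def by (simp only: if_True)
  next
    case False
    then show ?thesis using perm_range(2)[OF v False] unfolding w0_def by (simp only: if_False)
  qed
qed

text \<open>The slice at \<open>w0\<close> is a single point: each entry outside the antidiagonal is
  forced to vanish by a row or a column condition.\<close>

lemma slice_w0_entry:
  assumes M: "slice n (w0 n) M" and a: "a \<in> {1..n}" and j: "j \<in> {1..n}"
  shows "M a j = (if a = n + 1 - j then 1 else 0)"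
proof -
  let ?k = "n + 1 - a"
  have k: "?k \<in> {1..n}" "w0 n ?k = a" using a by (auto simp: w0_def)
  have wj: "w0 n j = n + 1 - j" using j by (simp add: w0_def)
  consider "a = n + 1 - j" | "a < n + 1 - j" | "n + 1 - j < a" by linarith
  then show ?thesis
  proof cases
    case 1
    then show ?thesis using sliceD(1)[OF M j] wj by simp
  next
    case 2
    then show ?thesis using sliceD(3)[OF M j a] wj by simp
  next
    case 3
    then have "?k < j" using a j by auto
    then have "M (w0 n ?k) j = 0" by (rule sliceD(2)[OF M k(1) j])
    then show ?thesis using 3 k(2) by simp
  qed
qed

lemma noninv_w0: "noninv n (w0 n) = {}"
  by (auto simp: noninv_def w0_def)

lemma counting_single_zero: "counting {0} zdeg = (\<lambda>\<mu>. if \<mu> = 0 then 1 else 0)"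
proof
  fix \<mu>
  have "{a \<in> {0::zexp}. zdeg a = \<mu>} = (if \<mu> = 0 then {0} else {})" by auto
  then show "counting {0} zdeg \<mu> = (if \<mu> = 0 then 1 else 0)" by (simp add: counting_def)
qed

lemma spanning_monomials_w0:
  assumes M: "slice n (w0 n) M"
  shows "spanning_monomials n (w0 n) (w0 n) M {0} (\<lambda>_. 1)"
  unfolding spanning_monomials_def
proof (intro conjI ballI)
  let ?J = "schubert_ideal n (w0 n) M"
  note id = ideal_in_schubert_ideal[of n M "w0 n"]
  show "{0} \<subseteq> exponents (slice_vars n (w0 n))" by (simp add: exponents_def)
  show "laurent_times_series (slice_denom n (w0 n)) (counting {0} zdeg) = lookup (loc True n (w0 n) (w0 n))"
    unfolding loc_diag[OF w0_permutes] slice_denom_def noninv_w0 counting_single_zero laurent_times_series_delta by simp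
  show "homogeneous (zdeg e) 1" if "e \<in> {0}" for e using that homogeneous_one by simp
  show "1 \<in> coordinate_ring n M" by (rule algebra_of_one)
  fix f assume "f \<in> coordinate_ring n M"
  then obtain c where c: "f = single 0 c"
  proof (induction arbitrary: thesis)
    case (const c)
    then show ?case by blast
  next
    case (gen g)
    then obtain a j where "g = M a j" "a \<in> {1..n}" "j \<in> {1..n}" by (auto simp: entries_def)
    then have "g = 1 \<or> g = 0" using slice_w0_entry[OF M] by simp
    then show ?case using gen.prems[of 1] gen.prems[of 0] by auto
  next
    case (add f g)
    then show ?case by (metis single_add)
  next
    case (mult f g)
    then show ?case by (metis mult_single add_0)
  qed
  have "f * 1 + 0 \<in> combinations constants ((\<lambda>_. 1) ` {0})"
    by (rule combinations.step) (auto simp: c combinations.zero)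
  then show "spanned ((\<lambda>_. 1) ` {0}) ?J f" by (intro spanned_combination[OF id]) simp
qed

text \<open>Some rank condition of \<open>v\<close> fails at the point \<open>w0\<close>; the
  corresponding minor is 1, so the ideal is everything and nothing has to be spanned.\<close>

lemma spanning_monomials_not_w0:
  assumes M: "slice n (w0 n) M" and v: "v permutes {1..n}" "v \<noteq> w0 n"
  shows "spanning_monomials n v (w0 n) M {} \<beta>"
  unfolding spanning_monomials_def
proof (intro conjI ballI)
  let ?J = "schubert_ideal n v M"
  note id = ideal_in_schubert_ideal[of n M v]
  interpret J: ideal_in "coordinate_ring n M" ?J by (rule id)
  obtain q where q: "q \<in> {1..n}" "rk v (n + 1 - q) q < q"
    using w0_unique_of_rank[OF v(1)] v(2) by (meson not_le)
  have "rk (w0 n) (n + 1 - q) q = q"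
  proof -
    have "{k. 1 \<le> k \<and> k \<le> q \<and> n + 1 - q \<le> w0 n k} = {1..q}"
      using q(1) by (auto simp: w0_def)
    then show ?thesis by (simp add: rk_def)
  qed
  then have "\<not> rk (w0 n) (n + 1 - q) q \<le> rk v (n + 1 - q) q" using q(2) by simp
  then have "\<not> bruhat_le (w0 n) v" unfolding bruhat_le_def by blast
  then have "loc True n v (w0 n) = 0" by (rule loc_support[OF v(1) w0_permutes])
  then show "laurent_times_series (slice_denom n (w0 n)) (counting {} zdeg) = lookup (loc True n v (w0 n))"
    by (simp add: counting_def laurent_times_series_def fun_eq_iff)
  fix f assume f: "f \<in> coordinate_ring n M"
  let ?r = "rk v (n + 1 - q) q"
  \<comment> \<open>Rows counted from the bottom and columns from the left, so that the antidiagonal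
    of ones becomes an identity matrix.\<close>
  have "gminor M (Suc ?r) (\<lambda>i. n - i) Suc \<in> ?J"
    by (rule minors_inD[OF minors_in_schubert_ideal[of "n + 1 - q" n q]]) (use q in auto)
  moreover have "mat (Suc ?r) (Suc ?r) (\<lambda>(i, j). M (n - i) (Suc j)) = 1\<^sub>m (Suc ?r)"
  proof (rule eq_matI)
    fix i j assume "i < dim_row (1\<^sub>m (Suc ?r) :: zpoly mat)" "j < dim_col (1\<^sub>m (Suc ?r) :: zpoly mat)"
    then have ij: "i < Suc ?r" "j < Suc ?r" by auto
    then have "n - i \<in> {1..n}" "Suc j \<in> {1..n}" using q by auto
    then show "mat (Suc ?r) (Suc ?r) (\<lambda>(i, j). M (n - i) (Suc j)) $$ (i, j) = 1\<^sub>m (Suc ?r) $$ (i, j)"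
      using ij slice_w0_entry[OF M, of "n - i" "Suc j"] q by auto
  qed auto
  ultimately have "1 \<in> ?J" by (simp add: gminor_def)
  from J.J_mult[OF f this] show "spanned (\<beta> ` {}) ?J f" by (intro spanned_in[OF id]) simp
qed (auto simp: exponents_def)

theorem spanning_monomials_exist:
  assumes "w permutes {1..n}" "v permutes {1..n}" "slice n w M"
  shows "\<exists>T \<beta>. spanning_monomials n v w M T \<beta>"
  using assms
proof (induction "pos_sum n w" arbitrary: w v M rule: less_induct)
  case less
  show ?case
  proof (cases "\<exists>i. ascent n w i")
    case False
    then have "w = w0 n" using permutes_no_ascent[OF less.prems(1)] by blast
    then show ?thesis
      using spanning_monomials_w0[of n M] spanning_monomials_not_w0[of n M v] less.prems by (cases "v = w0 n") blast+
  next
    case True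
    then obtain i where i: "ascent n w i" by blast
    interpret slice_step n w i M
      by unfold_locales (rule less.prems(1), rule i, rule less.prems(3))
    have lt: "pos_sum n w' < pos_sum n w" by (rule pos_sum_swap) (use bounds in auto)
    have w': "w' permutes {1..n}" by (rule permutes_comp_swap[OF w bounds(1,2)])
    obtain T \<beta> where T: "spanning_monomials n v w' M' T \<beta>"
      using less.hyps[OF lt w' less.prems(2) slice'] by blast
    have "v i \<noteq> v (i + 1)" using perm_range(3)[OF less.prems(2), of i "i + 1"] by simp
    then consider "v (i + 1) < v i" | "v i < v (i + 1)" by linarith
    then show ?thesis
    proof cases
      case 1
      then show ?thesis using spanning_descent[OF less.prems(2) _ T] by blast
    next
      case 2
      have vs: "v \<circ> transpose i (i + 1) permutes {1..n}" by (rule permutes_comp_swap[OF less.prems(2) bounds(1,2)])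
      obtain T' \<beta>' where T': "spanning_monomials n (v \<circ> transpose i (i + 1)) w' M' T' \<beta>'"
        using less.hyps[OF lt w' vs slice'] by blast
      then show ?thesis using spanning_ascent[OF less.prems(2) 2 T] by blast
    qed
  qed
qed

section \<open>The ideal of a permutation\<close>

text \<open>\<open>zmat\<close> in the form of a slice, with indices from 1; by
  \<open>slice_id\<close> it is the slice at the identity.\<close>

definition zentry :: "nat \<Rightarrow> nat \<Rightarrow> zpoly" where
  "zentry a b = (if b < a then zvar a b else if a = b then 1 else 0)"

abbreviation zcarrier :: "nat \<Rightarrow> zpoly set" where
  "zcarrier n \<equiv> carrier (zring n)"

lemma zcarrier_def: "zcarrier n = {f. \<forall>m \<in> keys f. m \<in> exponents (zvars n)}"
  by (simp add: zring_def exponents_def)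

lemma homogeneous_zentry: "homogeneous (var_degree a b) (zentry a b)"
  using homogeneous_one by (auto simp: zentry_def zvar_def homogeneous_def zdeg_single)

lemma slice_id: "slice n id zentry"
  unfolding slice_def using homogeneous_zentry by (auto simp: zentry_def)

lemma zcarrier_add: "f \<in> zcarrier n \<Longrightarrow> g \<in> zcarrier n \<Longrightarrow> f + g \<in> zcarrier n"
  using Poly_Mapping.keys_add[of f g] by (auto simp: zcarrier_def)

lemma zcarrier_mult: "f \<in> zcarrier n \<Longrightarrow> g \<in> zcarrier n \<Longrightarrow> f * g \<in> zcarrier n"
  unfolding zcarrier_def
proof (intro CollectI ballI)
  fix m assume fg: "f \<in> {f. \<forall>m\<in>keys f. m \<in> exponents (zvars n)}"
      "g \<in> {f. \<forall>m\<in>keys f. m \<in> exponents (zvars n)}" and m: "m \<in> keys (f * g)"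
  obtain a b where ab: "a \<in> keys f" "b \<in> keys g" "m = a + b"
    using m by (rule keys_mult_ex)
  have "a \<in> exponents (zvars n)" "b \<in> exponents (zvars n)" using ab fg by auto
  then show "m \<in> exponents (zvars n)"
    unfolding ab(3) exponents_def using Poly_Mapping.keys_add[of a b] by blast
qed

lemma zcarrier_const: "single 0 c \<in> zcarrier n"
  by (auto simp: zcarrier_def exponents_def)

lemma coordinate_ring_zentry: "coordinate_ring n zentry = zcarrier n"
proof
  show "coordinate_ring n zentry \<subseteq> zcarrier n"
  proof
    fix f assume "f \<in> coordinate_ring n zentry"
    then show "f \<in> zcarrier n"
    proof induction
      case (gen g)
      then obtain a b where ab: "g = zentry a b" "a \<in> {1..n}" "b \<in> {1..n}" by (auto simp: entries_def)
      then show ?case by (auto simp: zentry_def zcarrier_def exponents_def zvar_def zvars_def)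
    qed (auto intro: zcarrier_const zcarrier_add zcarrier_mult)
  qed
  interpret ideal_in "coordinate_ring n zentry" "{0}"
    by unfold_locales (auto intro: algebra_of.intros algebra_of_one algebra_of_uminus)
  have mono: "single m 1 \<in> coordinate_ring n zentry" if "m \<in> exponents (zvars n)" for m
  proof -
    have var: "zvar p q \<in> coordinate_ring n zentry" if "(p, q) \<in> zvars n" for p q
      using entry_in[of p n q zentry] that by (simp add: zvars_def zentry_def)
    have single: "single (single x k) 1 = zvar (fst x) (snd x) ^ k" for x k
    proof (induction k)
      case (Suc k)
      have "single (single x (Suc k)) (1::complex)
          = zvar (fst x) (snd x) * single (single x k) 1"
        using single_add[of x 1 k] by (simp add: zvar_def mult_single)
      then show ?case using Suc.IH by simp
    qed simp
    have "m = (\<Sum>x\<in>keys m. single x (lookup m x))"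
      by (rule poly_mapping_expand)
    then have "single m (1::complex)
        = (\<Prod>x\<in>keys m. zvar (fst x) (snd x) ^ lookup m x)"
      unfolding single[symmetric] prod_single_one by (rule arg_cong)
    moreover have "\<dots> \<in> coordinate_ring n zentry"
      using that by (intro R_prod R_power var) (auto simp: exponents_def)
    ultimately show ?thesis by simp
  qed
  show "zcarrier n \<subseteq> coordinate_ring n zentry"
  proof
    fix f assume f: "f \<in> zcarrier n"
    have "f = (\<Sum>m\<in>keys f. single 0 (lookup f m) * single m 1)"
      by (subst poly_mapping_expand[of f]) (simp add: mult_single)
    also have "\<dots> \<in> coordinate_ring n zentry"
      using f by (intro R_sum algebra_of.mult algebra_of.const mono) (auto simp: zcarrier_def)
    finally show "f \<in> coordinate_ring n zentry" .
  qed
qed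

section \<open>The ring S and the generators of the ideal\<close>

lemma zring_simps [simp]:
  "f \<otimes>\<^bsub>zring n\<^esub> g = f * g" "f \<oplus>\<^bsub>zring n\<^esub> g = f + g" "\<one>\<^bsub>zring n\<^esub> = 1" "\<zero>\<^bsub>zring n\<^esub> = 0"
  by (simp_all add: zring_def)

lemma zcarrier_zero: "0 \<in> zcarrier n" and zcarrier_one: "1 \<in> zcarrier n"
  using zcarrier_const[of 0 n] zcarrier_const[of 1 n] by simp_all

lemma cring_zring: "cring (zring n)"
proof (rule cringI)
  show "abelian_group (zring n)"
  proof (rule abelian_groupI)
    fix f assume "f \<in> zcarrier n"
    then have "- f \<in> zcarrier n" by (simp add: zcarrier_def)
    then show "\<exists>g\<in>zcarrier n. g \<oplus>\<^bsub>zring n\<^esub> f = \<zero>\<^bsub>zring n\<^esub>" by (intro bexI[of _ "- f"]) simp_all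
  qed (simp_all add: zcarrier_add zcarrier_zero add_ac)
  show "comm_monoid (zring n)"
    by (rule comm_monoidI) (simp_all add: zcarrier_mult zcarrier_one mult_ac)
qed (simp add: distrib_right)

lemma ideal_in_zcarrier: "ideal_in (zcarrier n) (combinations (zcarrier n) G)"
  using ideal_in_algebra_of[of "entries n zentry" G] unfolding coordinate_ring_zentry .

lemma zcarrier_combinations:
  assumes "x \<in> combinations (zcarrier n) G" "G \<subseteq> zcarrier n" shows "x \<in> zcarrier n"
  using assms zcarrier_const[of 0 n]
  by (induction x rule: combinations.induct) (auto intro: zcarrier_add zcarrier_mult)

lemma ideal_combinations:
  assumes "G \<subseteq> zcarrier n" shows "ideal (combinations (zcarrier n) G) (zring n)"
proof -
  interpret cring "zring n" by (rule cring_zring)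
  interpret I: ideal_in "zcarrier n" "combinations (zcarrier n) G" by (rule ideal_in_zcarrier)
  show ?thesis
  proof (rule idealI[OF ring_axioms])
    show "subgroup (combinations (zcarrier n) G) (add_monoid (zring n))"
    proof
      show "combinations (zcarrier n) G \<subseteq> carrier (add_monoid (zring n))"
        using zcarrier_combinations[OF _ assms] by auto
      fix x assume x: "x \<in> combinations (zcarrier n) G"
      have "inv\<^bsub>add_monoid (zring n)\<^esub> x = - x"
      proof -
        have "x \<in> zcarrier n" "- x \<in> zcarrier n" using zcarrier_combinations[OF _ assms] x I.J_uminus[OF x] by auto
        then have "\<ominus>\<^bsub>zring n\<^esub> x = - x" by (intro minus_equality) simp_all
        then show ?thesis by (simp add: a_inv_def)
      qed
      then show "inv\<^bsub>add_monoid (zring n)\<^esub> x \<in> combinations (zcarrier n) G" using I.J_uminus[OF x] by simp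
    qed (simp_all add: I.J_add I.J_zero)
  next
    fix a x assume "a \<in> combinations (zcarrier n) G" "x \<in> zcarrier n"
    then show "x \<otimes>\<^bsub>zring n\<^esub> a \<in> combinations (zcarrier n) G" "a \<otimes>\<^bsub>zring n\<^esub> x \<in> combinations (zcarrier n) G"
      using I.J_mult[of x a] by (simp_all add: mult.commute)
  qed
qed

lemma genideal_eq:
  assumes "G \<subseteq> zcarrier n" shows "Idl\<^bsub>zring n\<^esub> G = combinations (zcarrier n) G"
proof
  interpret cring "zring n" by (rule cring_zring)
  have "G \<subseteq> combinations (zcarrier n) G" using combinations_base[of "zcarrier n" _ G] zcarrier_const[of 1 n] by auto
  then show "Idl\<^bsub>zring n\<^esub> G \<subseteq> combinations (zcarrier n) G"
    by (rule genideal_minimal[OF ideal_combinations[OF assms]])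
  interpret I: ideal "Idl\<^bsub>zring n\<^esub> G" "zring n" by (rule genideal_ideal[OF assms])
  show "combinations (zcarrier n) G \<subseteq> Idl\<^bsub>zring n\<^esub> G"
  proof
    fix x assume "x \<in> combinations (zcarrier n) G"
    then show "x \<in> Idl\<^bsub>zring n\<^esub> G"
    proof induction
      case zero
      then show ?case using additive_subgroup.zero_closed[OF I.additive_subgroup_axioms] by simp
    next
      case (step r g x)
      have "g \<in> Idl\<^bsub>zring n\<^esub> G" using genideal_self[OF assms] step.hyps(2) by blast
      from I.I_l_closed[OF this step.hyps(1)] have "r * g \<in> Idl\<^bsub>zring n\<^esub> G" by simp
      from I.a_closed[OF this step.IH] show ?case by simp
    qed
  qed
qed

definition box_minors :: "nat \<Rightarrow> nat \<Rightarrow> nat \<Rightarrow> nat \<Rightarrow> zpoly set" where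
  "box_minors n p q r = {minor n A B | A B. A \<subseteq> {p..n} \<and> B \<subseteq> {1..q} \<and> card A = r + 1 \<and> card B = r + 1}"

definition essential_minors :: "nat \<Rightarrow> (nat \<Rightarrow> nat) \<Rightarrow> zpoly set" where
  "essential_minors n v = (\<Union>(p, q)\<in>essential_set n v. box_minors n p q (rk v p q))"

lemma minor_eq_gminor:
  assumes A: "A \<subseteq> {1..n}" "card A = k" and B: "B \<subseteq> {1..n}" "card B = k"
  shows "minor n A B = gminor zentry k (\<lambda>i. Suc (pick ((\<lambda>a. a - 1) ` A) i)) (\<lambda>j. Suc (pick ((\<lambda>b. b - 1) ` B) j))"
proof -
  have dim: "card {i. i < n \<and> i \<in> (\<lambda>a. a - 1) ` A} = k \<and> card ((\<lambda>a. a - 1) ` A) = k" if "A \<subseteq> {1..n}" "card A = k" for A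
  proof -
    have "{i. i < n \<and> i \<in> (\<lambda>a. a - 1) ` A} = (\<lambda>a. a - 1) ` A" using that(1) by force
    moreover have "inj_on (\<lambda>a. a - 1) A" using that(1) by (intro inj_on_diff_nat) auto
    ultimately show ?thesis using that(2) card_image by auto
  qed
  have range: "pick ((\<lambda>a. a - 1) ` A) i < n" if "A \<subseteq> {1..n}" "card A = k" "i < k" for A i
    using pick_in_set_le[of i "(\<lambda>a. a - 1) ` A"] dim[OF that(1,2)] that by force
  have "dim_row (zmat n) = n" "dim_col (zmat n) = n" by (simp_all add: zmat_def)
  then show ?thesis
    unfolding minor_def gminor_def submatrix_def
    using dim[OF A] dim[OF B] range[OF A] range[OF B]
    by (intro arg_cong[of _ _ det] eq_matI) (auto simp: zmat_def zentry_def)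
qed

lemma gminor_permute_rows:
  assumes "p permutes {0..<k}" "\<And>i. i < k \<Longrightarrow> \<alpha> i = \<alpha>' (p i)"
  shows "gminor M k \<alpha> \<beta> = signof p * gminor M k \<alpha>' \<beta>"
proof -
  let ?A = "mat k k (\<lambda>(i, j). M (\<alpha>' i) (\<beta> j))"
  have "mat k k (\<lambda>(i, j). M (\<alpha> i) (\<beta> j)) = mat k k (\<lambda>(i, j). ?A $$ (p i, j))"
    using assms permutes_in_image[OF assms(1)] by (intro eq_matI) auto
  then show ?thesis unfolding gminor_def using det_permute_rows[of ?A k p] assms(1) by simp
qed

text \<open>An injective sequence of indices is the increasing enumeration of its range, permuted;
  so a minor of sequences is, up to sign, a minor of sets.\<close>

lemma sorting_permutation:
  assumes inj: "inj_on \<alpha> {0..<k}" and pos: "\<And>i. i < k \<Longrightarrow> 1 \<le> \<alpha> i"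
  obtains p where "p permutes {0..<k}" "\<And>i. i < k \<Longrightarrow> \<alpha> i = Suc (pick ((\<lambda>a. a - 1) ` \<alpha> ` {0..<k}) (p i))"
proof -
  let ?A = "(\<lambda>a. a - 1) ` \<alpha> ` {0..<k}"
  have "inj_on (\<lambda>i. \<alpha> i - 1) {0..<k}"
    using inj pos by (intro inj_onI) (metis Suc_pred atLeastLessThan_iff inj_onD less_eq_Suc_le One_nat_def)
  then have bij1: "bij_betw (\<lambda>i. \<alpha> i - 1) {0..<k} ?A" by (auto simp: bij_betw_def image_image)
  then have card: "card ?A = k" using bij_betw_same_card by fastforce
  have inj2: "inj_on (pick ?A) {0..<k}"
    using pick_mono_le[of _ ?A] card by (intro inj_onI) (metis atLeastLessThan_iff nat_neq_iff)
  have "pick ?A ` {0..<k} \<subseteq> ?A" using pick_in_set_le[of _ ?A] card by auto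
  then have "pick ?A ` {0..<k} = ?A" using card card_image[OF inj2] by (intro card_subset_eq) auto
  then have bij2: "bij_betw (pick ?A) {0..<k} ?A" using inj2 by (simp add: bij_betw_def)
  define p where "p i = (if i \<in> {0..<k} then inv_into {0..<k} (pick ?A) (\<alpha> i - 1) else i)" for i
  have "bij_betw (inv_into {0..<k} (pick ?A) \<circ> (\<lambda>i. \<alpha> i - 1)) {0..<k} {0..<k}"
    by (rule bij_betw_trans[OF bij1 bij_betw_inv_into[OF bij2]])
  then have "bij_betw p {0..<k} {0..<k}" by (rule bij_betw_cong[THEN iffD1, rotated]) (simp add: p_def)
  then have "p permutes {0..<k}" by (rule bij_imp_permutes) (simp add: p_def)
  moreover have "\<alpha> i = Suc (pick ?A (p i))" if "i < k" for i
  proof -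
    have "\<alpha> i - 1 \<in> pick ?A ` {0..<k}" using bij1 bij2 that by (auto simp: bij_betw_def)
    then have "pick ?A (p i) = \<alpha> i - 1" using that by (simp add: p_def f_inv_into_f)
    then show ?thesis using pos[OF that] by simp
  qed
  ultimately show thesis by (rule that)
qed

context ideal_in begin

lemma signof_mult: "x \<in> J \<Longrightarrow> signof p * x \<in> J"
  by (cases "evenperm p") (auto simp: sign_def intro: J_uminus)

end

lemma box_minors_in:
  assumes J: "ideal_in (zcarrier n) J" and sub: "box_minors n p q r \<subseteq> J" and pq: "1 \<le> p" "q \<le> n"
  shows "minors_in zentry J {p..n} {1..q} (Suc r)"
proof (rule minors_inI)
  interpret ideal_in "zcarrier n" J by (rule J)
  let ?k = "Suc r"
  fix \<alpha> \<beta> assume \<alpha>: "\<And>i. i < ?k \<Longrightarrow> \<alpha> i \<in> {p..n}" and \<beta>: "\<And>j. j < ?k \<Longrightarrow> \<beta> j \<in> {1..q}"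
  show "gminor zentry ?k \<alpha> \<beta> \<in> J"
  proof (cases "inj_on \<alpha> {0..<?k} \<and> inj_on \<beta> {0..<?k}")
    case True
    let ?A = "\<alpha> ` {0..<?k}" and ?B = "\<beta> ` {0..<?k}"
    let ?\<alpha> = "\<lambda>i. Suc (pick ((\<lambda>a. a - 1) ` ?A) i)" and ?\<beta> = "\<lambda>i. Suc (pick ((\<lambda>a. a - 1) ` ?B) i)"
    have card: "card ?A = ?k" "card ?B = ?k" using True card_image[of \<alpha> "{0..<?k}"] card_image[of \<beta> "{0..<?k}"] by auto
    have sets: "?A \<subseteq> {p..n}" "?B \<subseteq> {1..q}" using \<alpha> \<beta> by auto
    have "minor n ?A ?B \<in> J" using sub sets card unfolding box_minors_def by auto
    moreover have "minor n ?A ?B = gminor zentry ?k ?\<alpha> ?\<beta>"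
      by (rule minor_eq_gminor) (use sets card pq in auto)
    ultimately have base: "gminor zentry ?k ?\<alpha> ?\<beta> \<in> J" by simp
    have "1 \<le> \<alpha> i" if "i < ?k" for i using \<alpha>[OF that] pq(1) by simp
    then obtain P where P: "P permutes {0..<?k}" "\<And>i. i < ?k \<Longrightarrow> \<alpha> i = ?\<alpha> (P i)"
      using sorting_permutation[of \<alpha> ?k] True by blast
    have "1 \<le> \<beta> i" if "i < ?k" for i using \<beta>[OF that] by simp
    then obtain S where S: "S permutes {0..<?k}" "\<And>i. i < ?k \<Longrightarrow> \<beta> i = ?\<beta> (S i)"
      using sorting_permutation[of \<beta> ?k] True by blast
    have "gminor zentry ?k \<alpha> \<beta> = signof P * gminor zentry ?k ?\<alpha> \<beta>" by (rule gminor_permute_rows[OF P(1)]) (rule P(2))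
    also have "gminor zentry ?k ?\<alpha> \<beta> = gminor (\<lambda>a b. zentry b a) ?k \<beta> ?\<alpha>" by (rule gminor_transpose[symmetric])
    also have "\<dots> = signof S * gminor (\<lambda>a b. zentry b a) ?k ?\<beta> ?\<alpha>" by (rule gminor_permute_rows[OF S(1)]) (rule S(2))
    also have "gminor (\<lambda>a b. zentry b a) ?k ?\<beta> ?\<alpha> = gminor zentry ?k ?\<alpha> ?\<beta>" by (rule gminor_transpose)
    finally have eq: "gminor zentry ?k \<alpha> \<beta> = signof P * (signof S * gminor zentry ?k ?\<alpha> ?\<beta>)" .
    show ?thesis unfolding eq by (intro signof_mult base)
  next
    case False
    have "gminor zentry ?k \<alpha> \<beta> = 0"
    proof (cases "inj_on \<beta> {0..<?k}")
      case True
      then have "\<not> inj_on \<alpha> {0..<?k}" using False by blast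
      then obtain j j' where "j < ?k" "j' < ?k" "j \<noteq> j'" "\<alpha> j = \<alpha> j'" by (auto simp: inj_on_def)
      then have "gminor (\<lambda>a b. zentry b a) ?k \<beta> \<alpha> = 0" by (rule gminor_repeated_column)
      then show ?thesis by (simp only: gminor_transpose[of zentry])
    next
      case False
      then obtain j j' where "j < ?k" "j' < ?k" "j \<noteq> j'" "\<beta> j = \<beta> j'" by (auto simp: inj_on_def)
      then show ?thesis by (rule gminor_repeated_column)
    qed
    then show ?thesis using J_zero by simp
  qed
qed

lemma zentry_in: "a \<in> {1..n} \<Longrightarrow> b \<in> {1..n} \<Longrightarrow> zentry a b \<in> zcarrier n"
  unfolding coordinate_ring_zentry[symmetric] by (rule entry_in)

lemma finite_essential_set: "finite (essential_set n v)"
  by (rule finite_subset[of _ "{1..n} \<times> {1..n}"]) (auto simp: essential_set_def diagram_def)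

lemma pick_pred_mem:
  assumes "A \<subseteq> {1..n}" "i < card A" shows "Suc (pick ((\<lambda>a. a - 1) ` A) i) \<in> A"
proof -
  have "inj_on (\<lambda>a. a - 1) A" using assms(1) by (intro inj_on_diff_nat) auto
  from card_image[OF this] have "pick ((\<lambda>a. a - 1) ` A) i \<in> (\<lambda>a. a - 1) ` A"
    using assms(2) by (intro pick_in_set_le) simp
  then obtain a where "a \<in> A" "pick ((\<lambda>a. a - 1) ` A) i = a - 1" by blast
  then show ?thesis using assms(1) by (cases a) auto
qed

lemma box_minors_subset:
  assumes J: "minors_in zentry J {p..n} {1..q} (Suc r)" and pq: "1 \<le> p" "q \<le> n"
  shows "box_minors n p q r \<subseteq> J"
proof
  fix g assume "g \<in> box_minors n p q r"
  then obtain A B where g: "g = minor n A B" and A: "A \<subseteq> {p..n}" "card A = Suc r" and B: "B \<subseteq> {1..q}" "card B = Suc r"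
    unfolding box_minors_def by auto
  have AB: "A \<subseteq> {1..n}" "B \<subseteq> {1..n}" using A(1) B(1) pq by auto
  show "g \<in> J"
    unfolding g minor_eq_gminor[OF AB(1) A(2) AB(2) B(2)]
    by (rule minors_inD[OF J]; rule subsetD[OF A(1) pick_pred_mem[OF AB(1)]] subsetD[OF B(1) pick_pred_mem[OF AB(2)]])
      (simp_all add: A(2) B(2))
qed

lemma box_minors_zcarrier:
  assumes "1 \<le> p" "q \<le> n" shows "box_minors n p q r \<subseteq> zcarrier n"
proof (rule box_minors_subset[OF minors_inI assms])
  interpret ideal_in "zcarrier n" "combinations (zcarrier n) {}" by (rule ideal_in_zcarrier)
  fix \<alpha> \<beta> assume "\<And>i. i < Suc r \<Longrightarrow> \<alpha> i \<in> {p..n}" "\<And>j. j < Suc r \<Longrightarrow> \<beta> j \<in> {1..q}"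
  then show "gminor zentry (Suc r) \<alpha> \<beta> \<in> zcarrier n"
    unfolding gminor_def using assms by (intro R_det zentry_in) fastforce+
qed

lemma essential_minors_zcarrier: "essential_minors n v \<subseteq> zcarrier n"
  unfolding essential_minors_def
proof (intro UN_least, clarify)
  fix p q g assume "(p, q) \<in> essential_set n v" "g \<in> box_minors n p q (rk v p q)"
  then show "g \<in> zcarrier n"
    using box_minors_zcarrier[of p q n "rk v p q"] by (auto simp: essential_set_def diagram_def)
qed

lemma perm_ideal_eq: "perm_ideal n v = combinations (zcarrier n) (essential_minors n v)" (is "_ = ?C")
proof
  interpret ideal_in "zcarrier n" ?C by (rule ideal_in_zcarrier)
  have rank: "rank_ideal n p q (rk v p q) = combinations (zcarrier n) (box_minors n p q (rk v p q))"
    if "(p, q) \<in> essential_set n v" for p q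
    unfolding rank_ideal_def box_minors_def[symmetric]
    using that by (intro genideal_eq box_minors_zcarrier) (auto simp: essential_set_def diagram_def)
  show "perm_ideal n v \<subseteq> ?C"
  proof
    fix x assume "x \<in> perm_ideal n v"
    then obtain f where f: "x = (\<Sum>e\<in>essential_set n v. f e)"
      "\<And>p q. (p, q) \<in> essential_set n v \<Longrightarrow> f (p, q) \<in> rank_ideal n p q (rk v p q)"
      unfolding perm_ideal_def by auto
    have "f e \<in> ?C" if e: "e \<in> essential_set n v" for e
    proof -
      obtain p q where pq: "e = (p, q)" by (cases e)
      have "f e \<in> combinations (zcarrier n) (box_minors n p q (rk v p q))"
        using f(2)[of p q] rank[of p q] e pq by simp
      then show ?thesis by (rule combinations_mono) (use e pq in \<open>auto simp: essential_minors_def\<close>)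
    qed
    then show "x \<in> ?C" unfolding f(1) by (rule J_sum)
  qed
  show "?C \<subseteq> perm_ideal n v"
  proof
    fix x assume "x \<in> ?C"
    then have "\<exists>f. x = (\<Sum>e\<in>essential_set n v. f e)
      \<and> (\<forall>(p, q)\<in>essential_set n v. f (p, q) \<in> rank_ideal n p q (rk v p q))"
    proof induction
      case zero
      have "0 \<in> rank_ideal n p q (rk v p q)" if "(p, q) \<in> essential_set n v" for p q
        unfolding rank[OF that] by (rule combinations.zero)
      then show ?case by (intro exI[of _ "\<lambda>_. 0"]) auto
    next
      case (step r g x)
      then obtain p0 q0 where e0: "(p0, q0) \<in> essential_set n v" "g \<in> box_minors n p0 q0 (rk v p0 q0)"
        unfolding essential_minors_def by auto
      obtain f where f: "x = (\<Sum>e\<in>essential_set n v. f e)"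
        "\<forall>(p, q)\<in>essential_set n v. f (p, q) \<in> rank_ideal n p q (rk v p q)" using step.IH by blast
      have "f (p0, q0) \<in> combinations (zcarrier n) (box_minors n p0 q0 (rk v p0 q0))"
        using f(2) e0(1) rank[OF e0(1)] by auto
      then have "r * g + f (p0, q0) \<in> rank_ideal n p0 q0 (rk v p0 q0)"
        unfolding rank[OF e0(1)] by (rule combinations.step[OF step.hyps(1) e0(2)])
      then have "\<forall>(p, q)\<in>essential_set n v. (f((p0, q0) := r * g + f (p0, q0))) (p, q) \<in> rank_ideal n p q (rk v p q)"
        using f(2) by auto
      moreover have "r * g + x = (\<Sum>e\<in>essential_set n v. (f((p0, q0) := r * g + f (p0, q0))) e)"
        unfolding f(1) using e0(1) finite_essential_set[of n v]
        by (simp add: sum.remove[of _ "(p0, q0)"] add.assoc)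
      ultimately show ?case by blast
    qed
    then show "x \<in> perm_ideal n v" unfolding perm_ideal_def by blast
  qed
qed

context inclusion_perm begin

text \<open>The essential conditions imply all rank conditions: along
  \<open>essential_induct\<close> the size of the minors grows only where a row or column is added,
  and then Laplace expansion applies.\<close>

lemma schubert_ideal_subset_perm_ideal: "schubert_ideal n v zentry \<subseteq> perm_ideal n v"
proof
  let ?I = "perm_ideal n v"
  have id: "ideal_in (zcarrier n) ?I" unfolding perm_ideal_eq by (rule ideal_in_zcarrier)
  interpret I: ideal_in "zcarrier n" ?I by (rule id)
  have min: "minors_in zentry ?I {p..n} {1..q} (Suc (rk v p q))" if "1 \<le> p" "p \<le> n + 1" "q \<le> n" for p q
  proof (rule essential_induct[where Z = "\<lambda>p q. minors_in zentry ?I {p..n} {1..q} (Suc (rk v p q))", OF _ _ _ _ _ _ _ that])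
    fix p q assume e: "(p, q) \<in> essential_set n v"
    then have "(p, q) \<in> diagram n v" by (simp add: essential_set_def)
    note D = diagramD[OF this]
    have "essential_minors n v \<subseteq> ?I"
      unfolding perm_ideal_eq using combinations_base[of "zcarrier n"] zcarrier_const[of 1 n] by auto
    then have "box_minors n p q (rk v p q) \<subseteq> ?I" using e unfolding essential_minors_def by blast
    then show "minors_in zentry ?I {p..n} {1..q} (Suc (rk v p q))" by (rule box_minors_in[OF id]) (use D in auto)
  next
    show "minors_in zentry ?I {p..n} {1..0} (Suc (rk v p 0))" for p
      by (rule minors_inI) (metis atLeastatMost_empty_iff empty_iff not_one_le_zero zero_less_Suc)
    show "minors_in zentry ?I {n + 1..n} {1..q} (Suc (rk v (n + 1) q))" for q
      by (rule minors_inI) (metis Suc_eq_plus1 atLeastatMost_empty_iff empty_iff not_less_eq_eq order_refl zero_less_Suc)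
  next
    fix p q assume a: "1 \<le> p" "p \<le> n" "1 \<le> q" "q \<le> n" "p \<le> v q"
      "minors_in zentry ?I {p..n} {1..q - 1} (Suc (rk v p (q - 1)))"
    have "minors_in zentry ?I {p..n} (insert q {1..q - 1}) (Suc (Suc (rk v p (q - 1))))"
      by (rule I.minors_in_insert_column[OF _ a(6)]) (rule zentry_in; use a in auto)
    moreover have "insert q {1..q - 1} = {1..q}" using a by auto
    ultimately show "minors_in zentry ?I {p..n} {1..q} (Suc (rk v p q))" using rk_v_left[of q p] a by simp
  next
    fix p q assume a: "1 \<le> p" "p \<le> n" "1 \<le> q" "q \<le> n" "vi p \<le> q"
      "minors_in zentry ?I {p + 1..n} {1..q} (Suc (rk v (p + 1) q))"
    have "minors_in zentry ?I (insert p {p + 1..n}) {1..q} (Suc (Suc (rk v (p + 1) q)))"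
      by (rule I.minors_in_insert_row[OF _ a(6)]) (rule zentry_in; use a in auto)
    moreover have "insert p {p + 1..n} = {p..n}" using a by auto
    ultimately show "minors_in zentry ?I {p..n} {1..q} (Suc (rk v p q))" using rk_v_row[of p q] a by simp
  next
    fix p q assume a: "(p, q) \<in> diagram n v" "(p, q + 1) \<in> diagram n v"
      "minors_in zentry ?I {p..n} {1..q + 1} (Suc (rk v p (q + 1)))"
    have "rk v p (q + 1) = rk v p q" using rk_v_right[of q p] diagramD(5)[OF a(2)] by simp
    then show "minors_in zentry ?I {p..n} {1..q} (Suc (rk v p q))"
      using minors_in_mono[OF a(3), of "{p..n}" "{1..q}"] by simp
  next
    fix p q assume a: "(p, q) \<in> diagram n v" "(p - 1, q) \<in> diagram n v"
      "minors_in zentry ?I {p - 1..n} {1..q} (Suc (rk v (p - 1) q))"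
    have "rk v (p - 1) q = rk v p q"
      using rk_v_row[of "p - 1" q] diagramD[OF a(2)] diagramD[OF a(1)] by auto
    then show "minors_in zentry ?I {p..n} {1..q} (Suc (rk v p q))"
      using minors_in_mono[OF a(3), of "{p..n}" "{1..q}"] by simp
  qed
  have "rank_minors n v zentry \<subseteq> ?I"
  proof
    fix g assume "g \<in> rank_minors n v zentry"
    then obtain p q \<alpha> \<beta> where g: "g = gminor zentry (Suc (rk v p q)) \<alpha> \<beta>" and pq: "p \<in> {1..n}" "q \<in> {1..n}"
      and \<alpha>: "\<And>i. i < Suc (rk v p q) \<Longrightarrow> \<alpha> i \<in> {p..n}" and \<beta>: "\<And>j. j < Suc (rk v p q) \<Longrightarrow> \<beta> j \<in> {1..q}"
      unfolding rank_minors_def by blast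
    show "g \<in> ?I" unfolding g by (rule minors_inD[OF min]) (use pq \<alpha> \<beta> in auto)
  qed
  moreover fix x assume "x \<in> schubert_ideal n v zentry"
  then have "x \<in> combinations (zcarrier n) (rank_minors n v zentry)"
    unfolding schubert_ideal_def coordinate_ring_zentry .
  ultimately show "x \<in> ?I" by (intro I.combinations_in_J)
qed

end

section \<open>Equations from the inclusions\<close>

text \<open>The right inverse of the unipotent matrix by forward substitution; \<open>zinv'\<close>
  is the left inverse. Both relations are needed, hence the identification in
  \<open>zinv'_eq\<close>.\<close>

function zinv :: "nat \<Rightarrow> nat \<Rightarrow> zpoly" where
  "zinv a b = (if a < b then 0 else if a = b then 1 else - (\<Sum>c\<in>{b..<a}. zentry a c * zinv c b))"
  by auto
termination by (relation "measure fst") auto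

function zinv' :: "nat \<Rightarrow> nat \<Rightarrow> zpoly" where
  "zinv' a b = (if a < b then 0 else if a = b then 1 else - (\<Sum>c\<in>{b<..a}. zinv' a c * zentry c b))"
  by auto
termination by (relation "measure (\<lambda>(a, b). a - b)") auto

declare zinv.simps [simp del] zinv'.simps [simp del]

lemma zentry_zinv:
  assumes "a \<in> {1..n}" "b \<in> {1..n}"
  shows "(\<Sum>c\<in>{1..n}. zentry a c * zinv c b) = (if a = b then 1 else 0)"
proof (cases "b < a")
  case True
  have "(\<Sum>c\<in>{1..n}. zentry a c * zinv c b) = (\<Sum>c\<in>{b..a}. zentry a c * zinv c b)"
    by (rule sum.mono_neutral_right) (use assms in \<open>auto simp: zentry_def zinv.simps[of _ b]\<close>)
  also have "{b..a} = insert a {b..<a}" using True by auto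
  also have "(\<Sum>c\<in>insert a {b..<a}. zentry a c * zinv c b) = zinv a b + (\<Sum>c\<in>{b..<a}. zentry a c * zinv c b)"
    by (simp add: zentry_def)
  also have "zinv a b = - (\<Sum>c\<in>{b..<a}. zentry a c * zinv c b)" using True by (subst zinv.simps) simp
  finally show ?thesis using True by simp
next
  case False
  have "(\<Sum>c\<in>{1..n}. zentry a c * zinv c b) = (\<Sum>c\<in>{1..n}. if c = a then zinv a b else 0)"
    using False by (intro sum.cong) (auto simp: zentry_def zinv.simps[of _ b])
  then show ?thesis using False assms by (simp add: zinv.simps)
qed

lemma zinv'_zentry:
  assumes "a \<in> {1..n}" "b \<in> {1..n}"
  shows "(\<Sum>c\<in>{1..n}. zinv' a c * zentry c b) = (if a = b then 1 else 0)"
proof (cases "b < a")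
  case True
  have "(\<Sum>c\<in>{1..n}. zinv' a c * zentry c b) = (\<Sum>c\<in>{b..a}. zinv' a c * zentry c b)"
    by (rule sum.mono_neutral_right) (use assms in \<open>auto simp: zentry_def zinv'.simps[of a]\<close>)
  also have "{b..a} = insert b {b<..a}" using True by auto
  also have "(\<Sum>c\<in>insert b {b<..a}. zinv' a c * zentry c b) = zinv' a b + (\<Sum>c\<in>{b<..a}. zinv' a c * zentry c b)"
    by (simp add: zentry_def)
  also have "zinv' a b = - (\<Sum>c\<in>{b<..a}. zinv' a c * zentry c b)" using True by (subst zinv'.simps) simp
  finally show ?thesis using True by simp
next
  case False
  have "(\<Sum>c\<in>{1..n}. zinv' a c * zentry c b) = (\<Sum>c\<in>{1..n}. if c = b then zinv' a b else 0)"
    using False by (intro sum.cong) (auto simp: zentry_def zinv'.simps[of a])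
  then show ?thesis using False assms by (simp add: zinv'.simps)
qed

lemma zinv'_eq: assumes "a \<in> {1..n}" "b \<in> {1..n}" shows "zinv' a b = zinv a b"
proof -
  have "zinv' a b = (\<Sum>c\<in>{1..n}. zinv' a c * (if c = b then 1 else 0))"
    using assms by (simp add: if_distrib cong: if_cong)
  also have "\<dots> = (\<Sum>c\<in>{1..n}. zinv' a c * (\<Sum>d\<in>{1..n}. zentry c d * zinv d b))"
    using assms(2) by (intro sum.cong refl) (simp only: zentry_zinv)
  also have "\<dots> = (\<Sum>d\<in>{1..n}. (\<Sum>c\<in>{1..n}. zinv' a c * zentry c d) * zinv d b)"
    unfolding sum_distrib_left sum_distrib_right mult.assoc by (rule sum.swap)
  also have "\<dots> = (\<Sum>d\<in>{1..n}. (if a = d then 1 else 0) * zinv d b)"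
    using assms(1) by (intro sum.cong refl) (simp only: zinv'_zentry)
  also have "\<dots> = zinv a b"
    using assms by (simp add: if_distrib[of "\<lambda>t. t * _"] cong: if_cong)
  finally show ?thesis .
qed

lemma zinv_zentry:
  assumes "a \<in> {1..n}" "b \<in> {1..n}"
  shows "(\<Sum>c\<in>{1..n}. zinv a c * zentry c b) = (if a = b then 1 else 0)"
  using zinv'_zentry[OF assms] zinv'_eq[OF assms(1)] by simp

lemma homogeneous_zinv: "homogeneous (var_degree a b) (zinv a b)"
proof (induction a b rule: zinv.induct)
  case (1 a b)
  have "homogeneous (var_degree a b) (zentry a c * zinv c b)" if "b < a" "c \<in> {b..<a}" for c
    using homogeneous_mult[OF homogeneous_zentry[where a = a and b = c] "1.IH"[of c]] that by simp
  then show ?case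
    using homogeneous_zero homogeneous_one by (subst zinv.simps) (auto intro!: homogeneous_uminus homogeneous_sum)
qed

lemma zinv_in: "a \<in> {1..n} \<Longrightarrow> 1 \<le> b \<Longrightarrow> zinv a b \<in> zcarrier n"
proof (induction a b rule: zinv.induct)
  case (1 a b)
  interpret ideal_in "zcarrier n" "combinations (zcarrier n) {}" by (rule ideal_in_zcarrier)
  show ?case
  proof (cases "b < a")
    case True
    have "zentry a c * zinv c b \<in> zcarrier n" if "c \<in> {b..<a}" for c
      using "1.prems" that True by (intro R_mult zentry_in "1.IH") auto
    then have "- (\<Sum>c\<in>{b..<a}. zentry a c * zinv c b) \<in> zcarrier n" by (intro R_uminus R_sum)
    then show ?thesis using True by (subst zinv.simps) simp
  next
    case False
    then show ?thesis using R_zero R_one by (subst zinv.simps) simp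
  qed
qed

context inclusion_perm begin

text \<open>F_b in E_{a-1} means that entries of the matrix vanish, E_b in F_{a-1} that entries of
  its inverse vanish. Of the latter, those covered by a chain are omitted, as they follow by
  \<open>Q_in\<close>.\<close>

definition inclusion_equations :: "zpoly set" where
  "inclusion_equations = (\<lambda>(a, b). zentry a b) ` P_set \<union> (\<lambda>(a, b). zinv a b) ` QR"

abbreviation "inclusion_ideal \<equiv> combinations (zcarrier n) inclusion_equations"

interpretation I: ideal_in "zcarrier n" inclusion_ideal
  by (rule ideal_in_zcarrier)

lemma equation_in: "g \<in> inclusion_equations \<Longrightarrow> g \<in> inclusion_ideal"
  by (rule combinations_base[OF I.R_one])

lemma P_in: "P a b \<Longrightarrow> zentry a b \<in> inclusion_ideal"
  by (rule equation_in) (auto simp: inclusion_equations_def P_set_def)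

text \<open>For a pair covered by a chain, the relation between the matrix and its inverse expresses
  the entry through products. The middle step of the chain decides which factor lies in the ideal: a
  matrix entry by \<open>P\<close>, or an entry of the inverse nearer to the diagonal.\<close>

lemma Q_in: "Q a b \<Longrightarrow> zinv a b \<in> inclusion_ideal"
proof (induction "a - b" arbitrary: a b rule: less_induct)
  case less
  have ba: "b < a" by (rule Q_less[OF less.prems])
  have r: "1 \<le> b" "a \<le> n" using less.prems by (simp_all add: Q_def)
  have ab: "a \<in> {1..n}" "b \<in> {1..n}" using ba r by auto
  consider "(a, b) \<in> QR" | "R1 a b" | "R2 a b" using less.prems by (auto simp: QR_def)
  then show ?case
  proof cases
    case 1
    have "zinv a b \<in> inclusion_equations"
      unfolding inclusion_equations_def by (intro UnI2 image_eqI[OF _ 1]) simp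
    then show ?thesis by (rule equation_in)
  next
    case 2
    then obtain q where q: "\<And>l. 1 \<le> l \<Longrightarrow> v l \<le> b \<Longrightarrow> l \<le> q" "\<And>l. 1 \<le> l \<Longrightarrow> l \<le> q \<Longrightarrow> v l < a"
      unfolding R1_def by blast
    have summand: "zentry a c * zinv c b \<in> inclusion_ideal" if c: "c \<in> {1..n} - {a}" for c
    proof -
      consider "c \<le> q" | "c < b" | "a < c" | "q < c" "b \<le> c" "c < a" using c by fastforce
      then show ?thesis
      proof cases
        case 1
        have "v l < a" if "1 \<le> l" "l \<le> c" for l using q(2)[of l] that 1 by linarith
        then have "P a c" using c r unfolding P_def by auto
        then show ?thesis using c r by (intro I.J_mult_right P_in zinv_in) auto
      next
        case 2
        then show ?thesis using I.J_zero by (simp add: zinv.simps)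
      next
        case 3
        then show ?thesis using I.J_zero by (simp add: zentry_def)
      next
        case 4
        have "l < c" if "1 \<le> l" "v l \<le> b" for l using q(1)[OF that] 4 by linarith
        then have "Q c b" using c r unfolding Q_def by auto
        then have "zinv c b \<in> inclusion_ideal" using 4 by (intro less.hyps) auto
        then show ?thesis using c ab by (intro I.J_mult zentry_in) auto
      qed
    qed
    have "zentry a a * zinv a b + (\<Sum>c\<in>{1..n} - {a}. zentry a c * zinv c b) = 0"
      using zentry_zinv[OF ab] ab ba by (subst sum.remove[of _ a, symmetric]) auto
    then have "zinv a b = - (\<Sum>c\<in>{1..n} - {a}. zentry a c * zinv c b)"
      by (simp add: zentry_def eq_neg_iff_add_eq_0)
    then show ?thesis using summand by (simp only:) (intro I.J_uminus I.J_sum)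
  next
    case 3
    then obtain p where p: "\<And>l. 1 \<le> l \<Longrightarrow> l \<le> b \<Longrightarrow> v l \<le> p" "\<And>l. 1 \<le> l \<Longrightarrow> v l \<le> p \<Longrightarrow> l < a"
      unfolding R2_def by blast
    have summand: "zinv a c * zentry c b \<in> inclusion_ideal" if c: "c \<in> {1..n} - {b}" for c
    proof -
      consider "p < c" | "c < b" | "c \<le> p" "b < c" using c by fastforce
      then show ?thesis
      proof cases
        case 1
        have "v l < c" if "1 \<le> l" "l \<le> b" for l using p(1)[OF that] 1 by linarith
        then have "P c b" using c r unfolding P_def by auto
        then show ?thesis using c ab by (intro I.J_mult P_in zinv_in) auto
      next
        case 2
        then show ?thesis using I.J_zero by (simp add: zentry_def)
      next
        case 3
        have "l < a" if "1 \<le> l" "v l \<le> c" for l using p(2)[OF that(1)] that 3 by linarith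
        then have Q: "Q a c" using c r unfolding Q_def by auto
        have "zinv a c \<in> inclusion_ideal" using Q_less[OF Q] 3 by (intro less.hyps Q) auto
        then show ?thesis using c ab by (intro I.J_mult_right zentry_in) auto
      qed
    qed
    have "zinv a b * zentry b b + (\<Sum>c\<in>{1..n} - {b}. zinv a c * zentry c b) = 0"
      using zinv_zentry[OF ab] ab ba by (subst sum.remove[of _ b, symmetric]) auto
    then have "zinv a b = - (\<Sum>c\<in>{1..n} - {b}. zinv a c * zentry c b)"
      by (simp add: zentry_def eq_neg_iff_add_eq_0)
    then show ?thesis using summand by (simp only:) (intro I.J_uminus I.J_sum)
  qed
qed

text \<open>Since E_{p-1} is contained in F_q, the entries (c, b) of the inverse with b < p and c >
  q lie in the ideal. The relation for column \<open>b\<close> thus involves only later columns up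
  to \<open>q\<close>, which are reduced to the columns p, ..., q by induction.\<close>

lemma column_relation:
  assumes p: "1 \<le> p" and q: "q \<le> n" and pos: "\<And>z. 1 \<le> z \<Longrightarrow> v z < p \<Longrightarrow> z \<le> q"
    and b: "b \<in> {1..q}"
  shows "\<exists>u. (\<forall>c\<in>{p..q}. u c \<in> zcarrier n) \<and>
    (\<forall>x\<in>{p..n}. zentry x b - (\<Sum>c\<in>{p..q}. u c * zentry x c) \<in> inclusion_ideal)"
  using b
proof (induction "q - b" arbitrary: b rule: less_induct)
  case less
  show ?case
  proof (cases "p \<le> b")
    case True
    have "(\<Sum>c\<in>{p..q}. (if c = b then 1 else 0) * zentry x c) = zentry x b" for x
      using True less.prems by (simp add: if_distrib[of "\<lambda>t. t * _"] cong: if_cong)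
    then show ?thesis using I.R_zero I.R_one I.J_zero
      by (intro exI[of _ "\<lambda>c. if c = b then 1 else 0"]) auto
  next
    case False
    let ?good = "\<lambda>c u. (\<forall>d\<in>{p..q}. u d \<in> zcarrier n) \<and>
        (\<forall>x\<in>{p..n}. zentry x c - (\<Sum>d\<in>{p..q}. u d * zentry x d) \<in> inclusion_ideal)"
    have "\<forall>c\<in>{b<..q}. \<exists>u. ?good c u"
      using less.prems by (intro ballI less.hyps) auto
    then obtain u where "\<forall>c\<in>{b<..q}. ?good c (u c)" using bchoice[of "{b<..q}" ?good] by blast
    then have u: "\<And>c d. c \<in> {b<..q} \<Longrightarrow> d \<in> {p..q} \<Longrightarrow> u c d \<in> zcarrier n"
      "\<And>c x. c \<in> {b<..q} \<Longrightarrow> x \<in> {p..n} \<Longrightarrow> zentry x c - (\<Sum>d\<in>{p..q}. u c d * zentry x d) \<in> inclusion_ideal"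
      by blast+
    define w where "w d = - (\<Sum>c\<in>{b<..q}. zinv c b * u c d)" for d
    have b1: "1 \<le> b" "b \<le> n" using less.prems q by auto
    show ?thesis
    proof (intro exI[of _ w] conjI ballI)
      show "w d \<in> zcarrier n" if "d \<in> {p..q}" for d
        unfolding w_def using that u(1) b1 q by (intro I.R_uminus I.R_sum I.R_mult zinv_in) auto
      fix x assume x: "x \<in> {p..n}"
      have xb: "x \<in> {1..n}" "b \<in> {1..n}" "x \<noteq> b" using x p b1 False by auto
      have split: "{1..n} = {1..<b} \<union> (insert b {b<..q} \<union> {q<..n})" using b1 less.prems q by auto
      have "0 = (\<Sum>c\<in>{1..n}. zentry x c * zinv c b)" using zentry_zinv[OF xb(1,2)] xb(3) by simp
      also have "\<dots> = (\<Sum>c\<in>insert b {b<..q} \<union> {q<..n}. zentry x c * zinv c b)"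
        unfolding split by (rule sum.mono_neutral_right) (auto simp: zinv.simps[of _ b])
      also have "\<dots> = (\<Sum>c\<in>insert b {b<..q}. zentry x c * zinv c b) + (\<Sum>c\<in>{q<..n}. zentry x c * zinv c b)"
        using less.prems by (intro sum.union_disjoint) auto
      finally have 0: "zentry x b + (\<Sum>c\<in>{b<..q}. zentry x c * zinv c b) + (\<Sum>c\<in>{q<..n}. zentry x c * zinv c b) = 0"
        by (simp add: zinv.simps[of b b])
      have "(\<Sum>c\<in>{q<..n}. zentry x c * zinv c b) \<in> inclusion_ideal"
      proof (rule I.J_sum)
        fix c assume c: "c \<in> {q<..n}"
        have "l < c" if "1 \<le> l" "v l \<le> b" for l using pos[of l] that c False by force
        then have "Q c b" using c b1 unfolding Q_def by auto
        then show "zentry x c * zinv c b \<in> inclusion_ideal" using xb c by (intro I.J_mult Q_in zentry_in) auto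
      qed
      moreover have "(\<Sum>c\<in>{b<..q}. zinv c b * (zentry x c - (\<Sum>d\<in>{p..q}. u c d * zentry x d))) \<in> inclusion_ideal"
        using u(2)[OF _ x] b1 q by (intro I.J_sum I.J_mult zinv_in) auto
      ultimately have "- (\<Sum>c\<in>{q<..n}. zentry x c * zinv c b)
          - (\<Sum>c\<in>{b<..q}. zinv c b * (zentry x c - (\<Sum>d\<in>{p..q}. u c d * zentry x d))) \<in> inclusion_ideal"
        by (intro I.J_diff I.J_uminus)
      moreover have "(\<Sum>c\<in>{b<..q}. zinv c b * (zentry x c - (\<Sum>d\<in>{p..q}. u c d * zentry x d)))
          = (\<Sum>c\<in>{b<..q}. zentry x c * zinv c b) + (\<Sum>d\<in>{p..q}. w d * zentry x d)"
      proof -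
        have "(\<Sum>d\<in>{p..q}. w d * zentry x d) = - (\<Sum>c\<in>{b<..q}. zinv c b * (\<Sum>d\<in>{p..q}. u c d * zentry x d))"
          unfolding w_def sum_distrib_left minus_mult_left[symmetric] sum_distrib_right sum_negf
          by (subst sum.swap) (simp only: mult.assoc)
        then show ?thesis by (simp add: right_diff_distrib sum_subtractf mult.commute)
      qed
      moreover have "zentry x b - (\<Sum>d\<in>{p..q}. w d * zentry x d)
          = - (\<Sum>c\<in>{q<..n}. zentry x c * zinv c b)
            - ((\<Sum>c\<in>{b<..q}. zentry x c * zinv c b) + (\<Sum>d\<in>{p..q}. w d * zentry x d))"
        using 0 by (simp add: algebra_simps eq_neg_iff_add_eq_0)
      ultimately show "zentry x b - (\<Sum>d\<in>{p..q}. w d * zentry x d) \<in> inclusion_ideal" by (simp only:)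
    qed
  qed
qed

text \<open>A condition of rank 0 concerns single entries. For positive rank r all columns are
  combinations of the r columns p, ..., q, so a minor of size r + 1 reduces to minors with a
  repeated column.\<close>

lemma essential_minors_in:
  assumes e: "(p, q) \<in> essential_set n v"
  shows "minors_in zentry inclusion_ideal {p..n} {1..q} (Suc (rk v p q))"
proof (rule minors_inI)
  let ?k = "Suc (rk v p q)"
  have pq: "(p, q) \<in> diagram n v" using e by (simp add: essential_set_def)
  note D = diagramD[OF pq]
  fix \<alpha> \<beta> assume \<alpha>: "\<And>i. i < ?k \<Longrightarrow> \<alpha> i \<in> {p..n}" and \<beta>: "\<And>j. j < ?k \<Longrightarrow> \<beta> j \<in> {1..q}"
  show "gminor zentry ?k \<alpha> \<beta> \<in> inclusion_ideal"
  proof (cases "rk v p q = 0")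
    case True
    then have "P p q" using diagram_rk_0[of p q] pq by blast
    then have "P (\<alpha> 0) (\<beta> 0)" by (rule P_mono) (use \<alpha>[of 0] \<beta>[of 0] in auto)
    moreover have "gminor zentry ?k \<alpha> \<beta> = zentry (\<alpha> 0) (\<beta> 0)"
      unfolding gminor_def True by (subst det_single) auto
    ultimately show ?thesis using P_in by simp
  next
    case False
    then have r: "rk v p q > 0" by simp
    note pr = essential_positive_rank[OF e r]
    let ?good = "\<lambda>j u. (\<forall>c\<in>{p..q}. u c \<in> zcarrier n) \<and>
      (\<forall>x\<in>{p..n}. zentry x (\<beta> j) - (\<Sum>c\<in>{p..q}. u c * zentry x c) \<in> inclusion_ideal)"
    have "\<forall>j\<in>{..<?k}. \<exists>u. ?good j u"
      using \<beta> by (intro ballI column_relation[OF D(1) D(4) pr(2)]) auto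
    then obtain u where "\<forall>j\<in>{..<?k}. ?good j (u j)" using bchoice[of "{..<?k}" ?good] by blast
    then have u: "\<And>j c. j < ?k \<Longrightarrow> c \<in> {p..q} \<Longrightarrow> u j c \<in> zcarrier n"
      "\<And>j x. j < ?k \<Longrightarrow> x \<in> {p..n} \<Longrightarrow> zentry x (\<beta> j) - (\<Sum>c\<in>{p..q}. u j c * zentry x c) \<in> inclusion_ideal"
      unfolding lessThan_iff[symmetric] by blast+
    show ?thesis
      unfolding gminor_def
    proof (rule I.det_columns_replace[of ?k "\<lambda>i j. zentry (\<alpha> i) (\<beta> j)" "{p..q}" "\<lambda>i c. zentry (\<alpha> i) c" u])
      show "zentry (\<alpha> i) (\<beta> j) \<in> zcarrier n" if "i < ?k" "j < ?k" for i j
        using \<alpha>[OF that(1)] \<beta>[OF that(2)] D by (intro zentry_in) auto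
      show "zentry (\<alpha> i) c \<in> zcarrier n" if "i < ?k" "c \<in> {p..q}" for i c
        using \<alpha>[OF that(1)] that D by (intro zentry_in) auto
      show "u j c \<in> zcarrier n" if "j < ?k" "c \<in> {p..q}" for j c by (rule u(1)[OF that])
      show "zentry (\<alpha> i) (\<beta> j) - (\<Sum>c\<in>{p..q}. u j c * zentry (\<alpha> i) c) \<in> inclusion_ideal" if "i < ?k" "j < ?k" for i j
        by (rule u(2)[OF that(2) \<alpha>[OF that(1)]])
      fix \<gamma> assume \<gamma>: "\<And>j. j < ?k \<Longrightarrow> \<gamma> j \<in> {p..q}"
      have "card {p..q} < ?k" using pr(1) D r rk_complement[of q p] by simp
      moreover have "\<gamma> ` {..<?k} \<subseteq> {p..q}" using \<gamma> by auto
      ultimately have "\<not> inj_on \<gamma> {..<?k}" using card_inj_on_le[of \<gamma> "{..<?k}" "{p..q}"] by fastforce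
      then obtain j j' where "j < ?k" "j' < ?k" "j \<noteq> j'" "\<gamma> j = \<gamma> j'" by (auto simp: inj_on_def)
      then have "gminor zentry ?k \<alpha> \<gamma> = 0" by (rule gminor_repeated_column)
      then show "det (mat ?k ?k (\<lambda>(i, j). zentry (\<alpha> i) (\<gamma> j))) \<in> inclusion_ideal"
        using I.J_zero unfolding gminor_def by simp
    qed
  qed
qed

lemma perm_ideal_subset: "perm_ideal n v \<subseteq> inclusion_ideal"
proof
  have "essential_minors n v \<subseteq> inclusion_ideal"
    unfolding essential_minors_def
  proof (intro UN_least, clarify)
    fix p q g assume e: "(p, q) \<in> essential_set n v" and g: "g \<in> box_minors n p q (rk v p q)"
    have "(p, q) \<in> diagram n v" using e by (simp add: essential_set_def)
    note D = diagramD[OF this]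
    show "g \<in> inclusion_ideal" using box_minors_subset[OF essential_minors_in[OF e] D(1,4)] g by blast
  qed
  moreover fix x assume "x \<in> perm_ideal n v"
  ultimately show "x \<in> inclusion_ideal" unfolding perm_ideal_eq by (intro I.combinations_in_J)
qed

end

section \<open>A basis of the quotient\<close>

lemma lookup_const_mult: "lookup (single 0 c * f) m = c * lookup f m"
  for f :: zpoly
proof -
  have "single 0 c * f = (\<Sum>k\<in>keys f. single k (c * lookup f k))"
    by (subst poly_mapping_expand[of f]) (simp add: sum_distrib_left mult_single)
  then have "lookup (single 0 c * f) m
      = (\<Sum>k\<in>keys f. if k = m then c * lookup f k else 0)"
    by (simp add: lookup_sum lookup_single when_def)
  then show ?thesis by (simp add: in_keys_iff)
qed

interpretation VS: vector_space "\<lambda>c f. single 0 c * f :: zpoly"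
  by unfold_locales (simp_all add: single_add mult_single algebra_simps flip: mult.assoc)

lemma combinations_eq_span: "combinations constants B = VS.span B"
proof
  show "combinations constants B \<subseteq> VS.span B"
  proof
    fix x assume "x \<in> combinations constants B"
    then show "x \<in> VS.span B"
      by induction (auto intro: VS.span_zero VS.span_add VS.span_scale VS.span_base)
  qed
  have "VS.subspace (combinations constants B)"
  proof (rule VS.subspaceI)
    show "single 0 c * x \<in> combinations constants B" if "x \<in> combinations constants B" for c x
      by (rule combinations_mult[OF that]) (auto simp: mult_single)
  qed (auto intro: combinations.zero combinations_add)
  moreover have "1 \<in> constants" by (rule range_eqI[of _ _ 1]) simp
  then have "B \<subseteq> combinations constants B" using combinations_base[of constants _ B] by blast
  ultimately show "VS.span B \<subseteq> combinations constants B" by (intro VS.span_minimal)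
qed

lemma independent_monomials: "VS.independent ((\<lambda>m. single m 1) ` M)"
  unfolding VS.dependent_def
proof clarify
  fix m
  let ?V = "{f :: zpoly. lookup f m = 0}"
  have "VS.subspace ?V" by (rule VS.subspaceI) (simp_all add: lookup_add lookup_const_mult)
  moreover have "(\<lambda>m. single m 1) ` M - {single m 1} \<subseteq> ?V"
    by (auto simp: lookup_single when_def)
  ultimately have "VS.span ((\<lambda>m. single m 1) ` M - {single m 1}) \<subseteq> ?V"
    by (intro VS.span_minimal)
  moreover assume "single m 1 \<in> VS.span ((\<lambda>m. single m 1) ` M - {single m 1})"
  ultimately show False by auto
qed

text \<open>A maximal independent subset of the family already has at least as many elements as the
  index set, so nothing is repeated and nothing left out.\<close>

lemma (in vector_space) independent_spanning_family:
  assumes "finite A" "independent B" "B \<subseteq> span (m ` A)" "card A \<le> card B"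
  shows "inj_on m A" "independent (m ` A)"
proof -
  obtain W where W: "W \<subseteq> m ` A" "independent W" "m ` A \<subseteq> span W"
    using maximal_independent_subset[of "m ` A"] by blast
  have fin: "finite W" using W(1) assms(1) by (auto intro: finite_subset)
  have "B \<subseteq> span W" using assms(3) span_minimal[OF W(3) subspace_span] by blast
  then have "card A \<le> card W" using independent_span_bound[OF fin assms(2)] assms(4) by simp
  moreover have "card W \<le> card (m ` A)" using W(1) assms(1) by (intro card_mono) auto
  moreover have "card (m ` A) \<le> card A" by (rule card_image_le[OF assms(1)])
  ultimately have c: "card (m ` A) = card A" "card W = card (m ` A)" by auto
  show "inj_on m A" by (rule eq_card_imp_inj_on[OF assms(1) c(1)])
  have "W = m ` A" using W(1) c(2) assms(1) by (intro card_subset_eq) auto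
  then show "independent (m ` A)" using W(2) by simp
qed

section \<open>Homogeneous parts and the count of all monomials\<close>

definition hpart :: "(nat \<Rightarrow>\<^sub>0 int) \<Rightarrow> zpoly \<Rightarrow> zpoly" where
  "hpart \<mu> = restrict_keys (\<lambda>m. zdeg m = \<mu>)"

lemma homogeneous_hpart: "homogeneous \<mu> (hpart \<mu> f)"
  by (simp add: homogeneous_def hpart_def keys_restrict_keys)

lemma hpart_same: "homogeneous \<mu> f \<Longrightarrow> hpart \<mu> f = f"
  unfolding hpart_def homogeneous_def by (intro restrict_keys_id) blast

lemma hpart_other: "homogeneous \<nu> f \<Longrightarrow> \<nu> \<noteq> \<mu> \<Longrightarrow> hpart \<mu> f = 0"
  unfolding hpart_def homogeneous_def by (intro restrict_keys_none) auto

lemma hpart_add: "hpart \<mu> (f + g) = hpart \<mu> f + hpart \<mu> g"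
  by (simp add: hpart_def restrict_keys_add)

lemma hpart_zero: "hpart \<mu> 0 = 0"
  by (simp add: hpart_def)

lemma hpart_mult:
  assumes g: "homogeneous \<delta> g"
  shows "hpart \<mu> (r * g) = hpart (\<mu> - \<delta>) r * g"
proof -
  let ?r0 = "hpart (\<mu> - \<delta>) r" and ?r1 = "restrict_keys (\<lambda>m. zdeg m \<noteq> \<mu> - \<delta>) r"
  have "r * g = ?r0 * g + ?r1 * g"
    using restrict_keys_split[of r "\<lambda>m. zdeg m = \<mu> - \<delta>"] unfolding hpart_def by (metis distrib_right)
  moreover have "hpart \<mu> (?r0 * g) = ?r0 * g"
    using homogeneous_mult[OF homogeneous_hpart[of "\<mu> - \<delta>" r] g] by (intro hpart_same) simp
  moreover have "hpart \<mu> (?r1 * g) = 0"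
    unfolding hpart_def
  proof (rule restrict_keys_none)
    fix m assume "m \<in> keys (?r1 * g)"
    then obtain a b where ab: "a \<in> keys ?r1" "b \<in> keys g" "m = a + b" by (rule keys_mult_ex)
    have "zdeg a \<noteq> \<mu> - \<delta>" "zdeg b = \<delta>" using ab g by (auto simp: keys_restrict_keys homogeneous_def)
    then show "zdeg m \<noteq> \<mu>" by (auto simp: ab(3) zdeg_add)
  qed
  ultimately show ?thesis by (simp add: hpart_add)
qed

lemma hpart_zcarrier: "f \<in> zcarrier n \<Longrightarrow> hpart \<mu> f \<in> zcarrier n"
  by (auto simp: zcarrier_def hpart_def keys_restrict_keys)

lemma hpart_combination:
  assumes "x \<in> combinations R G" and hom: "\<And>g. g \<in> G \<Longrightarrow> homogeneous (d g) g"
  shows "hpart \<mu> x \<in> combinations {hpart \<nu> r | \<nu> r. r \<in> R} G"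
  using assms(1)
proof induction
  case (step r g x)
  have "hpart (\<mu> - d g) r * g + hpart \<mu> x \<in> combinations {hpart \<nu> r | \<nu> r. r \<in> R} G"
    using step by (intro combinations.step) auto
  then show ?case by (simp add: hpart_add hpart_mult[OF hom[OF step.hyps(2)]])
qed (simp add: hpart_zero combinations.zero)

lemma homogeneous_monomials:
  assumes "f \<in> zcarrier n" "homogeneous \<mu> f" "f \<noteq> 0"
  shows "0 \<le> height \<mu>"
proof -
  obtain m where m: "m \<in> keys f" using assms(3) by (metis in_keys_iff lookup_zero poly_mapping_eqI)
  then have "m \<in> exponents (zvars n)" "zdeg m = \<mu>" using assms by (auto simp: zcarrier_def homogeneous_def)
  then show ?thesis using finitely_graded_monomials unfolding finitely_graded_def by blast
qed

lemma hilbert_denom_eq: "hilbert_denom n = (\<Prod>(i, j)\<in>zvars n. factor (var_degree i j))"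
  unfolding hilbert_denom_def zdeg_single by (simp add: case_prod_unfold)

lemma slice_denom_id: "slice_denom n id = hilbert_denom n" and slice_vars_id: "slice_vars n id = zvars n"
proof -
  have "zvars n = (\<lambda>(i, j). (j, i)) ` noninv n id" by (force simp: zvars_def noninv_def)
  moreover have "inj_on (\<lambda>(i, j). (j, i)) (noninv n id)" by (auto simp: inj_on_def)
  ultimately show "slice_denom n id = hilbert_denom n"
    unfolding slice_denom_def hilbert_denom_eq by (simp add: prod.reindex case_prod_unfold wt_True_eq_factor)
  show "slice_vars n id = zvars n" unfolding slice_vars_def by (force simp: zvars_def noninv_def)
qed

lemma finite_zvars: "finite (zvars n)"
  by (rule finite_subset[of _ "{1..n} \<times> {1..n}"]) (auto simp: zvars_def)

lemma height_zvars: "x \<in> zvars n \<Longrightarrow> 0 < height (case x of (i, j) \<Rightarrow> var_degree i j)"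
  by (auto simp: zvars_def height_diff)

lemma counting_monomials:
  "laurent_times_series (hilbert_denom n) (counting (exponents (zvars n)) zdeg) = (\<lambda>\<mu>. if \<mu> = 0 then 1 else 0)"
proof -
  let ?\<delta> = "\<lambda>(i, j). var_degree i j" and ?d = "\<lambda>(a::zexp, \<alpha>). zdeg a + exponent_degree (\<lambda>(i, j). var_degree i j) \<alpha>"
  have fg: "finitely_graded {0::zexp} zdeg" by (simp add: finitely_graded_def)
  have "counting (snd ` ({0::zexp} \<times> exponents (zvars n))) zdeg \<mu> = counting ({0::zexp} \<times> exponents (zvars n)) ?d (\<mu> - 0)" for \<mu>
    by (rule counting_image[where s = snd and d = zdeg and d' = ?d and \<delta> = 0]) (auto simp: inj_on_def zdeg_eq)
  then have "counting (exponents (zvars n)) zdeg = counting ({0} \<times> exponents (zvars n)) ?d" by (simp add: fun_eq_iff)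
  moreover have "laurent_times_series (\<Prod>x\<in>zvars n. factor (?\<delta> x)) (counting ({0} \<times> exponents (zvars n)) ?d) = counting {0} zdeg"
    by (rule counting_exponents[of "{0}" zdeg "zvars n" ?\<delta>, OF fg finite_zvars height_zvars])
  ultimately show ?thesis unfolding hilbert_denom_eq counting_single_zero by (simp add: case_prod_unfold)
qed

locale inclusion_basis = inclusion_perm +
  fixes T :: "zexp set" and \<beta> :: "zexp \<Rightarrow> zpoly"
  assumes T: "spanning_monomials n v id zentry T \<beta>"
begin

lemma T_subset: "T \<subseteq> exponents (zvars n)"
  using spanning_monomialsD(1)[OF T] by (simp only: slice_vars_id)

lemma T_counting: "laurent_times_series (hilbert_denom n) (counting T zdeg) = lookup (loc True n v id)"
  using spanning_monomialsD(2)[OF T] by (simp only: slice_denom_id)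

lemma homogeneous_\<beta>: "e \<in> T \<Longrightarrow> homogeneous (zdeg e) (\<beta> e)"
  by (rule spanning_monomialsD(3)[OF T])

lemma \<beta>_in: "e \<in> T \<Longrightarrow> \<beta> e \<in> zcarrier n"
  using spanning_monomialsD(5)[OF T] by (simp only: coordinate_ring_zentry)

lemma spanned_mod_perm_ideal: "f \<in> zcarrier n \<Longrightarrow> spanned (\<beta> ` T) (perm_ideal n v) f"
  using spanning_monomialsD(4)[OF T, of f] schubert_ideal_subset_perm_ideal
  by (auto simp: coordinate_ring_zentry elim: spanned_mono)

text \<open>The tag keeps a matrix entry and an entry of the inverse with the same indices apart;
  both occur if \<open>P\<close> and \<open>Q\<close> hold without a chain.\<close>

definition eqs :: "(bool \<times> nat \<times> nat) set" where
  "eqs = {False} \<times> P_set \<union> {True} \<times> QR"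

definition eq_poly :: "bool \<times> nat \<times> nat \<Rightarrow> zpoly" where
  "eq_poly x = (case x of (k, a, b) \<Rightarrow> if k then zinv a b else zentry a b)"

definition eq_degree :: "bool \<times> nat \<times> nat \<Rightarrow> (nat \<Rightarrow>\<^sub>0 int)" where
  "eq_degree x = (case x of (k, a, b) \<Rightarrow> var_degree a b)"

lemma finite_eqs: "finite eqs"
  using finite_P_QR by (simp add: eqs_def)

lemma inclusion_equations_eq: "inclusion_equations = eq_poly ` eqs"
proof -
  have "{k} \<times> A = Pair k ` A" for k :: bool and A :: "(nat \<times> nat) set" by auto
  moreover have "(\<lambda>x. eq_poly (False, x)) = (\<lambda>(a, b). zentry a b)" "(\<lambda>x. eq_poly (True, x)) = (\<lambda>(a, b). zinv a b)"
    by (auto simp: eq_poly_def)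
  ultimately show ?thesis
    by (simp only: inclusion_equations_def eqs_def image_Un image_image)
qed

lemma homogeneous_eq_poly: "homogeneous (eq_degree x) (eq_poly x)"
  using homogeneous_zentry homogeneous_zinv by (simp add: eq_poly_def eq_degree_def case_prod_unfold)

lemma height_eq_degree: "x \<in> eqs \<Longrightarrow> 0 < height (eq_degree x)"
  using P_less Q_less by (auto simp: eqs_def eq_degree_def height_diff P_set_def QR_def)

lemma loc_eqs: "loc True n v id = (\<Prod>x\<in>eqs. factor (eq_degree x))"
proof -
  have "(\<Prod>x\<in>{k} \<times> A. factor (eq_degree x)) = (\<Prod>(a, b)\<in>A. wt True b a)" for k and A :: "(nat \<times> nat) set"
    by (rule prod.reindex_bij_witness[of _ "\<lambda>x. (k, x)" snd]) (auto simp: eq_degree_def wt_True_eq_factor)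
  then show ?thesis
    unfolding loc_eq_psi_K_theory[OF permutes_id] psi_id_PQ eqs_def
    using finite_P_QR by (subst prod.union_disjoint) auto
qed

abbreviation "index \<equiv> T \<times> exponents eqs"

definition index_degree :: "zexp \<times> ((bool \<times> nat \<times> nat) \<Rightarrow>\<^sub>0 nat) \<Rightarrow> (nat \<Rightarrow>\<^sub>0 int)" where
  "index_degree = (\<lambda>(e, \<alpha>). zdeg e + exponent_degree eq_degree \<alpha>)"

definition eq_power :: "((bool \<times> nat \<times> nat) \<Rightarrow>\<^sub>0 nat) \<Rightarrow> zpoly" where
  "eq_power \<alpha> = (\<Prod>x\<in>eqs. eq_poly x ^ lookup \<alpha> x)"

definition element :: "zexp \<times> ((bool \<times> nat \<times> nat) \<Rightarrow>\<^sub>0 nat) \<Rightarrow> zpoly" where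
  "element = (\<lambda>(e, \<alpha>). \<beta> e * eq_power \<alpha>)"

lemma eq_power_add: "x \<in> eqs \<Longrightarrow> eq_power (\<alpha> + single x 1) = eq_poly x * eq_power \<alpha>"
proof -
  assume x: "x \<in> eqs"
  have "eq_power (\<alpha> + single x 1) = (\<Prod>y\<in>eqs. (if y = x then eq_poly y else 1) * eq_poly y ^ lookup \<alpha> y)"
    unfolding eq_power_def by (intro prod.cong) (auto simp: lookup_add lookup_single when_def)
  then show ?thesis using x finite_eqs by (simp add: prod.distrib eq_power_def)
qed

lemma finitely_graded_T: "finitely_graded T zdeg"
  by (rule finitely_graded_subset[OF finitely_graded_monomials T_subset])

lemma finitely_graded_index: "finitely_graded index index_degree"
  unfolding index_degree_def
  by (rule finitely_graded_exponents[OF finitely_graded_T finite_eqs height_eq_degree])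

text \<open>Multiplied by the denominator and by the factors of the equations, the count of the
  indices becomes \<open>loc\<close> at the identity, which is the product of these same factors.
  Cancelling leaves the count of all monomials.\<close>

lemma counting_index: "counting index index_degree = counting (exponents (zvars n)) zdeg"
proof -
  let ?E = "\<Prod>x\<in>eqs. factor (eq_degree x)" and ?D = "\<Prod>x\<in>zvars n. factor (case x of (i, j) \<Rightarrow> var_degree i j)"
  let ?h = "counting index index_degree" and ?g = "counting (exponents (zvars n)) zdeg"
  have D: "?D = hilbert_denom n" by (simp add: hilbert_denom_eq case_prod_unfold)
  have E: "laurent_times_series ?E ?h = counting T zdeg"
    unfolding index_degree_def by (rule counting_exponents[OF finitely_graded_T finite_eqs height_eq_degree])
  note b = bounded_counting[OF finitely_graded_index] bounded_counting[OF finitely_graded_monomials[of n]]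
  have keys_factor_prod: "0 \<le> height \<nu>" if "\<nu> \<in> keys (\<Prod>x\<in>X'. factor (\<delta> x))" "finite X'" "\<And>x. x \<in> X' \<Longrightarrow> 0 < height (\<delta> x)"
    for \<nu> X' and \<delta> :: "'z \<Rightarrow> (nat \<Rightarrow>\<^sub>0 int)"
    using that(2,1,3)
  proof (induction X' arbitrary: \<nu>)
    case (insert x X')
    then have "\<nu> \<in> keys (factor (\<delta> x) * (\<Prod>x\<in>X'. factor (\<delta> x)))" by simp
    then obtain a c where ac: "a \<in> keys (factor (\<delta> x))" "c \<in> keys (\<Prod>x\<in>X'. factor (\<delta> x))" "\<nu> = a + c"
      by (rule keys_mult_ex)
    have "0 \<le> height a" using ac(1) keys_factor[of "\<delta> x"] insert.prems(2)[of x] by force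
    moreover have "0 \<le> height c" using insert.IH[OF ac(2)] insert.prems(2) by blast
    ultimately show ?case by (simp add: ac(3) height_add)
  qed simp
  have "laurent_times_series ?E (laurent_times_series ?D ?h) = laurent_times_series ?E (laurent_times_series ?D ?g)"
  proof -
    have "laurent_times_series ?E (laurent_times_series ?D ?h) = laurent_times_series ?D (laurent_times_series ?E ?h)"
      by (simp only: laurent_times_series_mult[symmetric] mult.commute)
    also have "\<dots> = lookup ?E" unfolding E D T_counting loc_eqs ..
    also have "\<dots> = laurent_times_series ?E (laurent_times_series ?D ?g)"
      unfolding D counting_monomials laurent_times_series_delta ..
    finally show ?thesis .
  qed
  note eq = this
  have bD: "bounded_series (laurent_times_series ?D h)" if "bounded_series h" for h
    by (rule bounded_series_times[OF that keys_factor_prod[OF _ finite_zvars height_zvars]])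
  have eqD: "laurent_times_series ?D ?h = laurent_times_series ?D ?g"
    by (rule factor_prod_cancel[OF finite_eqs height_eq_degree bD[OF b(1)] bD[OF b(2)] eq])
  show ?thesis by (rule factor_prod_cancel[OF finite_zvars height_zvars b eqD])
qed

lemma eq_poly_mult_span:
  assumes f: "f \<in> VS.span (element ` {a \<in> index. index_degree a = \<mu> - eq_degree x})" and x: "x \<in> eqs"
  shows "eq_poly x * f \<in> VS.span (element ` {a \<in> index. index_degree a = \<mu> \<and> snd a \<noteq> 0})" (is "_ \<in> ?S")
  using f
proof (induction rule: VS.span_induct_alt)
  case base
  then show ?case by (simp add: VS.span_zero)
next
  case (step c b y)
  then obtain e \<alpha> where b: "b = element (e, \<alpha>)" "e \<in> T" "\<alpha> \<in> exponents eqs" "index_degree (e, \<alpha>) = \<mu> - eq_degree x" by auto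
  let ?\<alpha> = "\<alpha> + single x 1"
  have "keys ?\<alpha> \<subseteq> eqs"
    using Poly_Mapping.keys_add[of \<alpha> "single x 1"] b(3) x by (auto simp: exponents_def)
  moreover have "x \<in> keys ?\<alpha>" by (simp add: in_keys_iff lookup_add)
  then have "?\<alpha> \<noteq> 0" by auto
  ultimately have e\<alpha>: "(e, ?\<alpha>) \<in> {a \<in> index. index_degree a = \<mu> \<and> snd a \<noteq> 0}"
    using b by (simp add: exponents_def index_degree_def exponent_degree_add algebra_simps)
  have "element (e, ?\<alpha>) = eq_poly x * b"
    unfolding b(1) element_def prod.case eq_power_add[OF x] by (simp only: mult_ac)
  then have "eq_poly x * b \<in> ?S" using VS.span_base[OF imageI[OF e\<alpha>, of element]] by (simp only:)
  then have "single 0 c * (eq_poly x * b) + eq_poly x * y \<in> ?S"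
    using step by (intro VS.span_add VS.span_scale)
  then show ?case by (simp add: algebra_simps)
qed

lemma \<beta>_hpart_span:
  assumes "s \<in> combinations constants (\<beta> ` T)"
  shows "hpart \<mu> s \<in> VS.span (\<beta> ` {e \<in> T. zdeg e = \<mu>})" (is "_ \<in> ?S")
  using assms
proof induction
  case zero
  then show ?case by (simp add: hpart_zero VS.span_zero)
next
  case (step c g x)
  then obtain e k where e: "e \<in> T" "g = \<beta> e" "c = single 0 k" by auto
  have "homogeneous (zdeg e) (c * g)"
    using homogeneous_mult[OF homogeneous_const homogeneous_\<beta>[OF e(1)], of k] by (simp add: e)
  then have "hpart \<mu> (c * g) = (if zdeg e = \<mu> then c * g else 0)" using hpart_same hpart_other by auto
  moreover have "c * g \<in> ?S" if "zdeg e = \<mu>"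
    unfolding e(2,3) using e(1) that by (intro VS.span_scale VS.span_base imageI) simp
  ultimately have "hpart \<mu> (c * g) \<in> ?S" by (simp add: VS.span_zero)
  then show ?case using step.IH by (simp add: hpart_add VS.span_add)
qed

lemma element_zero: "element (e, 0) = \<beta> e"
  by (simp add: element_def eq_power_def)

lemma \<beta>_subset_element: "\<beta> ` {e \<in> T. zdeg e = \<mu>} \<subseteq> element ` {a \<in> index. index_degree a = \<mu>}"
proof (rule image_subsetI)
  fix e assume "e \<in> {e \<in> T. zdeg e = \<mu>}"
  then have "(e, 0) \<in> {a \<in> index. index_degree a = \<mu>}" by (simp add: exponents_def index_degree_def)
  from imageI[OF this, of element] show "\<beta> e \<in> element ` {a \<in> index. index_degree a = \<mu>}" unfolding element_zero .
qed

text \<open>Modulo the inclusion ideal \<open>f\<close> is a combination of the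
  \<open>\<beta> e\<close>. The remainder has coefficients of smaller height, since every equation
  has positive height.\<close>

lemma element_spans:
  assumes "f \<in> zcarrier n" "homogeneous \<mu> f"
  shows "f \<in> VS.span (element ` {a \<in> index. index_degree a = \<mu>})"
  using assms
proof (induction "nat (height \<mu> + 1)" arbitrary: f \<mu> rule: less_induct)
  case less
  let ?S = "VS.span (element ` {a \<in> index. index_degree a = \<mu>})"
  show ?case
  proof (cases "f = 0")
    case True
    then show ?thesis by (simp add: VS.span_zero)
  next
    case False
    then have h: "0 \<le> height \<mu>" using homogeneous_monomials less.prems by blast
    obtain s where s: "s \<in> combinations constants (\<beta> ` T)" "f - s \<in> perm_ideal n v"
      by (rule spannedE[OF spanned_mod_perm_ideal[OF less.prems(1)]])
    have "hpart \<mu> s \<in> ?S"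
      using \<beta>_hpart_span[OF s(1), of \<mu>] VS.span_mono[OF \<beta>_subset_element[of \<mu>]] by blast
    moreover have "hpart \<mu> (f - s) \<in> ?S"
    proof -
      have "f - s \<in> combinations (zcarrier n) inclusion_equations" using s(2) perm_ideal_subset by blast
      then show ?thesis
      proof induction
        case zero
        then show ?case by (simp add: hpart_zero VS.span_zero)
      next
        case (step r g y)
        then obtain x where x: "x \<in> eqs" "g = eq_poly x" by (auto simp: inclusion_equations_eq)
        let ?\<nu> = "\<mu> - eq_degree x"
        have "hpart ?\<nu> r \<in> VS.span (element ` {a \<in> index. index_degree a = ?\<nu>})"
          using height_eq_degree[OF x(1)] h
          by (intro less.hyps hpart_zcarrier step.hyps(1) homogeneous_hpart) (simp add: height_diff)
        from eq_poly_mult_span[OF this x(1)] have "eq_poly x * hpart ?\<nu> r \<in> ?S"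
          by (rule set_mp[OF VS.span_mono, rotated]) auto
        then have "hpart \<mu> (r * g) \<in> ?S" unfolding x(2) hpart_mult[OF homogeneous_eq_poly] by (simp add: mult.commute)
        then show ?case using step.IH by (simp add: hpart_add VS.span_add)
      qed
    qed
    ultimately have "hpart \<mu> s + hpart \<mu> (f - s) \<in> ?S" by (rule VS.span_add)
    then show ?thesis using hpart_same[OF less.prems(2)] by (simp flip: hpart_add)
  qed
qed

lemma element_independent:
  "inj_on element {a \<in> index. index_degree a = \<mu>}" "VS.independent (element ` {a \<in> index. index_degree a = \<mu>})"
proof -
  let ?A = "{a \<in> index. index_degree a = \<mu>}" and ?M = "{m \<in> exponents (zvars n). zdeg m = \<mu>}"
  let ?B = "(\<lambda>m. single m (1::complex)) ` ?M"
  have fin: "finite ?A" using finitely_graded_index unfolding finitely_graded_def by blast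
  have card: "card ?A \<le> card ?B"
  proof -
    have "inj_on (\<lambda>m. single m (1::complex)) ?M" by (intro inj_onI) (metis in_keys_iff lookup_single_eq lookup_single_not_eq zero_neq_one)
    then have "card ?B = card ?M" by (rule card_image)
    moreover have "card ?A = card ?M" using fun_cong[OF counting_index, of \<mu>] by (simp add: counting_def)
    ultimately show ?thesis by simp
  qed
  have sub: "?B \<subseteq> VS.span (element ` ?A)"
  proof (rule image_subsetI)
    fix m assume "m \<in> ?M"
    then show "single m 1 \<in> VS.span (element ` ?A)"
      by (intro element_spans) (auto simp: zcarrier_def homogeneous_def)
  qed
  show "inj_on element ?A" "VS.independent (element ` ?A)"
    using VS.independent_spanning_family[OF fin independent_monomials sub card] by blast+
qed

end

section \<open>Homogeneity of the ideal and the dimensions of the graded pieces\<close>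

lemma homogeneous_prod:
  "(\<And>i. i \<in> A \<Longrightarrow> homogeneous (d i) (f i)) \<Longrightarrow> homogeneous (\<Sum>i\<in>A. d i) (\<Prod>i\<in>A. f i)"
  by (induction A rule: infinite_finite_induct) (auto intro: homogeneous_one homogeneous_mult)

lemma homogeneous_gminor:
  "homogeneous ((\<Sum>j<k. single (\<beta> j) 1) - (\<Sum>i<k. single (\<alpha> i) 1)) (gminor zentry k \<alpha> \<beta>)"
    (is "homogeneous ?d _")
proof -
  let ?A = "mat k k (\<lambda>(i, j). zentry (\<alpha> i) (\<beta> j))"
  have "homogeneous ?d (signof p * (\<Prod>i = 0..<k. ?A $$ (i, p i)))" if p: "p permutes {0..<k}" for p
  proof -
    have "homogeneous (\<Sum>i = 0..<k. var_degree (\<alpha> i) (\<beta> (p i))) (\<Prod>i = 0..<k. ?A $$ (i, p i))"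
    proof (rule homogeneous_prod)
      fix i assume "i \<in> {0..<k}"
      moreover from this have "p i < k" using permutes_in_image[OF p, of i] by simp
      ultimately show "homogeneous (var_degree (\<alpha> i) (\<beta> (p i))) (?A $$ (i, p i))" using homogeneous_zentry by simp
    qed
    moreover have "(\<Sum>i = 0..<k. var_degree (\<alpha> i) (\<beta> (p i))) = ?d"
      using sum.permute[OF p, of "\<lambda>j. single (\<beta> j) (1::int)"]
      by (simp add: sum_subtractf comp_def lessThan_atLeast0)
    moreover have "homogeneous 0 (signof p :: zpoly)"
      using homogeneous_one homogeneous_uminus[OF homogeneous_one] by (simp add: sign_def)
    ultimately show ?thesis using homogeneous_mult[of 0 "signof p" ?d] by simp
  qed
  then have "homogeneous ?d (det ?A)" unfolding det_def by (auto intro!: homogeneous_sum)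
  then show ?thesis by (simp add: gminor_def)
qed

lemma homogeneous_essential_minors:
  assumes "g \<in> essential_minors n v" shows "\<exists>\<mu>. homogeneous \<mu> g"
proof -
  obtain p q where pq: "(p, q) \<in> essential_set n v" "g \<in> box_minors n p q (rk v p q)"
    using assms unfolding essential_minors_def by auto
  let ?G = "{g. \<exists>\<mu>. homogeneous \<mu> g}"
  have "minors_in zentry ?G {p..n} {1..q} (Suc (rk v p q))"
    using homogeneous_gminor by (intro minors_inI) blast
  then have "box_minors n p q (rk v p q) \<subseteq> ?G"
    by (rule box_minors_subset) (use pq(1) in \<open>auto simp: essential_set_def diagram_def\<close>)
  then show ?thesis using pq(2) by blast
qed

lemma hpart_perm_ideal:
  assumes "x \<in> perm_ideal n v" shows "hpart \<mu> x \<in> perm_ideal n v"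
proof -
  obtain d where "\<forall>g\<in>essential_minors n v. homogeneous (d g) g"
    using homogeneous_essential_minors bchoice[of "essential_minors n v" "\<lambda>g \<mu>. homogeneous \<mu> g"] by blast
  then have "hpart \<mu> x \<in> combinations {hpart \<nu> r | \<nu> r. r \<in> zcarrier n} (essential_minors n v)"
    using assms unfolding perm_ideal_eq by (intro hpart_combination[where d = d]) auto
  then show ?thesis
    unfolding perm_ideal_eq by (rule combinations_mono) (use hpart_zcarrier in auto)
qed

lemma subfield_constants: "subfield constants (zring n)"
proof -
  interpret cring "zring n" by (rule cring_zring)
  have uminus: "\<ominus>\<^bsub>zring n\<^esub> single 0 c = single 0 (- c)" for c
    by (rule minus_equality) (simp_all add: zcarrier_const flip: single_add)
  have "1 \<in> constants" by (rule range_eqI[of _ _ 1]) simp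
  then have "subring constants (zring n)"
    by (intro subringI) (auto simp: zcarrier_const uminus mult_single simp flip: single_add)
  then show ?thesis
  proof (rule subfieldI[OF subcringI'])
    show "Units (zring n\<lparr>carrier := constants\<rparr>) = constants - {\<zero>\<^bsub>zring n\<^esub>}"
    proof (rule equalityI; rule subsetI)
      fix x assume "x \<in> Units (zring n\<lparr>carrier := constants\<rparr>)"
      then show "x \<in> constants - {\<zero>\<^bsub>zring n\<^esub>}" by (auto simp: Units_def)
    next
      fix x assume "x \<in> constants - {\<zero>\<^bsub>zring n\<^esub>}"
      then obtain c where "x = single 0 c" "x \<noteq> 0" by auto
      then have c: "x = single 0 c" "c \<noteq> 0" by auto
      then have "x * single 0 (1 / c) = 1" by (simp add: mult_single)
      then show "x \<in> Units (zring n\<lparr>carrier := constants\<rparr>)" using c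
        by (auto simp: Units_def mult.commute intro!: bexI[of _ "single 0 (1 / c)"])
    qed
  qed
qed

context inclusion_basis begin

text \<open>The homogeneous part of an element of the ideal is spanned by elements that contain at
  least one equation, and these are independent of the \<open>\<beta> e\<close>.\<close>

lemma \<beta>_independent:
  assumes e0: "e0 \<in> T" "zdeg e0 = \<mu>" and s: "s \<in> VS.span (\<beta> ` ({e \<in> T. zdeg e = \<mu>} - {e0}))"
  shows "\<beta> e0 - s \<notin> perm_ideal n v"
proof
  let ?A = "{a \<in> index. index_degree a = \<mu>}" and ?A' = "{a \<in> index. index_degree a = \<mu> \<and> snd a \<noteq> 0}"
  let ?S = "VS.span (element ` ?A - {\<beta> e0})"
  assume mem: "\<beta> e0 - s \<in> perm_ideal n v"
  have a0: "(e0, 0) \<in> ?A" using e0 by (simp add: exponents_def index_degree_def)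
  have other: "element a \<in> element ` ?A - {\<beta> e0}" if "a \<in> ?A" "a \<noteq> (e0, 0)" for a
    using inj_onD[OF element_independent(1) _ that(1) a0] that unfolding element_zero by blast
  have "\<beta> ` ({e \<in> T. zdeg e = \<mu>} - {e0}) \<subseteq> element ` ?A - {\<beta> e0}"
  proof (rule image_subsetI)
    fix e assume "e \<in> {e \<in> T. zdeg e = \<mu>} - {e0}"
    then have "(e, 0) \<in> ?A" "(e, 0) \<noteq> (e0, 0 :: (bool \<times> nat \<times> nat) \<Rightarrow>\<^sub>0 nat)" by (auto simp: exponents_def index_degree_def)
    from other[OF this] show "\<beta> e \<in> element ` ?A - {\<beta> e0}" unfolding element_zero .
  qed
  then have sS: "s \<in> ?S" using s VS.span_mono by blast
  have "homogeneous \<mu> (\<beta> e0 - s)"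
  proof -
    have "VS.subspace {f. homogeneous \<mu> f}"
      using homogeneous_zero homogeneous_add homogeneous_mult[OF homogeneous_const, of \<mu>] by (intro VS.subspaceI) auto
    then have "VS.span (\<beta> ` ({e \<in> T. zdeg e = \<mu>} - {e0})) \<subseteq> {f. homogeneous \<mu> f}"
      using homogeneous_\<beta> by (intro VS.span_minimal) auto
    then show ?thesis using s e0 homogeneous_\<beta>[of e0] by (intro homogeneous_diff) auto
  qed
  moreover have "hpart \<mu> (\<beta> e0 - s) \<in> ?S"
  proof -
    have "\<beta> e0 - s \<in> combinations (zcarrier n) inclusion_equations" using mem perm_ideal_subset by blast
    then have "hpart \<mu> (\<beta> e0 - s) \<in> VS.span (element ` ?A')"
    proof induction
      case zero
      then show ?case by (simp add: hpart_zero VS.span_zero)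
    next
      case (step r g y)
      then obtain x where x: "x \<in> eqs" "g = eq_poly x" by (auto simp: inclusion_equations_eq)
      have "eq_poly x * hpart (\<mu> - eq_degree x) r \<in> VS.span (element ` ?A')"
        by (intro eq_poly_mult_span x(1) element_spans hpart_zcarrier step.hyps(1) homogeneous_hpart)
      then have "hpart \<mu> (r * g) \<in> VS.span (element ` ?A')"
        unfolding x(2) hpart_mult[OF homogeneous_eq_poly] by (simp add: mult.commute)
      then show ?case using step.IH by (simp add: hpart_add VS.span_add)
    qed
    moreover have "element ` ?A' \<subseteq> element ` ?A - {\<beta> e0}" using other by auto
    ultimately show ?thesis using VS.span_mono by blast
  qed
  ultimately have "\<beta> e0 - s \<in> ?S" by (simp add: hpart_same)
  then have "\<beta> e0 \<in> ?S" using VS.span_add[OF _ sS] by force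
  moreover have "\<beta> e0 \<in> element ` ?A" using imageI[OF a0, of element] unfolding element_zero .
  ultimately show False using element_independent(2)[of \<mu>] unfolding VS.dependent_def by blast
qed

lemma hilbert_eq_counting: "hilbert n (perm_ideal n v) \<mu> = counting T zdeg \<mu>"
proof -
  let ?I = "perm_ideal n v"
  let ?h = "\<lambda>f. ?I +>\<^bsub>zring n\<^esub> f"
  let ?T = "{e \<in> T. zdeg e = \<mu>}"
  interpret ideal ?I "zring n"
    unfolding perm_ideal_eq by (rule ideal_combinations[OF essential_minors_zcarrier])
  interpret I: ideal_in "zcarrier n" ?I unfolding perm_ideal_eq by (rule ideal_in_zcarrier)
  interpret h: ring_hom_ring "zring n" "zring n Quot ?I" ?h by (rule rcos_ring_hom_ring)
  have h_eqD: "f - g \<in> ?I" if "f \<in> zcarrier n" "?h f = ?h g" for f g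
  proof -
    have "f \<in> ?h g" using a_rcos_self[OF that(1)] that(2) by simp
    then obtain i where "i \<in> ?I" "f = i + g" unfolding a_r_coset_def' by auto
    then show ?thesis by simp
  qed
  have h_eqI: "?h f = ?h g" if "f \<in> zcarrier n" "g \<in> zcarrier n" "f - g \<in> ?I" for f g
  proof -
    have fg: "f - g \<in> zcarrier n" using that(3) a_subset by auto
    have "?h (f - g) = ?I" by (rule a_rcos_const[OF that(3)])
    then have "?h (f - g) = \<zero>\<^bsub>zring n Quot ?I\<^esub>" by (simp add: FactRing_def)
    moreover have "?h f = ?h (f - g) \<oplus>\<^bsub>zring n Quot ?I\<^esub> ?h g" using h.hom_add[OF fg that(2)] by simp
    ultimately show ?thesis using h.hom_closed[OF that(2)] by simp
  qed
  have span_carrier: "VS.span B \<subseteq> zcarrier n" if "B \<subseteq> zcarrier n" for B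
    unfolding combinations_eq_span[symmetric]
    using zcarrier_combinations[OF combinations_mono that] constants_subset[of "entries n zentry"] coordinate_ring_zentry by blast
  have \<beta>_carrier: "\<beta> ` A \<subseteq> zcarrier n" if "A \<subseteq> T" for A using \<beta>_in that by auto
  \<comment> \<open>Identifies the span of a list in the ring structure with the span in the complex
    vector space, where independence is known.\<close>
  have Span: "Span constants (map \<beta> es) = VS.span (\<beta> ` set es)" if "set es \<subseteq> T" for es
    using that
  proof (induction es)
    case (Cons e es)
    have "line_extension constants (\<beta> e) (VS.span (\<beta> ` set es)) = VS.span (insert (\<beta> e) (\<beta> ` set es))"
    proof (rule equalityI; rule subsetI)
      fix x assume "x \<in> line_extension constants (\<beta> e) (VS.span (\<beta> ` set es))"
      then obtain c y where "y \<in> VS.span (\<beta> ` set es)" "x = single 0 c * \<beta> e + y"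
        unfolding line_extension_mem_iff by auto
      then show "x \<in> VS.span (insert (\<beta> e) (\<beta> ` set es))"
        unfolding VS.span_insert by (intro CollectI exI[of _ c]) simp
    next
      fix x assume "x \<in> VS.span (insert (\<beta> e) (\<beta> ` set es))"
      then obtain c where "x - single 0 c * \<beta> e \<in> VS.span (\<beta> ` set es)" unfolding VS.span_insert by blast
      then show "x \<in> line_extension constants (\<beta> e) (VS.span (\<beta> ` set es))"
        unfolding line_extension_mem_iff by (intro bexI[of _ "single 0 c"] bexI) simp_all
    qed
    then show ?case using Cons.IH Cons.prems by simp
  qed simp
  have Span_image: "h.S.Span (?h ` constants) (map ?h (map \<beta> es)) = ?h ` VS.span (\<beta> ` set es)" if "set es \<subseteq> T" for es
  proof -
    have "constants \<subseteq> zcarrier n" "set (map \<beta> es) \<subseteq> zcarrier n" using zcarrier_const \<beta>_carrier[OF that] by auto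
    from h.Span_hom[OF this] show ?thesis unfolding Span[OF that] .
  qed
  have fin: "finite ?T" using finitely_graded_T unfolding finitely_graded_def by blast
  then obtain es where es: "set es = ?T" "distinct es" using finite_distinct_list by blast
  have indep: "h.S.independent (?h ` constants) (map (\<lambda>e. ?h (\<beta> e)) es')" if "distinct es'" "set es' \<subseteq> ?T" for es'
    using that
  proof (induction es')
    case (Cons e es')
    have es'T: "set es' \<subseteq> T" using Cons.prems by auto
    have "?h (\<beta> e) \<notin> h.S.Span (?h ` constants) (map ?h (map \<beta> es'))"
    proof
      assume "?h (\<beta> e) \<in> h.S.Span (?h ` constants) (map ?h (map \<beta> es'))"
      also have "h.S.Span (?h ` constants) (map ?h (map \<beta> es')) = ?h ` VS.span (\<beta> ` set es')"
        by (simp only: Span_image[OF es'T])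
      finally obtain s where s: "s \<in> VS.span (\<beta> ` set es')" "?h (\<beta> e) = ?h s" by blast
      have e: "e \<in> T" "zdeg e = \<mu>" using Cons.prems by auto
      have "\<beta> ` set es' \<subseteq> \<beta> ` (?T - {e})" using Cons.prems by auto
      then have "s \<in> VS.span (\<beta> ` (?T - {e}))" using s(1) VS.span_mono by blast
      then show False using \<beta>_independent[OF e] h_eqD[OF \<beta>_in[OF e(1)] s(2)] by blast
    qed
    then show ?case using Cons \<beta>_in by (auto simp: comp_def intro!: h.S.independent.li_Cons)
  qed simp
  have "graded_piece n ?I \<mu> = ?h ` VS.span (\<beta> ` ?T)"
  proof (rule equalityI; rule subsetI)
    fix c assume "c \<in> graded_piece n ?I \<mu>"
    then obtain f where f: "c = ?h f" "f \<in> zcarrier n" "homogeneous \<mu> f"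
      unfolding graded_piece_def homogeneous_def by blast
    obtain s where s: "s \<in> combinations constants (\<beta> ` T)" "f - s \<in> ?I"
      by (rule spannedE[OF spanned_mod_perm_ideal[OF f(2)]])
    have span: "hpart \<mu> s \<in> VS.span (\<beta> ` ?T)" by (rule \<beta>_hpart_span[OF s(1)])
    have "f - hpart \<mu> s = hpart \<mu> (f - s)"
      using hpart_add[of \<mu> "f - s" s] hpart_same[OF f(3)] by (simp only: diff_add_cancel diff_eq_eq)
    then have "f - hpart \<mu> s \<in> ?I" using hpart_perm_ideal[OF s(2), of \<mu>] by (simp only:)
    moreover have "hpart \<mu> s \<in> zcarrier n" using span span_carrier[OF \<beta>_carrier[of ?T]] by blast
    ultimately have "?h f = ?h (hpart \<mu> s)" by (intro h_eqI f(2))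
    then show "c \<in> ?h ` VS.span (\<beta> ` ?T)" using f(1) span by blast
  next
    fix c assume "c \<in> ?h ` VS.span (\<beta> ` ?T)"
    then obtain s where s: "c = ?h s" "s \<in> VS.span (\<beta> ` ?T)" by blast
    have "VS.subspace {f. homogeneous \<mu> f}"
      using homogeneous_zero homogeneous_add homogeneous_mult[OF homogeneous_const, of \<mu>] by (intro VS.subspaceI) auto
    then have "VS.span (\<beta> ` ?T) \<subseteq> {f. homogeneous \<mu> f}" using homogeneous_\<beta> by (intro VS.span_minimal) auto
    then have "homogeneous \<mu> s" "s \<in> zcarrier n" using s(2) span_carrier[OF \<beta>_carrier[of ?T]] by auto
    then show "c \<in> graded_piece n ?I \<mu>" unfolding graded_piece_def homogeneous_def s(1) by blast
  qed
  also have "\<dots> = h.S.Span (?h ` constants) (map (\<lambda>e. ?h (\<beta> e)) es)"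
    using Span_image[of es] es(1) by (simp add: comp_def del: ring.Span.simps)
  finally have piece: "h.S.Span (?h ` constants) (map (\<lambda>e. ?h (\<beta> e)) es) = graded_piece n ?I \<mu>" ..
  have "scalars n ?I = ?h ` constants" unfolding scalars_def by auto
  \<comment> \<open>The quotient must be nonzero for the scalars to form a field. Generators of
    positive height cannot produce 1, which has degree 0.\<close>
  moreover have "\<one>\<^bsub>zring n Quot ?I\<^esub> \<noteq> \<zero>\<^bsub>zring n Quot ?I\<^esub>"
  proof
    assume "\<one>\<^bsub>zring n Quot ?I\<^esub> = \<zero>\<^bsub>zring n Quot ?I\<^esub>"
    then have "?h 1 = ?h 0" using h.hom_one h.hom_zero by simp
    then have "1 \<in> ?I" using h_eqD[of 1 0] zcarrier_one by simp
    then have "1 \<in> combinations (zcarrier n) inclusion_equations" using perm_ideal_subset by blast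
    then have "hpart 0 1 = 0"
    proof (induction rule: combinations.induct)
      case (step r g y)
      then obtain x where x: "x \<in> eqs" "g = eq_poly x" by (auto simp: inclusion_equations_eq)
      have "hpart (0 - eq_degree x) r = 0"
      proof (rule ccontr)
        assume "hpart (0 - eq_degree x) r \<noteq> 0"
        from homogeneous_monomials[OF hpart_zcarrier[OF step.hyps(1)] homogeneous_hpart this]
        have "0 \<le> height (0 - eq_degree x)" .
        then show False using height_eq_degree[OF x(1)] by (simp only: height_diff height_zero)
      qed
      then show ?case using step.IH by (simp add: hpart_add x(2) hpart_mult[OF homogeneous_eq_poly])
    qed (simp add: hpart_zero)
    then show False using hpart_same[OF homogeneous_one] by simp
  qed
  then have "subfield (?h ` constants) (zring n Quot ?I)" by (rule h.img_is_subfield(2)[OF subfield_constants])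
  ultimately have "h.S.dim over scalars n ?I = (\<lambda>E. h.S.dim over ?h ` constants) E" for E by simp
  have "(h.S.dim over ?h ` constants) (graded_piece n ?I \<mu>) = length (map (\<lambda>e. ?h (\<beta> e)) es)"
    by (rule h.S.dimI[OF \<open>subfield (?h ` constants) (zring n Quot ?I)\<close>])
      (use h.S.dimension_independent[OF indep[OF es(2)]] es(1) piece in auto)
  then show ?thesis
    unfolding hilbert_def \<open>scalars n ?I = ?h ` constants\<close> counting_def using es distinct_card[of es] by simp
qed

lemma K_polynomial_eq: "K_polynomial n (perm_ideal n v) = loc True n v id"
proof -
  have "hilbert n (perm_ideal n v) = counting T zdeg" by (rule ext) (rule hilbert_eq_counting)
  then show ?thesis unfolding K_polynomial_def by (simp only: T_counting lookup_inverse)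
qed

end

section \<open>The multidegree\<close>

lemma subst_one_minus_hom:
  "laurent_hom (\<lambda>i. 1 - fps_X * fps_const (lvar i)) (\<lambda>i. Abs_fps (\<lambda>k. lvar i ^ k) :: nat laurent fps)"
proof
  fix i :: nat
  let ?c = "lvar i :: nat laurent"
  have "(1 - fps_X * fps_const ?c) * Abs_fps (\<lambda>k. ?c ^ k) = Abs_fps (\<lambda>k. ?c ^ k) - fps_X * (fps_const ?c * Abs_fps (\<lambda>k. ?c ^ k))"
    by (simp add: algebra_simps)
  also have "\<dots> = 1"
  proof (rule fps_ext)
    fix k
    show "fps_nth (Abs_fps (\<lambda>k. ?c ^ k) - fps_X * (fps_const ?c * Abs_fps (\<lambda>k. ?c ^ k))) k = fps_nth 1 k"
      by (cases k) simp_all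
  qed
  finally show "(1 - fps_X * fps_const ?c) * Abs_fps (\<lambda>k. ?c ^ k) = 1" .
qed

lemma subst_one_minus_eq_eval:
  "subst_one_minus = laurent_eval (\<lambda>i. 1 - fps_X * fps_const (lvar i)) (\<lambda>i. Abs_fps (\<lambda>k. lvar i ^ k))"
  by (simp add: fun_eq_iff subst_one_minus_def laurent_eval_def mono_eval_def one_minus_power_def)

text \<open>Each K-theoretic weight becomes the degree variable times the cohomological weight times
  a series with constant term 1, so the order of the product is the number of its factors.\<close>

lemma lowest_degree_part_wt_prod:
  assumes "finite A" "\<And>p. p \<in> A \<Longrightarrow> a p \<noteq> b p"
  shows "lowest_degree_part (subst_one_minus (\<Prod>p\<in>A. wt True (a p) (b p))) = (\<Prod>p\<in>A. wt False (a p) (b p))"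
proof -
  let ?T = "\<lambda>i::nat. 1 - fps_X * fps_const (lvar i)" and ?T' = "\<lambda>i. Abs_fps (\<lambda>k. lvar i ^ k) :: nat laurent fps"
  interpret laurent_hom ?T ?T' by (rule subst_one_minus_hom)
  have wt: "laurent_eval ?T ?T' (wt True i j) = fps_X * (fps_const (wt False i j) * ?T' j)" for i j
  proof -
    have "laurent_eval ?T ?T' (wt True i j) = 1 - ?T i * ?T' j" by (simp add: wt_def diff mult)
    also have "\<dots> = ?T j * ?T' j - ?T i * ?T' j" by (simp only: unit)
    also have "\<dots> = (?T j - ?T i) * ?T' j" by (rule left_diff_distrib[symmetric])
    also have "?T j - ?T i = fps_X * fps_const (wt False i j)"
      by (simp add: wt_def algebra_simps flip: fps_const_sub)
    finally show ?thesis by (simp only: mult.assoc)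
  qed
  define F where "F = (\<Prod>p\<in>A. fps_const (wt False (a p) (b p)) * ?T' (b p))"
  have eq: "subst_one_minus (\<Prod>p\<in>A. wt True (a p) (b p)) = fps_X ^ card A * F"
    unfolding subst_one_minus_eq_eval prod wt prod.distrib F_def by simp
  have F0: "fps_nth F 0 = (\<Prod>p\<in>A. wt False (a p) (b p))"
    unfolding F_def by (induction A rule: infinite_finite_induct) simp_all
  have nz: "fps_nth F 0 \<noteq> 0" unfolding F0 using assms by simp
  have "subdegree (fps_X ^ card A * F) = card A"
    by (rule subdegreeI) (simp_all add: fps_X_power_mult_nth nz)
  then show ?thesis unfolding lowest_degree_part_def eq by (simp add: fps_X_power_mult_nth F0)
qed

theorem corollary6p6:
  fixes n :: nat and v :: "nat \<Rightarrow> nat"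
  assumes "v permutes {1..n}"
    and "defined_by_inclusions n v"
  shows "(K_polynomial n (perm_ideal n v) = specialize_t n (double_grothendieck n (w0 n \<circ> v)) \<and>
      specialize_t n (double_grothendieck n (w0 n \<circ> v)) =
        (\<Prod>(x, y) \<in> diagram n v. 1 - lvar (y - rk v x y) * lvar_inv (x + rk v x y))) \<and>
    (multidegree n (perm_ideal n v) = specialize_t n (double_schubert n (w0 n \<circ> v)) \<and>
      specialize_t n (double_schubert n (w0 n \<circ> v)) =
        (\<Prod>(x, y) \<in> diagram n v. lvar (y - rk v x y) - lvar (x + rk v x y)))"
proof -
  interpret inclusion_perm n v by unfold_locales (rule assms)+
  obtain T \<beta> where T: "spanning_monomials n v id zentry T \<beta>"
    using spanning_monomials_exist[OF permutes_id assms(1) slice_id] by blast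
  interpret inclusion_basis n v T \<beta> by unfold_locales (rule T)
  let ?a = "\<lambda>p. snd p - rk v (fst p) (snd p)" and ?b = "\<lambda>p. fst p + rk v (fst p) (snd p)"
  have w: "w0 n \<circ> v permutes {1..n}" by (rule permutes_compose[OF assms(1) w0_permutes])
  have loc: "loc k n v id = (\<Prod>p\<in>diagram n v. wt k (?a p) (?b p))" for k
    unfolding loc_id_eq by (simp add: case_prod_unfold)
  have G: "specialize_t n (double_grothendieck n (w0 n \<circ> v)) = loc True n v id"
    unfolding double_grothendieck_eq[OF w] specialize_t_eq_loc ..
  have S: "specialize_t n (double_schubert n (w0 n \<circ> v)) = loc False n v id"
    unfolding double_schubert_eq[OF w] specialize_t_eq_loc ..
  have "multidegree n (perm_ideal n v) = loc False n v id"
    unfolding multidegree_def K_polynomial_eq loc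
  proof (rule lowest_degree_part_wt_prod)
    show "finite (diagram n v)" by (rule finite_diagram)
    \<comment> \<open>A factor with equal indices would be 0. It does not occur: y - r counts values
      below x, so it is less than x.\<close>
    fix p assume "p \<in> diagram n v"
    then have D: "1 \<le> fst p" "fst p \<le> n" "snd p - rk v (fst p) (snd p) = card {k. 1 \<le> k \<and> k \<le> snd p \<and> v k < fst p}"
      using diagramD(1,2)[of "fst p" "snd p"] rk_complement'[of "snd p" "fst p"] by simp_all
    have "card {k. 1 \<le> k \<and> k \<le> snd p \<and> v k < fst p} \<le> fst p - 1"
      by (rule card_small_values[OF assms(1)]) (use D in simp)
    then show "?a p \<noteq> ?b p" using D by simp
  qed
  then show ?thesis unfolding K_polynomial_eq G S loc wt_def by (simp add: case_prod_unfold)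
qed

end
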